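(* If $\mathbb{X}$ is a Cartesian restriction category, then $\mathbf{Fa\grave{a}}(\mathbb{X})$ is a generalized differential restriction category, with $$D[f]:=[\delta(f)]_1$$ for each map $f$ of $\mathbf{Fa\grave{a}}(\mathbb{X})$, and with $L((A,+,0),X)$ being the first component of $\delta((A,+,0),X)$, i.e. the total commutative monoid $\big(((A,+,0),A),(+,\pi_0+,0,\ldots),(0,\pi_00,0,\ldots)\big)$ in $\mathbf{Fa\grave{a}}(\mathbb{X})$.
   Context: Composition is diagrammatic: $fg$ means first $f$, then $g$. A restriction category is a category with an operation assigning to each $f:X\to Y$ a map $\overline{f}:X\to X$ with: [R.1] $\overline{f}f=f$; [R.2] $\overline{f}\,\overline{g}=\overline{g}\,\overline{f}$ for $f,g$ with the same domain; [R.3] $\overline{\overline{f}g}=\overline{f}\,\overline{g}$ for $f,g$ with the same domain; [R.4] $f\overline{g}=\overline{fg}f$. A map $f$ is total if $\overline{f}=1$. A Cartesian restriction category is a restriction category with chosen restriction products: a chosen object $1$ with, for each $X$, a unique total map $!:X\to1$, such that every $f:X\to1$ equals $\overline{f}\,!$; and for all $X,Y$ a chosen object $X\times Y$ with total projections $\pi_0,\pi_1$ such that for all $f:Z\to X$, $g:Z\to Y$ there is a unique $\langle f,g\rangle:Z\to X\times Y$ with $\langle f,g\rangle\pi_0=\overline{g}f$ and $\langle f,g\rangle\pi_1=\overline{f}g$. A total commutative monoid $(A,+,0)$ is a commutative monoid whose structure maps are total; for $f,g:X\to A$, $f+g:=\langle f,g\rangle+$ and $0:X\to A$ denotes $!\,0$.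 In $A^n\times X$, $\pi_0,\ldots,\pi_{n-1}$ are the projections to the copies of $A$ and $\pi_n$ the projection to $X$. We write $h(z_1,\ldots,z_k)$ for $\langle z_1,\ldots,z_k\rangle h$. A generalized differential restriction category is a Cartesian restriction category with: for each object $X$, a total commutative monoid $L(X)=(L_0(X),+_X,0_X)$ with $L(L_0(X))=L(X)$, $L(X\times Y)=L(X)\times L(Y)$ (product monoid) and $L(1)=1$; and for each map $f:X\to Y$ a map $D[f]:L_0(X)\times X\to L_0(Y)$ such that (for all well-typed maps): [DR.1] $D[+_X]=\pi_0+_X$ and $D[0_X]=\pi_00_X$; [DR.2] $\langle a+b,c\rangle D[f]=\langle a,c\rangle D[f]+\langle b,c\rangle D[f]$ and $\langle0,a\rangle D[f]=\overline{af}\,0$; [DR.3] $D[\pi_0]=\pi_0\pi_0$ and $D[\pi_1]=\pi_0\pi_1$; [DR.4] $D[\langle f,g\rangle]=\langle D[f],D[g]\rangle$; [DR.5] $D[fg]=\langle D[f],\pi_1f\rangle D[g]$; [DR.6] $\langle\langle a,0\rangle,\langle c,d\rangle\rangle D[D[f]]=\overline{c}\,\langle a,d\rangle D[f]$; [DR.7] $\langle\langle0,b\rangle,\langle c,d\rangle\rangle D[D[f]]=\langle\langle0,c\rangle,\langle b,d\rangle\rangle D[D[f]]$; [DR.8] $D[\overline{f}]=(1\times\overline{f})\pi_0=\overline{\pi_1f}\,\pi_0$; [DR.9] $\overline{D[f]}=1\times\overline{f}=\overline{\pi_1f}$. The Cartesian restriction category $\mathbf{Fa\grave{a}}(\mathbb{X})$.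 Objects: pairs $((A,+,0),X)$, abbreviated $(A,X)$, with $(A,+,0)$ a total commutative monoid and $X$ an object of $\mathbb{X}$. Maps $(A,X)\to(B,Y)$: sequences $f=(f_*,f_1,f_2,\ldots)$ with $f_*:X\to Y$ and, for $n\ge1$, $f_n:A^n\times X\to B$ such that $\overline{f_n}=1\times\overline{f_*}=\overline{\pi_nf_*}$, and $f_n$ is symmetric and additive in its first $n$ variables (additive: substituting a sum $a+b$ in a variable gives the sum of the maps obtained by substituting $a$ and $b$, and substituting $0$ gives the corresponding restriction of the zero map). Identities $(1_X,\pi_0,0,0,\ldots)$. Composition: $(fg)_*=f_*g_*$ and $$(fg)_n=\sum_{\{B_1,\ldots,B_k\}}g_k\big(f_{|B_1|}(a_{B_1},x),\ldots,f_{|B_k|}(a_{B_k},x),f_*(x)\big),$$ the sum being over partitions of $\{1,\ldots,n\}$ into nonempty blocks, $a_1,\ldots,a_n,x$ being the projections from $A^n\times X$ and $f_m(a_B,x)=f_m(a_{i_1},\ldots,a_{i_m},x)$ for $B=\{i_1<\cdots<i_m\}$. Restriction: $\overline{f}=(\overline{f_*},\overline{\pi_1f_*}\pi_0,\overline{\pi_2f_*}0,\overline{\pi_3f_*}0,\ldots)$. Chosen products: $(A,X)\times(B,Y)=(A\times B,X\times Y)$ with the product monoid on $A\times B$, projections $(\pi_i,\pi_0\pi_i,0,0,\ldots)$, pairing $\langle f,g\rangle_*=\langle f_*,g_*\rangle$, $\langle f,g\rangle_n=\langle f_n,g_n\rangle$; terminal object $(1,1)$. The map $[\delta(f)]_1$.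 For $f:(A,X)\to(B,Y)$, $[\delta(f)]_1:(A,A)\times(A,X)=(A\times A,A\times X)\to(B,B)$ is the map of $\mathbf{Fa\grave{a}}(\mathbb{X})$ with $([\delta(f)]_1)_*=f_1$ and, for $r\ge1$, writing the variables (projections) of $(A\times A)^r\times(A\times X)$ as $(v^1,w^1),\ldots,(v^r,w^r),(a,x)$, $$([\delta(f)]_1)_r=f_{r+1}(a,w^1,\ldots,w^r,x)+\sum_{j=1}^r f_r\big(v^j,w^1,\ldots,\widehat{w^j},\ldots,w^r,x\big),$$ where $\widehat{w^j}$ means $w^j$ is omitted. *)

theory Defs
  imports "HOL-Algebra.FiniteProduct" "HOL-Library.Disjoint_Sets" "HOL-Library.Multiset"
begin

section \<open>Cartesian restriction categories\<close>

text \<open>Composition is diagrammatic: \<open>f \<cdot> g\<close> is first \<open>f\<close>, then \<open>g\<close>. The restriction of \<open>f\<close>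
  is written \<open>\<rho> f\<close>. The operations are only constrained on well-typed arguments.\<close>

record ('o, 'm) rcat =
  Ob :: "'o set"
  Ar :: "'m set"
  Dom :: "'m \<Rightarrow> 'o"
  Cod :: "'m \<Rightarrow> 'o"
  Idn :: "'o \<Rightarrow> 'm"
  Comp :: "'m \<Rightarrow> 'm \<Rightarrow> 'm"  (infixl "\<cdot>\<index>" 70)
  Rst :: "'m \<Rightarrow> 'm"  ("\<rho>\<index>")

record ('o, 'm) crc = "('o, 'm) rcat" +
  Trm :: 'o  ("\<^bold>1\<index>")
  Bang :: "'o \<Rightarrow> 'm"  ("\<^bold>!\<index>")
  Prd :: "'o \<Rightarrow> 'o \<Rightarrow> 'o"  (infixr "\<^bold>\<times>\<index>" 80)
  Pr0 :: "'o \<Rightarrow> 'o \<Rightarrow> 'm"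
  Pr1 :: "'o \<Rightarrow> 'o \<Rightarrow> 'm"
  Pairing :: "'m \<Rightarrow> 'm \<Rightarrow> 'm"  ("\<langle>_,/ _\<rangle>\<index>")

definition Hom :: "('o, 'm, 'z) rcat_scheme \<Rightarrow> 'o \<Rightarrow> 'o \<Rightarrow> 'm set" where
  "Hom C X Y = {f \<in> Ar C. Dom C f = X \<and> Cod C f = Y}"

definition is_total :: "('o, 'm, 'z) rcat_scheme \<Rightarrow> 'm \<Rightarrow> bool" where
  "is_total C f \<longleftrightarrow> Rst C f = Idn C (Dom C f)"

locale restriction_category =
  fixes C :: "('o, 'm, 'z) rcat_scheme" (structure)
  assumes Dom_Ob: "f \<in> Ar C \<Longrightarrow> Dom C f \<in> Ob C"
    and Cod_Ob: "f \<in> Ar C \<Longrightarrow> Cod C f \<in> Ob C"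
    and Id_Hom: "X \<in> Ob C \<Longrightarrow> Idn C X \<in> Hom C X X"
    and Comp_Hom: "\<lbrakk>f \<in> Hom C X Y; g \<in> Hom C Y Z\<rbrakk> \<Longrightarrow> f \<cdot> g \<in> Hom C X Z"
    and Id_left: "f \<in> Hom C X Y \<Longrightarrow> Idn C X \<cdot> f = f"
    and Id_right: "f \<in> Hom C X Y \<Longrightarrow> f \<cdot> Idn C Y = f"
    and Comp_assoc: "\<lbrakk>f \<in> Hom C W X; g \<in> Hom C X Y; h \<in> Hom C Y Z\<rbrakk>
      \<Longrightarrow> (f \<cdot> g) \<cdot> h = f \<cdot> (g \<cdot> h)"
    and Rst_Hom: "f \<in> Hom C X Y \<Longrightarrow> \<rho> f \<in> Hom C X X"
    and R1: "f \<in> Hom C X Y \<Longrightarrow> \<rho> f \<cdot> f = f"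
    and R2: "\<lbrakk>f \<in> Hom C X Y; g \<in> Hom C X Z\<rbrakk> \<Longrightarrow> \<rho> f \<cdot> \<rho> g = \<rho> g \<cdot> \<rho> f"
    and R3: "\<lbrakk>f \<in> Hom C X Y; g \<in> Hom C X Z\<rbrakk> \<Longrightarrow> \<rho> (\<rho> f \<cdot> g) = \<rho> f \<cdot> \<rho> g"
    and R4: "\<lbrakk>f \<in> Hom C X Y; g \<in> Hom C Y Z\<rbrakk> \<Longrightarrow> f \<cdot> \<rho> g = \<rho> (f \<cdot> g) \<cdot> f"

locale cartesian_restriction_category = restriction_category C
  for C :: "('o, 'm) crc" (structure) +
  assumes Trm_Ob: "\<^bold>1 \<in> Ob C"
    and Bang_Hom: "X \<in> Ob C \<Longrightarrow> \<^bold>! X \<in> Hom C X \<^bold>1"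
    and Bang_total: "X \<in> Ob C \<Longrightarrow> is_total C (\<^bold>! X)"
    and Bang_unique: "\<lbrakk>f \<in> Hom C X \<^bold>1; is_total C f\<rbrakk> \<Longrightarrow> f = \<^bold>! X"
    and Bang_Rst: "f \<in> Hom C X \<^bold>1 \<Longrightarrow> f = \<rho> f \<cdot> \<^bold>! X"
    and Prd_Ob: "\<lbrakk>X \<in> Ob C; Y \<in> Ob C\<rbrakk> \<Longrightarrow> X \<^bold>\<times> Y \<in> Ob C"
    and Pr0_Hom: "\<lbrakk>X \<in> Ob C; Y \<in> Ob C\<rbrakk> \<Longrightarrow> Pr0 C X Y \<in> Hom C (X \<^bold>\<times> Y) X"
    and Pr0_total: "\<lbrakk>X \<in> Ob C; Y \<in> Ob C\<rbrakk> \<Longrightarrow> is_total C (Pr0 C X Y)"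
    and Pr1_Hom: "\<lbrakk>X \<in> Ob C; Y \<in> Ob C\<rbrakk> \<Longrightarrow> Pr1 C X Y \<in> Hom C (X \<^bold>\<times> Y) Y"
    and Pr1_total: "\<lbrakk>X \<in> Ob C; Y \<in> Ob C\<rbrakk> \<Longrightarrow> is_total C (Pr1 C X Y)"
    and Pair_Hom: "\<lbrakk>f \<in> Hom C Z X; g \<in> Hom C Z Y\<rbrakk> \<Longrightarrow> \<langle>f, g\<rangle> \<in> Hom C Z (X \<^bold>\<times> Y)"
    and Pair_Pr0: "\<lbrakk>f \<in> Hom C Z X; g \<in> Hom C Z Y\<rbrakk> \<Longrightarrow> \<langle>f, g\<rangle> \<cdot> Pr0 C X Y = \<rho> g \<cdot> f"
    and Pair_Pr1: "\<lbrakk>f \<in> Hom C Z X; g \<in> Hom C Z Y\<rbrakk> \<Longrightarrow> \<langle>f, g\<rangle> \<cdot> Pr1 C X Y = \<rho> f \<cdot> g"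
    and Pair_unique: "\<lbrakk>f \<in> Hom C Z X; g \<in> Hom C Z Y; h \<in> Hom C Z (X \<^bold>\<times> Y);
      h \<cdot> Pr0 C X Y = \<rho> g \<cdot> f; h \<cdot> Pr1 C X Y = \<rho> f \<cdot> g\<rbrakk> \<Longrightarrow> h = \<langle>f, g\<rangle>"


section \<open>Total commutative monoids\<close>

record ('o, 'm) imonoid =
  mobj :: 'o
  madd :: 'm
  mzero :: 'm

context
  fixes C :: "('o, 'm) crc" (structure)
begin

definition cross :: "'m \<Rightarrow> 'm \<Rightarrow> 'm" where
  "cross f g = \<langle>Pr0 C (Dom C f) (Dom C g) \<cdot> f, Pr1 C (Dom C f) (Dom C g) \<cdot> g\<rangle>"

text \<open>The sum \<open>f + g\<close> of two maps into (the object of) \<open>M\<close>, and the zero map from \<open>Z\<close>.\<close>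

definition plus_map :: "('o, 'm) imonoid \<Rightarrow> 'm \<Rightarrow> 'm \<Rightarrow> 'm" where
  "plus_map M f g = \<langle>f, g\<rangle> \<cdot> madd M"

definition zero_map :: "('o, 'm) imonoid \<Rightarrow> 'o \<Rightarrow> 'm" where
  "zero_map M Z = \<^bold>! Z \<cdot> mzero M"

text \<open>The monoid laws are the usual diagrams, written with the projections out of
  \<open>A\<close>, \<open>A \<times> A\<close> and \<open>A \<times> (A \<times> A)\<close> as variables.\<close>

definition total_comm_monoid :: "('o, 'm) imonoid \<Rightarrow> bool" where
  "total_comm_monoid M \<longleftrightarrow> (let A = mobj M in
     A \<in> Ob C \<and>
     madd M \<in> Hom C (A \<^bold>\<times> A) A \<and> is_total C (madd M) \<and>
     mzero M \<in> Hom C \<^bold>1 A \<and> is_total C (mzero M) \<and>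
     plus_map M (zero_map M A) (Idn C A) = Idn C A \<and>
     plus_map M (Pr1 C A A) (Pr0 C A A) = plus_map M (Pr0 C A A) (Pr1 C A A) \<and>
     (let a = Pr0 C A (A \<^bold>\<times> A);
          b = Pr1 C A (A \<^bold>\<times> A) \<cdot> Pr0 C A A;
          c = Pr1 C A (A \<^bold>\<times> A) \<cdot> Pr1 C A A
      in plus_map M (plus_map M a b) c = plus_map M a (plus_map M b c)))"

definition prod_monoid :: "('o, 'm) imonoid \<Rightarrow> ('o, 'm) imonoid \<Rightarrow> ('o, 'm) imonoid" where
  "prod_monoid M N = (let A = mobj M; B = mobj N in
     \<lparr>mobj = A \<^bold>\<times> B,
      madd = \<langle>cross (Pr0 C A B) (Pr0 C A B) \<cdot> madd M, cross (Pr1 C A B) (Pr1 C A B) \<cdot> madd N\<rangle>,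
      mzero = \<langle>mzero M, mzero N\<rangle>\<rparr>)"

definition trivial_monoid :: "('o, 'm) imonoid" where
  "trivial_monoid = \<lparr>mobj = \<^bold>1, madd = \<^bold>! (\<^bold>1 \<^bold>\<times> \<^bold>1), mzero = \<^bold>! \<^bold>1\<rparr>"

text \<open>The maps from \<open>Z\<close> into \<open>M\<close> form a commutative monoid with unit the (total) zero map, so
  that finite sums of such maps are instances of \<open>finprod\<close>.\<close>

definition hom_monoid :: "('o, 'm) imonoid \<Rightarrow> 'o \<Rightarrow> 'm monoid" where
  "hom_monoid M Z =
     \<lparr>carrier = Hom C Z (mobj M), monoid.mult = plus_map M, one = zero_map M Z\<rparr>"

definition sum_map :: "('o, 'm) imonoid \<Rightarrow> 'o \<Rightarrow> ('i \<Rightarrow> 'm) \<Rightarrow> 'i set \<Rightarrow> 'm" where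
  "sum_map M Z t I = finprod (hom_monoid M Z) t I"

end


section \<open>Generalized differential restriction categories\<close>

locale generalized_differential_restriction_category = cartesian_restriction_category C
  for C :: "('o, 'm) crc" (structure) +
  fixes L :: "'o \<Rightarrow> ('o, 'm) imonoid"
    and D :: "'m \<Rightarrow> 'm"
  assumes L_monoid: "X \<in> Ob C \<Longrightarrow> total_comm_monoid C (L X)"
    and L_idem: "X \<in> Ob C \<Longrightarrow> L (mobj (L X)) = L X"
    and L_prod: "\<lbrakk>X \<in> Ob C; Y \<in> Ob C\<rbrakk> \<Longrightarrow> L (X \<^bold>\<times> Y) = prod_monoid C (L X) (L Y)"
    and L_Trm: "L \<^bold>1 = trivial_monoid C"
    and D_Hom: "f \<in> Hom C X Y \<Longrightarrow> D f \<in> Hom C (mobj (L X) \<^bold>\<times> X) (mobj (L Y))"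
    and DR1_add: "\<lbrakk>X \<in> Ob C; A = mobj (L X)\<rbrakk>
      \<Longrightarrow> D (madd (L X)) = Pr0 C (A \<^bold>\<times> A) (A \<^bold>\<times> A) \<cdot> madd (L X)"
    and DR1_zero: "X \<in> Ob C \<Longrightarrow> D (mzero (L X)) = Pr0 C \<^bold>1 \<^bold>1 \<cdot> mzero (L X)"
    and DR2_add: "\<lbrakk>f \<in> Hom C X Y; a \<in> Hom C Z (mobj (L X)); b \<in> Hom C Z (mobj (L X));
        c \<in> Hom C Z X\<rbrakk>
      \<Longrightarrow> \<langle>plus_map C (L X) a b, c\<rangle> \<cdot> D f = plus_map C (L Y) (\<langle>a, c\<rangle> \<cdot> D f) (\<langle>b, c\<rangle> \<cdot> D f)"
    and DR2_zero: "\<lbrakk>f \<in> Hom C X Y; a \<in> Hom C Z X\<rbrakk>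
      \<Longrightarrow> \<langle>zero_map C (L X) Z, a\<rangle> \<cdot> D f = \<rho> (a \<cdot> f) \<cdot> zero_map C (L Y) Z"
    and DR3_Pr0: "\<lbrakk>X \<in> Ob C; Y \<in> Ob C; A = mobj (L X); B = mobj (L Y)\<rbrakk>
      \<Longrightarrow> D (Pr0 C X Y) = Pr0 C (A \<^bold>\<times> B) (X \<^bold>\<times> Y) \<cdot> Pr0 C A B"
    and DR3_Pr1: "\<lbrakk>X \<in> Ob C; Y \<in> Ob C; A = mobj (L X); B = mobj (L Y)\<rbrakk>
      \<Longrightarrow> D (Pr1 C X Y) = Pr0 C (A \<^bold>\<times> B) (X \<^bold>\<times> Y) \<cdot> Pr1 C A B"
    and DR4: "\<lbrakk>f \<in> Hom C Z X; g \<in> Hom C Z Y\<rbrakk> \<Longrightarrow> D \<langle>f, g\<rangle> = \<langle>D f, D g\<rangle>"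
    and DR5: "\<lbrakk>f \<in> Hom C X Y; g \<in> Hom C Y Z\<rbrakk>
      \<Longrightarrow> D (f \<cdot> g) = \<langle>D f, Pr1 C (mobj (L X)) X \<cdot> f\<rangle> \<cdot> D g"
    and DR6: "\<lbrakk>f \<in> Hom C X Y; a \<in> Hom C Z (mobj (L X)); c \<in> Hom C Z (mobj (L X));
        d \<in> Hom C Z X\<rbrakk>
      \<Longrightarrow> \<langle>\<langle>a, zero_map C (L X) Z\<rangle>, \<langle>c, d\<rangle>\<rangle> \<cdot> D (D f) = \<rho> c \<cdot> (\<langle>a, d\<rangle> \<cdot> D f)"
    and DR7: "\<lbrakk>f \<in> Hom C X Y; b \<in> Hom C Z (mobj (L X)); c \<in> Hom C Z (mobj (L X));
        d \<in> Hom C Z X\<rbrakk>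
      \<Longrightarrow> \<langle>\<langle>zero_map C (L X) Z, b\<rangle>, \<langle>c, d\<rangle>\<rangle> \<cdot> D (D f)
        = \<langle>\<langle>zero_map C (L X) Z, c\<rangle>, \<langle>b, d\<rangle>\<rangle> \<cdot> D (D f)"
    and DR8: "\<lbrakk>f \<in> Hom C X Y; A = mobj (L X)\<rbrakk>
      \<Longrightarrow> D (\<rho> f) = cross C (Idn C A) (\<rho> f) \<cdot> Pr0 C A X
        \<and> cross C (Idn C A) (\<rho> f) \<cdot> Pr0 C A X = \<rho> (Pr1 C A X \<cdot> f) \<cdot> Pr0 C A X"
    and DR9: "\<lbrakk>f \<in> Hom C X Y; A = mobj (L X)\<rbrakk>
      \<Longrightarrow> \<rho> (D f) = cross C (Idn C A) (\<rho> f) \<and> cross C (Idn C A) (\<rho> f) = \<rho> (Pr1 C A X \<cdot> f)"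


section \<open>The Faa di Bruno construction\<close>

text \<open>The object \<open>A\<^sup>n \<times> X\<close> is bracketed to the right, \<open>A \<times> (A \<times> \<dots> (A \<times> X))\<close>; in particular
  \<open>A\<^sup>0 \<times> X\<close> is \<open>X\<close> and \<open>A\<^sup>1 \<times> X\<close> is \<open>A \<times> X\<close>. \<open>pow_proj C A X n i\<close> is the projection \<open>\<pi>\<^sub>i\<close> out of
  \<open>A\<^sup>n \<times> X\<close>, where \<open>i \<le> n\<close>. \<open>app C h as x\<close> is \<open>h(a\<^sub>1, \<dots>, a\<^sub>n, x)\<close> for \<open>as = [a\<^sub>1, \<dots>, a\<^sub>n]\<close>.\<close>

context
  fixes C :: "('o, 'm) crc" (structure)
begin

primrec pow_times :: "'o \<Rightarrow> nat \<Rightarrow> 'o \<Rightarrow> 'o" where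
  "pow_times A 0 X = X"
| "pow_times A (Suc n) X = A \<^bold>\<times> pow_times A n X"

primrec pow_proj :: "'o \<Rightarrow> 'o \<Rightarrow> nat \<Rightarrow> nat \<Rightarrow> 'm" where
  "pow_proj A X 0 i = Idn C X"
| "pow_proj A X (Suc n) i =
     (case i of 0 \<Rightarrow> Pr0 C A (pow_times A n X)
      | Suc j \<Rightarrow> Pr1 C A (pow_times A n X) \<cdot> pow_proj A X n j)"

definition app :: "'m \<Rightarrow> 'm list \<Rightarrow> 'm \<Rightarrow> 'm" where
  "app h as x = foldr (\<lambda>a t. \<langle>a, t\<rangle>) as x \<cdot> h"

end

type_synonym ('o, 'm) faa_ob = "('o, 'm) imonoid \<times> 'o"

text \<open>A map of \<open>Faa(C)\<close> together with its source and target. The component \<open>f\<^sub>*\<close> of the sequence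
  \<open>(f\<^sub>*, f\<^sub>1, f\<^sub>2, \<dots>)\<close> is stored at index \<open>0\<close>.\<close>

record ('o, 'm) faa_ar =
  fsrc :: "('o, 'm) faa_ob"
  ftgt :: "('o, 'm) faa_ob"
  fseq :: "nat \<Rightarrow> 'm"

context
  fixes C :: "('o, 'm) crc" (structure)
begin

definition faa_Ob :: "('o, 'm) faa_ob set" where
  "faa_Ob = {(M, X). total_comm_monoid C M \<and> X \<in> Ob C}"

text \<open>For \<open>h : A\<^sup>n \<times> X \<rightarrow> B\<close>, where \<open>A\<close> and \<open>B\<close> underlie the monoids \<open>M\<close> and \<open>N\<close>. Variables are
  arbitrary (possibly partial) maps out of a common object \<open>Z\<close>.\<close>

definition symmetric_map :: "('o, 'm) imonoid \<Rightarrow> 'o \<Rightarrow> nat \<Rightarrow> 'm \<Rightarrow> bool" where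
  "symmetric_map M X n h \<longleftrightarrow>
     (\<forall>Z \<in> Ob C. \<forall>as bs. \<forall>x \<in> Hom C Z X.
        length as = n \<and> set as \<subseteq> Hom C Z (mobj M) \<and> mset bs = mset as
        \<longrightarrow> app C h bs x = app C h as x)"

definition multiadditive ::
    "('o, 'm) imonoid \<Rightarrow> 'o \<Rightarrow> ('o, 'm) imonoid \<Rightarrow> nat \<Rightarrow> 'm \<Rightarrow> bool" where
  "multiadditive M X N n h \<longleftrightarrow>
     (\<forall>Z \<in> Ob C. \<forall>as. \<forall>x \<in> Hom C Z X. \<forall>i < n.
        length as = n \<and> set as \<subseteq> Hom C Z (mobj M) \<longrightarrow>
        (\<forall>a \<in> Hom C Z (mobj M). \<forall>b \<in> Hom C Z (mobj M).
           app C h (as[i := plus_map C M a b]) x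
             = plus_map C N (app C h (as[i := a]) x) (app C h (as[i := b]) x)) \<and>
        app C h (as[i := zero_map C M Z]) x
          = \<rho> (app C h (as[i := zero_map C M Z]) x) \<cdot> zero_map C N Z)"

definition faa_Ar :: "('o, 'm) faa_ar set" where
  "faa_Ar = {f. fsrc f \<in> faa_Ob \<and> ftgt f \<in> faa_Ob \<and>
     (let (M, X) = fsrc f; (N, Y) = ftgt f; A = mobj M; B = mobj N in
       fseq f 0 \<in> Hom C X Y \<and>
       (\<forall>n \<ge> 1. fseq f n \<in> Hom C (pow_times C A n X) B \<and>
          \<rho> (fseq f n) = \<rho> (pow_proj C A X n n \<cdot> fseq f 0) \<and>
          symmetric_map M X n (fseq f n) \<and>
          multiadditive M X N n (fseq f n)))}"

text \<open>The sequence \<open>(u, v, 0, 0, \<dots>)\<close>.\<close>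

definition faa_linear :: "('o, 'm) faa_ob \<Rightarrow> ('o, 'm) faa_ob \<Rightarrow> 'm \<Rightarrow> 'm \<Rightarrow> ('o, 'm) faa_ar" where
  "faa_linear S T u v =
     \<lparr>fsrc = S, ftgt = T,
      fseq = (\<lambda>n. if n = 0 then u else if n = 1 then v
                  else zero_map C (fst T) (pow_times C (mobj (fst S)) n (snd S)))\<rparr>"

definition faa_Id :: "('o, 'm) faa_ob \<Rightarrow> ('o, 'm) faa_ar" where
  "faa_Id S = (let (M, X) = S in faa_linear S S (Idn C X) (Pr0 C (mobj M) X))"

text \<open>A partition of \<open>{0, \<dots>, n - 1}\<close> is a set \<open>P\<close> of blocks. The blocks are listed by increasing
  minimum; since \<open>g\<^sub>k\<close> is symmetric, the value does not depend on this choice.\<close>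

definition faa_Comp :: "('o, 'm) faa_ar \<Rightarrow> ('o, 'm) faa_ar \<Rightarrow> ('o, 'm) faa_ar" where
  "faa_Comp f g =
     \<lparr>fsrc = fsrc f, ftgt = ftgt g,
      fseq = (\<lambda>n. if n = 0 then fseq f 0 \<cdot> fseq g 0 else
        (let (M, X) = fsrc f; A = mobj M;
             a = pow_proj C A X n; x = pow_proj C A X n n;
             block = (\<lambda>B. app C (fseq f (card B)) (map a (sorted_list_of_set B)) x)
         in sum_map C (fst (ftgt g)) (pow_times C A n X)
              (\<lambda>P. app C (fseq g (card P)) (map block (sorted_key_list_of_set Min P)) (x \<cdot> fseq f 0))
              {P. partition_on {..<n} P}))\<rparr>"

definition faa_Rst :: "('o, 'm) faa_ar \<Rightarrow> ('o, 'm) faa_ar" where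
  "faa_Rst f = (let (M, X) = fsrc f; A = mobj M in
     \<lparr>fsrc = fsrc f, ftgt = fsrc f,
      fseq = (\<lambda>n. if n = 0 then \<rho> (fseq f 0) else
        \<rho> (pow_proj C A X n n \<cdot> fseq f 0) \<cdot>
          (if n = 1 then Pr0 C A X else zero_map C M (pow_times C A n X)))\<rparr>)"

definition faa_Trm :: "('o, 'm) faa_ob" where
  "faa_Trm = (trivial_monoid C, \<^bold>1)"

definition faa_Bang :: "('o, 'm) faa_ob \<Rightarrow> ('o, 'm) faa_ar" where
  "faa_Bang S = (let (M, X) = S in
     \<lparr>fsrc = S, ftgt = faa_Trm, fseq = (\<lambda>n. \<^bold>! (pow_times C (mobj M) n X))\<rparr>)"

definition faa_Prd :: "('o, 'm) faa_ob \<Rightarrow> ('o, 'm) faa_ob \<Rightarrow> ('o, 'm) faa_ob" where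
  "faa_Prd S T = (prod_monoid C (fst S) (fst T), snd S \<^bold>\<times> snd T)"

definition faa_Pr0 :: "('o, 'm) faa_ob \<Rightarrow> ('o, 'm) faa_ob \<Rightarrow> ('o, 'm) faa_ar" where
  "faa_Pr0 S T = (let (M, X) = S; (N, Y) = T; A = mobj M; B = mobj N in
     faa_linear (faa_Prd S T) S (Pr0 C X Y) (Pr0 C (A \<^bold>\<times> B) (X \<^bold>\<times> Y) \<cdot> Pr0 C A B))"

definition faa_Pr1 :: "('o, 'm) faa_ob \<Rightarrow> ('o, 'm) faa_ob \<Rightarrow> ('o, 'm) faa_ar" where
  "faa_Pr1 S T = (let (M, X) = S; (N, Y) = T; A = mobj M; B = mobj N in
     faa_linear (faa_Prd S T) T (Pr1 C X Y) (Pr0 C (A \<^bold>\<times> B) (X \<^bold>\<times> Y) \<cdot> Pr1 C A B))"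

definition faa_Pair :: "('o, 'm) faa_ar \<Rightarrow> ('o, 'm) faa_ar \<Rightarrow> ('o, 'm) faa_ar" where
  "faa_Pair f g =
     \<lparr>fsrc = fsrc f, ftgt = faa_Prd (ftgt f) (ftgt g), fseq = (\<lambda>n. \<langle>fseq f n, fseq g n\<rangle>)\<rparr>"

definition faa :: "(('o, 'm) faa_ob, ('o, 'm) faa_ar) crc" where
  "faa =
     \<lparr>Ob = faa_Ob, Ar = faa_Ar, Dom = fsrc, Cod = ftgt, Idn = faa_Id, Comp = faa_Comp,
      Rst = faa_Rst, Trm = faa_Trm, Bang = faa_Bang, Prd = faa_Prd,
      Pr0 = faa_Pr0, Pr1 = faa_Pr1, Pairing = faa_Pair\<rparr>"

text \<open>\<open>faa_L\<close> sends \<open>((A, +, 0), X)\<close> to \<open>(((A, +, 0), A), (+, \<pi>\<^sub>0+, 0, \<dots>), (0, \<pi>\<^sub>00, 0, \<dots>))\<close>, and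
  \<open>faa_D f\<close> is \<open>[\<delta>(f)]\<^sub>1\<close>.\<close>

definition faa_L :: "('o, 'm) faa_ob \<Rightarrow> (('o, 'm) faa_ob, ('o, 'm) faa_ar) imonoid" where
  "faa_L S = (let M = fst S; A = mobj M; T = (M, A) in
     \<lparr>mobj = T,
      madd = faa_linear (faa_Prd T T) T (madd M) (Pr0 C (A \<^bold>\<times> A) (A \<^bold>\<times> A) \<cdot> madd M),
      mzero = faa_linear faa_Trm T (mzero M) (Pr0 C \<^bold>1 \<^bold>1 \<cdot> mzero M)\<rparr>)"

definition faa_D :: "('o, 'm) faa_ar \<Rightarrow> ('o, 'm) faa_ar" where
  "faa_D f = (let (M, X) = fsrc f; A = mobj M; N = fst (ftgt f) in
     \<lparr>fsrc = faa_Prd (M, A) (M, X), ftgt = (N, mobj N),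
      fseq = (\<lambda>r. if r = 0 then fseq f 1 else
        (let v = (\<lambda>j. pow_proj C (A \<^bold>\<times> A) (A \<^bold>\<times> X) r j \<cdot> Pr0 C A A);
             w = (\<lambda>j. pow_proj C (A \<^bold>\<times> A) (A \<^bold>\<times> X) r j \<cdot> Pr1 C A A);
             a = pow_proj C (A \<^bold>\<times> A) (A \<^bold>\<times> X) r r \<cdot> Pr0 C A X;
             x = pow_proj C (A \<^bold>\<times> A) (A \<^bold>\<times> X) r r \<cdot> Pr1 C A X
         in plus_map C N
              (app C (fseq f (Suc r)) (a # map w [0..<r]) x)
              (sum_map C N (pow_times C (A \<^bold>\<times> A) r (A \<^bold>\<times> X))
                 (\<lambda>j. app C (fseq f r) (v j # map w (filter (\<lambda>i. i \<noteq> j) [0..<r])) x)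
                 {..<r})))\<rparr>)"

end

end

theory Submission
  imports Defs "HOL-Combinatorics.Permutations"
begin

text \<open>A map \<open>f\<close> is studied through its values \<open>f\<^sub>n(a\<^sub>1, \<dots>, a\<^sub>n, x)\<close> at families with a common domain of
  definition. By symmetry such a value depends only on the multiset of the \<open>a\<^sub>i\<close>, and these values
  determine \<open>f\<close>. The chain rule is combinatorial: a partition of a set with one additional point
  either has this point as a singleton block or arises by adding it to a block of a partition of the
  original set, and these two cases are the two kinds of summands in \<open>[\<delta>(f)]\<^sub>1\<close>. Associativity of
  the Faa di Bruno composition is a consequence of the chain rule: it is obvious for \<open>f\<^sub>*\<close>, and every
  \<open>f\<^sub>n\<close> can be read off from the iterated derivatives. The axioms that do not involve composition
  reduce to the case where the arguments are projections; there all composites with derivatives are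
  explicit sums, and the axioms for the second derivative express additivity and the symmetry of
  \<open>f\<^sub>n\<close>.\<close>

section \<open>Calculus in a Cartesian restriction category\<close>

text \<open>The definitions admit arbitrary partial arguments, whose domains would obscure the
  combinatorics. The remedy is that the domain of a tuple is the meet of the domains of its entries,
  so all entries may be restricted to it without changing the tuple. After this restriction the
  summands of a Faa di Bruno sum share one domain, and sums and substitutions behave as for total
  maps. The delicate case is zero: an empty sum is the total zero map, while additivity produces
  zero restricted to the common domain. A direct proof of associativity would have to match
  partitions of the set of blocks of a partition with families of partitions of the single blocks.
  The chain rule replaces this by the addition of one point. It also has the right shape for an
  induction: with the tangent functor \<open>T\<close>, the derivatives of \<open>(fg)h\<close> and
  \<open>f(gh)\<close> are the two bracketings of \<open>T(f)\<close>, \<open>T(g)\<close> and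
  \<open>D[h]\<close>, so the claim reproduces itself. This requires functoriality of
  \<open>T\<close> before composition is known to be associative.\<close>

lemma Hom_iff: "f \<in> Hom C X Y \<longleftrightarrow> f \<in> Ar C \<and> Dom C f = X \<and> Cod C f = Y"
  by (auto simp: Hom_def)

lemma HomD:
  assumes "f \<in> Hom C X Y"
  shows "f \<in> Ar C" "Dom C f = X" "Cod C f = Y"
  using assms by (simp_all add: Hom_iff)

section \<open>Restriction idempotents and domains of definition\<close>

context restriction_category
begin

lemmas Dom_Ob' [simp] = Dom_Ob
lemmas Cod_Ob' [simp] = Cod_Ob

lemma Idn_type [simp]:
  assumes "X \<in> Ob C"
  shows "Idn C X \<in> Ar C" "Dom C (Idn C X) = X" "Cod C (Idn C X) = X"
  using Id_Hom[OF assms] by (simp_all add: Hom_iff)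

lemma Comp_type [simp]:
  assumes "f \<in> Ar C" "g \<in> Ar C" "Cod C f = Dom C g"
  shows "f \<cdot> g \<in> Ar C" "Dom C (f \<cdot> g) = Dom C f" "Cod C (f \<cdot> g) = Cod C g"
  using Comp_Hom[of f "Dom C f" "Cod C f" g "Cod C g"] assms by (simp_all add: Hom_iff)

lemma Rst_type [simp]:
  assumes "f \<in> Ar C"
  shows "\<rho> f \<in> Ar C" "Dom C (\<rho> f) = Dom C f" "Cod C (\<rho> f) = Dom C f"
  using Rst_Hom[of f "Dom C f" "Cod C f"] assms by (simp_all add: Hom_iff)

lemma Idn_Comp [simp]: "f \<in> Ar C \<Longrightarrow> Dom C f = X \<Longrightarrow> Idn C X \<cdot> f = f"
  using Id_left[of f X "Cod C f"] by (simp add: Hom_iff)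

lemma Comp_Idn [simp]: "f \<in> Ar C \<Longrightarrow> Cod C f = X \<Longrightarrow> f \<cdot> Idn C X = f"
  using Id_right[of f "Dom C f" X] by (simp add: Hom_iff)

lemma assoc [simp]:
  "f \<in> Ar C \<Longrightarrow> g \<in> Ar C \<Longrightarrow> h \<in> Ar C \<Longrightarrow> Cod C f = Dom C g \<Longrightarrow> Cod C g = Dom C h
   \<Longrightarrow> (f \<cdot> g) \<cdot> h = f \<cdot> (g \<cdot> h)"
  using Comp_assoc[of f "Dom C f" "Cod C f" g "Cod C g" h "Cod C h"] by (simp add: Hom_iff)

lemma Rst_Comp_self [simp]: "f \<in> Ar C \<Longrightarrow> \<rho> f \<cdot> f = f"
  using R1[of f "Dom C f" "Cod C f"] by (simp add: Hom_iff)

lemma Rst_Comp_self' [simp]: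
  "f \<in> Ar C \<Longrightarrow> g \<in> Ar C \<Longrightarrow> Cod C f = Dom C g \<Longrightarrow> \<rho> f \<cdot> (f \<cdot> g) = f \<cdot> g"
  using assoc[of "\<rho> f" f g] by simp

lemma Rst_commute:
  "f \<in> Ar C \<Longrightarrow> g \<in> Ar C \<Longrightarrow> Dom C f = Dom C g \<Longrightarrow> \<rho> f \<cdot> \<rho> g = \<rho> g \<cdot> \<rho> f"
  using R2[of f "Dom C f" "Cod C f" g "Cod C g"] by (simp add: Hom_iff)

lemma Rst_left_commute:
  assumes "f \<in> Ar C" "g \<in> Ar C" "h \<in> Ar C" "Dom C f = Dom C g" "Dom C h = Dom C g"
  shows "\<rho> f \<cdot> (\<rho> g \<cdot> h) = \<rho> g \<cdot> (\<rho> f \<cdot> h)"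
proof -
  have "\<rho> f \<cdot> (\<rho> g \<cdot> h) = (\<rho> f \<cdot> \<rho> g) \<cdot> h" using assms by simp
  also have "\<dots> = (\<rho> g \<cdot> \<rho> f) \<cdot> h" using assms by (simp only: Rst_commute)
  finally show ?thesis using assms by simp
qed

lemmas Rst_ac = Rst_commute Rst_left_commute

lemma Rst_Rst_Comp [simp]:
  "f \<in> Ar C \<Longrightarrow> g \<in> Ar C \<Longrightarrow> Dom C f = Dom C g \<Longrightarrow> \<rho> (\<rho> f \<cdot> g) = \<rho> f \<cdot> \<rho> g"
  using R3[of f "Dom C f" "Cod C f" g "Cod C g"] by (simp add: Hom_iff)

lemma Comp_Rst:
  "f \<in> Ar C \<Longrightarrow> g \<in> Ar C \<Longrightarrow> Cod C f = Dom C g \<Longrightarrow> f \<cdot> \<rho> g = \<rho> (f \<cdot> g) \<cdot> f"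
  using R4[of f "Dom C f" "Cod C f" g "Cod C g"] by (simp add: Hom_iff)

lemma Rst_Idn [simp]: "X \<in> Ob C \<Longrightarrow> \<rho> (Idn C X) = Idn C X"
  using Rst_Comp_self[of "Idn C X"] by (simp del: Rst_Comp_self)

lemma Rst_Rst [simp]: "f \<in> Ar C \<Longrightarrow> \<rho> (\<rho> f) = \<rho> f"
  using Rst_Rst_Comp[of f "Idn C (Dom C f)"] by simp

lemma Rst_idem [simp]: "f \<in> Ar C \<Longrightarrow> \<rho> f \<cdot> \<rho> f = \<rho> f"
  using Rst_Comp_self[of "\<rho> f"] by simp

lemma Rst_idem' [simp]:
  "f \<in> Ar C \<Longrightarrow> h \<in> Ar C \<Longrightarrow> Dom C h = Dom C f \<Longrightarrow> \<rho> f \<cdot> (\<rho> f \<cdot> h) = \<rho> f \<cdot> h"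
  using assoc[of "\<rho> f" "\<rho> f" h] by simp

text \<open>By [R.4] the left side is the restriction of
  \<open>\<rho> (f \<cdot> g) \<cdot> f\<close>; by [R.3] and [R.1] the factor
  \<open>\<rho> f\<close> is absorbed. Thus the domain of a composite depends on its second factor
  only through the restriction of that factor.\<close>

lemma Rst_Comp_Rst [simp]:
  assumes "f \<in> Ar C" "g \<in> Ar C" "Cod C f = Dom C g"
  shows "\<rho> (f \<cdot> \<rho> g) = \<rho> (f \<cdot> g)"
proof -
  have "\<rho> (f \<cdot> \<rho> g) = \<rho> (f \<cdot> g) \<cdot> \<rho> f" using assms by (subst Comp_Rst) simp_all
  also have "\<dots> = \<rho> f \<cdot> \<rho> (f \<cdot> g)" using assms by (subst Rst_commute) simp_all
  also have "\<dots> = \<rho> (\<rho> f \<cdot> (f \<cdot> g))" using assms by (subst Rst_Rst_Comp) simp_all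
  finally show ?thesis using assms by simp
qed

text \<open>For restriction idempotents, \<open>e \<cdot> e' = e\<close> expresses that
  \<open>e\<close> lies below \<open>e'\<close>. In this order a composite is defined at most where
  its first factor is.\<close>

lemma Rst_Comp_le [simp]:
  assumes "f \<in> Ar C" "g \<in> Ar C" "Cod C f = Dom C g"
  shows "\<rho> f \<cdot> \<rho> (f \<cdot> g) = \<rho> (f \<cdot> g)" "\<rho> (f \<cdot> g) \<cdot> \<rho> f = \<rho> (f \<cdot> g)"
proof -
  show 1: "\<rho> f \<cdot> \<rho> (f \<cdot> g) = \<rho> (f \<cdot> g)"
    using Rst_Rst_Comp[of f "f \<cdot> g"] assms by simp
  show "\<rho> (f \<cdot> g) \<cdot> \<rho> f = \<rho> (f \<cdot> g)" using 1 assms by (simp add: Rst_commute)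
qed

lemma Rst_Comp_total [simp]:
  assumes "f \<in> Ar C" "g \<in> Ar C" "Cod C f = Dom C g" "\<rho> g = Idn C (Dom C g)"
  shows "\<rho> (f \<cdot> g) = \<rho> f"
  using Rst_Comp_Rst[OF assms(1-3)] assms by simp

text \<open>This transports equations between domains along a substitution. It is the way in which
  the condition that \<open>f\<^sub>n\<close> has the domain of
  \<open>\<pi>\<^sub>n f\<^sub>*\<close> is used later.\<close>

lemma Rst_mono_eq:
  assumes "f \<in> Ar C" "g \<in> Ar C" "h \<in> Ar C" "Dom C g = Dom C h" "Cod C f = Dom C g" "\<rho> g = \<rho> h"
  shows "\<rho> (f \<cdot> g) = \<rho> (f \<cdot> h)"
  using assms Rst_Comp_Rst by metis

end

section \<open>Pairing of partial maps\<close>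

context cartesian_restriction_category
begin

lemma Trm_Ob' [simp]: "\<^bold>1 \<in> Ob C" by (rule Trm_Ob)

lemma Prd_Ob' [simp]: "X \<in> Ob C \<Longrightarrow> Y \<in> Ob C \<Longrightarrow> X \<^bold>\<times> Y \<in> Ob C" by (rule Prd_Ob)

lemma Bang_type [simp]:
  assumes "X \<in> Ob C"
  shows "\<^bold>! X \<in> Ar C" "Dom C (\<^bold>! X) = X" "Cod C (\<^bold>! X) = \<^bold>1" "\<rho> (\<^bold>! X) = Idn C X"
  using Bang_Hom[OF assms] Bang_total[OF assms] by (simp_all add: Hom_iff is_total_def)

lemma Pr0_type [simp]:
  assumes "X \<in> Ob C" "Y \<in> Ob C"
  shows "Pr0 C X Y \<in> Ar C" "Dom C (Pr0 C X Y) = X \<^bold>\<times> Y" "Cod C (Pr0 C X Y) = X"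
    "\<rho> (Pr0 C X Y) = Idn C (X \<^bold>\<times> Y)"
  using Pr0_Hom[OF assms] Pr0_total[OF assms] by (simp_all add: Hom_iff is_total_def)

lemma Pr1_type [simp]:
  assumes "X \<in> Ob C" "Y \<in> Ob C"
  shows "Pr1 C X Y \<in> Ar C" "Dom C (Pr1 C X Y) = X \<^bold>\<times> Y" "Cod C (Pr1 C X Y) = Y"
    "\<rho> (Pr1 C X Y) = Idn C (X \<^bold>\<times> Y)"
  using Pr1_Hom[OF assms] Pr1_total[OF assms] by (simp_all add: Hom_iff is_total_def)

lemma Pair_type [simp]:
  assumes "f \<in> Ar C" "g \<in> Ar C" "Dom C f = Dom C g"
  shows "\<langle>f, g\<rangle> \<in> Ar C" "Dom C \<langle>f, g\<rangle> = Dom C g" "Cod C \<langle>f, g\<rangle> = Cod C f \<^bold>\<times> Cod C g"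
  using Pair_Hom[of f "Dom C f" "Cod C f" g "Cod C g"] assms by (simp_all add: Hom_iff)

lemma Pair_Comp_Pr0 [simp]:
  "f \<in> Ar C \<Longrightarrow> g \<in> Ar C \<Longrightarrow> Dom C f = Dom C g \<Longrightarrow> Cod C f = X \<Longrightarrow> Cod C g = Y
   \<Longrightarrow> \<langle>f, g\<rangle> \<cdot> Pr0 C X Y = \<rho> g \<cdot> f"
  by (intro Pair_Pr0) (auto simp: Hom_iff)

lemma Pair_Comp_Pr1 [simp]:
  "f \<in> Ar C \<Longrightarrow> g \<in> Ar C \<Longrightarrow> Dom C f = Dom C g \<Longrightarrow> Cod C f = X \<Longrightarrow> Cod C g = Y
   \<Longrightarrow> \<langle>f, g\<rangle> \<cdot> Pr1 C X Y = \<rho> f \<cdot> g"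
  by (intro Pair_Pr1) (auto simp: Hom_iff)

lemma Pair_Comp_Pr0_Comp [simp]:
  assumes "f \<in> Ar C" "g \<in> Ar C" "Dom C f = Dom C g" "Cod C f = X" "Cod C g = Y" "h \<in> Ar C" "Dom C h = X"
  shows "\<langle>f, g\<rangle> \<cdot> (Pr0 C X Y \<cdot> h) = \<rho> g \<cdot> (f \<cdot> h)"
proof -
  have "X \<in> Ob C" "Y \<in> Ob C" using assms Cod_Ob by blast+
  then show ?thesis
    using assms Pair_Comp_Pr0[of f g X Y] assoc[of "\<langle>f,g\<rangle>" "Pr0 C X Y" h] by simp
qed

lemma Pair_Comp_Pr1_Comp [simp]:
  assumes "f \<in> Ar C" "g \<in> Ar C" "Dom C f = Dom C g" "Cod C f = X" "Cod C g = Y" "h \<in> Ar C" "Dom C h = Y"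
  shows "\<langle>f, g\<rangle> \<cdot> (Pr1 C X Y \<cdot> h) = \<rho> f \<cdot> (g \<cdot> h)"
proof -
  have "X \<in> Ob C" "Y \<in> Ob C" using assms Cod_Ob by blast+
  then show ?thesis
    using assms Pair_Comp_Pr1[of f g X Y] assoc[of "\<langle>f,g\<rangle>" "Pr1 C X Y" h] by simp
qed

text \<open>Composition with a total projection keeps the domain, and the first projection of the
  pair is \<open>\<rho> g \<cdot> f\<close>.\<close>

lemma Rst_Pair [simp]:
  assumes "f \<in> Ar C" "g \<in> Ar C" "Dom C f = Dom C g"
  shows "\<rho> \<langle>f, g\<rangle> = \<rho> f \<cdot> \<rho> g"
proof -
  have "\<rho> \<langle>f, g\<rangle> = \<rho> (\<langle>f, g\<rangle> \<cdot> Pr0 C (Cod C f) (Cod C g))"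
    using assms by (subst Rst_Comp_total) simp_all
  also have "\<dots> = \<rho> g \<cdot> \<rho> f" using assms by simp
  finally show ?thesis using assms by (simp add: Rst_commute)
qed

text \<open>Uniqueness of pairings. The restriction \<open>\<rho> g\<close> that occurs in a
  projection of \<open>\<langle>f, g\<rangle>\<close> is moved past \<open>z\<close> by [R.4] and
  becomes \<open>\<rho> (z \<cdot> g)\<close>, as the uniqueness condition requires.\<close>

lemma Comp_Pair [simp]:
  assumes "z \<in> Ar C" "f \<in> Ar C" "g \<in> Ar C" "Dom C f = Dom C g" "Cod C z = Dom C g"
  shows "z \<cdot> \<langle>f, g\<rangle> = \<langle>z \<cdot> f, z \<cdot> g\<rangle>"
proof (rule Pair_unique)
  show "z \<cdot> f \<in> Hom C (Dom C z) (Cod C f)" "z \<cdot> g \<in> Hom C (Dom C z) (Cod C g)"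
    "z \<cdot> \<langle>f, g\<rangle> \<in> Hom C (Dom C z) (Cod C f \<^bold>\<times> Cod C g)" using assms by (simp_all add: Hom_iff)
  have 1: "z \<cdot> \<rho> g \<cdot> f = \<rho> (z \<cdot> g) \<cdot> (z \<cdot> f)" "z \<cdot> \<rho> f \<cdot> g = \<rho> (z \<cdot> f) \<cdot> (z \<cdot> g)"
    using assms by (simp_all add: Comp_Rst del: assoc) (simp_all)
  show "z \<cdot> \<langle>f, g\<rangle> \<cdot> Pr0 C (Cod C f) (Cod C g) = \<rho> (z \<cdot> g) \<cdot> (z \<cdot> f)"
    "z \<cdot> \<langle>f, g\<rangle> \<cdot> Pr1 C (Cod C f) (Cod C g) = \<rho> (z \<cdot> f) \<cdot> (z \<cdot> g)"
    using assms 1 by simp_all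
qed

lemma Pair_Pr0_Pr1 [simp]:
  assumes "h \<in> Ar C" "Cod C h = X \<^bold>\<times> Y" "X \<in> Ob C" "Y \<in> Ob C"
  shows "\<langle>h \<cdot> Pr0 C X Y, h \<cdot> Pr1 C X Y\<rangle> = h"
  by (rule Pair_unique[where Z="Dom C h" and X=X and Y=Y, symmetric]) (use assms in \<open>simp_all add: Hom_iff\<close>)

lemma Pair_Pr0_Pr1_Idn [simp]:
  assumes "X \<in> Ob C" "Y \<in> Ob C"
  shows "\<langle>Pr0 C X Y, Pr1 C X Y\<rangle> = Idn C (X \<^bold>\<times> Y)"
  using Pair_Pr0_Pr1[of "Idn C (X \<^bold>\<times> Y)" X Y] assms by simp

lemma Prd_eqI:
  assumes "h \<in> Hom C Z (X \<^bold>\<times> Y)" "k \<in> Hom C Z (X \<^bold>\<times> Y)" "X \<in> Ob C" "Y \<in> Ob C"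
    "h \<cdot> Pr0 C X Y = k \<cdot> Pr0 C X Y" "h \<cdot> Pr1 C X Y = k \<cdot> Pr1 C X Y"
  shows "h = k"
proof -
  have "\<langle>h \<cdot> Pr0 C X Y, h \<cdot> Pr1 C X Y\<rangle> = h" "\<langle>k \<cdot> Pr0 C X Y, k \<cdot> Pr1 C X Y\<rangle> = k"
    using assms(1-4) by (simp_all add: Hom_iff)
  then show ?thesis using assms(5,6) by metis
qed

lemma Pair_Rst_left:
  assumes "e \<in> Ar C" "a \<in> Ar C" "b \<in> Ar C" "Dom C a = Dom C b" "Dom C e = Dom C b"
  shows "\<langle>\<rho> e \<cdot> a, b\<rangle> = \<rho> e \<cdot> \<langle>a, b\<rangle>"
  by (rule Prd_eqI[of _ "Dom C e" "Cod C a" "Cod C b"])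
     (use assms in \<open>simp_all add: Hom_iff Rst_ac\<close>)

lemma Pair_Rst_right:
  assumes "e \<in> Ar C" "a \<in> Ar C" "b \<in> Ar C" "Dom C a = Dom C b" "Dom C e = Dom C b"
  shows "\<langle>a, \<rho> e \<cdot> b\<rangle> = \<rho> e \<cdot> \<langle>a, b\<rangle>"
  by (rule Prd_eqI[of _ "Dom C e" "Cod C a" "Cod C b"])
     (use assms in \<open>simp_all add: Hom_iff Rst_ac\<close>)

text \<open>The pair is already restricted to the domains of both components, so a further
  restriction of one component to the domain of the other loses nothing.\<close>

lemma Pair_Rst:
  assumes "a \<in> Ar C" "b \<in> Ar C" "Dom C a = Dom C b"
  shows "\<langle>\<rho> b \<cdot> a, b\<rangle> = \<langle>a, b\<rangle>" "\<langle>a, \<rho> a \<cdot> b\<rangle> = \<langle>a, b\<rangle>"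
proof -
  have "\<langle>\<rho> b \<cdot> a, b\<rangle> = \<rho> b \<cdot> \<langle>a, b\<rangle>" "\<langle>a, \<rho> a \<cdot> b\<rangle> = \<rho> a \<cdot> \<langle>a, b\<rangle>"
    using assms Pair_Rst_left[of b a b] Pair_Rst_right[of a a b] by simp_all
  moreover have "\<rho> b \<cdot> \<rho> \<langle>a, b\<rangle> = \<rho> \<langle>a, b\<rangle>" "\<rho> a \<cdot> \<rho> \<langle>a, b\<rangle> = \<rho> \<langle>a, b\<rangle>"
    using assms by (simp_all add: Rst_ac)
  then have "\<rho> b \<cdot> \<langle>a, b\<rangle> = \<langle>a, b\<rangle>" "\<rho> a \<cdot> \<langle>a, b\<rangle> = \<langle>a, b\<rangle>"
    using assms assoc[of "\<rho> b" "\<rho> \<langle>a, b\<rangle>" "\<langle>a, b\<rangle>"] assoc[of "\<rho> a" "\<rho> \<langle>a, b\<rangle>" "\<langle>a, b\<rangle>"]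
      Rst_Comp_self[of "\<langle>a, b\<rangle>"] by (simp_all del: Comp_Pair Rst_Pair)
  ultimately show "\<langle>\<rho> b \<cdot> a, b\<rangle> = \<langle>a, b\<rangle>" "\<langle>a, \<rho> a \<cdot> b\<rangle> = \<langle>a, b\<rangle>" by simp_all
qed

lemma cross_type [simp]:
  assumes "f \<in> Ar C" "g \<in> Ar C"
  shows "cross C f g \<in> Ar C" "Dom C (cross C f g) = Dom C f \<^bold>\<times> Dom C g"
    "Cod C (cross C f g) = Cod C f \<^bold>\<times> Cod C g"
  using assms by (simp_all add: cross_def)

lemma Comp_cross:
  assumes "z \<in> Ar C" "f \<in> Ar C" "g \<in> Ar C" "Cod C z = Dom C f \<^bold>\<times> Dom C g"
  shows "z \<cdot> cross C f g = \<langle>z \<cdot> (Pr0 C (Dom C f) (Dom C g) \<cdot> f), z \<cdot> (Pr1 C (Dom C f) (Dom C g) \<cdot> g)\<rangle>"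
  using assms by (simp add: cross_def)

text \<open>This is the source of the second equations in [DR.8] and [DR.9], which hold in every
  Cartesian restriction category. By [R.4] the second component of the cross is a restricted
  projection; the restriction is pulled out of the pair of projections, which is the
  identity.\<close>

lemma cross_Idn_Rst:
  assumes "f \<in> Ar C" "A \<in> Ob C" "Dom C f = X"
  shows "cross C (Idn C A) (\<rho> f) = \<rho> (Pr1 C A X \<cdot> f)"
proof -
  have "X \<in> Ob C" using assms Dom_Ob by blast
  then have "cross C (Idn C A) (\<rho> f) = \<langle>Pr0 C A X, \<rho> (Pr1 C A X \<cdot> f) \<cdot> Pr1 C A X\<rangle>"
    using assms by (simp add: cross_def Comp_Rst)
  also have "\<dots> = \<rho> (Pr1 C A X \<cdot> f)"
    using assms \<open>X \<in> Ob C\<close> by (simp add: Pair_Rst_right del: Comp_Pair)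
  finally show ?thesis .
qed

text \<open>Each map into the terminal object is a restriction of the unique total one, so it
  carries no information beyond its domain.\<close>

lemma to_Trm_eqI:
  assumes "f \<in> Hom C X \<^bold>1" "g \<in> Hom C X \<^bold>1" "\<rho> f = \<rho> g"
  shows "f = g"
  using Bang_Rst assms by metis

lemma Comp_Bang:
  assumes "f \<in> Ar C" "Cod C f = X"
  shows "f \<cdot> \<^bold>! X = \<rho> f \<cdot> \<^bold>! (Dom C f)"
  by (rule to_Trm_eqI[where X="Dom C f"]) (use assms Cod_Ob in \<open>auto simp: Hom_iff\<close>)

lemma Bang_Trm [simp]: "\<^bold>! \<^bold>1 = Idn C \<^bold>1"
  by (rule to_Trm_eqI) (simp_all add: Hom_iff)

lemma total_Comp_Bang [simp]:
  assumes "f \<in> Ar C" "Cod C f = X" "\<rho> f = Idn C (Dom C f)"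
  shows "f \<cdot> \<^bold>! X = \<^bold>! (Dom C f)"
  using Comp_Bang[OF assms(1,2)] assms by simp

end

context restriction_category
begin

lemma Rst_absorb [simp]:
  assumes "f \<in> Ar C" "g \<in> Ar C" "Dom C f = Dom C g"
  shows "\<rho> f \<cdot> (\<rho> g \<cdot> f) = \<rho> g \<cdot> f"
  using assms by (subst Rst_left_commute) simp_all

lemma Rst_absorb' [simp]:
  assumes "f \<in> Ar C" "g \<in> Ar C" "h \<in> Ar C" "Dom C f = Dom C g" "Dom C g = Dom C h"
  shows "\<rho> f \<cdot> (\<rho> g \<cdot> (\<rho> h \<cdot> f)) = \<rho> g \<cdot> (\<rho> h \<cdot> f)"
  using assms by (subst Rst_left_commute) simp_all

end

context cartesian_restriction_category
begin

text \<open>Projecting from a pair restricts each component to the domain of the other; here these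
  restrictions are removed when the components are recombined. The maps \<open>a'\<close> and
  \<open>b'\<close> merely supply domains: after composition with a total map, the map behind a
  restriction is no longer literally the component itself.\<close>

lemma Pair_Rst_both:
  assumes "a \<in> Ar C" "b \<in> Ar C" "Dom C a = Dom C b" "a' \<in> Ar C" "b' \<in> Ar C"
    "\<rho> a' = \<rho> a" "\<rho> b' = \<rho> b"
  shows "\<langle>\<rho> b' \<cdot> a, \<rho> a' \<cdot> b\<rangle> = \<langle>a, b\<rangle>"
proof -
  have "\<langle>\<rho> b \<cdot> a, \<rho> a \<cdot> b\<rangle> = \<rho> b \<cdot> \<langle>a, \<rho> a \<cdot> b\<rangle>"
    using assms by (subst Pair_Rst_left) simp_all
  also have "\<dots> = \<rho> b \<cdot> \<langle>a, b\<rangle>" using assms by (simp only: Pair_Rst(2))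
  also have "\<dots> = \<langle>\<rho> b \<cdot> a, b\<rangle>" using assms by (subst Pair_Rst_left) simp_all
  also have "\<dots> = \<langle>a, b\<rangle>" using assms by (simp only: Pair_Rst(1))
  finally show ?thesis using assms by simp
qed

end

section \<open>Sums of maps into a total commutative monoid\<close>

locale crc_monoid = cartesian_restriction_category +
  fixes M :: "('a, 'b) imonoid"
  assumes tcm: "total_comm_monoid C M"
begin

abbreviation "pl \<equiv> plus_map C M"
abbreviation "zm \<equiv> zero_map C M"

lemma mobj_Ob [simp]: "mobj M \<in> Ob C"
  using tcm by (simp add: total_comm_monoid_def Let_def)

lemma madd_type [simp]:
  "madd M \<in> Ar C" "Dom C (madd M) = mobj M \<^bold>\<times> mobj M" "Cod C (madd M) = mobj M"
  "\<rho> (madd M) = Idn C (mobj M \<^bold>\<times> mobj M)"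
  using tcm by (simp_all add: total_comm_monoid_def Let_def is_total_def Hom_iff)

lemma mzero_type [simp]:
  "mzero M \<in> Ar C" "Dom C (mzero M) = \<^bold>1" "Cod C (mzero M) = mobj M" "\<rho> (mzero M) = Idn C \<^bold>1"
  using tcm by (simp_all add: total_comm_monoid_def Let_def is_total_def Hom_iff)

lemma plus_map_type [simp]:
  assumes "f \<in> Ar C" "g \<in> Ar C" "Dom C f = Dom C g" "Cod C f = mobj M" "Cod C g = mobj M"
  shows "pl f g \<in> Ar C" "Dom C (pl f g) = Dom C g" "Cod C (pl f g) = mobj M"
    "\<rho> (pl f g) = \<rho> f \<cdot> \<rho> g"
  using assms by (simp_all add: plus_map_def)

lemma zero_map_type [simp]:
  assumes "Z \<in> Ob C"
  shows "zm Z \<in> Ar C" "Dom C (zm Z) = Z" "Cod C (zm Z) = mobj M" "\<rho> (zm Z) = Idn C Z"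
  using assms by (simp_all add: zero_map_def)

lemma Comp_plus_map [simp]:
  assumes "z \<in> Ar C" "f \<in> Ar C" "g \<in> Ar C" "Dom C f = Dom C g" "Cod C f = mobj M" "Cod C g = mobj M"
    "Cod C z = Dom C g"
  shows "z \<cdot> pl f g = pl (z \<cdot> f) (z \<cdot> g)"
  using assms unfolding plus_map_def by (subst assoc[symmetric]) simp_all

lemma Comp_zero_map:
  assumes "z \<in> Ar C" "Cod C z = Z"
  shows "z \<cdot> zm Z = \<rho> z \<cdot> zm (Dom C z)"
proof -
  have "Z \<in> Ob C" using assms Cod_Ob by blast
  then show ?thesis using assms Comp_Bang[of z Z]
    assoc[of z "\<^bold>! Z" "mzero M"] unfolding zero_map_def by simp
qed

lemma total_Comp_zero_map [simp]:
  assumes "z \<in> Ar C" "Cod C z = Z" "\<rho> z = Idn C (Dom C z)"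
  shows "z \<cdot> zm Z = zm (Dom C z)"
  using Comp_zero_map[OF assms(1,2)] assms by simp

lemma plus_map_Rst:
  assumes "f \<in> Ar C" "g \<in> Ar C" "Dom C f = Dom C g" "Cod C f = mobj M" "Cod C g = mobj M"
    "e \<in> Ar C" "Dom C e = Dom C g"
  shows "pl (\<rho> e \<cdot> f) g = \<rho> e \<cdot> pl f g" "pl f (\<rho> e \<cdot> g) = \<rho> e \<cdot> pl f g"
proof -
  have "pl (\<rho> e \<cdot> f) g = (\<rho> e \<cdot> \<langle>f, g\<rangle>) \<cdot> madd M"
    using assms unfolding plus_map_def by (subst Pair_Rst_left) simp_all
  then show "pl (\<rho> e \<cdot> f) g = \<rho> e \<cdot> pl f g"
    unfolding plus_map_def using assms by (subst (asm) assoc) simp_all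
  have "pl f (\<rho> e \<cdot> g) = (\<rho> e \<cdot> \<langle>f, g\<rangle>) \<cdot> madd M"
    using assms unfolding plus_map_def by (subst Pair_Rst_right) simp_all
  then show "pl f (\<rho> e \<cdot> g) = \<rho> e \<cdot> pl f g"
    unfolding plus_map_def using assms by (subst (asm) assoc) simp_all
qed

lemma plus_map_Rst_both:
  assumes "a \<in> Ar C" "b \<in> Ar C" "Dom C a = Dom C b" "Cod C a = mobj M" "Cod C b = mobj M"
    "a' \<in> Ar C" "b' \<in> Ar C" "\<rho> a' = \<rho> a" "\<rho> b' = \<rho> b"
  shows "pl (\<rho> b' \<cdot> a) (\<rho> a' \<cdot> b) = pl a b"
  using assms unfolding plus_map_def by (simp only: Pair_Rst_both)

text \<open>The law for the two projections is precomposed with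
  \<open>\<langle>f, g\<rangle>\<close>. The projections then return each map restricted to the
  domain of the other, and the sum absorbs these restrictions.\<close>

lemma plus_map_commute:
  assumes "f \<in> Ar C" "g \<in> Ar C" "Dom C f = Dom C g" "Cod C f = mobj M" "Cod C g = mobj M"
  shows "pl f g = pl g f"
proof -
  let ?A = "mobj M"
  have "pl (Pr1 C ?A ?A) (Pr0 C ?A ?A) = pl (Pr0 C ?A ?A) (Pr1 C ?A ?A)"
    using tcm by (simp add: total_comm_monoid_def Let_def)
  then have "\<langle>f, g\<rangle> \<cdot> pl (Pr1 C ?A ?A) (Pr0 C ?A ?A) = \<langle>f, g\<rangle> \<cdot> pl (Pr0 C ?A ?A) (Pr1 C ?A ?A)" by simp
  then have "pl (\<rho> f \<cdot> g) (\<rho> g \<cdot> f) = pl (\<rho> g \<cdot> f) (\<rho> f \<cdot> g)" using assms by simp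
  then show ?thesis using assms by (simp add: plus_map_Rst_both del: plus_map_type)
qed

text \<open>Precomposing the unit law with \<open>f\<close> yields zero only on the domain of
  \<open>f\<close>. Adding \<open>f\<close> restricts to this domain anyway, so the total zero map
  is a unit for partial maps as well.\<close>

lemma plus_map_zero_left [simp]:
  assumes "f \<in> Ar C" "Cod C f = mobj M" "Dom C f = Z"
  shows "pl (zm Z) f = f"
proof -
  have Z: "Z \<in> Ob C" using assms Dom_Ob by blast
  have "pl (zm (mobj M)) (Idn C (mobj M)) = Idn C (mobj M)"
    using tcm by (simp add: total_comm_monoid_def Let_def)
  then have "f \<cdot> pl (zm (mobj M)) (Idn C (mobj M)) = f \<cdot> Idn C (mobj M)" by simp
  then have "pl (\<rho> f \<cdot> zm Z) f = f" using assms Z Comp_zero_map[of f "mobj M"] by simp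
  moreover have "pl (\<rho> f \<cdot> zm Z) f = pl (zm Z) f"
    using assms Z plus_map_Rst_both[of "zm Z" f "zm Z" f] by simp
  ultimately show ?thesis by simp
qed

lemma plus_map_zero_right [simp]:
  assumes "f \<in> Ar C" "Cod C f = mobj M" "Dom C f = Z"
  shows "pl f (zm Z) = f"
proof -
  have Z: "Z \<in> Ob C" using assms Dom_Ob by blast
  then show ?thesis using plus_map_commute[of f "zm Z"] assms by simp
qed

text \<open>Additivity of the components produces zeros restricted to a common domain; these, too,
  are neutral for maps with that domain.\<close>

lemma plus_map_rzero [simp]:
  assumes "f \<in> Ar C" "Cod C f = mobj M" "Dom C f = Z" "e \<in> Ar C" "\<rho> e = \<rho> f"
  shows "pl (\<rho> e \<cdot> zm Z) f = f" "pl f (\<rho> e \<cdot> zm Z) = f"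
proof -
  have Z: "Z \<in> Ob C" using assms Dom_Ob by blast
  have "Dom C e = Z" using assms(1,3,4) Rst_type(2)[of e] Rst_type(2)[of f] assms(5) by simp
  with Z show "pl (\<rho> e \<cdot> zm Z) f = f" "pl f (\<rho> e \<cdot> zm Z) = f"
    using assms plus_map_Rst_both[of "zm Z" f "zm Z" f] plus_map_Rst_both[of f "zm Z" f "zm Z"]
    by simp_all
qed

text \<open>The law for the projections is precomposed with
  \<open>\<langle>f, \<langle>g, h\<rangle>\<rangle>\<close>. The domain of this triple is the
  domain of both iterated sums, so the restrictions that the substitution introduces are
  absorbed.\<close>

lemma plus_map_assoc:
  assumes "f \<in> Ar C" "g \<in> Ar C" "h \<in> Ar C" "Dom C f = Dom C g" "Dom C g = Dom C h"
    "Cod C f = mobj M" "Cod C g = mobj M" "Cod C h = mobj M"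
  shows "pl (pl f g) h = pl f (pl g h)"
proof -
  let ?A = "mobj M"
  define a b c where "a = Pr0 C ?A (?A \<^bold>\<times> ?A)" and "b = Pr1 C ?A (?A \<^bold>\<times> ?A) \<cdot> Pr0 C ?A ?A"
    and "c = Pr1 C ?A (?A \<^bold>\<times> ?A) \<cdot> Pr1 C ?A ?A"
  define t where "t = \<langle>f, \<langle>g, h\<rangle>\<rangle>"
  have ty: "a \<in> Hom C (?A \<^bold>\<times> ?A \<^bold>\<times> ?A) ?A" "b \<in> Hom C (?A \<^bold>\<times> ?A \<^bold>\<times> ?A) ?A"
    "c \<in> Hom C (?A \<^bold>\<times> ?A \<^bold>\<times> ?A) ?A" "t \<in> Hom C (Dom C h) (?A \<^bold>\<times> ?A \<^bold>\<times> ?A)"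
    using assms by (simp_all add: a_def b_def c_def t_def Hom_iff)
  have t: "\<rho> t = \<rho> f \<cdot> (\<rho> g \<cdot> \<rho> h)" using assms by (simp add: t_def)
  have "pl (pl a b) c = pl a (pl b c)"
    using tcm by (simp add: total_comm_monoid_def Let_def a_def b_def c_def)
  then have "t \<cdot> pl (pl a b) c = t \<cdot> pl a (pl b c)" by simp
  then have 1: "pl (pl (t \<cdot> a) (t \<cdot> b)) (t \<cdot> c) = pl (t \<cdot> a) (pl (t \<cdot> b) (t \<cdot> c))"
    using ty by (simp add: Hom_iff)
  have e: "t \<cdot> a = \<rho> t \<cdot> f" "t \<cdot> b = \<rho> t \<cdot> g" "t \<cdot> c = \<rho> t \<cdot> h"
    unfolding t using assms by (simp_all add: t_def a_def b_def c_def Rst_ac)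
  have "pl (pl (t \<cdot> a) (t \<cdot> b)) (t \<cdot> c) = \<rho> t \<cdot> pl (pl f g) h"
    "pl (t \<cdot> a) (pl (t \<cdot> b) (t \<cdot> c)) = \<rho> t \<cdot> pl f (pl g h)"
    unfolding e using ty assms by (simp_all add: Hom_iff)
  moreover have "\<rho> t = \<rho> (pl (pl f g) h)" "\<rho> t = \<rho> (pl f (pl g h))"
    unfolding t using assms by simp_all
  then have "\<rho> t \<cdot> pl (pl f g) h = pl (pl f g) h" "\<rho> t \<cdot> pl f (pl g h) = pl f (pl g h)"
    using assms Rst_Comp_self[of "pl (pl f g) h"] Rst_Comp_self[of "pl f (pl g h)"]
    by (simp_all del: Comp_plus_map Rst_Comp_self plus_map_type(4))
  ultimately show ?thesis using 1 by simp
qed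

abbreviation "hm \<equiv> hom_monoid C M"

lemma hm_simps [simp]:
  "carrier (hm Z) = Hom C Z (mobj M)" "monoid.mult (hm Z) = pl" "one (hm Z) = zm Z"
  by (simp_all add: hom_monoid_def)

text \<open>The carrier contains all partial maps, and the unit is the total zero map. An empty sum
  is therefore total, which is why the rules on domains and on precomposition of sums assume a
  nonempty index set.\<close>

lemma hm_comm_monoid: "Z \<in> Ob C \<Longrightarrow> comm_monoid (hm Z)"
  by unfold_locales (auto simp: Hom_iff plus_map_assoc intro: plus_map_commute)

abbreviation "sm \<equiv> sum_map C M"

lemma sum_map_Hom:
  assumes "Z \<in> Ob C" "\<And>i. i \<in> I \<Longrightarrow> t i \<in> Hom C Z (mobj M)"
  shows "sm Z t I \<in> Hom C Z (mobj M)"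
  using comm_monoid.finprod_closed[OF hm_comm_monoid[OF assms(1)], of t I] assms(2)
  by (auto simp: sum_map_def)

lemma sum_map_empty [simp]: "Z \<in> Ob C \<Longrightarrow> sm Z t {} = zm Z"
  using comm_monoid.finprod_empty[OF hm_comm_monoid] by (simp add: sum_map_def)

lemma sum_map_insert:
  assumes "Z \<in> Ob C" "finite I" "j \<notin> I" "\<And>i. i \<in> insert j I \<Longrightarrow> t i \<in> Hom C Z (mobj M)"
  shows "sm Z t (insert j I) = pl (t j) (sm Z t I)"
  using comm_monoid.finprod_insert[OF hm_comm_monoid[OF assms(1)], of I j t] assms
  by (auto simp: sum_map_def)

lemma sum_map_cong:
  assumes "Z \<in> Ob C" "\<And>i. i \<in> I \<Longrightarrow> t i = s i" "\<And>i. i \<in> I \<Longrightarrow> s i \<in> Hom C Z (mobj M)"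
  shows "sm Z t I = sm Z s I"
  using comm_monoid.finprod_cong'[OF hm_comm_monoid[OF assms(1)], of I I s t] assms
  by (auto simp: sum_map_def)

lemma sum_map_singleton [simp]:
  assumes "Z \<in> Ob C" "t j \<in> Hom C Z (mobj M)"
  shows "sm Z t {j} = t j"
  using sum_map_insert[of Z "{}" j t] assms by (simp add: Hom_iff)

lemma sum_map_UN:
  assumes "Z \<in> Ob C" "finite I" "\<And>i. i \<in> I \<Longrightarrow> finite (J i)"
    "\<And>i i'. i \<in> I \<Longrightarrow> i' \<in> I \<Longrightarrow> i \<noteq> i' \<Longrightarrow> J i \<inter> J i' = {}"
    "\<And>i j. i \<in> I \<Longrightarrow> j \<in> J i \<Longrightarrow> t j \<in> Hom C Z (mobj M)"
  shows "sm Z t (\<Union>i\<in>I. J i) = sm Z (\<lambda>i. sm Z t (J i)) I"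
  using comm_monoid.finprod_UN_disjoint[OF hm_comm_monoid[OF assms(1)], of I J t] assms
  by (auto simp: sum_map_def pairwise_def disjnt_def)

lemma sum_map_plus:
  assumes "Z \<in> Ob C" "\<And>i. i \<in> I \<Longrightarrow> t i \<in> Hom C Z (mobj M)" "\<And>i. i \<in> I \<Longrightarrow> s i \<in> Hom C Z (mobj M)"
  shows "sm Z (\<lambda>i. pl (t i) (s i)) I = pl (sm Z t I) (sm Z s I)"
  using comm_monoid.finprod_multf[OF hm_comm_monoid[OF assms(1)], of t I s] assms
  by (auto simp: sum_map_def)

lemma sum_map_reindex:
  assumes "Z \<in> Ob C" "inj_on h I" "\<And>i. i \<in> I \<Longrightarrow> t (h i) \<in> Hom C Z (mobj M)"
  shows "sm Z t (h ` I) = sm Z (\<lambda>i. t (h i)) I"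
  using comm_monoid.finprod_reindex[OF hm_comm_monoid[OF assms(1)], of t h I] assms
  by (auto simp: sum_map_def)

lemma sum_map_bij:
  assumes "Z \<in> Ob C" "bij_betw h I J" "\<And>i. i \<in> I \<Longrightarrow> t (h i) = s i" "\<And>i. i \<in> I \<Longrightarrow> s i \<in> Hom C Z (mobj M)"
  shows "sm Z t J = sm Z s I"
proof -
  have J: "J = h ` I" and inj: "inj_on h I" using assms(2) by (auto simp: bij_betw_def)
  have "sm Z t J = sm Z (\<lambda>i. t (h i)) I" unfolding J using assms by (intro sum_map_reindex inj) auto
  also have "\<dots> = sm Z s I" using assms by (intro sum_map_cong) auto
  finally show ?thesis .
qed

lemma sum_map_swap:
  assumes "Z \<in> Ob C" "finite I" "finite J" "\<And>i j. i \<in> I \<Longrightarrow> j \<in> J \<Longrightarrow> t i j \<in> Hom C Z (mobj M)"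
  shows "sm Z (\<lambda>i. sm Z (t i) J) I = sm Z (\<lambda>j. sm Z (\<lambda>i. t i j) I) J"
  using assms(2,4)
proof (induction I)
  case empty
  have "sm Z (\<lambda>j. zm Z) J = zm Z"
    using comm_monoid.finprod_one[OF hm_comm_monoid[OF assms(1)], of J] by (simp add: sum_map_def)
  then show ?case using assms(1) by simp
next
  case (insert k I)
  have "sm Z (\<lambda>i. sm Z (t i) J) (insert k I) = pl (sm Z (t k) J) (sm Z (\<lambda>i. sm Z (t i) J) I)"
    using insert assms by (intro sum_map_insert sum_map_Hom) auto
  also have "\<dots> = pl (sm Z (t k) J) (sm Z (\<lambda>j. sm Z (\<lambda>i. t i j) I) J)" using insert by simp
  also have "\<dots> = sm Z (\<lambda>j. pl (t k j) (sm Z (\<lambda>i. t i j) I)) J"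
    using insert assms by (intro sum_map_plus[symmetric] sum_map_Hom) auto
  also have "\<dots> = sm Z (\<lambda>j. sm Z (\<lambda>i. t i j) (insert k I)) J"
    using insert assms
    by (intro sum_map_cong sum_map_Hom sum_map_insert[symmetric, where t="\<lambda>i. t i _"]) auto
  finally show ?case .
qed

lemma Rst_sum_map:
  assumes "Z \<in> Ob C" "finite I" "I \<noteq> {}" "\<And>i. i \<in> I \<Longrightarrow> t i \<in> Hom C Z (mobj M)"
    "\<And>i. i \<in> I \<Longrightarrow> \<rho> (t i) = \<rho> e" "e \<in> Ar C"
  shows "\<rho> (sm Z t I) = \<rho> e"
  using assms(2-5)
proof (induction I rule: finite_ne_induct)
  case (singleton x)
  then show ?case using assms(1) by simp
next
  case (insert x F)
  have "sm Z t F \<in> Hom C Z (mobj M)" using insert assms by (intro sum_map_Hom) auto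
  then show ?case using insert assms by (subst sum_map_insert) (auto simp: Hom_iff)
qed

lemma Comp_sum_map:
  assumes "z \<in> Hom C W Z" "finite I" "I \<noteq> {}" "\<And>i. i \<in> I \<Longrightarrow> t i \<in> Hom C Z (mobj M)"
  shows "z \<cdot> sm Z t I = sm W (\<lambda>i. z \<cdot> t i) I"
  using assms(2-4)
proof (induction I rule: finite_ne_induct)
  case (singleton x)
  have "Z \<in> Ob C" "W \<in> Ob C" using assms(1) Dom_Ob Cod_Ob by (auto simp: Hom_iff)
  then show ?case using assms(1) singleton by (simp add: Hom_iff)
next
  case (insert x F)
  have o: "Z \<in> Ob C" "W \<in> Ob C" using assms(1) Dom_Ob Cod_Ob by (auto simp: Hom_iff)
  have "sm Z t F \<in> Hom C Z (mobj M)" using insert o by (intro sum_map_Hom) auto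
  then have "z \<cdot> sm Z t (insert x F) = pl (z \<cdot> t x) (sm W (\<lambda>i. z \<cdot> t i) F)"
    using insert assms(1) o by (subst sum_map_insert) (auto simp: Hom_iff)
  also have "\<dots> = sm W (\<lambda>i. z \<cdot> t i) (insert x F)"
    using insert assms(1) o by (subst sum_map_insert) (auto simp: Hom_iff)
  finally show ?case .
qed

lemma sum_map_rzero:
  assumes "finite I" "x \<in> Hom C Z (mobj M)" "\<And>i. i \<in> I \<Longrightarrow> t i = \<rho> x \<cdot> zm Z"
  shows "pl x (sm Z t I) = x"
  using assms(1,3)
proof (induction I)
  case empty
  have "Z \<in> Ob C" using assms(2) Dom_Ob by (auto simp: Hom_iff)
  then show ?case using assms(2) by (simp add: Hom_iff)
next
  case (insert k I)
  have Z: "Z \<in> Ob C" using assms(2) Dom_Ob by (auto simp: Hom_iff)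
  have t: "t i \<in> Hom C Z (mobj M)" if "i \<in> insert k I" for i
    unfolding insert.prems[OF that] using assms(2) Z by (simp add: Hom_iff)
  then have s: "sm Z t I \<in> Hom C Z (mobj M)" using Z by (intro sum_map_Hom) auto
  have "pl x (sm Z t (insert k I)) = pl x (pl (t k) (sm Z t I))"
    using insert Z t by (subst sum_map_insert) auto
  also have "\<dots> = pl (pl x (t k)) (sm Z t I)"
    using t[of k] s assms(2) by (subst plus_map_assoc) (auto simp: Hom_iff)
  also have "pl x (t k) = x" using insert.prems[of k] assms(2) by (simp add: Hom_iff)
  finally show ?case using insert by simp
qed

text \<open>This collapses the sum over partitions when one of the composed maps has vanishing
  higher components, and the sum over the variables of a derivative when one variable is
  zero.\<close>

lemma sum_map_single:
  assumes "finite I" "j \<in> I" "t j \<in> Hom C Z (mobj M)"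
    "\<And>i. i \<in> I \<Longrightarrow> i \<noteq> j \<Longrightarrow> t i = \<rho> (t j) \<cdot> zm Z"
  shows "sm Z t I = t j"
proof -
  have Z: "Z \<in> Ob C" using assms(3) Dom_Ob by (auto simp: Hom_iff)
  have t: "t i \<in> Hom C Z (mobj M)" if "i \<in> I" for i
    using assms(3,4) that Z by (cases "i = j") (simp_all add: Hom_iff)
  have "sm Z t I = sm Z t (insert j (I - {j}))" using assms by (simp add: insert_absorb)
  also have "\<dots> = pl (t j) (sm Z t (I - {j}))"
    using assms Z t by (subst sum_map_insert) auto
  also have "\<dots> = t j" using assms by (intro sum_map_rzero) auto
  finally show ?thesis .
qed

lemma sum_map_all_rzero:
  assumes "finite I" "I \<noteq> {}" "e \<in> Ar C" "Dom C e = Z" "\<And>i. i \<in> I \<Longrightarrow> t i = \<rho> e \<cdot> zm Z"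
  shows "sm Z t I = \<rho> e \<cdot> zm Z"
proof -
  obtain j where j: "j \<in> I" using assms by auto
  have Z: "Z \<in> Ob C" using assms(3,4) Dom_Ob by (auto simp: Hom_iff)
  have "sm Z t I = t j"
    by (rule sum_map_single) (use assms j Z in \<open>auto simp: Hom_iff\<close>)
  then show ?thesis using assms j by simp
qed

lemma plus_map_left_commute:
  assumes "f \<in> Ar C" "g \<in> Ar C" "h \<in> Ar C" "Dom C f = Dom C g" "Dom C g = Dom C h"
    "Cod C f = mobj M" "Cod C g = mobj M" "Cod C h = mobj M"
  shows "pl f (pl g h) = pl g (pl f h)"
  using assms plus_map_assoc[of f g h] plus_map_assoc[of g f h] plus_map_commute[of f g] by simp

lemmas plus_map_ac = plus_map_assoc plus_map_commute plus_map_left_commute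

end

declare crc_monoid.mobj_Ob [simp] crc_monoid.madd_type [simp] crc_monoid.mzero_type [simp]
  crc_monoid.plus_map_type [simp] crc_monoid.zero_map_type [simp] crc_monoid.Comp_plus_map [simp]
  crc_monoid.total_Comp_zero_map [simp] crc_monoid.plus_map_zero_left [simp]
  crc_monoid.plus_map_zero_right [simp] crc_monoid.plus_map_rzero [simp]
  crc_monoid.sum_map_empty [simp] crc_monoid.sum_map_singleton [simp]

section \<open>Product monoids and the trivial monoid\<close>

context cartesian_restriction_category
begin

abbreviation "cm \<equiv> crc_monoid C"

lemma cm_iff: "cm M \<longleftrightarrow> total_comm_monoid C M"
  by (simp add: crc_monoid_def crc_monoid_axioms_def cartesian_restriction_category_axioms)

lemma plus_map_Pair:
  assumes M: "cm M" and N: "cm N"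
    and "a \<in> Ar C" "b \<in> Ar C" "c \<in> Ar C" "d \<in> Ar C"
    "Dom C a = Dom C b" "Dom C b = Dom C c" "Dom C c = Dom C d"
    "Cod C a = mobj M" "Cod C c = mobj M" "Cod C b = mobj N" "Cod C d = mobj N"
  shows "\<langle>plus_map C M (\<rho> b \<cdot> a) (\<rho> d \<cdot> c), plus_map C N (\<rho> a \<cdot> b) (\<rho> c \<cdot> d)\<rangle>
    = \<langle>plus_map C M a c, plus_map C N b d\<rangle>"
proof -
  define p q where "p = plus_map C M a c" and "q = plus_map C N b d"
  have p: "p \<in> Ar C" "Dom C p = Dom C d" "Cod C p = mobj M" "\<rho> p = \<rho> a \<cdot> \<rho> c"
    and q: "q \<in> Ar C" "Dom C q = Dom C d" "Cod C q = mobj N" "\<rho> q = \<rho> b \<cdot> \<rho> d"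
    using assms by (simp_all add: p_def q_def)
  have 1: "plus_map C M (\<rho> b \<cdot> a) (\<rho> d \<cdot> c) = \<rho> q \<cdot> p" "plus_map C N (\<rho> a \<cdot> b) (\<rho> c \<cdot> d) = \<rho> p \<cdot> q"
    using assms unfolding p(4) q(4)
    by (simp_all add: crc_monoid.plus_map_Rst p_def q_def del: crc_monoid.Comp_plus_map)
      (simp_all add: Rst_ac)
  show ?thesis unfolding 1 p_def[symmetric] q_def[symmetric]
    using p q by (intro Pair_Rst_both) simp_all
qed

lemma prod_monoid_simps [simp]:
  "mobj (prod_monoid C M N) = mobj M \<^bold>\<times> mobj N" "mzero (prod_monoid C M N) = \<langle>mzero M, mzero N\<rangle>"
  by (simp_all add: prod_monoid_def Let_def)

lemma zero_map_prod [simp]: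
  assumes "cm M" "cm N" "Z \<in> Ob C"
  shows "zero_map C (prod_monoid C M N) Z = \<langle>zero_map C M Z, zero_map C N Z\<rangle>"
  using assms by (simp add: zero_map_def)

lemma madd_prod_type:
  assumes "cm M" "cm N"
  shows "madd (prod_monoid C M N) \<in> Ar C"
    "Dom C (madd (prod_monoid C M N)) = (mobj M \<^bold>\<times> mobj N) \<^bold>\<times> (mobj M \<^bold>\<times> mobj N)"
    "Cod C (madd (prod_monoid C M N)) = mobj M \<^bold>\<times> mobj N"
    "\<rho> (madd (prod_monoid C M N)) = Idn C ((mobj M \<^bold>\<times> mobj N) \<^bold>\<times> (mobj M \<^bold>\<times> mobj N))"
  using assms by (simp_all add: prod_monoid_def Let_def cross_def)

text \<open>The two \<open>cross\<close> maps in the product monoid regroup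
  \<open>((a, b), (a', b'))\<close> as \<open>((a, a'), (b, b'))\<close>. The restrictions created
  by the projections out of \<open>\<langle>f, g\<rangle>\<close> are removed by
  \<open>Pair_Rst_both\<close>.\<close>

lemma plus_map_prod:
  assumes M: "cm M" and N: "cm N" and ty: "f \<in> Ar C" "g \<in> Ar C" "Dom C f = Dom C g"
    "Cod C f = mobj M \<^bold>\<times> mobj N" "Cod C g = mobj M \<^bold>\<times> mobj N"
  shows "plus_map C (prod_monoid C M N) f g =
    \<langle>plus_map C M (f \<cdot> Pr0 C (mobj M) (mobj N)) (g \<cdot> Pr0 C (mobj M) (mobj N)),
     plus_map C N (f \<cdot> Pr1 C (mobj M) (mobj N)) (g \<cdot> Pr1 C (mobj M) (mobj N))\<rangle>"
proof -
  let ?A = "mobj M" and ?B = "mobj N"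
  let ?AB = "?A \<^bold>\<times> ?B"
  have 1: "\<langle>f, g\<rangle> \<cdot> (\<langle>Pr0 C ?AB ?AB \<cdot> p, Pr1 C ?AB ?AB \<cdot> p\<rangle> \<cdot> k)
     = \<langle>f \<cdot> p, g \<cdot> p\<rangle> \<cdot> k" if "p \<in> Ar C" "Dom C p = ?AB" "\<rho> p = Idn C ?AB" "k \<in> Ar C" "Dom C k = Cod C p \<^bold>\<times> Cod C p" for p k
  proof -
    have "\<langle>f, g\<rangle> \<cdot> (\<langle>Pr0 C ?AB ?AB \<cdot> p, Pr1 C ?AB ?AB \<cdot> p\<rangle> \<cdot> k)
      = \<langle>\<rho> g \<cdot> (f \<cdot> p), \<rho> f \<cdot> (g \<cdot> p)\<rangle> \<cdot> k"
      using that M N ty by (subst assoc[symmetric]) simp_all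
    also have "\<langle>\<rho> g \<cdot> (f \<cdot> p), \<rho> f \<cdot> (g \<cdot> p)\<rangle> = \<langle>f \<cdot> p, g \<cdot> p\<rangle>"
      using that M N ty by (intro Pair_Rst_both) simp_all
    finally show ?thesis .
  qed
  show ?thesis
    using M N ty 1[of "Pr0 C ?A ?B" "madd M"] 1[of "Pr1 C ?A ?B" "madd N"]
    by (simp add: plus_map_def prod_monoid_def cross_def Let_def)
qed

lemma plus_map_prod_Pair:
  assumes M: "cm M" and N: "cm N"
    and "a \<in> Ar C" "b \<in> Ar C" "c \<in> Ar C" "d \<in> Ar C"
    "Dom C a = Dom C b" "Dom C b = Dom C c" "Dom C c = Dom C d"
    "Cod C a = mobj M" "Cod C c = mobj M" "Cod C b = mobj N" "Cod C d = mobj N"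
  shows "plus_map C (prod_monoid C M N) \<langle>a, b\<rangle> \<langle>c, d\<rangle> = \<langle>plus_map C M a c, plus_map C N b d\<rangle>"
  using assms by (simp add: plus_map_prod plus_map_Pair)

lemma cm_prod [simp]:
  assumes M: "cm M" and N: "cm N"
  shows "cm (prod_monoid C M N)"
proof -
  let ?A = "mobj M" and ?B = "mobj N"
  let ?AB = "?A \<^bold>\<times> ?B"
  let ?p = "\<lambda>p q. p C ?AB ?AB \<cdot> q C ?A ?B"
  have "plus_map C M (?p Pr1 Pr0) (?p Pr0 Pr0) = plus_map C M (?p Pr0 Pr0) (?p Pr1 Pr0)"
    "plus_map C N (?p Pr1 Pr1) (?p Pr0 Pr1) = plus_map C N (?p Pr0 Pr1) (?p Pr1 Pr1)"
    using M N by (simp_all add: crc_monoid.plus_map_commute[of C _ "Pr1 C ?AB ?AB \<cdot> _"])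
  then show ?thesis
    unfolding cm_iff total_comm_monoid_def Let_def is_total_def Hom_iff
    using assms
    by (simp add: madd_prod_type plus_map_prod crc_monoid.plus_map_assoc[OF M] crc_monoid.plus_map_assoc[OF N])
qed

text \<open>This makes pairing compatible with the Faa di Bruno sum and with the sum in the
  derivative.\<close>

lemma sum_map_prod_Pair:
  assumes M: "cm M" and N: "cm N" and Z: "Z \<in> Ob C" and I: "finite I"
    and "\<And>i. i \<in> I \<Longrightarrow> t i \<in> Hom C Z (mobj M)" "\<And>i. i \<in> I \<Longrightarrow> s i \<in> Hom C Z (mobj N)"
  shows "sum_map C (prod_monoid C M N) Z (\<lambda>i. \<langle>t i, s i\<rangle>) I = \<langle>sum_map C M Z t I, sum_map C N Z s I\<rangle>"
  using I assms(5-)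
proof (induction I)
  case empty
  then show ?case using M N Z by simp
next
  case (insert j I)
  have "sum_map C M Z t I \<in> Hom C Z (mobj M)" "sum_map C N Z s I \<in> Hom C Z (mobj N)"
    using insert by (auto intro!: crc_monoid.sum_map_Hom[OF M Z] crc_monoid.sum_map_Hom[OF N Z])
  then show ?case
    using insert M N Z
      crc_monoid.sum_map_insert[OF M Z insert(1,2), of t] crc_monoid.sum_map_insert[OF N Z insert(1,2), of s]
      crc_monoid.sum_map_insert[OF cm_prod[OF M N] Z insert(1,2), of "\<lambda>i. \<langle>t i, s i\<rangle>"]
    by (simp add: Hom_iff plus_map_prod_Pair)
qed

lemma trivial_monoid_simps [simp]:
  "mobj (trivial_monoid C) = \<^bold>1" "madd (trivial_monoid C) = \<^bold>! (\<^bold>1 \<^bold>\<times> \<^bold>1)"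
  "mzero (trivial_monoid C) = Idn C \<^bold>1"
  by (simp_all add: trivial_monoid_def)

lemma cm_trivial [simp]: "cm (trivial_monoid C)"
  unfolding cm_iff total_comm_monoid_def Let_def is_total_def Hom_iff
  by (auto simp: plus_map_def zero_map_def intro!: to_Trm_eqI simp: Hom_iff)


section \<open>Evaluation of the components of a sequence\<close>

definition tup :: "'m list \<Rightarrow> 'm \<Rightarrow> 'm" where
  "tup as x = foldr (\<lambda>a t. \<langle>a, t\<rangle>) as x"

lemma tup_simps [simp]: "tup [] x = x" "tup (a # as) x = \<langle>a, tup as x\<rangle>"
  by (simp_all add: tup_def)

lemma app_tup: "app C h as x = tup as x \<cdot> h"
  by (simp add: app_def tup_def)

lemma pow_times_Ob [simp]: "A \<in> Ob C \<Longrightarrow> X \<in> Ob C \<Longrightarrow> pow_times C A n X \<in> Ob C"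
  by (induction n) auto

lemma pow_proj_type [simp]:
  assumes "A \<in> Ob C" "X \<in> Ob C"
  shows "pow_proj C A X n i \<in> Ar C" "Dom C (pow_proj C A X n i) = pow_times C A n X"
    "Cod C (pow_proj C A X n i) = (if i < n then A else X)"
    "\<rho> (pow_proj C A X n i) = Idn C (pow_times C A n X)"
  using assms by (induction n arbitrary: i) (auto split: nat.split)

lemma tup_type [simp]:
  assumes "set as \<subseteq> Hom C Z A" "x \<in> Hom C Z X"
  shows "tup as x \<in> Ar C" "Dom C (tup as x) = Z" "Cod C (tup as x) = pow_times C A (length as) X"
  using assms by (induction as) (auto simp: Hom_iff)

lemma Comp_tup:
  assumes "set as \<subseteq> Hom C Z A" "x \<in> Hom C Z X" "z \<in> Hom C W Z"
  shows "z \<cdot> tup as x = tup (map ((\<cdot>) z) as) (z \<cdot> x)"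
  using assms(1)
proof (induction as)
  case (Cons a as)
  then show ?case using tup_type[of as Z A x X] assms(2,3) by (simp add: Hom_iff)
qed simp

text \<open>Coherent families have a common domain of definition; all partiality reduces to these.\<close>

definition coh :: "'o \<Rightarrow> 'o \<Rightarrow> 'o \<Rightarrow> 'm set \<Rightarrow> 'm \<Rightarrow> bool" where
  "coh Z A X S x \<longleftrightarrow> x \<in> Hom C Z X \<and> (\<forall>a \<in> S. a \<in> Hom C Z A \<and> \<rho> a = \<rho> x)"

lemma cohD:
  assumes "coh Z A X S x"
  shows "x \<in> Hom C Z X" "a \<in> S \<Longrightarrow> a \<in> Hom C Z A" "a \<in> S \<Longrightarrow> \<rho> a = \<rho> x" "Z \<in> Ob C" "X \<in> Ob C"
  using assms Dom_Ob Cod_Ob by (auto simp: coh_def Hom_iff)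

lemma coh_mono: "coh Z A X S x \<Longrightarrow> S' \<subseteq> S \<Longrightarrow> coh Z A X S' x"
  by (auto simp: coh_def)

lemma coh_insert: "coh Z A X (insert a S) x \<longleftrightarrow> a \<in> Hom C Z A \<and> \<rho> a = \<rho> x \<and> coh Z A X S x"
  by (auto simp: coh_def)

text \<open>All restriction idempotents involved are \<open>\<rho> x\<close>, and so is their
  product.\<close>

lemma coh_tup:
  assumes "coh Z A X (set as) x"
  shows "tup as x \<in> Hom C Z (pow_times C A (length as) X)" "\<rho> (tup as x) = \<rho> x"
proof -
  have s: "set as \<subseteq> Hom C Z A" "x \<in> Hom C Z X" using assms by (auto simp: coh_def)
  show "tup as x \<in> Hom C Z (pow_times C A (length as) X)"
    using tup_type[OF s] by (simp add: Hom_iff)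
  show "\<rho> (tup as x) = \<rho> x" using assms
  proof (induction as)
    case (Cons a as)
    have s: "set as \<subseteq> Hom C Z A" "x \<in> Hom C Z X" using Cons.prems by (auto simp: coh_def)
    show ?case using tup_type[OF s] s(2) Cons by (simp add: coh_insert Hom_iff)
  qed simp
qed

text \<open>The restrictions that the projections introduce are to the common domain, and every
  entry absorbs them.\<close>

lemma tup_proj:
  assumes "coh Z A X (set as) x" "i \<le> length as" "A \<in> Ob C"
  shows "tup as x \<cdot> pow_proj C A X (length as) i = (if i < length as then as ! i else x)"
  using assms
proof (induction as arbitrary: i)
  case Nil
  then show ?case by (auto simp: coh_def Hom_iff)
next
  case (Cons a as)
  have c: "coh Z A X (set as) x" using Cons.prems by (auto simp: coh_def)
  note t = coh_tup[OF c]
  have X: "X \<in> Ob C" using cohD[OF c] by auto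
  have a: "a \<in> Hom C Z A" "\<rho> a = \<rho> x" using Cons.prems by (auto simp: coh_def)
  show ?case
  proof (cases i)
    case 0
    then show ?thesis using a t X Cons.prems cohD(1)[OF c] by (simp add: Hom_iff) (metis a(2) Rst_Comp_self)
  next
    case (Suc j)
    have IH: "tup as x \<cdot> pow_proj C A X (length as) j = (if j < length as then as ! j else x)"
      using Cons.IH[OF c, of j] Cons.prems Suc by simp
    have "tup (a # as) x \<cdot> pow_proj C A X (length (a # as)) i
        = \<rho> a \<cdot> (tup as x \<cdot> pow_proj C A X (length as) j)"
      using Suc a t X Cons.prems by (simp add: Hom_iff)
    also have "\<dots> = (\<rho> (tup as x) \<cdot> tup as x) \<cdot> pow_proj C A X (length as) j"
      using a t X Cons.prems cohD(1)[OF c] by (subst assoc) (simp_all add: Hom_iff)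
    also have "\<dots> = tup as x \<cdot> pow_proj C A X (length as) j"
      using t Rst_Comp_self[of "tup as x"] by (simp only: Hom_iff)
    finally show ?thesis using IH Suc by simp
  qed
qed

lemma tup_unique:
  assumes "h \<in> Hom C Z (pow_times C A n X)" "A \<in> Ob C" "X \<in> Ob C"
  shows "tup (map (\<lambda>i. h \<cdot> pow_proj C A X n i) [0..<n]) (h \<cdot> pow_proj C A X n n) = h"
  using assms(1)
proof (induction n arbitrary: h)
  case 0
  then show ?case using assms by (simp add: Hom_iff)
next
  case (Suc n)
  let ?P = "pow_times C A n X"
  let ?h = "h \<cdot> Pr1 C A ?P"
  have h: "?h \<in> Hom C Z ?P" using Suc assms by (simp add: Hom_iff)
  have "map (\<lambda>i. h \<cdot> pow_proj C A X (Suc n) i) [0..<Suc n]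
    = (h \<cdot> Pr0 C A ?P) # map (\<lambda>i. ?h \<cdot> pow_proj C A X n i) [0..<n]"
    using Suc.prems assms by (simp add: map_upt_Suc Hom_iff del: upt_Suc)
  moreover have "h \<cdot> pow_proj C A X (Suc n) (Suc n) = ?h \<cdot> pow_proj C A X n n"
    using Suc.prems assms by (simp add: Hom_iff)
  ultimately have "tup (map (\<lambda>i. h \<cdot> pow_proj C A X (Suc n) i) [0..<Suc n]) (h \<cdot> pow_proj C A X (Suc n) (Suc n))
     = \<langle>h \<cdot> Pr0 C A ?P, ?h\<rangle>"
    using Suc.IH[OF h] by (simp only: tup_simps)
  also have "\<dots> = h" using Suc.prems assms by (simp add: Hom_iff)
  finally show ?case .
qed

text \<open>The projections serve as a generic point: they form a coherent family of total maps
  whose tuple is the identity, so a component is its own value there.\<close>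

lemma coh_pow_proj:
  assumes "A \<in> Ob C" "X \<in> Ob C"
  shows "coh (pow_times C A n X) A X (set (map (pow_proj C A X n) [0..<n])) (pow_proj C A X n n)"
  using assms by (auto simp: coh_def Hom_iff)

lemma tup_pow_proj:
  assumes "A \<in> Ob C" "X \<in> Ob C"
  shows "tup (map (pow_proj C A X n) [0..<n]) (pow_proj C A X n n) = Idn C (pow_times C A n X)"
proof -
  have e: "map (\<lambda>i. Idn C (pow_times C A n X) \<cdot> pow_proj C A X n i) [0..<n] = map (pow_proj C A X n) [0..<n]"
    using assms by (intro map_cong) simp_all
  show ?thesis
    using tup_unique[of "Idn C (pow_times C A n X)" "pow_times C A n X" A n X, unfolded e] assms
    by (simp add: Hom_iff)
qed

text \<open>Together with \<open>Rst_tup_greatest\<close> this describes the domain of a tuple as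
  the meet of the domains of its entries. In this form it is visibly independent of the order of the
  entries.\<close>

lemma Rst_tup_le:
  assumes "set as \<subseteq> Hom C Z A" "x \<in> Hom C Z X" "a \<in> insert x (set as)"
  shows "\<rho> (tup as x) \<cdot> \<rho> a = \<rho> (tup as x)"
  using assms
proof (induction as)
  case Nil
  then show ?case by (simp add: Hom_iff)
next
  case (Cons b as)
  have s: "set as \<subseteq> Hom C Z A" using Cons by simp
  note t = tup_type[OF s Cons.prems(2)]
  have b: "b \<in> Ar C" "Dom C b = Z" using Cons by (simp_all add: Hom_iff)
  have a: "a \<in> Ar C" "Dom C a = Z" using Cons by (auto simp add: Hom_iff)
  show ?case
  proof (cases "a = b")
    case True
    then show ?thesis using t b by (simp add: Rst_ac)
  next
    case False
    then show ?thesis using Cons t b a by auto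
  qed
qed

lemma Rst_tup_greatest:
  assumes "set as \<subseteq> Hom C Z A" "x \<in> Hom C Z X" "w \<in> Ar C" "Dom C w = Z"
    "\<And>a. a \<in> insert x (set as) \<Longrightarrow> \<rho> w \<cdot> \<rho> a = \<rho> w"
  shows "\<rho> w \<cdot> \<rho> (tup as x) = \<rho> w"
  using assms(1,5)
proof (induction as)
  case Nil
  then show ?case by simp
next
  case (Cons b as)
  have s: "set as \<subseteq> Hom C Z A" using Cons by simp
  note t = tup_type[OF s assms(2)]
  have b: "b \<in> Ar C" "Dom C b = Z" using Cons by (simp_all add: Hom_iff)
  have "\<rho> w \<cdot> \<rho> (tup (b # as) x) = (\<rho> w \<cdot> \<rho> b) \<cdot> \<rho> (tup as x)" using t b assms by simp
  also have "\<rho> w \<cdot> \<rho> b = \<rho> w" using Cons.prems by simp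
  also have "\<rho> w \<cdot> \<rho> (tup as x) = \<rho> w" by (rule Cons.IH) (use Cons.prems in auto)
  finally show ?case .
qed

text \<open>Restricting all arguments to the domain \<open>e\<close> of their tuple does not change
  the tuple and makes the family coherent. Statements about arbitrary partial arguments are reduced
  to coherent families in this way.\<close>

lemma app_normalize:
  assumes "set as \<subseteq> Hom C Z A" "x \<in> Hom C Z X" "h \<in> Hom C (pow_times C A (length as) X) B"
  defines "e \<equiv> \<rho> (tup as x)"
  shows "app C h as x = app C h (map ((\<cdot>) e) as) (e \<cdot> x)"
    "coh Z A X (set (map ((\<cdot>) e) as)) (e \<cdot> x)" "e \<in> Hom C Z Z" "\<rho> e = e" "\<rho> (e \<cdot> x) = e"
proof -
  note t = tup_type[OF assms(1,2)]
  show e: "e \<in> Hom C Z Z" "\<rho> e = e" using t by (simp_all add: e_def Hom_iff)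
  have "tup as x = e \<cdot> tup as x" using t by (simp add: e_def)
  also have "\<dots> = tup (map ((\<cdot>) e) as) (e \<cdot> x)" using Comp_tup[OF assms(1,2) e(1)] .
  finally show "app C h as x = app C h (map ((\<cdot>) e) as) (e \<cdot> x)" by (simp add: app_tup)
  show x: "\<rho> (e \<cdot> x) = e" using t assms(2) Rst_tup_le[OF assms(1,2), of x] by (simp add: e_def Hom_iff)
  have "\<rho> (e \<cdot> a) = e" if "a \<in> set as" for a
    using t Rst_tup_le[OF assms(1,2), of a] that assms(1) by (auto simp add: e_def Hom_iff)
  then show "coh Z A X (set (map ((\<cdot>) e) as)) (e \<cdot> x)"
    using assms(1,2) e x by (auto simp: coh_def Hom_iff)
qed

end

lemma faa_simps [simp]:
  "Ob (faa C) = faa_Ob C" "Ar (faa C) = faa_Ar C" "Dom (faa C) = fsrc" "Cod (faa C) = ftgt"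
  "Idn (faa C) = faa_Id C" "Comp (faa C) = faa_Comp C" "Rst (faa C) = faa_Rst C"
  "Trm (faa C) = faa_Trm C" "Bang (faa C) = faa_Bang C" "Prd (faa C) = faa_Prd C"
  "Pr0 (faa C) = faa_Pr0 C" "Pr1 (faa C) = faa_Pr1 C" "Pairing (faa C) = faa_Pair C"
  by (simp_all add: faa_def)

section \<open>Components as functions of multisets of arguments\<close>

context cartesian_restriction_category
begin

abbreviation FH :: "('o, 'm) imonoid \<Rightarrow> 'o \<Rightarrow> ('o, 'm) imonoid \<Rightarrow> 'o \<Rightarrow> ('o, 'm) faa_ar set" where
  "FH M X N Y \<equiv> Hom (faa C) (M, X) (N, Y)"

lemma faa_Ob_iff [simp]: "(M, X) \<in> faa_Ob C \<longleftrightarrow> cm M \<and> X \<in> Ob C"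
  by (simp add: faa_Ob_def cm_iff)

text \<open>\<open>ev f m x\<close> is \<open>f\<^sub>n(a\<^sub>1, \<dots>, a\<^sub>n, x)\<close> for the multiset \<open>m\<close> of \<open>a\<^sub>1, \<dots>, a\<^sub>n\<close>; by symmetry of \<open>f\<^sub>n\<close> the
  order chosen does not matter.\<close>

definition ev :: "('o, 'm) faa_ar \<Rightarrow> 'm multiset \<Rightarrow> 'm \<Rightarrow> 'm" where
  "ev f m x = app C (fseq f (size m)) (SOME as. mset as = m) x"

lemma FH_D:
  assumes "f \<in> FH M X N Y"
  shows "cm M" "cm N" "X \<in> Ob C" "Y \<in> Ob C" "fsrc f = (M, X)" "ftgt f = (N, Y)"
    "fseq f 0 \<in> Hom C X Y"
    "n \<ge> 1 \<Longrightarrow> fseq f n \<in> Hom C (pow_times C (mobj M) n X) (mobj N)"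
    "n \<ge> 1 \<Longrightarrow> \<rho> (fseq f n) = \<rho> (pow_proj C (mobj M) X n n \<cdot> fseq f 0)"
    "n \<ge> 1 \<Longrightarrow> symmetric_map C M X n (fseq f n)"
    "n \<ge> 1 \<Longrightarrow> multiadditive C M X N n (fseq f n)"
  using assms by (auto simp: Hom_iff[of f "faa C"] faa_Ar_def Let_def)

lemma FH_multi:
  assumes "f \<in> FH M X N Y" "Z \<in> Ob C" "x \<in> Hom C Z X" "set as \<subseteq> Hom C Z (mobj M)" "i < length as"
  shows "a \<in> Hom C Z (mobj M) \<Longrightarrow> b \<in> Hom C Z (mobj M) \<Longrightarrow>
      app C (fseq f (length as)) (as[i := plus_map C M a b]) x =
      plus_map C N (app C (fseq f (length as)) (as[i := a]) x) (app C (fseq f (length as)) (as[i := b]) x)"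
    "app C (fseq f (length as)) (as[i := zero_map C M Z]) x
      = \<rho> (app C (fseq f (length as)) (as[i := zero_map C M Z]) x) \<cdot> zero_map C N Z"
proof -
  have "multiadditive C M X N (length as) (fseq f (length as))"
    using FH_D(11)[OF assms(1), of "length as"] assms(5) by simp
  then show "a \<in> Hom C Z (mobj M) \<Longrightarrow> b \<in> Hom C Z (mobj M) \<Longrightarrow>
      app C (fseq f (length as)) (as[i := plus_map C M a b]) x =
      plus_map C N (app C (fseq f (length as)) (as[i := a]) x) (app C (fseq f (length as)) (as[i := b]) x)"
    "app C (fseq f (length as)) (as[i := zero_map C M Z]) x
      = \<rho> (app C (fseq f (length as)) (as[i := zero_map C M Z]) x) \<cdot> zero_map C N Z"
    using assms(2-) unfolding multiadditive_def by blast+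
qed

lemma ev_mset:
  assumes f: "f \<in> FH M X N Y" and c: "coh Z (mobj M) X (set as) x"
  shows "ev f (mset as) x = app C (fseq f (length as)) as x"
proof (cases "as = []")
  case True
  then show ?thesis by (simp add: ev_def)
next
  case False
  define bs where "bs = (SOME bs. mset bs = mset as)"
  have bs: "mset bs = mset as" unfolding bs_def by (rule someI) simp
  have "app C (fseq f (length as)) bs x = app C (fseq f (length as)) as x"
    using FH_D(10)[OF f, of "length as"] False bs cohD[OF c]
    unfolding symmetric_map_def by (auto simp: Suc_le_eq)
  then show ?thesis by (simp add: ev_def bs_def)
qed

lemma ev_list:
  assumes f: "f \<in> FH M X N Y" and c: "coh Z (mobj M) X (set_mset m) x"
  obtains as where "m = mset as" "coh Z (mobj M) X (set as) x"
    "ev f m x = tup as x \<cdot> fseq f (length as)"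
proof -
  obtain as where as: "mset as = m" using ex_mset by blast
  then have "coh Z (mobj M) X (set as) x" using c by (metis set_mset_mset)
  then show ?thesis using that[of as] as ev_mset[OF f] by (auto simp: app_tup)
qed

lemma ev_empty:
  "ev f {#} x = x \<cdot> fseq f 0"
  by (simp add: ev_def app_tup)

lemma ev_Hom:
  assumes f: "f \<in> FH M X N Y" and c: "coh Z (mobj M) X (set_mset m) x" "m \<noteq> {#}"
  shows "ev f m x \<in> Hom C Z (mobj N)"
proof -
  obtain as where as: "m = mset as" "coh Z (mobj M) X (set as) x"
    "ev f m x = tup as x \<cdot> fseq f (length as)" using ev_list[OF f c(1)] by blast
  then show ?thesis using coh_tup[OF as(2)] FH_D(8)[OF f, of "length as"] c(2)
    by (auto simp: Hom_iff Suc_le_eq)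
qed

text \<open>The domain condition on the components, after substitution. The result is the same for
  every \<open>m\<close>, whatever its size; hence the values of \<open>f\<close> at several blocks
  of variables form a coherent family again.\<close>

lemma ev_Rst:
  assumes f: "f \<in> FH M X N Y" and c: "coh Z (mobj M) X (set_mset m) x"
  shows "\<rho> (ev f m x) = \<rho> (x \<cdot> fseq f 0)"
proof (cases "m = {#}")
  case True
  then show ?thesis by (simp add: ev_empty)
next
  case False
  obtain as where as: "m = mset as" "coh Z (mobj M) X (set as) x"
    "ev f m x = tup as x \<cdot> fseq f (length as)" using ev_list[OF f c(1)] by blast
  then have n: "length as \<ge> 1" using False by (auto simp: Suc_le_eq)
  let ?p = "pow_proj C (mobj M) X (length as) (length as)"
  have p: "?p \<in> Hom C (pow_times C (mobj M) (length as) X) X"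
    using FH_D(1,3)[OF f] by (simp add: Hom_iff)
  have "\<rho> (ev f m x) = \<rho> (tup as x \<cdot> (?p \<cdot> fseq f 0))"
    unfolding as(3) using p FH_D(7-9)[OF f] n coh_tup[OF as(2)]
    by (intro Rst_mono_eq) (simp_all add: Hom_iff)
  also have "tup as x \<cdot> (?p \<cdot> fseq f 0) = (tup as x \<cdot> ?p) \<cdot> fseq f 0"
    using p FH_D(7)[OF f] coh_tup[OF as(2)] by (subst assoc) (simp_all add: Hom_iff)
  also have "tup as x \<cdot> ?p = x" using tup_proj[OF as(2), of "length as"] FH_D(1)[OF f] by simp
  finally show ?thesis .
qed

text \<open>Precomposition with a partial \<open>z\<close> may shrink the common domain, but all
  entries keep sharing it, because restrictions of composites depend only on restrictions of the
  second factor.\<close>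

lemma Comp_coh:
  assumes "coh Z A X S x" "z \<in> Hom C W Z"
  shows "coh W A X ((\<cdot>) z ` S) (z \<cdot> x)"
  unfolding coh_def
proof (intro conjI ballI)
  note x = cohD(1)[OF assms(1)]
  show "z \<cdot> x \<in> Hom C W X" using x assms(2) by (simp add: Hom_iff)
  fix b assume "b \<in> (\<cdot>) z ` S"
  then obtain a where a: "b = z \<cdot> a" "a \<in> S" by blast
  show "b \<in> Hom C W A" using a cohD(2)[OF assms(1) a(2)] assms(2) by (simp add: Hom_iff)
  show "\<rho> b = \<rho> (z \<cdot> x)" unfolding a(1) using cohD(2,3)[OF assms(1) a(2)] x assms(2)
    by (intro Rst_mono_eq) (simp_all add: Hom_iff)
qed

lemma Comp_ev:
  assumes f: "f \<in> FH M X N Y" and c: "coh Z (mobj M) X (set_mset m) x" and z: "z \<in> Hom C W Z"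
  shows "z \<cdot> ev f m x = ev f (image_mset ((\<cdot>) z) m) (z \<cdot> x)"
proof -
  obtain as where as: "m = mset as" "coh Z (mobj M) X (set as) x"
    "ev f m x = tup as x \<cdot> fseq f (length as)" using ev_list[OF f c(1)] by blast
  have s: "set as \<subseteq> Hom C Z (mobj M)" "x \<in> Hom C Z X" using as(2) by (auto simp: coh_def)
  have h: "fseq f (length as) \<in> Ar C" "Dom C (fseq f (length as)) = pow_times C (mobj M) (length as) X"
    using FH_D(7)[OF f] FH_D(8)[OF f, of "length as"] by (cases "as = []"; simp add: Hom_iff Suc_le_eq)+
  have "z \<cdot> ev f m x = (z \<cdot> tup as x) \<cdot> fseq f (length as)"
    using z h coh_tup(1)[OF as(2)] unfolding as(3) by (subst assoc) (simp_all add: Hom_iff)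
  also have "\<dots> = tup (map ((\<cdot>) z) as) (z \<cdot> x) \<cdot> fseq f (length as)"
    using Comp_tup[OF s z] by simp
  also have "\<dots> = ev f (mset (map ((\<cdot>) z) as)) (z \<cdot> x)"
    using ev_mset[OF f, of W "map ((\<cdot>) z) as" "z \<cdot> x"] Comp_coh[OF as(2) z] by (simp add: app_tup)
  finally show ?thesis using as(1) by simp
qed

lemma ev_plus:
  assumes f: "f \<in> FH M X N Y" and c: "coh Z (mobj M) X (insert a (insert b (set_mset m))) x"
  shows "ev f (add_mset (plus_map C M a b) m) x
    = plus_map C N (ev f (add_mset a m) x) (ev f (add_mset b m) x)"
proof -
  obtain as where as: "m = mset as" using ex_mset by metis
  have ca: "a \<in> Hom C Z (mobj M)" "b \<in> Hom C Z (mobj M)" "\<rho> a = \<rho> x" "\<rho> b = \<rho> x"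
    "coh Z (mobj M) X (set as) x" using c as by (auto simp: coh_insert)
  have e: "ev f (add_mset d m) x = app C (fseq f (Suc (length as))) ((a # as)[0 := d]) x"
    if "d \<in> Hom C Z (mobj M)" "\<rho> d = \<rho> x" for d
    using ev_mset[OF f, of Z "d # as" x] that ca as by (simp add: coh_insert)
  have "plus_map C M a b \<in> Hom C Z (mobj M)" "\<rho> (plus_map C M a b) = \<rho> x"
    using ca FH_D(1)[OF f] cohD(1)[OF ca(5)] by (simp_all add: Hom_iff)
  note e3 = e[OF ca(1,3)] e[OF ca(2,4)] e[OF this]
  show ?thesis unfolding e3
    using FH_multi(1)[OF f cohD(4,1)[OF ca(5)], of "a # as" 0 a b] ca(1,2) cohD(2)[OF ca(5)]
    by (auto simp del: list_update.simps)
qed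

text \<open>Multiadditivity speaks of the total zero map, which is coherent with \<open>x\<close>
  only for total \<open>x\<close>. The tuple restricts its first entry to the domain of the others,
  so the restricted zero may be exchanged for the total one; the domain of the value is then known
  from \<open>ev_Rst\<close>.\<close>

lemma ev_rzero:
  assumes f: "f \<in> FH M X N Y" and c: "coh Z (mobj M) X (set_mset m) x"
  shows "ev f (add_mset (\<rho> x \<cdot> zero_map C M Z) m) x = \<rho> (x \<cdot> fseq f 0) \<cdot> zero_map C N Z"
proof -
  obtain as where as: "m = mset as" using ex_mset by metis
  let ?h = "fseq f (Suc (length as))" and ?o = "zero_map C M Z"
  have c: "coh Z (mobj M) X (set as) x" using c as by simp
  note x = cohD(1)[OF c] and Z = cohD(4)[OF c] and M = FH_D(1)[OF f] and t = coh_tup[OF c]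
  have s: "set as \<subseteq> Hom C Z (mobj M)" using cohD(2)[OF c] by blast
  have c0: "coh Z (mobj M) X (set (\<rho> x \<cdot> ?o # as)) x"
    using c M x Z by (simp add: coh_insert Hom_iff)
  have "ev f (add_mset (\<rho> x \<cdot> ?o) m) x = app C ?h (\<rho> x \<cdot> ?o # as) x"
    using ev_mset[OF f c0] as by simp
  also have "\<dots> = \<langle>\<rho> (tup as x) \<cdot> ?o, tup as x\<rangle> \<cdot> ?h" using t by (simp add: app_tup)
  also have "\<langle>\<rho> (tup as x) \<cdot> ?o, tup as x\<rangle> = \<langle>?o, tup as x\<rangle>"
    using t M Z by (intro Pair_Rst) (simp_all add: Hom_iff)
  finally have 1: "ev f (add_mset (\<rho> x \<cdot> ?o) m) x = app C ?h ((?o # as)[0 := ?o]) x"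
    by (simp add: app_tup)
  also have "\<dots> = \<rho> (app C ?h ((?o # as)[0 := ?o]) x) \<cdot> zero_map C N Z"
    using FH_multi(2)[OF f cohD(4,1)[OF c], of "?o # as" 0] s M Z
    by (auto simp: Hom_iff simp del: list_update.simps)
  also have "\<rho> (app C ?h ((?o # as)[0 := ?o]) x) = \<rho> (ev f (add_mset (\<rho> x \<cdot> ?o) m) x)"
    using 1 by simp
  also have "\<dots> = \<rho> (x \<cdot> fseq f 0)" using ev_Rst[OF f, of Z "mset (\<rho> x \<cdot> ?o # as)" x] c0 as by simp
  finally show ?thesis .
qed

text \<open>Iterated additivity. The index set is nonempty because an empty sum is total and need
  not be coherent with \<open>x\<close>.\<close>

lemma ev_sum:
  assumes f: "f \<in> FH M X N Y" and c: "coh Z (mobj M) X (t ` I \<union> set_mset m) x"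
    and I: "finite I" "I \<noteq> {}"
  shows "ev f (add_mset (sum_map C M Z t I) m) x
    = sum_map C N Z (\<lambda>i. ev f (add_mset (t i) m) x) I"
  using I c
proof (induction I rule: finite_ne_induct)
  case (singleton j)
  have "t j \<in> Hom C Z (mobj M)" "Z \<in> Ob C" "ev f (add_mset (t j) m) x \<in> Hom C Z (mobj N)"
    using singleton cohD[OF singleton] by (auto intro!: ev_Hom[OF f])
  then show ?case using FH_D[OF f] by simp
next
  case (insert j I)
  note M = FH_D(1)[OF f] and N = FH_D(2)[OF f]
  have c1: "coh Z (mobj M) X (insert (t i) (set_mset m)) x" if "i \<in> insert j I" for i
    by (rule coh_mono[OF insert.prems]) (use that in auto)
  have c2: "coh Z (mobj M) X (t ` I \<union> set_mset m) x" by (rule coh_mono[OF insert.prems]) auto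
  have x: "x \<in> Hom C Z X" "Z \<in> Ob C" using cohD[OF c2] by auto
  have t: "t i \<in> Hom C Z (mobj M)" "\<rho> (t i) = \<rho> x" if "i \<in> insert j I" for i
    using c1[OF that] by (auto simp: coh_insert)
  have s: "sum_map C M Z t I \<in> Hom C Z (mobj M)" "\<rho> (sum_map C M Z t I) = \<rho> x"
    using t x insert(1,2) crc_monoid.sum_map_Hom[OF M x(2), of I t]
      crc_monoid.Rst_sum_map[OF M x(2), of I t x] by (auto simp: Hom_iff)
  have e: "ev f (add_mset (t i) m) x \<in> Hom C Z (mobj N)" if "i \<in> insert j I" for i
    using c1[OF that] by (intro ev_Hom[OF f]) auto
  have "ev f (add_mset (sum_map C M Z t (insert j I)) m) x
    = ev f (add_mset (plus_map C M (t j) (sum_map C M Z t I)) m) x"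
    using t insert(1,3) crc_monoid.sum_map_insert[OF M x(2), of I j t] by simp
  also have "\<dots> = plus_map C N (ev f (add_mset (t j) m) x) (ev f (add_mset (sum_map C M Z t I) m) x)"
    using c1[of j] s by (intro ev_plus[OF f]) (auto simp: coh_insert)
  also have "\<dots> = sum_map C N Z (\<lambda>i. ev f (add_mset (t i) m) x) (insert j I)"
    using insert.IH[OF c2] insert(1,3) e
      crc_monoid.sum_map_insert[OF N x(2), of I j "\<lambda>i. ev f (add_mset (t i) m) x"] by simp
  finally show ?case .
qed

text \<open>Families with total \<open>x\<close> suffice: the components are the values at the
  projections, which are total.\<close>

lemma faa_eqI:
  assumes f: "f \<in> FH M X N Y" and g: "g \<in> FH M X N Y" and 0: "fseq f 0 = fseq g 0"
    and ev: "\<And>Z m x. coh Z (mobj M) X (set_mset m) x \<Longrightarrow> \<rho> x = Idn C Z \<Longrightarrow> m \<noteq> {#} \<Longrightarrow> ev f m x = ev g m x"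
  shows "f = g"
proof -
  have "fseq f n = fseq g n" for n
  proof (cases "n = 0")
    case False
    let ?A = "mobj M"
    let ?m = "map (pow_proj C ?A X n) [0..<n]" and ?x = "pow_proj C ?A X n n"
    have ob: "?A \<in> Ob C" "X \<in> Ob C" using FH_D(1,3)[OF f] by auto
    note c = coh_pow_proj[OF ob, of n]
    have "fseq h n = ev h (mset ?m) ?x" if h: "h \<in> FH M X N Y" for h
    proof -
      have "ev h (mset ?m) ?x = app C (fseq h n) ?m ?x" using ev_mset[OF h c] by simp
      also have "\<dots> = fseq h n" using tup_pow_proj[OF ob, of n] FH_D(8)[OF h, of n] False ob
        by (simp add: app_tup Hom_iff)
      finally show ?thesis by simp
    qed
    moreover have "mset ?m \<noteq> {#}" using False by (simp only: mset_zero_iff) simp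
    then have "ev f (mset ?m) ?x = ev g (mset ?m) ?x"
      using c ob by (intro ev) auto
    ultimately show ?thesis using f g by simp
  qed (use 0 in simp)
  moreover have "fsrc f = fsrc g" "ftgt f = ftgt g" using FH_D(5,6)[OF f] FH_D(5,6)[OF g] by auto
  ultimately show ?thesis by (simp add: faa_ar.equality fun_eq_iff)
qed

lemma Comp_eq_self:
  assumes "e \<in> Hom C Z Z" "w \<in> Ar C" "Dom C w = Z" "e \<cdot> \<rho> w = \<rho> w"
  shows "e \<cdot> w = w"
proof -
  have "e \<cdot> w = (e \<cdot> \<rho> w) \<cdot> w" using assms(1-3) by (subst assoc) (simp_all add: Hom_iff)
  then show ?thesis using assms by simp
qed

text \<open>Maps are defined by symmetry and additivity at all partial arguments and in every
  position. It suffices to check coherent families and the first position: arguments are restricted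
  to the domain of their tuple, and symmetry moves the variable in question to the front.\<close>

lemma FH_I:
  assumes M: "cm M" "cm N" "X \<in> Ob C" "Y \<in> Ob C" and st: "fsrc f = (M, X)" "ftgt f = (N, Y)"
    and f0: "fseq f 0 \<in> Hom C X Y"
    and fn: "\<And>n. n \<ge> 1 \<Longrightarrow> fseq f n \<in> Hom C (pow_times C (mobj M) n X) (mobj N)"
    and Rf: "\<And>n. n \<ge> 1 \<Longrightarrow> \<rho> (fseq f n) = \<rho> (pow_proj C (mobj M) X n n \<cdot> fseq f 0)"
    and sym: "\<And>Z as bs x. coh Z (mobj M) X (set as) x \<Longrightarrow> as \<noteq> [] \<Longrightarrow> mset bs = mset as \<Longrightarrow>
      app C (fseq f (length as)) bs x = app C (fseq f (length as)) as x"
    and add: "\<And>Z a b as x. coh Z (mobj M) X (insert a (insert b (set as))) x \<Longrightarrow>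
      app C (fseq f (Suc (length as))) (plus_map C M a b # as) x =
      plus_map C N (app C (fseq f (Suc (length as))) (a # as) x) (app C (fseq f (Suc (length as))) (b # as) x)"
    and zero: "\<And>Z as x. coh Z (mobj M) X (set as) x \<Longrightarrow>
      app C (fseq f (Suc (length as))) (\<rho> x \<cdot> zero_map C M Z # as) x = \<rho> (x \<cdot> fseq f 0) \<cdot> zero_map C N Z"
  shows "f \<in> FH M X N Y"
proof -
  let ?A = "mobj M"
  have sy: "symmetric_map C M X n (fseq f n)" if "n \<ge> 1" for n
    unfolding symmetric_map_def
  proof (intro ballI allI impI)
    fix Z as bs x
    assume Z: "Z \<in> Ob C" and x: "x \<in> Hom C Z X"
      and a: "length as = n \<and> set as \<subseteq> Hom C Z ?A \<and> mset bs = mset as"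
    then have as: "set as \<subseteq> Hom C Z ?A" "length as = n" and bs: "set bs \<subseteq> Hom C Z ?A" "length bs = n"
      "mset bs = mset as" using mset_eq_setD[of bs as] mset_eq_length[of bs as] by auto
    have sets: "set as = set bs" using bs(3) by (rule mset_eq_setD[symmetric])
    have ha: "fseq f n \<in> Hom C (pow_times C ?A (length as) X) (mobj N)"
      and hb: "fseq f n \<in> Hom C (pow_times C ?A (length bs) X) (mobj N)" using fn[OF that] as bs by auto
    note na = app_normalize[OF as(1) x ha] and nb = app_normalize[OF bs(1) x hb]
    note ta = tup_type[OF as(1) x] and tb = tup_type[OF bs(1) x]
    \<comment> \<open>The tuples of a list and of its permutation have the same domain, being meets
      of the same idempotents. Both sides are therefore normalized by the same restriction.\<close>
    have "\<rho> (tup as x) \<cdot> \<rho> (tup bs x) = \<rho> (tup as x)"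
      using ta sets by (intro Rst_tup_greatest[OF bs(1) x] Rst_tup_le[OF as(1) x]) auto
    moreover have "\<rho> (tup bs x) \<cdot> \<rho> (tup as x) = \<rho> (tup bs x)"
      using tb sets by (intro Rst_tup_greatest[OF as(1) x] Rst_tup_le[OF bs(1) x]) auto
    ultimately have e: "\<rho> (tup bs x) = \<rho> (tup as x)" using ta tb Rst_commute by metis
    show "app C (fseq f n) bs x = app C (fseq f n) as x"
      unfolding na(1) nb(1) e
      using sym[OF na(2), of "map ((\<cdot>) (\<rho> (tup as x))) bs"] as bs that
      by (cases "as = []") auto
  qed
  have ma: "multiadditive C M X N n (fseq f n)" if "n \<ge> 1" for n
    unfolding multiadditive_def
  proof (intro ballI allI impI conjI)
    fix Z as x i
    assume Z: "Z \<in> Ob C" and x: "x \<in> Hom C Z X" and i: "i < n" and "length as = n \<and> set as \<subseteq> Hom C Z ?A"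
    then have as: "set as \<subseteq> Hom C Z ?A" "length as = n" by auto
    let ?h = "fseq f n"
    \<comment> \<open>The arguments other than the one at position \<open>i\<close>. As multisets
      \<open>as[i := c]\<close> and \<open>c # r\<close> agree, so symmetry applies.\<close>
    define r where "r = take i as @ drop (Suc i) as"
    have r: "Suc (length r) = n" using as(2) i by (simp add: r_def)
    have ri: "mset (as[i := c]) = mset (c # r)" for c
      using as(2) i unfolding r_def by (subst upd_conv_take_nth_drop) auto
    have setc: "set (as[i := c]) = insert c (set r)" for c
      using mset_eq_setD[OF ri[of c]] by simp
    have sc: "set (as[i := c]) \<subseteq> Hom C Z ?A" if "c \<in> Hom C Z ?A" for c
      using as(1) that set_update_subset_insert[of as i c] by blast
    have h: "?h \<in> Hom C (pow_times C ?A (length (as[i := c])) X) (mobj N)" for c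
      using fn[OF that] as by auto
    have hh: "?h \<in> Ar C" "Dom C ?h = pow_times C ?A n X" using fn[OF that] by (auto simp: Hom_iff)
    have first: "app C ?h (map ((\<cdot>) e) (as[i := c])) y = app C ?h (e \<cdot> c # map ((\<cdot>) e) r) y"
      if "coh Z ?A X (insert (e \<cdot> c) (set (map ((\<cdot>) e) r))) y" for e c y
      using sym[of Z "e \<cdot> c # map ((\<cdot>) e) r" y "map ((\<cdot>) e) (as[i := c])"] that ri[of c] r by simp
    { fix a b assume a: "a \<in> Hom C Z ?A" and b: "b \<in> Hom C Z ?A"
      let ?c = "plus_map C M a b"
      let ?t = "\<lambda>c. tup (as[i := c]) x" and ?u = "\<lambda>c. app C ?h (as[i := c]) x"
      have c: "?c \<in> Hom C Z ?A" using a b M by (simp add: Hom_iff)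
      note tc = tup_type[OF sc[OF c] x] and ta = tup_type[OF sc[OF a] x] and tb = tup_type[OF sc[OF b] x]
      \<comment> \<open>All three tuples are restricted to the domain of the one containing the sum.
        It lies below the domains of \<open>a\<close> and \<open>b\<close>, because a sum is defined
        only where both summands are.\<close>
      define e where "e = \<rho> (?t ?c)"
      note n = app_normalize[OF sc[OF c] x h, folded e_def]
      have rc: "e \<cdot> \<rho> ?c = e" unfolding e_def by (rule Rst_tup_le[OF sc[OF c] x]) (simp add: setc)
      have ea: "e \<cdot> \<rho> a = e" "e \<cdot> \<rho> b = e"
      proof -
        have "(e \<cdot> \<rho> ?c) \<cdot> \<rho> a = e \<cdot> \<rho> ?c" "(e \<cdot> \<rho> ?c) \<cdot> \<rho> b = e \<cdot> \<rho> ?c"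
          using a b M n(3) by (simp_all add: Hom_iff Rst_ac)
        then show "e \<cdot> \<rho> a = e" "e \<cdot> \<rho> b = e" unfolding rc by auto
      qed
      have Rea: "\<rho> (e \<cdot> a) = e" "\<rho> (e \<cdot> b) = e"
        unfolding e_def using ea[unfolded e_def] a b tc by (simp_all add: Hom_iff)
      have cr: "coh Z ?A X (insert (e \<cdot> ?c) (set (map ((\<cdot>) e) r))) (e \<cdot> x)"
        using n(2) setc[of ?c] by simp
      have cab: "coh Z ?A X (insert (e \<cdot> a) (insert (e \<cdot> b) (set (map ((\<cdot>) e) r)))) (e \<cdot> x)"
        using coh_mono[OF cr, of "set (map ((\<cdot>) e) r)"] Rea n(3,5) a b by (auto simp: coh_insert Hom_iff)
      have u: "?u d \<in> Ar C" "Dom C (?u d) = Z" "Cod C (?u d) = mobj N" if "d \<in> Hom C Z ?A" for d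
        using tup_type[OF sc[OF that] x] h[of d] by (simp_all add: app_tup Hom_iff)
      have eu: "e \<cdot> ?u d = app C ?h (map ((\<cdot>) e) (as[i := d])) (e \<cdot> x)" if d: "d \<in> Hom C Z ?A" for d
        unfolding app_tup Comp_tup[OF sc[OF d] x n(3), symmetric]
        using tup_type[OF sc[OF d] x] h[of d] n(3) by (subst assoc) (simp_all add: Hom_iff)
      have "?u ?c = app C ?h (e \<cdot> ?c # map ((\<cdot>) e) r) (e \<cdot> x)"
        unfolding n(1) by (rule first[OF cr])
      also have "e \<cdot> ?c = plus_map C M (e \<cdot> a) (e \<cdot> b)"
        using n(3) a b M by (simp add: Hom_iff)
      also have "app C ?h (\<dots> # map ((\<cdot>) e) r) (e \<cdot> x) = plus_map C N
        (app C ?h (e \<cdot> a # map ((\<cdot>) e) r) (e \<cdot> x)) (app C ?h (e \<cdot> b # map ((\<cdot>) e) r) (e \<cdot> x))"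
        using add[OF cab] r by simp
      also have "\<dots> = plus_map C N (e \<cdot> ?u a) (e \<cdot> ?u b)"
        unfolding eu[OF a] eu[OF b]
        by (subst (1 2) first) (use cab in \<open>auto intro: coh_mono\<close>)
      also have "\<dots> = e \<cdot> plus_map C N (?u a) (?u b)"
        using u[OF a] u[OF b] n(3) M by (simp add: Hom_iff)
      \<comment> \<open>The factor \<open>e\<close> may be dropped: the sum of the two values is
        defined only where \<open>a\<close>, \<open>b\<close>, \<open>x\<close> and the remaining
        arguments are, hence only inside \<open>e\<close>.\<close>
      also have "\<dots> = plus_map C N (?u a) (?u b)"
      proof -
        let ?w = "plus_map C N (?u a) (?u b)"
        have w: "?w \<in> Ar C" "Dom C ?w = Z" "\<rho> ?w = \<rho> (?u a) \<cdot> \<rho> (?u b)"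
          using u[OF a] u[OF b] M by simp_all
        have le: "\<rho> (?u d) \<cdot> \<rho> k = \<rho> (?u d)" if d: "d \<in> Hom C Z ?A" and k: "k \<in> insert x (set (as[i := d]))" for d k
        proof -
          note t = tup_type[OF sc[OF d] x]
          have k': "k \<in> Ar C" "Dom C k = Z" using k x sc[OF d] by (auto simp: Hom_iff)
          have "\<rho> (?u d) \<cdot> \<rho> (?t d) = \<rho> (?u d)" using t hh as by (simp add: app_tup)
          moreover have "\<rho> (?t d) \<cdot> \<rho> k = \<rho> (?t d)" by (rule Rst_tup_le[OF sc[OF d] x k])
          ultimately show ?thesis using t u[OF d] k' by (metis assoc Rst_type)
        qed
        have "\<rho> ?w \<cdot> \<rho> k = \<rho> ?w" if k: "k \<in> insert x (set (as[i := ?c]))" for k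
        proof (cases "k = ?c")
          case True
          have "\<rho> ?w \<cdot> \<rho> k = (\<rho> (?u a) \<cdot> \<rho> a) \<cdot> (\<rho> (?u b) \<cdot> \<rho> b)"
            using True a b M u[OF a] u[OF b] w by (simp add: Hom_iff Rst_ac)
          also have "\<dots> = \<rho> ?w" using le[OF a, of a] le[OF b, of b] by (simp add: setc w(3))
          finally show ?thesis .
        next
          case False
          then have k': "k \<in> insert x (set (as[i := b]))" using k by (auto simp: setc)
          have "\<rho> ?w \<cdot> \<rho> k = \<rho> (?u a) \<cdot> (\<rho> (?u b) \<cdot> \<rho> k)"
            using u[OF a] u[OF b] w k' sc[OF b] x by (auto simp: Hom_iff)
          then show ?thesis using le[OF b k'] w(3) by simp
        qed
        then have "\<rho> ?w \<cdot> e = \<rho> ?w" unfolding e_def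
          using w by (intro Rst_tup_greatest[OF sc[OF c] x]) auto
        then have "e \<cdot> \<rho> ?w = \<rho> ?w" unfolding e_def using w tc by (metis Rst_commute)
        then show ?thesis by (rule Comp_eq_self[OF n(3) w(1,2)])
      qed
      finally show "?u ?c = plus_map C N (?u a) (?u b)" .
    }
    let ?o = "zero_map C M Z"
    have z: "?o \<in> Hom C Z ?A" using M Z by (simp add: Hom_iff)
    let ?e = "\<rho> (tup (as[i := ?o]) x)"
    note n = app_normalize[OF sc[OF z] x h]
    have cr: "coh Z ?A X (insert (?e \<cdot> ?o) (set (map ((\<cdot>) ?e) r))) (?e \<cdot> x)"
      using n(2) setc[of ?o] by simp
    have "app C ?h (as[i := ?o]) x = app C ?h (?e \<cdot> ?o # map ((\<cdot>) ?e) r) (?e \<cdot> x)"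
      unfolding n(1) by (rule first[OF cr])
    also have "\<dots> = app C ?h (\<rho> (?e \<cdot> x) \<cdot> ?o # map ((\<cdot>) ?e) r) (?e \<cdot> x)"
      unfolding n(5) ..
    also have "\<dots> = \<rho> ((?e \<cdot> x) \<cdot> fseq f 0) \<cdot> zero_map C N Z"
      using zero[OF coh_mono[OF cr], of "map ((\<cdot>) ?e) r"] r by auto
    finally have 1: "app C ?h (as[i := ?o]) x = \<rho> ((?e \<cdot> x) \<cdot> fseq f 0) \<cdot> zero_map C N Z" .
    have "(?e \<cdot> x) \<cdot> fseq f 0 \<in> Hom C Z Y" using n(3) x f0 by (simp add: Hom_iff)
    then have "\<rho> (app C ?h (as[i := ?o]) x) = \<rho> ((?e \<cdot> x) \<cdot> fseq f 0)"
      unfolding 1 using M Z by (simp add: Hom_iff del: assoc)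
    then show "app C ?h (as[i := ?o]) x = \<rho> (app C ?h (as[i := ?o]) x) \<cdot> zero_map C N Z"
      using 1 by simp
  qed
  show ?thesis using assms(1-9) sy ma by (simp add: Hom_iff[of f "faa C"] faa_Ar_def Let_def)
qed

end

section \<open>Partitions\<close>

abbreviation partitions :: "'i set \<Rightarrow> 'i set set set" where
  "partitions S \<equiv> {P. partition_on S P}"

text \<open>The discrete partition is a witness, also for the empty set. Sums over partitions are
  thus never empty, and their domains can be computed.\<close>

lemma partitions_nonempty: "partitions S \<noteq> {}"
  using partition_on_singletons[of S] by blast

lemma partition_on_finite_block: "finite S \<Longrightarrow> partition_on S P \<Longrightarrow> B \<in> P \<Longrightarrow> finite B"
  by (metis partition_onD1 finite_subset Union_upper)

lemma partition_on_block: "partition_on S P \<Longrightarrow> B \<in> P \<Longrightarrow> B \<subseteq> S \<and> B \<noteq> {}"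
  by (auto simp: partition_on_def)

lemma partition_on_ex1: "partition_on S P \<Longrightarrow> j \<in> S \<Longrightarrow> \<exists>B\<in>P. j \<in> B \<and> (\<forall>B'\<in>P. j \<in> B' \<longrightarrow> B' = B)"
  by (auto simp: partition_on_def disjoint_def)

text \<open>This makes the Faa di Bruno sum independent of the labels of the variables.\<close>

lemma bij_betw_partitions_image:
  assumes "inj_on h S"
  shows "bij_betw ((`) ((`) h)) (partitions S) (partitions (h ` S))"
proof (rule bij_betw_byWitness[where f' = "(`) ((`) (inv_into S h))"])
  have im: "(`) k ` P \<in> partitions (k ` T)" if "inj_on k T" "P \<in> partitions T" for k :: "'x \<Rightarrow> 'y" and T P
  proof -
    have "{} \<notin> (`) k ` P" using that(2) by (auto simp: partition_on_def)
    then show ?thesis using partition_on_inj_image[of T P k] that by simp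
  qed
  have inj': "inj_on (inv_into S h) (h ` S)" by (rule inj_on_inv_into) simp
  have S: "inv_into S h ` h ` S = S" using assms by (simp add: inv_into_image_cancel)
  show "(`) ((`) h) ` partitions S \<subseteq> partitions (h ` S)" using im[OF assms] by blast
  show "(`) ((`) (inv_into S h)) ` partitions (h ` S) \<subseteq> partitions S"
    using im[OF inj', unfolded S] by blast
  show "\<forall>P\<in>partitions S. (`) (inv_into S h) ` (`) h ` P = P"
  proof
    fix P assume "P \<in> partitions S"
    then have "inv_into S h ` h ` B = B" if "B \<in> P" for B
      using that assms by (intro inv_into_image_cancel) (auto simp: partition_on_def)
    then show "(`) (inv_into S h) ` (`) h ` P = P" by (simp add: image_image)
  qed
  show "\<forall>P\<in>partitions (h ` S). (`) h ` (`) (inv_into S h) ` P = P"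
  proof
    fix P assume "P \<in> partitions (h ` S)"
    then have "h ` inv_into S h ` B = B" if "B \<in> P" for B
      using that by (intro image_inv_into_cancel[OF refl]) (auto simp: partition_on_def)
    then show "(`) h ` (`) (inv_into S h) ` P = P" by (simp add: image_image)
  qed
qed

lemma (in linorder) mset_sorted_key_list_of_set:
  assumes "inj_on k P" "finite P"
  shows "mset (sorted_key_list_of_set k P) = mset_set P"
proof -
  interpret folding_insort_key less_eq less P k by unfold_locales (rule assms(1))
  have "distinct (sorted_key_list_of_set k P)"
    by (rule distinct_if_distinct_map[OF distinct_sorted_key_list_of_set[OF subset_refl]])
  then have "mset (sorted_key_list_of_set k P) = mset_set (set (sorted_key_list_of_set k P))"
    by (rule mset_set_set[symmetric])
  then show ?thesis unfolding set_sorted_key_list_of_set[OF subset_refl assms(2)] .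
qed

text \<open>Blocks are nonempty and disjoint, so a block is identified by its minimum. The list of
  blocks sorted by minimum, which occurs in the definition of composition, thus contains each block
  exactly once.\<close>

lemma partition_on_inj_Min:
  fixes P :: "nat set set"
  assumes "partition_on S P" "finite S"
  shows "inj_on Min P"
proof (rule inj_onI)
  fix B B' assume B: "B \<in> P" "B' \<in> P" "Min B = Min B'"
  then have "Min B \<in> B" "Min B' \<in> B'"
    using assms partition_on_finite_block partition_on_block by (metis Min_in)+
  then show "B = B'" using B assms(1) by (auto simp: partition_on_def disjoint_def)
qed

text \<open>For composition with a linear map on the right: every partition other than
  \<open>{S}\<close> feeds at least two arguments into that map.\<close>

lemma partition_on_card_ge2:
  assumes "partition_on S P" "finite S" "P \<noteq> {S}" "S \<noteq> {}"
  shows "card P \<ge> 2"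
proof -
  have fin: "finite P" using assms finite_elements by blast
  have "P \<noteq> {}" using assms by (auto simp: partition_on_def)
  moreover have "card P \<noteq> 1" using assms(1,3) by (auto simp: partition_on_def card_1_singleton_iff)
  ultimately show ?thesis using fin by (metis card_0_eq One_nat_def Suc_1 less_2_cases_iff not_le)
qed

text \<open>For composition with a linear map on the left: every partition other than the discrete
  one evaluates that map at two or more arguments in some block.\<close>

lemma partition_on_ex_card_ge2:
  assumes "partition_on S P" "finite S" "P \<noteq> (\<lambda>i. {i}) ` S"
  shows "\<exists>B\<in>P. card B \<ge> 2"
proof (rule ccontr)
  assume "\<not> ?thesis"
  then have c: "card B < 2" if "B \<in> P" for B using that by (auto simp: not_le)
  have s: "\<exists>i. B = {i}" if "B \<in> P" for B
  proof -
    have "finite B" "B \<noteq> {}" using assms that partition_on_finite_block partition_on_block by metis+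
    then have "card B = 1" using c[OF that] by (metis card_0_eq less_2_cases One_nat_def)
    then show ?thesis by (auto simp: card_1_singleton_iff)
  qed
  have "P = (\<lambda>i. {i}) ` S"
  proof
    show "P \<subseteq> (\<lambda>i. {i}) ` S" using s assms(1) by (fastforce simp: partition_on_def)
    show "(\<lambda>i. {i}) ` S \<subseteq> P"
    proof
      fix B assume "B \<in> (\<lambda>i. {i}) ` S"
      then obtain i where i: "i \<in> S" "B = {i}" by blast
      then obtain B' where "B' \<in> P" "i \<in> B'" using assms(1) by (auto simp: partition_on_def)
      then show "B \<in> P" using s[of B'] i by auto
    qed
  qed
  then show False using assms(3) by contradiction
qed


section \<open>Composition\<close>

context cartesian_restriction_category
begin

text \<open>An index set labels the variables, so that partitions and the replacement of one
  variable make sense even if arguments coincide as maps.\<close>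

definition E :: "('o, 'm) faa_ar \<Rightarrow> 'i set \<Rightarrow> ('i \<Rightarrow> 'm) \<Rightarrow> 'm \<Rightarrow> 'm" where
  "E f S a x = ev f (image_mset a (mset_set S)) x"

lemma E_Hom:
  assumes "f \<in> FH M X N Y" "coh Z (mobj M) X (a ` S) x" "finite S" "S \<noteq> {}"
  shows "E f S a x \<in> Hom C Z (mobj N)"
  unfolding E_def by (rule ev_Hom) (use assms in \<open>auto simp: mset_set_empty_iff\<close>)

lemma E_Rst:
  assumes "f \<in> FH M X N Y" "coh Z (mobj M) X (a ` S) x" "finite S"
  shows "\<rho> (E f S a x) = \<rho> (x \<cdot> fseq f 0)"
  unfolding E_def by (rule ev_Rst) (use assms in auto)

lemma E_cong: "(\<And>i. i \<in> S \<Longrightarrow> a i = b i) \<Longrightarrow> E f S a x = E f S b x"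
  unfolding E_def by (metis (mono_tags, lifting) elem_mset_set image_mset_cong infinite_set_mset_mset_set empty_iff)

lemma Comp_E:
  assumes "f \<in> FH M X N Y" "coh Z (mobj M) X (a ` S) x" "finite S" "z \<in> Hom C W Z"
  shows "z \<cdot> E f S a x = E f S (\<lambda>i. z \<cdot> a i) (z \<cdot> x)"
  unfolding E_def using Comp_ev[OF assms(1) _ assms(4), of "image_mset a (mset_set S)" x] assms
  by (simp add: image_mset.compositionality comp_def)

lemma E_reindex: "inj_on h S \<Longrightarrow> E f (h ` S) a x = E f S (\<lambda>i. a (h i)) x"
  unfolding E_def by (simp add: image_mset_mset_set[symmetric] image_mset.compositionality comp_def)

lemma E_update:
  assumes "finite S" "j \<in> S"
  shows "E f S (a(j := d)) x = ev f (add_mset d (image_mset a (mset_set (S - {j})))) x"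
proof -
  have "mset_set S = add_mset j (mset_set (S - {j}))"
    using assms mset_set.remove by fastforce
  moreover have "image_mset (a(j := d)) (mset_set (S - {j})) = image_mset a (mset_set (S - {j}))"
    using assms(1) by (intro image_mset_cong) auto
  ultimately show ?thesis unfolding E_def by simp
qed

lemma E_insert:
  assumes "finite S" "j \<notin> S"
  shows "E f (insert j S) a x = ev f (add_mset (a j) (image_mset a (mset_set S))) x"
  using E_update[of "insert j S" j f a "a j" x] assms by simp

lemma E_update_plus:
  assumes f: "f \<in> FH M X N Y" and "finite S" "j \<in> S" "coh Z (mobj M) X (insert d (insert e (a ` (S - {j})))) x"
  shows "E f S (a(j := plus_map C M d e)) x = plus_map C N (E f S (a(j := d)) x) (E f S (a(j := e)) x)"
  unfolding E_update[OF assms(2,3)] by (rule ev_plus[OF f]) (use assms in auto)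

lemma E_update_sum:
  assumes f: "f \<in> FH M X N Y" and "finite S" "j \<in> S" "coh Z (mobj M) X (t ` I \<union> a ` (S - {j})) x"
    "finite I" "I \<noteq> {}"
  shows "E f S (a(j := sum_map C M Z t I)) x = sum_map C N Z (\<lambda>i. E f S (a(j := t i)) x) I"
  unfolding E_update[OF assms(2,3)] by (rule ev_sum[OF f]) (use assms in auto)

lemma E_update_rzero:
  assumes f: "f \<in> FH M X N Y" and "finite S" "j \<in> S" "coh Z (mobj M) X (a ` (S - {j})) x"
  shows "E f S (a(j := \<rho> x \<cdot> zero_map C M Z)) x = \<rho> (x \<cdot> fseq f 0) \<cdot> zero_map C N Z"
  unfolding E_update[OF assms(2,3)] by (rule ev_rzero[OF f]) (use assms in auto)

lemma coh_E:
  assumes f: "f \<in> FH M X N Y" and c: "coh Z (mobj M) X (a ` S) x" and S: "finite S"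
    and P: "\<And>B. B \<in> P \<Longrightarrow> B \<subseteq> S \<and> B \<noteq> {}"
  shows "coh Z (mobj N) Y ((\<lambda>B. E f B a x) ` P) (x \<cdot> fseq f 0)"
  unfolding coh_def
proof (intro conjI ballI)
  show "x \<cdot> fseq f 0 \<in> Hom C Z Y" using cohD(1)[OF c] FH_D(7)[OF f] by (simp add: Hom_iff)
  fix b assume "b \<in> (\<lambda>B. E f B a x) ` P"
  then obtain B where B: "b = E f B a x" "B \<in> P" by blast
  have cB: "coh Z (mobj M) X (a ` B) x" by (rule coh_mono[OF c]) (use P B in blast)
  have "finite B" using S P B(2) finite_subset by metis
  then show "b \<in> Hom C Z (mobj N)" "\<rho> b = \<rho> (x \<cdot> fseq f 0)"
    using E_Hom[OF f cB] E_Rst[OF f cB] P B by auto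
qed

text \<open>The Faa di Bruno sum over an arbitrary finite index set in place of
  \<open>{..<n}\<close>, so that a point can be added to the index set.\<close>

definition cs :: "('o, 'm) faa_ar \<Rightarrow> ('o, 'm) faa_ar \<Rightarrow> 'o \<Rightarrow> 'i set \<Rightarrow> ('i \<Rightarrow> 'm) \<Rightarrow> 'm \<Rightarrow> 'm" where
  "cs f g Z S a x = sum_map C (fst (ftgt g)) Z (\<lambda>P. E g P (\<lambda>B. E f B a x) (x \<cdot> fseq f 0)) (partitions S)"

end

locale faa_pair = cartesian_restriction_category +
  fixes f g M X N Y K V
  assumes f: "f \<in> FH M X N Y" and g: "g \<in> FH N Y K V"
begin

lemma cK [simp]: "cm K" and cN [simp]: "cm N" and cM [simp]: "cm M"
  using FH_D(1,2)[OF g] FH_D(1)[OF f] by auto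

lemma ob [simp]: "X \<in> Ob C" "Y \<in> Ob C" "V \<in> Ob C" using FH_D(3,4)[OF f] FH_D(4)[OF g] by auto

lemma fg0 [simp]: "fseq f 0 \<in> Ar C" "Dom C (fseq f 0) = X" "Cod C (fseq f 0) = Y"
  "fseq g 0 \<in> Ar C" "Dom C (fseq g 0) = Y" "Cod C (fseq g 0) = V"
  using FH_D(7)[OF f] FH_D(7)[OF g] by (auto simp: Hom_iff)

abbreviation "tm a x P \<equiv> E g P (\<lambda>B. E f B a x) (x \<cdot> fseq f 0)"

lemma cs_K: "cs f g Z S a x = sum_map C K Z (tm a x) (partitions S)"
  by (simp add: cs_def FH_D(6)[OF g])

lemma coh_block:
  assumes "coh Z (mobj M) X (a ` S) x" "finite S" "partition_on S P"
  shows "coh Z (mobj N) Y ((\<lambda>B. E f B a x) ` P) (x \<cdot> fseq f 0)" "finite P" "S \<noteq> {} \<Longrightarrow> P \<noteq> {}"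
proof -
  show "coh Z (mobj N) Y ((\<lambda>B. E f B a x) ` P) (x \<cdot> fseq f 0)"
    by (rule coh_E[OF f assms(1,2)]) (use assms(3) partition_on_block in blast)
  show "finite P" using assms finite_elements by blast
  show "S \<noteq> {} \<Longrightarrow> P \<noteq> {}" using assms(3) by (auto simp: partition_on_def)
qed

lemma tm_type:
  assumes c: "coh Z (mobj M) X (a ` S) x" "finite S" "S \<noteq> {}" "partition_on S P"
  shows "tm a x P \<in> Hom C Z (mobj K)" "\<rho> (tm a x P) = \<rho> (x \<cdot> (fseq f 0 \<cdot> fseq g 0))"
proof -
  note b = coh_block[OF c(1,2,4)]
  show "tm a x P \<in> Hom C Z (mobj K)" using b c(3) by (intro E_Hom[OF g]) auto
  show "\<rho> (tm a x P) = \<rho> (x \<cdot> (fseq f 0 \<cdot> fseq g 0))"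
    using E_Rst[OF g b(1,2)] cohD(1)[OF c(1)] by (simp add: Hom_iff)
qed

lemma cs_type:
  assumes c: "coh Z (mobj M) X (a ` S) x" "finite S" "S \<noteq> {}"
  shows "cs f g Z S a x \<in> Hom C Z (mobj K)" "\<rho> (cs f g Z S a x) = \<rho> (x \<cdot> (fseq f 0 \<cdot> fseq g 0))"
proof -
  have x: "x \<in> Ar C" "Cod C x = X" using cohD(1)[OF c(1)] by (auto simp: Hom_iff)
  show "cs f g Z S a x \<in> Hom C Z (mobj K)" unfolding cs_K
    by (rule crc_monoid.sum_map_Hom) (use tm_type[OF c] cohD(4)[OF c(1)] in auto)
  show "\<rho> (cs f g Z S a x) = \<rho> (x \<cdot> (fseq f 0 \<cdot> fseq g 0))" unfolding cs_K
    using tm_type[OF c] cohD(4)[OF c(1)] finitely_many_partition_on[OF c(2)] x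
    by (intro crc_monoid.Rst_sum_map partitions_nonempty) auto
qed

lemma cs_cong:
  assumes "\<And>i. i \<in> S \<Longrightarrow> a i = b i" and c: "coh Z (mobj M) X (a ` S) x" "finite S" "S \<noteq> {}"
  shows "cs f g Z S a x = cs f g Z S b x"
proof -
  have "tm a x P = tm b x P" if "partition_on S P" for P
    by (intro E_cong) (use assms(1) partition_on_block[OF that] in blast)
  then show ?thesis unfolding cs_K
    by (intro crc_monoid.sum_map_cong) (use tm_type[OF c] cohD(4)[OF c(1)] in \<open>auto\<close>)
qed

text \<open>Relabelling the variables carries partitions bijectively to partitions and matches the
  terms. This gives the symmetry of the composite.\<close>

lemma cs_reindex:
  assumes h: "inj_on h S" and c: "coh Z (mobj M) X (a ` h ` S) x" "finite S" "S \<noteq> {}"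
  shows "cs f g Z (h ` S) a x = cs f g Z S (\<lambda>i. a (h i)) x"
  unfolding cs_K
proof (rule crc_monoid.sum_map_bij[OF _ _ bij_betw_partitions_image[OF h]])
  show "cm K" "Z \<in> Ob C" using cohD(4)[OF c(1)] by auto
  fix P assume "P \<in> partitions S"
  then have P: "partition_on S P" by simp
  have inj: "inj_on h B" if "B \<in> P" for B using partition_on_block[OF P that] h inj_on_subset by blast
  have injh: "inj_on ((`) h) P" using h P
    by (metis inj_on_image_eq_iff inj_onI partition_on_block)
  show "tm a x ((`) h ` P) = tm (\<lambda>i. a (h i)) x P"
    unfolding E_reindex[OF injh] by (rule E_cong) (simp add: E_reindex inj)
  show "tm (\<lambda>i. a (h i)) x P \<in> Hom C Z (mobj K)"
    using c P by (intro tm_type(1)) (auto simp: image_image)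
qed

lemma Comp_cs:
  assumes c: "coh Z (mobj M) X (a ` S) x" "finite S" "S \<noteq> {}" and z: "z \<in> Hom C W Z"
  shows "z \<cdot> cs f g Z S a x = cs f g W S (\<lambda>i. z \<cdot> a i) (z \<cdot> x)"
proof -
  have x: "x \<in> Ar C" "Dom C x = Z" "Cod C x = X" and z': "z \<in> Ar C" "Dom C z = W" "Cod C z = Z"
    using cohD(1)[OF c(1)] z by (auto simp: Hom_iff)
  have W: "W \<in> Ob C" "Z \<in> Ob C" using z' Dom_Ob Cod_Ob by auto
  have "z \<cdot> tm a x P = tm (\<lambda>i. z \<cdot> a i) (z \<cdot> x) P" if P: "partition_on S P" for P
  proof -
    note b = coh_block[OF c(1,2) P]
    have "z \<cdot> tm a x P = E g P (\<lambda>B. z \<cdot> E f B a x) (z \<cdot> (x \<cdot> fseq f 0))"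
      using b by (intro Comp_E[OF g _ _ z])
    also have "\<dots> = E g P (\<lambda>B. E f B (\<lambda>i. z \<cdot> a i) (z \<cdot> x)) (z \<cdot> (x \<cdot> fseq f 0))"
    proof (rule E_cong)
      fix B assume "B \<in> P"
      then have "B \<subseteq> S" using partition_on_block[OF P] by blast
      then show "z \<cdot> E f B a x = E f B (\<lambda>i. z \<cdot> a i) (z \<cdot> x)"
        using c(1,2) finite_subset by (intro Comp_E[OF f _ _ z]) (auto intro: coh_mono)
    qed
    finally show ?thesis using x z' by simp
  qed
  note tm = this
  have c': "coh W (mobj M) X ((\<lambda>i. z \<cdot> a i) ` S) (z \<cdot> x)"
    using Comp_coh[OF c(1) z] by (simp add: image_image)
  have "z \<cdot> cs f g Z S a x = sum_map C K W (\<lambda>P. z \<cdot> tm a x P) (partitions S)"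
    unfolding cs_K using tm_type[OF c] finitely_many_partition_on[OF c(2)]
    by (intro crc_monoid.Comp_sum_map[OF _ z] partitions_nonempty) auto
  also have "\<dots> = cs f g W S (\<lambda>i. z \<cdot> a i) (z \<cdot> x)"
    unfolding cs_K using tm_type[OF c' c(2,3)] tm W
    by (intro crc_monoid.sum_map_cong) auto
  finally show ?thesis .
qed

text \<open>The index \<open>j\<close> lies in exactly one block \<open>B\<close>, so changing its
  variable changes only the argument of \<open>g\<close> that belongs to \<open>B\<close>.
  Additivity of a term in this variable follows from that of \<open>f\<close> at \<open>B\<close>,
  followed by that of \<open>g\<close> at \<open>P\<close>.\<close>

lemma tm_update:
  assumes c: "coh Z (mobj M) X (a ` (S - {j})) x" and S: "finite S" "j \<in> S"
    and P: "partition_on S P"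
  obtains B where "B \<in> P" "j \<in> B" "B \<subseteq> S"
    "coh Z (mobj M) X (a ` (B - {j})) x"
    "coh Z (mobj N) Y ((\<lambda>B. E f B a x) ` (P - {B})) (x \<cdot> fseq f 0)"
    "\<And>d. tm (a(j := d)) x P = E g P ((\<lambda>B. E f B a x)(B := E f B (a(j := d)) x)) (x \<cdot> fseq f 0)"
proof -
  obtain B where B: "B \<in> P" "j \<in> B" "\<And>B'. B' \<in> P \<Longrightarrow> j \<in> B' \<Longrightarrow> B' = B"
    using partition_on_ex1[OF P S(2)] by blast
  have sub: "B' \<subseteq> S \<and> B' \<noteq> {}" if "B' \<in> P" for B' using partition_on_block[OF P that] .
  show ?thesis
  proof (rule that[of B])
    show "B \<in> P" "j \<in> B" "B \<subseteq> S" using B(1,2) sub[OF B(1)] by auto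
    show "coh Z (mobj M) X (a ` (B - {j})) x" using sub[OF B(1)] by (intro coh_mono[OF c]) auto
    show "coh Z (mobj N) Y ((\<lambda>B. E f B a x) ` (P - {B})) (x \<cdot> fseq f 0)"
    proof (rule coh_E[OF f c])
      show "finite (S - {j})" using S(1) by simp
      fix B' assume B': "B' \<in> P - {B}"
      then have "j \<notin> B'" using B(3) by blast
      then show "B' \<subseteq> S - {j} \<and> B' \<noteq> {}" using sub B' by blast
    qed
    show "tm (a(j := d)) x P = E g P ((\<lambda>B. E f B a x)(B := E f B (a(j := d)) x)) (x \<cdot> fseq f 0)" for d
    proof (rule E_cong)
      fix B' assume "B' \<in> P"
      show "E f B' (a(j := d)) x = ((\<lambda>B. E f B a x)(B := E f B (a(j := d)) x)) B'"
      proof (cases "B' = B")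
        case False
        then have "j \<notin> B'" using B(3) \<open>B' \<in> P\<close> by blast
        then have "E f B' (a(j := d)) x = E f B' a x" by (intro E_cong) auto
        then show ?thesis using False by simp
      qed simp
    qed
  qed
qed

lemma cs_update_plus:
  assumes c: "coh Z (mobj M) X (insert d (insert e (a ` (S - {j})))) x" and S: "finite S" "j \<in> S"
  shows "cs f g Z S (a(j := plus_map C M d e)) x
    = plus_map C K (cs f g Z S (a(j := d)) x) (cs f g Z S (a(j := e)) x)"
proof -
  have c0: "coh Z (mobj M) X (a ` (S - {j})) x" using c by (rule coh_mono) auto
  have cu: "coh Z (mobj M) X ((a(j := d)) ` S) x" "coh Z (mobj M) X ((a(j := e)) ` S) x"
    using c by (auto elim: coh_mono)
  have ne: "S \<noteq> {}" using S by auto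
  note ty = tm_type[OF cu(1) S(1) ne] tm_type[OF cu(2) S(1) ne]
  have Z: "Z \<in> Ob C" using cohD(4)[OF c] .
  have "tm (a(j := plus_map C M d e)) x P = plus_map C K (tm (a(j := d)) x P) (tm (a(j := e)) x P)"
    if P: "partition_on S P" for P
  proof -
    obtain B where B: "B \<in> P" "j \<in> B" "B \<subseteq> S"
    "coh Z (mobj M) X (a ` (B - {j})) x"
    "coh Z (mobj N) Y ((\<lambda>B. E f B a x) ` (P - {B})) (x \<cdot> fseq f 0)"
    and u: "\<And>d. tm (a(j := d)) x P = E g P ((\<lambda>B. E f B a x)(B := E f B (a(j := d)) x)) (x \<cdot> fseq f 0)"
      using tm_update[OF c0 S P] by blast
    have fB: "finite B" "finite P" using S(1) B(3) finite_subset finite_elements[OF S(1) P] by auto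
    have cB: "coh Z (mobj M) X ((a(j := d)) ` B) x" "coh Z (mobj M) X ((a(j := e)) ` B) x"
      using coh_mono[OF cu(1) image_mono[OF B(3)]] coh_mono[OF cu(2) image_mono[OF B(3)]] by auto
    have "coh Z (mobj N) Y (insert (E f B (a(j := d)) x) (insert (E f B (a(j := e)) x) ((\<lambda>B. E f B a x) ` (P - {B})))) (x \<cdot> fseq f 0)"
      using B(2,5) E_Hom[OF f cB(1) fB(1)] E_Rst[OF f cB(1) fB(1)] E_Hom[OF f cB(2) fB(1)] E_Rst[OF f cB(2) fB(1)]
      by (auto simp: coh_insert)
    note p = E_update_plus[OF g fB(2) B(1) this]
    have "coh Z (mobj M) X (insert d (insert e (a ` (B - {j})))) x"
      using B(3) by (intro coh_mono[OF c]) auto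
    then show ?thesis unfolding u p[symmetric] by (simp add: E_update_plus[OF f fB(1) B(2)])
  qed
  then have "cs f g Z S (a(j := plus_map C M d e)) x
    = sum_map C K Z (\<lambda>P. plus_map C K (tm (a(j := d)) x P) (tm (a(j := e)) x P)) (partitions S)"
    unfolding cs_K using ty by (intro crc_monoid.sum_map_cong) (use Z in \<open>auto simp: Hom_iff\<close>)
  also have "\<dots> = plus_map C K (cs f g Z S (a(j := d)) x) (cs f g Z S (a(j := e)) x)"
    unfolding cs_K using ty by (intro crc_monoid.sum_map_plus) (use Z in \<open>auto\<close>)
  finally show ?thesis .
qed

lemma cs_update_rzero:
  assumes c: "coh Z (mobj M) X (a ` (S - {j})) x" and S: "finite S" "j \<in> S"
  shows "cs f g Z S (a(j := \<rho> x \<cdot> zero_map C M Z)) x = \<rho> (x \<cdot> (fseq f 0 \<cdot> fseq g 0)) \<cdot> zero_map C K Z"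
proof -
  have x: "x \<in> Ar C" "Dom C x = Z" "Cod C x = X" using cohD(1)[OF c] by (auto simp: Hom_iff)
  have "tm (a(j := \<rho> x \<cdot> zero_map C M Z)) x P = \<rho> (x \<cdot> (fseq f 0 \<cdot> fseq g 0)) \<cdot> zero_map C K Z"
    if P: "partition_on S P" for P
  proof -
    obtain B where B: "B \<in> P" "j \<in> B" "B \<subseteq> S"
    "coh Z (mobj M) X (a ` (B - {j})) x"
    "coh Z (mobj N) Y ((\<lambda>B. E f B a x) ` (P - {B})) (x \<cdot> fseq f 0)"
    and u: "\<And>d. tm (a(j := d)) x P = E g P ((\<lambda>B. E f B a x)(B := E f B (a(j := d)) x)) (x \<cdot> fseq f 0)"
      using tm_update[OF c S P] by blast
    have fB: "finite B" "finite P" using S(1) B(3) finite_subset finite_elements[OF S(1) P] by auto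
    show ?thesis unfolding u E_update_rzero[OF f fB(1) B(2,4)] E_update_rzero[OF g fB(2) B(1,5)]
      using x by simp
  qed
  then show ?thesis unfolding cs_K
    using finitely_many_partition_on[OF S(1)] x
    by (intro crc_monoid.sum_map_all_rzero partitions_nonempty) auto
qed

abbreviation "fg \<equiv> faa_Comp C f g"

lemma Comp_simps: "fsrc fg = (M, X)" "ftgt fg = (K, V)" "fseq fg 0 = fseq f 0 \<cdot> fseq g 0"
  using FH_D(5)[OF f] FH_D(6)[OF g] by (simp_all add: faa_Comp_def)

text \<open>The definition of composition lists the blocks and their elements in a fixed order. By
  symmetry of \<open>f\<close> and \<open>g\<close> the lists may be replaced by multisets, and the
  definition becomes \<open>cs\<close> at the projections.\<close>

lemma fseq_Comp:
  assumes "n \<ge> 1"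
  shows "fseq fg n = cs f g (pow_times C (mobj M) n X) {..<n} (pow_proj C (mobj M) X n) (pow_proj C (mobj M) X n n)"
proof -
  let ?a = "pow_proj C (mobj M) X n" and ?Z = "pow_times C (mobj M) n X"
  let ?block = "\<lambda>B. app C (fseq f (card B)) (map ?a (sorted_list_of_set B)) (?a n)"
  have c: "coh ?Z (mobj M) X (?a ` {..<n}) (?a n)"
    using coh_pow_proj[of "mobj M" X n] by (simp add: atLeast0LessThan)
  have ne: "{..<n} \<noteq> {}" using assms by (auto simp: lessThan_empty_iff)
  have t: "app C (fseq g (card P)) (map ?block (sorted_key_list_of_set Min P)) (?a n \<cdot> fseq f 0) = tm ?a (?a n) P"
    if P: "partition_on {..<n} P" for P
  proof -
    note b = coh_block[OF c _ P, simplified]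
    have bl: "?block B = E f B ?a (?a n)" if "B \<in> P" for B
    proof -
      have B: "B \<subseteq> {..<n}" "finite B" using partition_on_block[OF P that] finite_subset by auto
      have "coh ?Z (mobj M) X (set (map ?a (sorted_list_of_set B))) (?a n)"
        using B by (intro coh_mono[OF c]) auto
      moreover have "mset (sorted_list_of_set B) = mset_set B"
        using mset_set_set[of "sorted_list_of_set B"] B(2) by simp
      ultimately show ?thesis using ev_mset[OF f, of ?Z "map ?a (sorted_list_of_set B)" "?a n"] B(2)
        by (simp add: E_def)
    qed
    have inj: "inj_on Min P" using partition_on_inj_Min[OF P] by simp
    note ms = mset_sorted_key_list_of_set[OF inj b(2)]
    let ?l = "sorted_key_list_of_set Min P"
    have sl: "set ?l = P" "length ?l = card P"
      using arg_cong[OF ms, of set_mset] arg_cong[OF ms, of size] b(2) by auto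
    have m: "map ?block ?l = map (\<lambda>B. E f B ?a (?a n)) ?l" using bl sl by simp
    have "coh ?Z (mobj N) Y (set (map (\<lambda>B. E f B ?a (?a n)) ?l)) (?a n \<cdot> fseq f 0)"
      using b(1) sl by simp
    from ev_mset[OF g this] show ?thesis unfolding m using sl by (simp add: E_def ms)
  qed
  show ?thesis using assms unfolding cs_K
    by (auto simp: faa_Comp_def FH_D(5)[OF f] FH_D(6)[OF g] Let_def t
      intro!: crc_monoid.sum_map_cong tm_type(1)[OF c _ ne])
qed

lemma app_Comp:
  assumes c: "coh Z (mobj M) X (set as) x" "as \<noteq> []"
  shows "app C (fseq fg (length as)) as x = cs f g Z {..<length as} (nth as) x"
proof -
  let ?n = "length as"
  let ?a = "pow_proj C (mobj M) X ?n" and ?Z = "pow_times C (mobj M) ?n X"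
  have c': "coh ?Z (mobj M) X (?a ` {..<?n}) (?a ?n)"
    using coh_pow_proj[of "mobj M" X ?n] by (simp add: atLeast0LessThan)
  have ne: "{..<?n} \<noteq> {}" "?n \<ge> 1" using c(2) by (auto simp: lessThan_empty_iff Suc_le_eq)
  have "app C (fseq fg ?n) as x = cs f g Z {..<?n} (\<lambda>i. tup as x \<cdot> ?a i) (tup as x \<cdot> ?a ?n)"
    using Comp_cs[OF c' _ ne(1) coh_tup(1)[OF c(1)]] fseq_Comp[OF ne(2)] by (simp add: app_tup)
  also have "tup as x \<cdot> ?a ?n = x" using tup_proj[OF c(1)] by simp
  also have "cs f g Z {..<?n} (\<lambda>i. tup as x \<cdot> ?a i) x = cs f g Z {..<?n} (nth as) x"
    using c ne by (intro cs_cong[symmetric]) (auto simp: tup_proj[OF c(1)] elim!: coh_mono)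
  finally show ?thesis .
qed

lemma Comp_FH: "fg \<in> FH M X K V"
proof (rule FH_I)
  show "cm M" "cm K" "X \<in> Ob C" "V \<in> Ob C" "fsrc fg = (M, X)" "ftgt fg = (K, V)"
    by (simp_all add: Comp_simps)
  show "fseq fg 0 \<in> Hom C X V" by (simp add: Comp_simps Hom_iff)
  fix n :: nat assume n: "1 \<le> n"
  let ?a = "pow_proj C (mobj M) X n" and ?Z = "pow_times C (mobj M) n X"
  have c: "coh ?Z (mobj M) X (?a ` {..<n}) (?a n)"
    using coh_pow_proj[of "mobj M" X n] by (simp add: atLeast0LessThan)
  have "{..<n} \<noteq> {}" using n by (auto simp: lessThan_empty_iff)
  from cs_type[OF c _ this] show "fseq fg n \<in> Hom C ?Z (mobj K)" "\<rho> (fseq fg n) = \<rho> (?a n \<cdot> fseq fg 0)"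
    unfolding fseq_Comp[OF n] by (simp_all add: Comp_simps)
next
  fix Z as bs x assume c: "coh Z (mobj M) X (set as) x" "as \<noteq> []" "mset bs = mset as"
  then have l: "length bs = length as" "set bs = set as" using mset_eq_length mset_eq_setD by metis+
  \<comment> \<open>The permutation of the arguments is turned into a relabelling of the index set
    \<open>{..<length as}\<close>, under which \<open>cs\<close> is invariant.\<close>
  obtain p where p: "p permutes {..<length as}" "permute_list p as = bs"
    using mset_eq_permutation[OF c(3)] by blast
  have ne: "{..<length as} \<noteq> {}" using c(2) by (auto simp: lessThan_empty_iff)
  have pim: "p ` {..<length as} = {..<length as}" using permutes_image[OF p(1)] .
  have sas: "(!) as ` {..<length as} = set as" by (auto simp: set_conv_nth)
  have "app C (fseq fg (length as)) bs x = cs f g Z {..<length as} (nth bs) x"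
    using app_Comp[of Z bs x] c l by (cases "bs = []") auto
  also have "\<dots> = cs f g Z {..<length as} (\<lambda>i. as ! p i) x"
  proof (rule cs_cong)
    show "bs ! i = as ! p i" if "i \<in> {..<length as}" for i
      using p that by (auto simp: permute_list_nth)
    have "(!) bs ` {..<length as} \<subseteq> set as" using l by (metis image_subsetI lessThan_iff nth_mem)
    then show "coh Z (mobj M) X ((!) bs ` {..<length as}) x" by (rule coh_mono[OF c(1)])
  qed (use ne in auto)
  also have "\<dots> = cs f g Z (p ` {..<length as}) (nth as) x"
    using p(1) c(1) ne sas pim by (intro cs_reindex[symmetric]) (auto simp: permutes_inj_on)
  also have "\<dots> = app C (fseq fg (length as)) as x" using app_Comp[OF c(1,2)] pim by simp
  finally show "app C (fseq fg (length as)) bs x = app C (fseq fg (length as)) as x" .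
next
  fix Z a b as x assume c: "coh Z (mobj M) X (insert a (insert b (set as))) x"
  \<comment> \<open>Lists that differ in their head are updates at index 0 of one indexed family, as
    \<open>cs_update_plus\<close> requires.\<close>
  have n: "nth (d # as) = (nth (a # as))(0 := d)" for d by (auto simp: fun_eq_iff nth_Cons split: nat.split)
  have im: "(nth (a # as)) ` ({..<Suc (length as)} - {0}) \<subseteq> set as" by (auto simp: nth_Cons' intro!: nth_mem)
  have x: "x \<in> Hom C Z X" using cohD(1)[OF c] .
  have "coh Z (mobj M) X (set (plus_map C M a b # as)) x"
    using c x by (auto simp: coh_insert Hom_iff)
  moreover have "coh Z (mobj M) X (set (a # as)) x" "coh Z (mobj M) X (set (b # as)) x"
    using c by (auto simp: coh_insert)
  ultimately show "app C (fseq fg (Suc (length as))) (plus_map C M a b # as) x = plus_map C K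
    (app C (fseq fg (Suc (length as))) (a # as) x) (app C (fseq fg (Suc (length as))) (b # as) x)"
    using app_Comp[of Z "a # as" x] app_Comp[of Z "b # as" x] app_Comp[of Z "plus_map C M a b # as" x]
      cs_update_plus[OF coh_mono[OF c insert_mono[OF insert_mono[OF im]]]]
    by (simp add: n[symmetric])
next
  fix Z as x assume c: "coh Z (mobj M) X (set as) x"
  let ?z = "\<rho> x \<cdot> zero_map C M Z"
  have n: "nth (d # as) = (nth (?z # as))(0 := d)" for d by (auto simp: fun_eq_iff nth_Cons split: nat.split)
  have im: "(nth (?z # as)) ` ({..<Suc (length as)} - {0}) \<subseteq> set as" by (auto simp: nth_Cons' intro!: nth_mem)
  have "coh Z (mobj M) X (set (?z # as)) x"
    using c cohD(1,4)[OF c] by (auto simp: coh_insert Hom_iff)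
  then show "app C (fseq fg (Suc (length as))) (?z # as) x = \<rho> (x \<cdot> fseq fg 0) \<cdot> zero_map C K Z"
    using app_Comp[of Z "?z # as" x] cs_update_rzero[OF coh_mono[OF c im]]
    by (simp add: n[symmetric] Comp_simps)
qed

text \<open>An enumeration of \<open>S\<close> reduces the claim to the index set
  \<open>{..<n}\<close>. For empty \<open>S\<close> the value lies in \<open>V\<close> and not in
  the monoid \<open>K\<close>, so it would not be a sum in \<open>K\<close>.\<close>

lemma E_Comp:
  assumes c: "coh Z (mobj M) X (a ` S) x" "finite S" "S \<noteq> {}"
  shows "E fg S a x = cs f g Z S a x"
proof -
  obtain s where s: "distinct s" "set s = S" using c(2) finite_distinct_list by metis
  let ?n = "length s"
  have sn: "nth s ` {..<?n} = S" using s(2) by (auto simp: set_conv_nth)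
  have cl: "coh Z (mobj M) X (set (map a s)) x" using c s by simp
  have "E fg S a x = ev fg (mset (map a s)) x" using mset_set_set[OF s(1)] s(2) by (simp add: E_def)
  also have "\<dots> = app C (fseq fg (length (map a s))) (map a s) x" by (rule ev_mset[OF Comp_FH cl])
  also have "\<dots> = cs f g Z {..<?n} (nth (map a s)) x" using app_Comp[OF cl] c(3) s(2) by auto
  also have "\<dots> = cs f g Z {..<?n} (\<lambda>i. a (s ! i)) x"
    using cl c(3) s(2) by (intro cs_cong) (auto elim!: coh_mono simp: lessThan_empty_iff)
  also have "\<dots> = cs f g Z (nth s ` {..<?n}) a x"
    using s c sn by (intro cs_reindex[symmetric]) (auto simp: inj_on_nth lessThan_empty_iff)
  finally show ?thesis using sn by simp
qed

end

section \<open>Maps whose higher components vanish\<close>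

context cartesian_restriction_category
begin

lemma ev_indexed:
  obtains n and as :: "'m list" where "m = image_mset (nth as) (mset_set {..<n})" "n = length as" "mset as = m"
proof -
  obtain as where as: "mset as = m" using ex_mset by blast
  have "mset as = image_mset (nth as) (mset [0..<length as])"
    by (metis map_nth mset_map)
  then have "m = image_mset (nth as) (mset_set {..<length as})"
    using as by (metis mset_upt atLeast0LessThan)
  then show ?thesis using that as by blast
qed

text \<open>The maps of the form \<open>(f\<^sub>*, f\<^sub>1, 0, 0, \<dots>)\<close>, where the
  zeros are restricted to the domain of \<open>f\<^sub>*\<close>. Identities, projections,
  restrictions and the structure maps of \<open>faa_L\<close> are of this kind. Composition with
  them involves no sum over partitions.\<close>

definition lin :: "('o, 'm) faa_ar \<Rightarrow> bool" where
  "lin f \<longleftrightarrow> (\<forall>M X N Y Z m x. f \<in> FH M X N Y \<longrightarrow> coh Z (mobj M) X (set_mset m) x \<longrightarrow> size m \<ge> 2 \<longrightarrow>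
     ev f m x = \<rho> (x \<cdot> fseq f 0) \<cdot> zero_map C N Z)"

lemma linD:
  assumes "lin f" "f \<in> FH M X N Y" "coh Z (mobj M) X (set_mset m) x" "size m \<ge> 2"
  shows "ev f m x = \<rho> (x \<cdot> fseq f 0) \<cdot> zero_map C N Z"
  using assms unfolding lin_def by blast

lemma E_singleton: "E f {i} a x = ev f {#a i#} x"
  by (simp add: E_def)

lemma fseq_1:
  assumes "f \<in> FH M X N Y"
  shows "fseq f 1 = ev f {#Pr0 C (mobj M) X#} (Pr1 C (mobj M) X)"
proof -
  have "coh (mobj M \<^bold>\<times> X) (mobj M) X (set [Pr0 C (mobj M) X]) (Pr1 C (mobj M) X)"
    using FH_D(1,3)[OF assms] by (simp add: coh_def Hom_iff)
  from ev_mset[OF assms this] show ?thesis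
    using FH_D(1,3)[OF assms] FH_D(8)[OF assms, of 1] by (simp add: app_tup Hom_iff)
qed

end

context faa_pair
begin

text \<open>A set with one element has only one partition.\<close>

lemma ev_Comp_singleton:
  assumes c: "coh Z (mobj M) X {a} x"
  shows "ev fg {#a#} x = ev g {#ev f {#a#} x#} (x \<cdot> fseq f 0)"
proof -
  have "P = {{0}}" if P: "partition_on {0::nat} P" for P
  proof -
    have "B = {0}" if "B \<in> P" for B using partition_on_block[OF P that] by auto
    moreover have "P \<noteq> {}" using P by (auto simp: partition_on_def)
    ultimately show ?thesis by blast
  qed
  then have p: "partitions {0::nat} = {{{0}}}"
    using partition_on_space[of "{0::nat}"] by blast
  have c': "coh Z (mobj M) X ((\<lambda>i::nat. a) ` {0}) x" using c by simp
  have "ev fg {#a#} x = cs f g Z {0::nat} (\<lambda>i. a) x"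
    using E_Comp[OF c'] by (simp add: E_singleton)
  also have "\<dots> = tm (\<lambda>i. a) x {{0::nat}}"
    unfolding cs_K p using tm_type(1)[OF c', of "{{0}}"] partition_on_space[of "{0::nat}"] cohD(4)[OF c]
      crc_monoid.sum_map_singleton[of C K Z "tm (\<lambda>i. a) x" "{{0}}"] by simp
  finally show ?thesis by (simp add: E_singleton)
qed

text \<open>A partition with at least two blocks contributes a value of \<open>g\<close> at two or
  more arguments, which is zero; only \<open>{S}\<close> remains.\<close>

lemma E_Comp_lin_right:
  assumes l: "lin g" and c: "coh Z (mobj M) X (a ` S) x" "finite S" "S \<noteq> {}"
  shows "E fg S a x = ev g {#E f S a x#} (x \<cdot> fseq f 0)"
proof -
  have x: "x \<in> Ar C" "Dom C x = Z" "Cod C x = X" using cohD(1)[OF c(1)] by (auto simp: Hom_iff)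
  have S: "partition_on S {S}" using partition_on_space[OF c(3)] .
  have "sum_map C K Z (tm a x) (partitions S) = tm a x {S}"
  proof (rule crc_monoid.sum_map_single)
    show "finite (partitions S)" using finitely_many_partition_on[OF c(2)] .
    show "{S} \<in> partitions S" using S by simp
    show "tm a x {S} \<in> Hom C Z (mobj K)" by (rule tm_type[OF c S])
    fix P assume P: "P \<in> partitions S" "P \<noteq> {S}"
    then have "card P \<ge> 2" using partition_on_card_ge2[of S P] c by auto
    moreover have "coh Z (mobj N) Y ((\<lambda>B. E f B a x) ` P) (x \<cdot> fseq f 0)" "finite P"
      using coh_block[OF c(1,2)] P by auto
    ultimately show "tm a x P = \<rho> (tm a x {S}) \<cdot> zero_map C K Z"
      unfolding tm_type(2)[OF c S] unfolding E_def[of g P]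
      using linD[OF l g, of Z "image_mset (\<lambda>B. E f B a x) (mset_set P)" "x \<cdot> fseq f 0"] x by simp
  qed simp
  then show ?thesis unfolding E_Comp[OF c] cs_K by (simp add: E_singleton)
qed

text \<open>A block with at least two elements gives \<open>g\<close> a zero argument, and
  additivity of \<open>g\<close> makes the whole term zero; only the discrete partition
  remains.\<close>

lemma E_Comp_lin_left:
  assumes l: "lin f" and c: "coh Z (mobj M) X (a ` S) x" "finite S" "S \<noteq> {}"
  shows "E fg S a x = E g S (\<lambda>i. ev f {#a i#} x) (x \<cdot> fseq f 0)"
proof -
  let ?Q = "(\<lambda>i. {i}) ` S"
  have x: "x \<in> Ar C" "Dom C x = Z" "Cod C x = X" using cohD(1)[OF c(1)] by (auto simp: Hom_iff)
  have Q: "partition_on S ?Q" using partition_on_singletons[of S] .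
  have "sum_map C K Z (tm a x) (partitions S) = tm a x ?Q"
  proof (rule crc_monoid.sum_map_single)
    show "finite (partitions S)" using finitely_many_partition_on[OF c(2)] .
    show "?Q \<in> partitions S" using Q by simp
    show "tm a x ?Q \<in> Hom C Z (mobj K)" by (rule tm_type[OF c Q])
    fix P assume P: "P \<in> partitions S" "P \<noteq> ?Q"
    then obtain B where B: "B \<in> P" "card B \<ge> 2" using partition_on_ex_card_ge2[of S P] c by auto
    have "B \<subseteq> S" "finite B"
      using partition_on_block[of S P B] partition_on_finite_block[of S P B] P B c(2) by auto
    then have "E f B a x = \<rho> (x \<cdot> fseq f 0) \<cdot> zero_map C N Z"
      unfolding E_def using linD[OF l f, of Z "image_mset a (mset_set B)" x] B(2) coh_mono[OF c(1) image_mono[of B S a]]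
      by simp
    \<comment> \<open>The family is updated at \<open>B\<close> with the value that it already has
      there, which brings the term into the form of \<open>E_update_rzero\<close>.\<close>
    then have e: "(\<lambda>B. E f B a x) = (\<lambda>B. E f B a x)(B := \<rho> (x \<cdot> fseq f 0) \<cdot> zero_map C N Z)" by auto
    have b: "coh Z (mobj N) Y ((\<lambda>B. E f B a x) ` P) (x \<cdot> fseq f 0)" "finite P"
      using coh_block[OF c(1,2)] P by auto
    have "tm a x P = \<rho> ((x \<cdot> fseq f 0) \<cdot> fseq g 0) \<cdot> zero_map C K Z"
      by (subst e, rule E_update_rzero[OF g b(2) B(1)]) (rule coh_mono[OF b(1)], auto)
    then show "tm a x P = \<rho> (tm a x ?Q) \<cdot> zero_map C K Z"
      unfolding tm_type(2)[OF c Q] using x by simp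
  qed simp
  also have "tm a x ?Q = E g S (\<lambda>i. ev f {#a i#} x) (x \<cdot> fseq f 0)"
    by (subst E_reindex) (simp_all add: E_singleton)
  finally show ?thesis unfolding E_Comp[OF c] cs_K .
qed

lemma ev_Comp_lin_right:
  assumes l: "lin g" and c: "coh Z (mobj M) X (set_mset m) x" "m \<noteq> {#}"
  shows "ev fg m x = ev g {#ev f m x#} (x \<cdot> fseq f 0)"
proof -
  obtain n and as :: "'b list" where m: "m = image_mset (nth as) (mset_set {..<n})" using ev_indexed by metis
  show ?thesis using E_Comp_lin_right[OF l, of Z "nth as" "{..<n}" x] c
    by (auto simp: m E_def mset_set_empty_iff)
qed

lemma ev_Comp_lin_left:
  assumes l: "lin f" and c: "coh Z (mobj M) X (set_mset m) x" "m \<noteq> {#}"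
  shows "ev fg m x = ev g (image_mset (\<lambda>a. ev f {#a#} x) m) (x \<cdot> fseq f 0)"
proof -
  obtain n and as :: "'b list" where m: "m = image_mset (nth as) (mset_set {..<n})" using ev_indexed by metis
  show ?thesis using E_Comp_lin_left[OF l, of Z "nth as" "{..<n}" x] c
    by (auto simp: m E_def mset_set_empty_iff image_mset.compositionality comp_def)
qed

text \<open>Since \<open>g\<close> is linear, only the one-block term counts; its argument is a zero
  value of \<open>f\<close>, which additivity of \<open>g\<close> sends to zero.\<close>

lemma lin_Comp:
  assumes "lin f" "lin g" shows "lin fg"
  unfolding lin_def
proof (intro allI impI)
  fix M' X' K' V' Z m x
  assume h: "fg \<in> FH M' X' K' V'" and c: "coh Z (mobj M') X' (set_mset m) x" and m: "size m \<ge> 2"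
  have e: "M' = M" "X' = X" "K' = K" "V' = V"
    using FH_D(5,6)[OF h] FH_D(5,6)[OF Comp_FH] by auto
  note c = c[unfolded e]
  have x: "x \<in> Ar C" "Dom C x = Z" "Cod C x = X" using cohD(1)[OF c] by (auto simp: Hom_iff)
  have ne: "m \<noteq> {#}" using m by auto
  have y: "coh Z (mobj N) Y {} (x \<cdot> fseq f 0)" using x by (simp add: coh_def Hom_iff)
  have "ev fg m x = ev g {#ev f m x#} (x \<cdot> fseq f 0)" by (rule ev_Comp_lin_right[OF assms(2) c ne])
  also have "ev f m x = \<rho> (x \<cdot> fseq f 0) \<cdot> zero_map C N Z" by (rule linD[OF assms(1) f c m])
  also have "ev g {#\<dots>#} (x \<cdot> fseq f 0) = \<rho> ((x \<cdot> fseq f 0) \<cdot> fseq g 0) \<cdot> zero_map C K Z"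
    by (rule ev_rzero[OF g]) (use y in simp)
  finally show "ev fg m x = \<rho> (x \<cdot> fseq fg 0) \<cdot> zero_map C K' Z"
    using x e by (simp add: Comp_simps)
qed

end

section \<open>Pairing, identities and linear maps\<close>

context cartesian_restriction_category
begin

lemma Comp_FH: "f \<in> FH M X N Y \<Longrightarrow> g \<in> FH N Y K V \<Longrightarrow> faa_Comp C f g \<in> FH M X K V"
  using faa_pair.Comp_FH[of C f g M X N Y K V]
  by (simp add: faa_pair_def faa_pair_axioms_def cartesian_restriction_category_axioms)

lemma faa_pairI: "f \<in> FH M X N Y \<Longrightarrow> g \<in> FH N Y K V \<Longrightarrow> faa_pair C f g M X N Y K V"
  by (simp add: faa_pair_def faa_pair_axioms_def cartesian_restriction_category_axioms)

lemma fseq_Comp_0 [simp]: "fseq (faa_Comp C f g) 0 = fseq f 0 \<cdot> fseq g 0"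
  by (simp add: faa_Comp_def)

lemma app_Pair:
  assumes f: "f \<in> FH M X N Y" and g: "g \<in> FH M X K V" and c: "coh Z (mobj M) X (set as) x" "as \<noteq> []"
  shows "app C (fseq (faa_Pair C f g) (length as)) as x = \<langle>ev f (mset as) x, ev g (mset as) x\<rangle>"
proof -
  have n: "length as \<ge> 1" using c(2) by (simp add: Suc_le_eq)
  show ?thesis using coh_tup[OF c(1)] FH_D(8)[OF f n] FH_D(8)[OF g n]
    by (simp add: ev_mset[OF f c(1)] ev_mset[OF g c(1)] app_tup faa_Pair_def Hom_iff)
qed

lemma Pair_rzero:
  assumes "e \<in> Ar C" "d \<in> Ar C" "Dom C e = Dom C d" "a \<in> Ar C" "b \<in> Ar C" "Dom C a = Dom C d" "Dom C b = Dom C d"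
  shows "\<langle>\<rho> e \<cdot> a, \<rho> d \<cdot> b\<rangle> = (\<rho> e \<cdot> \<rho> d) \<cdot> \<langle>a, b\<rangle>"
proof -
  have "\<langle>\<rho> e \<cdot> a, \<rho> d \<cdot> b\<rangle> = \<rho> e \<cdot> \<langle>a, \<rho> d \<cdot> b\<rangle>"
    using assms by (intro Pair_Rst_left) simp_all
  also have "\<langle>a, \<rho> d \<cdot> b\<rangle> = \<rho> d \<cdot> \<langle>a, b\<rangle>"
    using assms by (intro Pair_Rst_right) simp_all
  also have "\<rho> e \<cdot> (\<rho> d \<cdot> \<langle>a, b\<rangle>) = (\<rho> e \<cdot> \<rho> d) \<cdot> \<langle>a, b\<rangle>"
    using assms by (intro assoc[symmetric]) simp_all
  finally show ?thesis .
qed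

lemma Pair_FH:
  assumes f: "f \<in> FH M X N Y" and g: "g \<in> FH M X K V"
  shows "faa_Pair C f g \<in> FH M X (prod_monoid C N K) (Y \<^bold>\<times> V)"
proof (rule FH_I)
  note cm = FH_D(1,2)[OF f] FH_D(2)[OF g] and ob = FH_D(3,4)[OF f] FH_D(4)[OF g]
  let ?h = "faa_Pair C f g"
  show "cm M" "cm (prod_monoid C N K)" "X \<in> Ob C" "Y \<^bold>\<times> V \<in> Ob C" using cm ob by simp_all
  show "fsrc ?h = (M, X)" "ftgt ?h = (prod_monoid C N K, Y \<^bold>\<times> V)"
    using FH_D(5,6)[OF f] FH_D(6)[OF g] by (simp_all add: faa_Pair_def faa_Prd_def)
  show "fseq ?h 0 \<in> Hom C X (Y \<^bold>\<times> V)" using FH_D(7)[OF f] FH_D(7)[OF g] by (simp add: faa_Pair_def Hom_iff)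
  fix n :: nat assume n: "1 \<le> n"
  show "fseq ?h n \<in> Hom C (pow_times C (mobj M) n X) (mobj (prod_monoid C N K))"
    using FH_D(8)[OF f n] FH_D(8)[OF g n] by (simp add: faa_Pair_def Hom_iff)
  show "\<rho> (fseq ?h n) = \<rho> (pow_proj C (mobj M) X n n \<cdot> fseq ?h 0)"
    using FH_D(8)[OF f n] FH_D(8)[OF g n] FH_D(9)[OF f n] FH_D(9)[OF g n] FH_D(7)[OF f] FH_D(7)[OF g] cm ob
    by (simp add: faa_Pair_def Hom_iff)
next
  fix Z as bs x assume c: "coh Z (mobj M) X (set as) x" "as \<noteq> []" "mset bs = mset as"
  then have l: "length bs = length as" "set bs = set as" using mset_eq_length mset_eq_setD by metis+
  then have b: "bs \<noteq> []" using c by auto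
  show "app C (fseq (faa_Pair C f g) (length as)) bs x = app C (fseq (faa_Pair C f g) (length as)) as x"
    using app_Pair[OF f g c(1,2)] app_Pair[OF f g _ b, of Z x] l c by simp
next
  note cm = FH_D(1,2)[OF f] FH_D(2)[OF g]
  fix Z a b as x assume c: "coh Z (mobj M) X (insert a (insert b (set as))) x"
  then have ab: "a \<in> Hom C Z (mobj M)" "b \<in> Hom C Z (mobj M)" "\<rho> a = \<rho> x" "\<rho> b = \<rho> x"
    "coh Z (mobj M) X (set as) x" by (auto simp: coh_insert)
  note x = cohD(1)[OF c]
  have cc: "coh Z (mobj M) X (set (plus_map C M a b # as)) x" "coh Z (mobj M) X (set (a # as)) x" "coh Z (mobj M) X (set (b # as)) x"
    using ab x cm by (auto simp: coh_insert Hom_iff)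
  note H = ev_Hom[OF f cc(2)[folded set_mset_mset]] ev_Hom[OF g cc(2)[folded set_mset_mset]]
    ev_Hom[OF f cc(3)[folded set_mset_mset]] ev_Hom[OF g cc(3)[folded set_mset_mset]]
  have "coh Z (mobj M) X (insert a (insert b (set_mset (mset as)))) x" using c by simp
  note p = ev_plus[OF f this] ev_plus[OF g this]
  show "app C (fseq (faa_Pair C f g) (Suc (length as))) (plus_map C M a b # as) x = plus_map C (prod_monoid C N K)
    (app C (fseq (faa_Pair C f g) (Suc (length as))) (a # as) x) (app C (fseq (faa_Pair C f g) (Suc (length as))) (b # as) x)"
    using app_Pair[OF f g cc(1)] app_Pair[OF f g cc(2)] app_Pair[OF f g cc(3)] H cm
    by (simp add: p plus_map_prod_Pair Hom_iff)
next
  note cm = FH_D(1,2)[OF f] FH_D(2)[OF g]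
  fix Z as x assume c: "coh Z (mobj M) X (set as) x"
  let ?z = "\<rho> x \<cdot> zero_map C M Z"
  note x = cohD(1,4)[OF c]
  have cz: "coh Z (mobj M) X (set (?z # as)) x" using c x cm by (auto simp: coh_insert Hom_iff)
  have "coh Z (mobj M) X (set_mset (mset as)) x" using c by simp
  note p = ev_rzero[OF f this] ev_rzero[OF g this]
  show "app C (fseq (faa_Pair C f g) (Suc (length as))) (?z # as) x = \<rho> (x \<cdot> fseq (faa_Pair C f g) 0) \<cdot> zero_map C (prod_monoid C N K) Z"
    using app_Pair[OF f g cz] x cm FH_D(7)[OF f] FH_D(7)[OF g]
    by (simp add: p Pair_rzero faa_Pair_def Hom_iff del: Comp_Pair) (simp add: faa_Pair_def)
qed

lemma fseq_Pair_0 [simp]: "fseq (faa_Pair C f g) n = \<langle>fseq f n, fseq g n\<rangle>"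
  by (simp add: faa_Pair_def)

lemma ev_Pair:
  assumes f: "f \<in> FH M X N Y" and g: "g \<in> FH M X K V" and c: "coh Z (mobj M) X (set_mset m) x" "m \<noteq> {#}"
  shows "ev (faa_Pair C f g) m x = \<langle>ev f m x, ev g m x\<rangle>"
proof -
  obtain as where as: "m = mset as" using ex_mset by metis
  then have c': "coh Z (mobj M) X (set as) x" "as \<noteq> []" using c by auto
  show ?thesis using ev_mset[OF Pair_FH[OF f g] c'(1)] app_Pair[OF f g c'] as by simp
qed

lemma lin_Pair:
  assumes f: "f \<in> FH M X N Y" and g: "g \<in> FH M X K V" and l: "lin f" "lin g"
  shows "lin (faa_Pair C f g)"
  unfolding lin_def
proof (intro allI impI)
  fix M' X' K' V' Z m x
  assume h: "faa_Pair C f g \<in> FH M' X' K' V'" and c: "coh Z (mobj M') X' (set_mset m) x" and m: "size m \<ge> 2"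
  have e: "M' = M" "X' = X" "K' = prod_monoid C N K"
    using FH_D(5,6)[OF h] FH_D(5,6)[OF Pair_FH[OF f g]] by auto
  note c = c[unfolded e]
  note x = cohD(1,4)[OF c] and cm = FH_D(1,2)[OF f] FH_D(2)[OF g]
  have ne: "m \<noteq> {#}" using m by auto
  show "ev (faa_Pair C f g) m x = \<rho> (x \<cdot> fseq (faa_Pair C f g) 0) \<cdot> zero_map C K' Z"
    using x cm FH_D(7)[OF f] FH_D(7)[OF g]
    by (simp add: ev_Pair[OF f g c ne] linD[OF l(1) f c m] linD[OF l(2) g c m] e Pair_rzero Hom_iff del: Comp_Pair)
      simp
qed

text \<open>Total homomorphisms of the monoids, with the laws expressed at partial arguments. Such a
  map \<open>k\<close> provides the component \<open>f\<^sub>1 = \<pi>\<^sub>0 k\<close> of a linear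
  map.\<close>

definition addhom :: "('o, 'm) imonoid \<Rightarrow> ('o, 'm) imonoid \<Rightarrow> 'm \<Rightarrow> bool" where
  "addhom M N k \<longleftrightarrow> k \<in> Hom C (mobj M) (mobj N) \<and> \<rho> k = Idn C (mobj M) \<and>
    (\<forall>Z a b. a \<in> Hom C Z (mobj M) \<longrightarrow> b \<in> Hom C Z (mobj M) \<longrightarrow>
       plus_map C M a b \<cdot> k = plus_map C N (a \<cdot> k) (b \<cdot> k)) \<and>
    (\<forall>Z \<in> Ob C. zero_map C M Z \<cdot> k = zero_map C N Z)"

abbreviation flin :: "('o, 'm) imonoid \<Rightarrow> 'o \<Rightarrow> ('o, 'm) imonoid \<Rightarrow> 'o \<Rightarrow> 'm \<Rightarrow> 'm \<Rightarrow> ('o, 'm) faa_ar" where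
  "flin M X N Y u k \<equiv> faa_linear C (M, X) (N, Y) u (Pr0 C (mobj M) X \<cdot> k)"

text \<open>At one argument the map acts by composition with \<open>k\<close>, from two arguments on
  its values are restricted zeros. Additivity thus reduces to that of \<open>k\<close>, and a
  permutation of two or more arguments concerns only zeros. Identities, projections, addition and
  zero are instances.\<close>

lemma flin:
  assumes M: "cm M" "cm N" "X \<in> Ob C" "Y \<in> Ob C" and u: "u \<in> Hom C X Y" "\<rho> u = Idn C X" and k: "addhom M N k"
  shows flin_FH: "flin M X N Y u k \<in> FH M X N Y"
    and lin_flin: "lin (flin M X N Y u k)"
    and ev_flin: "coh Z (mobj M) X {a} x \<Longrightarrow> ev (flin M X N Y u k) {#a#} x = a \<cdot> k"
    and flin_0: "fseq (flin M X N Y u k) 0 = u"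
proof -
  let ?f = "flin M X N Y u k"
  have k': "k \<in> Ar C" "Dom C k = mobj M" "Cod C k = mobj N" "\<rho> k = Idn C (mobj M)"
    using k by (auto simp: addhom_def Hom_iff)
  have u': "u \<in> Ar C" "Dom C u = X" "Cod C u = Y" using u by (auto simp: Hom_iff)
  show f0: "fseq ?f 0 = u" by (simp add: faa_linear_def)
  have f1: "fseq ?f (Suc 0) = Pr0 C (mobj M) X \<cdot> k" by (simp add: faa_linear_def)
  have f2: "fseq ?f n = zero_map C N (pow_times C (mobj M) n X)" if "n \<ge> 2" for n
    using that by (simp add: faa_linear_def)
  have a1: "app C (fseq ?f (Suc 0)) [a] x = a \<cdot> k" if c: "coh Z (mobj M) X (set [a]) x" for Z a x
  proof -
    have a: "a \<in> Ar C" "Dom C a = Z" "Cod C a = mobj M" "x \<in> Ar C" "Dom C x = Z" "Cod C x = X"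
      "\<rho> x = \<rho> a"
      using c by (auto simp: coh_insert Hom_iff dest: cohD(1))
    show ?thesis using a k' by (simp add: app_tup f1)
  qed
  have a2: "app C (fseq ?f (length as)) as x = \<rho> x \<cdot> zero_map C N Z"
    if c: "coh Z (mobj M) X (set as) x" and n: "length as \<ge> 2" for Z as x
    using crc_monoid.Comp_zero_map[OF M(2), of "tup as x" "pow_times C (mobj M) (length as) X"] coh_tup[OF c]
    by (simp add: app_tup f2[OF n] Hom_iff)
  show FH: "?f \<in> FH M X N Y"
  proof (rule FH_I)
    show "fsrc ?f = (M, X)" "ftgt ?f = (N, Y)" by (simp_all add: faa_linear_def)
    show "fseq ?f 0 \<in> Hom C X Y" using u f0 by simp
    fix n :: nat assume n: "1 \<le> n"
    consider "n = 1" | "n \<ge> 2" using n by linarith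
    then show "fseq ?f n \<in> Hom C (pow_times C (mobj M) n X) (mobj N)"
      "\<rho> (fseq ?f n) = \<rho> (pow_proj C (mobj M) X n n \<cdot> fseq ?f 0)"
      unfolding f0
      by (cases; use f1 f2 M k' u u' in \<open>simp add: Hom_iff\<close>)+
  next
    fix Z as bs x assume c: "coh Z (mobj M) X (set as) x" "as \<noteq> []" "mset bs = mset as"
    then have l: "length bs = length as" "set bs = set as" using mset_eq_length mset_eq_setD by metis+
    show "app C (fseq ?f (length as)) bs x = app C (fseq ?f (length as)) as x"
    proof (cases "length as \<ge> 2")
      case True
      then show ?thesis using a2[OF c(1)] a2[of Z bs x] c l by simp
    next
      case False
      then obtain a where "as = [a]" using c(2) by (cases as; cases "tl as") auto
      then have "bs = as" using c(3) by simp
      then show ?thesis by simp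
    qed
  next
    fix Z a b as x assume c: "coh Z (mobj M) X (insert a (insert b (set as))) x"
    then have ab: "a \<in> Hom C Z (mobj M)" "b \<in> Hom C Z (mobj M)" "\<rho> a = \<rho> x" "\<rho> b = \<rho> x"
      "coh Z (mobj M) X (set as) x" by (auto simp: coh_insert)
    note x = cohD(1,4)[OF c]
    have cc: "coh Z (mobj M) X (set (plus_map C M a b # as)) x" "coh Z (mobj M) X (set (a # as)) x" "coh Z (mobj M) X (set (b # as)) x"
      using ab x M by (auto simp: coh_insert Hom_iff)
    show "app C (fseq ?f (Suc (length as))) (plus_map C M a b # as) x = plus_map C N
      (app C (fseq ?f (Suc (length as))) (a # as) x) (app C (fseq ?f (Suc (length as))) (b # as) x)"
    proof (cases "as = []")
      case True
      then show ?thesis using a1 cc k ab by (simp add: addhom_def)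
    next
      case False
      then have n: "length (d # as) \<ge> 2" for d by (cases as) auto
      then show ?thesis using a2[OF cc(1) n] a2[OF cc(2) n] a2[OF cc(3) n] x M by (simp add: Hom_iff)
    qed
  next
    fix Z as x assume c: "coh Z (mobj M) X (set as) x"
    let ?z = "\<rho> x \<cdot> zero_map C M Z"
    note x = cohD(1,4)[OF c]
    have cz: "coh Z (mobj M) X (set (?z # as)) x" using c x M by (auto simp: coh_insert Hom_iff)
    show "app C (fseq ?f (Suc (length as))) (?z # as) x = \<rho> (x \<cdot> fseq ?f 0) \<cdot> zero_map C N Z"
    proof (cases "as = []")
      case True
      have "zero_map C M Z \<cdot> k = zero_map C N Z" using k x by (simp add: addhom_def)
      then show ?thesis using True a1[of Z ?z x] cz x M k' u u' f0 by (simp add: Hom_iff)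
    next
      case False
      then have n: "length (d # as) \<ge> 2" for d by (cases as) auto
      then show ?thesis using a2[OF cz n] x M u u' f0 by (simp add: Hom_iff)
    qed
  qed (use M in simp_all)
  show "ev ?f {#a#} x = a \<cdot> k" if c: "coh Z (mobj M) X {a} x"
    using ev_mset[OF FH, of Z "[a]" x] a1[of Z a x] c by simp
  show "lin ?f" unfolding lin_def
  proof (intro allI impI)
    fix M' X' N' Y' Z m x
    assume h: "?f \<in> FH M' X' N' Y'" and c: "coh Z (mobj M') X' (set_mset m) x" and m: "size m \<ge> 2"
    have e: "M' = M" "X' = X" "N' = N"
      using FH_D(5,6)[OF h] FH_D(5,6)[OF FH] by auto
    note c = c[unfolded e]
    obtain as where as: "m = mset as" using ex_mset by metis
    show "ev ?f m x = \<rho> (x \<cdot> fseq ?f 0) \<cdot> zero_map C N' Z"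
      using ev_mset[OF FH, of Z as x] a2[of Z as x] c m u u' cohD(1)[OF c] by (simp add: as e f0 Hom_iff)
  qed
qed

lemma addhom_Idn: "cm M \<Longrightarrow> addhom M M (Idn C (mobj M))"
  unfolding addhom_def by (auto simp: Hom_iff)

lemma Pair_Comp_Pr_same:
  assumes "u \<in> Hom C Z A" "w \<in> Hom C Z B" "\<rho> u = \<rho> w"
  shows "\<langle>u, w\<rangle> \<cdot> Pr0 C A B = u" "\<langle>u, w\<rangle> \<cdot> Pr1 C A B = w"
proof -
  have "\<rho> w \<cdot> u = u" "\<rho> u \<cdot> w = w"
    using assms Rst_Comp_self[of u] Rst_Comp_self[of w] by (simp_all add: Hom_iff)
  then show "\<langle>u, w\<rangle> \<cdot> Pr0 C A B = u" "\<langle>u, w\<rangle> \<cdot> Pr1 C A B = w"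
    using assms by (simp_all add: Hom_iff)
qed

lemma plus_map_prod_Pr:
  assumes "cm M" "cm N" "a \<in> Hom C Z (mobj M \<^bold>\<times> mobj N)" "b \<in> Hom C Z (mobj M \<^bold>\<times> mobj N)"
  shows "plus_map C (prod_monoid C M N) a b \<cdot> Pr0 C (mobj M) (mobj N)
      = plus_map C M (a \<cdot> Pr0 C (mobj M) (mobj N)) (b \<cdot> Pr0 C (mobj M) (mobj N))"
    "plus_map C (prod_monoid C M N) a b \<cdot> Pr1 C (mobj M) (mobj N)
      = plus_map C N (a \<cdot> Pr1 C (mobj M) (mobj N)) (b \<cdot> Pr1 C (mobj M) (mobj N))"
  using assms
  by (simp_all add: plus_map_prod Hom_iff del: Pair_Comp_Pr0 Pair_Comp_Pr1)
    (rule Pair_Comp_Pr_same[of _ Z]; simp add: Hom_iff)+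

lemma addhom_Pr0: "cm M \<Longrightarrow> cm N \<Longrightarrow> addhom (prod_monoid C M N) M (Pr0 C (mobj M) (mobj N))"
  and addhom_Pr1: "cm M \<Longrightarrow> cm N \<Longrightarrow> addhom (prod_monoid C M N) N (Pr1 C (mobj M) (mobj N))"
  unfolding addhom_def by (auto simp: plus_map_prod_Pr) (auto simp: Hom_iff)

context
  fixes M X
  assumes M: "cm M" and X: "X \<in> Ob C"
begin

lemma faa_Id_flin: "faa_Id C (M, X) = flin M X M X (Idn C X) (Idn C (mobj M))"
  using M X by (simp add: faa_Id_def)

lemmas Id_flin = M M X X Id_Hom[OF X] Rst_Idn[OF X] addhom_Idn[OF M]

lemma Id_FH: "faa_Id C (M, X) \<in> FH M X M X"
  unfolding faa_Id_flin by (rule flin_FH[OF Id_flin])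

lemma lin_Id: "lin (faa_Id C (M, X))"
  unfolding faa_Id_flin by (rule lin_flin[OF Id_flin])

lemma ev_Id: "coh Z (mobj M) X {a} x \<Longrightarrow> ev (faa_Id C (M, X)) {#a#} x = a"
  unfolding faa_Id_flin using ev_flin[OF Id_flin] by (auto simp: coh_insert Hom_iff)

end

lemma fseq_Id_0 [simp]: "fseq (faa_Id C (M, X)) 0 = Idn C X"
  by (simp add: faa_Id_def faa_linear_def)

context
  fixes M X N Y
  assumes M: "cm M" and X: "X \<in> Ob C" and N: "cm N" and Y: "Y \<in> Ob C"
begin

lemma faa_Pr_flin:
  "faa_Pr0 C (M, X) (N, Y) = flin (prod_monoid C M N) (X \<^bold>\<times> Y) M X (Pr0 C X Y) (Pr0 C (mobj M) (mobj N))"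
  "faa_Pr1 C (M, X) (N, Y) = flin (prod_monoid C M N) (X \<^bold>\<times> Y) N Y (Pr1 C X Y) (Pr1 C (mobj M) (mobj N))"
  by (simp_all add: faa_Pr0_def faa_Pr1_def faa_Prd_def Let_def)

lemmas Pr0_flin = cm_prod[OF M N] M Prd_Ob[OF X Y] X Pr0_Hom[OF X Y] Pr0_type(4)[OF X Y] addhom_Pr0[OF M N]
lemmas Pr1_flin = cm_prod[OF M N] N Prd_Ob[OF X Y] Y Pr1_Hom[OF X Y] Pr1_type(4)[OF X Y] addhom_Pr1[OF M N]

lemma fPr0_FH: "faa_Pr0 C (M, X) (N, Y) \<in> FH (prod_monoid C M N) (X \<^bold>\<times> Y) M X"
  and fPr1_FH: "faa_Pr1 C (M, X) (N, Y) \<in> FH (prod_monoid C M N) (X \<^bold>\<times> Y) N Y"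
  unfolding faa_Pr_flin by (rule flin_FH[OF Pr0_flin] flin_FH[OF Pr1_flin])+

lemma lin_fPr0: "lin (faa_Pr0 C (M, X) (N, Y))"
  and lin_fPr1: "lin (faa_Pr1 C (M, X) (N, Y))"
  unfolding faa_Pr_flin by (rule lin_flin[OF Pr0_flin] lin_flin[OF Pr1_flin])+

lemma ev_fPr0: "coh Z (mobj M \<^bold>\<times> mobj N) (X \<^bold>\<times> Y) {a} x \<Longrightarrow>
    ev (faa_Pr0 C (M, X) (N, Y)) {#a#} x = a \<cdot> Pr0 C (mobj M) (mobj N)"
  and ev_fPr1: "coh Z (mobj M \<^bold>\<times> mobj N) (X \<^bold>\<times> Y) {a} x \<Longrightarrow>
    ev (faa_Pr1 C (M, X) (N, Y)) {#a#} x = a \<cdot> Pr1 C (mobj M) (mobj N)"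
  unfolding faa_Pr_flin using ev_flin[OF Pr0_flin] ev_flin[OF Pr1_flin] by simp_all

end

lemma fseq_fPr_0 [simp]: "fseq (faa_Pr0 C (M, X) (N, Y)) 0 = Pr0 C X Y" "fseq (faa_Pr1 C (M, X) (N, Y)) 0 = Pr1 C X Y"
  by (simp_all add: faa_Pr0_def faa_Pr1_def faa_linear_def Let_def)

end

section \<open>The derivative\<close>

locale faa_map = cartesian_restriction_category C for C :: "('o, 'm) crc" (structure) +
  fixes f M X N Y
  assumes f: "f \<in> FH M X N Y"
begin

lemma cM [simp]: "cm M" and cN [simp]: "cm N" and ob [simp]: "X \<in> Ob C" "Y \<in> Ob C"
  using FH_D(1-4)[OF f] by auto

lemma f0 [simp]: "fseq f 0 \<in> Ar C" "Dom C (fseq f 0) = X" "Cod C (fseq f 0) = Y"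
  using FH_D(7)[OF f] by (auto simp: Hom_iff)

text \<open>The formula for \<open>([\<delta>(f)]\<^sub>1)\<^sub>r\<close> over an arbitrary finite
  index set, with the variables as parameters. For empty \<open>S\<close> the sum is the total zero
  map and the value is \<open>f\<^sub>1(a, x)\<close>, so the formula also covers the component at
  index 0 of the derivative.\<close>

definition ds :: "'o \<Rightarrow> 'i set \<Rightarrow> ('i \<Rightarrow> 'm) \<Rightarrow> ('i \<Rightarrow> 'm) \<Rightarrow> 'm \<Rightarrow> 'm \<Rightarrow> 'm" where
  "ds Z S v w a x = plus_map C N (ev f (add_mset a (image_mset w (mset_set S))) x)
     (sum_map C N Z (\<lambda>j. E f S (w(j := v j)) x) S)"

lemma ds_summands:
  assumes c: "coh Z (mobj M) X (insert a (v ` S \<union> w ` S)) x" "finite S"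
  shows "ev f (add_mset a (image_mset w (mset_set S))) x \<in> Hom C Z (mobj N)"
    "\<rho> (ev f (add_mset a (image_mset w (mset_set S))) x) = \<rho> (x \<cdot> fseq f 0)"
    "j \<in> S \<Longrightarrow> E f S (w(j := v j)) x \<in> Hom C Z (mobj N)"
    "j \<in> S \<Longrightarrow> \<rho> (E f S (w(j := v j)) x) = \<rho> (x \<cdot> fseq f 0)"
proof -
  have 1: "coh Z (mobj M) X (set_mset (add_mset a (image_mset w (mset_set S)))) x"
    using c(2) by (intro coh_mono[OF c(1)]) auto
  then show "ev f (add_mset a (image_mset w (mset_set S))) x \<in> Hom C Z (mobj N)"
    by (rule ev_Hom[OF f]) simp
  show "\<rho> (ev f (add_mset a (image_mset w (mset_set S))) x) = \<rho> (x \<cdot> fseq f 0)"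
    using 1 by (rule ev_Rst[OF f])
  assume j: "j \<in> S"
  have 2: "coh Z (mobj M) X ((w(j := v j)) ` S) x" using j by (intro coh_mono[OF c(1)]) auto
  show "E f S (w(j := v j)) x \<in> Hom C Z (mobj N)" using j by (intro E_Hom[OF f 2 c(2)]) auto
  show "\<rho> (E f S (w(j := v j)) x) = \<rho> (x \<cdot> fseq f 0)" using E_Rst[OF f 2 c(2)] .
qed

lemma ds_sum:
  assumes c: "coh Z (mobj M) X (insert a (v ` S \<union> w ` S)) x" "finite S"
  shows "sum_map C N Z (\<lambda>j. E f S (w(j := v j)) x) S \<in> Hom C Z (mobj N)"
    "S \<noteq> {} \<Longrightarrow> \<rho> (sum_map C N Z (\<lambda>j. E f S (w(j := v j)) x) S) = \<rho> (x \<cdot> fseq f 0)"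
proof -
  note s = ds_summands(3,4)[OF c] and x = cohD(1,4)[OF c(1)]
  show "sum_map C N Z (\<lambda>j. E f S (w(j := v j)) x) S \<in> Hom C Z (mobj N)"
    using s x by (intro crc_monoid.sum_map_Hom) auto
  show "\<rho> (sum_map C N Z (\<lambda>j. E f S (w(j := v j)) x) S) = \<rho> (x \<cdot> fseq f 0)" if "S \<noteq> {}"
    using s x c(2) that by (intro crc_monoid.Rst_sum_map) (auto simp: Hom_iff[of x])
qed

lemma ds_type:
  assumes c: "coh Z (mobj M) X (insert a (v ` S \<union> w ` S)) x" "finite S"
  shows "ds Z S v w a x \<in> Hom C Z (mobj N)" "\<rho> (ds Z S v w a x) = \<rho> (x \<cdot> fseq f 0)"
proof -
  note 1 = ds_summands(1,2)[OF c] ds_sum[OF c]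
  note x = cohD(1,4)[OF c(1)]
  show "ds Z S v w a x \<in> Hom C Z (mobj N)" using 1 by (simp add: ds_def Hom_iff)
  show "\<rho> (ds Z S v w a x) = \<rho> (x \<cdot> fseq f 0)"
  proof (cases "S = {}")
    case True
    then show ?thesis using 1 x by (simp add: ds_def Hom_iff)
  next
    case False
    then show ?thesis using 1 x by (simp add: ds_def Hom_iff)
  qed
qed

lemma ds_cong:
  assumes c: "coh Z (mobj M) X (insert a (v ` S \<union> w ` S)) x" "finite S"
    and e: "\<And>i. i \<in> S \<Longrightarrow> v i = v' i" "\<And>i. i \<in> S \<Longrightarrow> w i = w' i"
  shows "ds Z S v w a x = ds Z S v' w' a x"
proof -
  have 1: "image_mset w (mset_set S) = image_mset w' (mset_set S)"
    using c(2) e by (intro image_mset_cong) auto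
  have t: "E f S (w(j := v j)) x = E f S (w'(j := v' j)) x" if "j \<in> S" for j
    using e that by (intro E_cong) auto
  have "sum_map C N Z (\<lambda>j. E f S (w(j := v j)) x) S = sum_map C N Z (\<lambda>j. E f S (w'(j := v' j)) x) S"
    using t ds_summands(3)[OF c] cohD(4)[OF c(1)] by (intro crc_monoid.sum_map_cong) auto
  then show ?thesis unfolding ds_def 1 by simp
qed

lemma ds_reindex:
  assumes h: "inj_on h S" and c: "coh Z (mobj M) X (insert a (v ` h ` S \<union> w ` h ` S)) x" "finite S"
  shows "ds Z (h ` S) v w a x = ds Z S (\<lambda>i. v (h i)) (\<lambda>i. w (h i)) a x"
proof -
  have 1: "image_mset w (mset_set (h ` S)) = image_mset (\<lambda>i. w (h i)) (mset_set S)"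
    by (simp add: image_mset_mset_set[OF h, symmetric] image_mset.compositionality comp_def)
  have t: "E f (h ` S) (w(h j := v (h j))) x = E f S ((\<lambda>i. w (h i))(j := v (h j))) x" if "j \<in> S" for j
    unfolding E_reindex[OF h] using h that by (intro E_cong) (auto simp: inj_on_def)
  have "sum_map C N Z (\<lambda>j. E f (h ` S) (w(j := v j)) x) (h ` S) = sum_map C N Z (\<lambda>j. E f (h ` S) (w(h j := v (h j))) x) S"
    using ds_summands(3)[OF c(1)] c(2) cohD(4)[OF c(1)]
    by (intro crc_monoid.sum_map_reindex[OF _ _ h]) auto
  also have "\<dots> = sum_map C N Z (\<lambda>j. E f S ((\<lambda>i. w (h i))(j := v (h j))) x) S"
    using t ds_summands(3)[OF c(1)] c(2) cohD(4)[OF c(1)] by (intro crc_monoid.sum_map_cong) (auto simp flip: t)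
  finally show ?thesis unfolding ds_def 1 by simp
qed

lemma Comp_ds:
  assumes c: "coh Z (mobj M) X (insert a (v ` S \<union> w ` S)) x" "finite S"
    and z: "z \<in> Hom C W Z" "\<rho> (z \<cdot> x) = \<rho> z"
  shows "z \<cdot> ds Z S v w a x = ds W S (\<lambda>i. z \<cdot> v i) (\<lambda>i. z \<cdot> w i) (z \<cdot> a) (z \<cdot> x)"
proof -
  have z': "z \<in> Ar C" "Dom C z = W" "Cod C z = Z" using z by (auto simp: Hom_iff)
  have W: "W \<in> Ob C" "Z \<in> Ob C" using z' Dom_Ob Cod_Ob by auto
  let ?m = "add_mset a (image_mset w (mset_set S))"
  let ?m' = "add_mset (z \<cdot> a) (image_mset (\<lambda>i. z \<cdot> w i) (mset_set S))"
  let ?t = "\<lambda>j. E f S (w(j := v j)) x" and ?t' = "\<lambda>j. E f S ((\<lambda>i. z \<cdot> w i)(j := z \<cdot> v j)) (z \<cdot> x)"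
  note s = ds_summands[OF c] and ss = ds_sum(1)[OF c]
  have c': "coh W (mobj M) X (insert (z \<cdot> a) ((\<lambda>i. z \<cdot> v i) ` S \<union> (\<lambda>i. z \<cdot> w i) ` S)) (z \<cdot> x)"
    using Comp_coh[OF c(1) z(1)] by (simp add: image_Un image_image)
  note s' = ds_summands[OF c' c(2)]
  have 1: "z \<cdot> ev f ?m x = ev f ?m' (z \<cdot> x)"
    using Comp_ev[OF f _ z(1), of ?m x] c by (simp add: image_mset.compositionality comp_def)
      (metis (no_types, lifting) Un_upper2 coh_mono insert_mono)
  have t: "z \<cdot> ?t j = ?t' j" if j: "j \<in> S" for j
  proof -
    have "coh Z (mobj M) X ((w(j := v j)) ` S) x" using j by (intro coh_mono[OF c(1)]) auto
    then have "z \<cdot> ?t j = E f S (\<lambda>i. z \<cdot> (w(j := v j)) i) (z \<cdot> x)" by (intro Comp_E[OF f _ c(2) z(1)])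
    also have "\<dots> = ?t' j" by (intro E_cong) auto
    finally show ?thesis .
  qed
  show ?thesis
  proof (cases "S = {}")
    case True
    \<comment> \<open>Here the empty sum is the total zero map, with which precomposition commutes
      only up to a restriction; it is dropped as a neutral summand before composing.\<close>
    have "z \<cdot> plus_map C N (ev f {#a#} x) (zero_map C N Z) = ev f {#z \<cdot> a#} (z \<cdot> x)"
      using s(1) 1 z' by (simp add: True Hom_iff del: crc_monoid.Comp_plus_map)
    then show ?thesis using True W s'(1) by (simp add: ds_def Hom_iff del: crc_monoid.Comp_plus_map)
  next
    case False
    have "z \<cdot> sum_map C N Z ?t S = sum_map C N W (\<lambda>j. z \<cdot> ?t j) S"
      using False c(2) s(3) by (intro crc_monoid.Comp_sum_map[OF _ z(1)]) auto
    also have "\<dots> = sum_map C N W ?t' S"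
      using t s'(3) W by (intro crc_monoid.sum_map_cong) auto
    finally show ?thesis using s(1) ss 1 z' by (simp add: ds_def Hom_iff)
  qed
qed

text \<open>One variable of the derivative is the pair \<open>(v j, w j)\<close>, so both entries
  change together. The first summand and the summands for \<open>k \<noteq> j\<close> contain
  \<open>w j\<close> but not \<open>v j\<close>, the summand for \<open>j\<close> contains
  \<open>v j\<close> but not \<open>w j\<close>. Each of them is therefore additive in the
  pair.\<close>

lemma ds_update_plus:
  assumes c: "coh Z (mobj M) X ({a, d, d', e, e'} \<union> v ` (S - {j}) \<union> w ` (S - {j})) x" and S: "finite S" "j \<in> S"
  shows "ds Z S (v(j := plus_map C M d d')) (w(j := plus_map C M e e')) a x
    = plus_map C N (ds Z S (v(j := d)) (w(j := e)) a x) (ds Z S (v(j := d')) (w(j := e')) a x)"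
proof -
  have Z: "Z \<in> Ob C" using cohD(4)[OF c] .
  have ms: "mset_set S = add_mset j (mset_set (S - {j}))"
    using S mset_set.remove by fastforce
  have wi: "image_mset (w(j := b)) (mset_set S) = add_mset b (image_mset w (mset_set (S - {j})))" for b
    unfolding ms using S(1) by (auto intro!: image_mset_cong)
  let ?t = "\<lambda>d e k. E f S ((w(j := e))(k := (v(j := d)) k)) x"
  have c1: "coh Z (mobj M) X (insert a ((v(j := d)) ` S \<union> (w(j := e)) ` S)) x"
    by (rule coh_mono[OF c]) auto
  have c2: "coh Z (mobj M) X (insert a ((v(j := d')) ` S \<union> (w(j := e')) ` S)) x"
    by (rule coh_mono[OF c]) auto
  note s1 = ds_summands(1,3)[OF c1 S(1)] ds_sum(1)[OF c1 S(1)]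
  note s2 = ds_summands(1,3)[OF c2 S(1)] ds_sum(1)[OF c2 S(1)]
  have "ev f (add_mset (plus_map C M e e') (add_mset a (image_mset w (mset_set (S - {j}))))) x
    = plus_map C N (ev f (add_mset e (add_mset a (image_mset w (mset_set (S - {j}))))) x)
       (ev f (add_mset e' (add_mset a (image_mset w (mset_set (S - {j}))))) x)"
    by (rule ev_plus[OF f]) (rule coh_mono[OF c], use S(1) in auto)
  then have h: "ev f (add_mset a (image_mset (w(j := plus_map C M e e')) (mset_set S))) x
    = plus_map C N (ev f (add_mset a (image_mset (w(j := e)) (mset_set S))) x)
       (ev f (add_mset a (image_mset (w(j := e')) (mset_set S))) x)"
    unfolding wi by (simp only: add_mset_commute)
  have t: "?t (plus_map C M d d') (plus_map C M e e') k = plus_map C N (?t d e k) (?t d' e' k)" if k: "k \<in> S" for k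
  proof (cases "k = j")
    case True
    have "E f S (w(j := plus_map C M d d')) x = plus_map C N (E f S (w(j := d)) x) (E f S (w(j := d')) x)"
      by (rule E_update_plus[OF f S]) (rule coh_mono[OF c], auto)
    then show ?thesis using True by simp
  next
    case False
    have "E f S ((w(k := v k))(j := plus_map C M e e')) x
      = plus_map C N (E f S ((w(k := v k))(j := e)) x) (E f S ((w(k := v k))(j := e')) x)"
      by (rule E_update_plus[OF f S]) (rule coh_mono[OF c], use k False in auto)
    then show ?thesis using False by (simp add: fun_upd_twist)
  qed
  have "sum_map C N Z (?t (plus_map C M d d') (plus_map C M e e')) S
    = sum_map C N Z (\<lambda>k. plus_map C N (?t d e k) (?t d' e' k)) S"
    using t s1(2) s2(2) Z by (intro crc_monoid.sum_map_cong) (auto simp: Hom_iff simp del: fun_upd_apply)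
  also have "\<dots> = plus_map C N (sum_map C N Z (?t d e) S) (sum_map C N Z (?t d' e') S)"
    using s1(2) s2(2) Z by (intro crc_monoid.sum_map_plus) (auto simp del: fun_upd_apply)
  finally show ?thesis unfolding ds_def h using s1(1,3) s2(1,3)
    by (simp add: Hom_iff crc_monoid.plus_map_ac[OF cN])
qed

lemma ds_update_rzero:
  assumes c: "coh Z (mobj M) X (insert a (v ` (S - {j}) \<union> w ` (S - {j}))) x" and S: "finite S" "j \<in> S"
  shows "ds Z S (v(j := \<rho> x \<cdot> zero_map C M Z)) (w(j := \<rho> x \<cdot> zero_map C M Z)) a x
    = \<rho> (x \<cdot> fseq f 0) \<cdot> zero_map C N Z"
proof -
  let ?z = "\<rho> x \<cdot> zero_map C M Z" and ?o = "\<rho> (x \<cdot> fseq f 0) \<cdot> zero_map C N Z"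
  note x = cohD(1,4)[OF c]
  have ms: "mset_set S = add_mset j (mset_set (S - {j}))"
    using S mset_set.remove by fastforce
  have wi: "image_mset (w(j := b)) (mset_set S) = add_mset b (image_mset w (mset_set (S - {j})))" for b
    unfolding ms using S(1) by (auto intro!: image_mset_cong)
  have "ev f (add_mset ?z (add_mset a (image_mset w (mset_set (S - {j}))))) x = ?o"
    by (rule ev_rzero[OF f]) (rule coh_mono[OF c], use S(1) in auto)
  then have h: "ev f (add_mset a (image_mset (w(j := ?z)) (mset_set S))) x = ?o"
    unfolding wi by (simp only: add_mset_commute)
  have t: "E f S ((w(j := ?z))(k := (v(j := ?z)) k)) x = ?o" if k: "k \<in> S" for k
  proof (cases "k = j")
    case True
    have "E f S (w(j := ?z)) x = ?o"
      by (rule E_update_rzero[OF f S]) (rule coh_mono[OF c], auto)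
    then show ?thesis using True by simp
  next
    case False
    have "E f S ((w(k := v k))(j := ?z)) x = ?o"
      by (rule E_update_rzero[OF f S]) (rule coh_mono[OF c], use k False in auto)
    then show ?thesis using False by (simp add: fun_upd_twist)
  qed
  have "sum_map C N Z (\<lambda>k. E f S ((w(j := ?z))(k := (v(j := ?z)) k)) x) S = ?o"
    using t S x by (intro crc_monoid.sum_map_all_rzero) (auto simp: Hom_iff simp del: fun_upd_apply)
  then show ?thesis unfolding ds_def h using x by (simp add: Hom_iff)
qed

abbreviation "A \<equiv> mobj M"
abbreviation "MM \<equiv> prod_monoid C M M"
abbreviation "df \<equiv> faa_D C f"
abbreviation "pA0 \<equiv> Pr0 C A A"
abbreviation "pA1 \<equiv> Pr1 C A A"
abbreviation "pX0 \<equiv> Pr0 C A X"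
abbreviation "pX1 \<equiv> Pr1 C A X"

lemma D_simps: "fsrc df = (MM, A \<^bold>\<times> X)" "ftgt df = (N, mobj N)" "fseq df 0 = fseq f 1"
  using FH_D(5,6)[OF f] by (simp_all add: faa_D_def faa_Prd_def Let_def)

lemma f1: "fseq f 1 \<in> Hom C (A \<^bold>\<times> X) (mobj N)" "\<rho> (fseq f 1) = \<rho> (pX1 \<cdot> fseq f 0)"
  using FH_D(8,9)[OF f, of 1] by (simp_all add: Hom_iff)

lemma coh_D:
  assumes "coh Z (A \<^bold>\<times> A) (A \<^bold>\<times> X) (p ` S) q"
  shows "coh Z A X (insert (q \<cdot> pX0) ((\<lambda>i. p i \<cdot> pA0) ` S \<union> (\<lambda>i. p i \<cdot> pA1) ` S)) (q \<cdot> pX1)"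
  using assms by (auto simp: coh_def Hom_iff)

abbreviation "dd Z S p q \<equiv> ds Z S (\<lambda>i. p i \<cdot> pA0) (\<lambda>i. p i \<cdot> pA1) (q \<cdot> pX0) (q \<cdot> pX1)"

lemma fseq_D:
  assumes "n \<ge> 1"
  shows "fseq df n = dd (pow_times C (A \<^bold>\<times> A) n (A \<^bold>\<times> X)) {..<n}
    (pow_proj C (A \<^bold>\<times> A) (A \<^bold>\<times> X) n) (pow_proj C (A \<^bold>\<times> A) (A \<^bold>\<times> X) n n)"
proof -
  let ?p = "pow_proj C (A \<^bold>\<times> A) (A \<^bold>\<times> X) n" and ?Z = "pow_times C (A \<^bold>\<times> A) n (A \<^bold>\<times> X)"
  let ?v = "\<lambda>i. ?p i \<cdot> pA0" and ?w = "\<lambda>i. ?p i \<cdot> pA1" and ?a = "?p n \<cdot> pX0" and ?x = "?p n \<cdot> pX1"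
  have c: "coh ?Z (A \<^bold>\<times> A) (A \<^bold>\<times> X) (?p ` {..<n}) (?p n)"
    using coh_pow_proj[of "A \<^bold>\<times> A" "A \<^bold>\<times> X" n] by (simp add: atLeast0LessThan)
  note cD = coh_D[OF c]
  have "coh ?Z A X (set (?a # map ?w [0..<n])) ?x"
    by (rule coh_mono[OF cD]) auto
  note e1 = ev_mset[OF f this]
  have h: "app C (fseq f (Suc n)) (?a # map ?w [0..<n]) ?x = ev f (add_mset ?a (image_mset ?w (mset_set {..<n}))) ?x"
    using e1 by (simp add: atLeast0LessThan)
  have t: "app C (fseq f n) (?v j # map ?w (filter (\<lambda>i. i \<noteq> j) [0..<n])) ?x = E f {..<n} (?w(j := ?v j)) ?x"
    if j: "j \<in> {..<n}" for j
  proof -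
    have "coh ?Z A X (set (?v j # map ?w (filter (\<lambda>i. i \<noteq> j) [0..<n]))) ?x"
      using j by (intro coh_mono[OF cD]) auto
    note e2 = ev_mset[OF f this]
    \<comment> \<open>The omission of \<open>w j\<close> is expressed by filtering the list of
      indices. Its multiset is that of \<open>{..<n} - {j}\<close>, the form used by
      \<open>E_update\<close>.\<close>
    have d: "distinct (filter (\<lambda>i. i \<noteq> j) [0..<n])" "set (filter (\<lambda>i. i \<noteq> j) [0..<n]) = {..<n} - {j}" by auto
    then have "length (filter (\<lambda>i. i \<noteq> j) [0..<n]) = n - 1" using j distinct_card[OF d(1)] by simp
    moreover have "mset (filter (\<lambda>i. i \<noteq> j) [0..<n]) = mset_set ({..<n} - {j})"
      using mset_set_set[OF d(1)] d(2) by simp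
    ultimately show ?thesis using e2 j assms E_update[of "{..<n}" j f ?w "?v j" ?x]
      by (simp del: mset_filter)
  qed
  have sm: "sum_map C N ?Z (\<lambda>j. app C (fseq f n) (?v j # map ?w (filter (\<lambda>i. i \<noteq> j) [0..<n])) ?x) {..<n}
    = sum_map C N ?Z (\<lambda>j. E f {..<n} (?w(j := ?v j)) ?x) {..<n}"
    using t ds_summands(3)[OF cD] by (intro crc_monoid.sum_map_cong) (auto simp del: fun_upd_apply)
  show ?thesis using assms FH_D(5,6)[OF f] unfolding ds_def h[symmetric] sm[symmetric]
    by (simp add: faa_D_def Let_def)
qed

lemma app_D:
  assumes c: "coh Z (A \<^bold>\<times> A) (A \<^bold>\<times> X) (set ps) q" "ps \<noteq> []"
  shows "app C (fseq df (length ps)) ps q = dd Z {..<length ps} (nth ps) q"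
proof -
  let ?n = "length ps"
  let ?p = "pow_proj C (A \<^bold>\<times> A) (A \<^bold>\<times> X) ?n" and ?Z = "pow_times C (A \<^bold>\<times> A) ?n (A \<^bold>\<times> X)"
  have c': "coh ?Z (A \<^bold>\<times> A) (A \<^bold>\<times> X) (?p ` {..<?n}) (?p ?n)"
    using coh_pow_proj[of "A \<^bold>\<times> A" "A \<^bold>\<times> X" ?n] by (simp add: atLeast0LessThan)
  have ne: "?n \<ge> 1" using c(2) by (simp add: Suc_le_eq)
  let ?t = "tup ps q"
  have t: "?t \<in> Hom C Z ?Z" "?t \<in> Ar C" "Cod C ?t = ?Z" "Dom C ?t = Z" using coh_tup(1)[OF c(1)] by (auto simp: Hom_iff)
  have tp: "?t \<cdot> ?p i = (if i < ?n then ps ! i else q)" if "i \<le> ?n" for i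
    using tup_proj[OF c(1) that] by simp
  have q: "q \<in> Ar C" "Dom C q = Z" "Cod C q = A \<^bold>\<times> X" using cohD(1)[OF c(1)] by (auto simp: Hom_iff)
  have tq: "?t \<cdot> (?p ?n \<cdot> pX0) = q \<cdot> pX0" "?t \<cdot> (?p ?n \<cdot> pX1) = q \<cdot> pX1"
    using t tp[of ?n] assoc[of ?t "?p ?n" pX0] assoc[of ?t "?p ?n" pX1] by simp_all
  have ti: "?t \<cdot> (?p i \<cdot> pA0) = ps ! i \<cdot> pA0" "?t \<cdot> (?p i \<cdot> pA1) = ps ! i \<cdot> pA1" if "i < ?n" for i
    using t tp[of i] that assoc[of ?t "?p i" pA0] assoc[of ?t "?p i" pA1] by simp_all
  have "\<rho> (?t \<cdot> (?p ?n \<cdot> pX1)) = \<rho> ?t" unfolding tq using q coh_tup(2)[OF c(1)] by simp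
  from Comp_ds[OF coh_D[OF c'] _ t(1) this]
  have "?t \<cdot> fseq df ?n = ds Z {..<?n} (\<lambda>i. ?t \<cdot> (?p i \<cdot> pA0)) (\<lambda>i. ?t \<cdot> (?p i \<cdot> pA1)) (q \<cdot> pX0) (q \<cdot> pX1)"
    unfolding fseq_D[OF ne] by (simp add: tq)
  also have "\<dots> = dd Z {..<?n} (nth ps) q"
  proof (rule ds_cong[symmetric])
    have "coh Z (A \<^bold>\<times> A) (A \<^bold>\<times> X) ((!) ps ` {..<?n}) q" by (rule coh_mono[OF c(1)]) auto
    from coh_D[OF this]
    show "coh Z A X (insert (q \<cdot> pX0) ((\<lambda>i. ps ! i \<cdot> pA0) ` {..<?n} \<union> (\<lambda>i. ps ! i \<cdot> pA1) ` {..<?n})) (q \<cdot> pX1)" .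
  qed (auto simp: ti)
  finally show ?thesis by (simp add: app_tup)
qed

lemma D_FH: "df \<in> FH MM (A \<^bold>\<times> X) N (mobj N)"
proof (rule FH_I)
  show "cm MM" "cm N" "A \<^bold>\<times> X \<in> Ob C" "mobj N \<in> Ob C" by simp_all
  show "fsrc df = (MM, A \<^bold>\<times> X)" "ftgt df = (N, mobj N)" "fseq df 0 \<in> Hom C (A \<^bold>\<times> X) (mobj N)"
    using D_simps f1 by auto
  fix n :: nat assume n: "1 \<le> n"
  let ?p = "pow_proj C (A \<^bold>\<times> A) (A \<^bold>\<times> X) n" and ?Z = "pow_times C (A \<^bold>\<times> A) n (A \<^bold>\<times> X)"
  have c: "coh ?Z (A \<^bold>\<times> A) (A \<^bold>\<times> X) (?p ` {..<n}) (?p n)"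
    using coh_pow_proj[of "A \<^bold>\<times> A" "A \<^bold>\<times> X" n] by (simp add: atLeast0LessThan)
  note ty = ds_type[OF coh_D[OF c] finite_lessThan]
  show "fseq df n \<in> Hom C (pow_times C (mobj MM) n (A \<^bold>\<times> X)) (mobj N)"
    unfolding fseq_D[OF n] using ty by simp
  \<comment> \<open>The domain demanded of the components is that of \<open>f\<^sub>1\<close>, the
    component at index 0 of the derivative. By the condition on \<open>f\<close> this is the domain
    of \<open>pX1 \<cdot> fseq f 0\<close>, and all summands have it.\<close>
  have "\<rho> (?p n \<cdot> fseq df 0) = \<rho> (?p n \<cdot> (pX1 \<cdot> fseq f 0))"
    unfolding D_simps using f1 by (intro Rst_mono_eq) (simp_all add: Hom_iff)
  then show "\<rho> (fseq df n) = \<rho> (pow_proj C (mobj MM) (A \<^bold>\<times> X) n n \<cdot> fseq df 0)"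
    unfolding fseq_D[OF n] using ty by simp
next
  fix Z as bs x assume c: "coh Z (mobj MM) (A \<^bold>\<times> X) (set as) x" "as \<noteq> []" "mset bs = mset as"
  then have l: "length bs = length as" "set bs = set as" using mset_eq_length mset_eq_setD by metis+
  obtain p where p: "p permutes {..<length as}" "permute_list p as = bs"
    using mset_eq_permutation[OF c(3)] by blast
  have pim: "p ` {..<length as} = {..<length as}" using permutes_image[OF p(1)] .
  have c': "coh Z (A \<^bold>\<times> A) (A \<^bold>\<times> X) (set as) x" "coh Z (A \<^bold>\<times> A) (A \<^bold>\<times> X) (set bs) x" using c(1) l by simp_all
  have c1: "coh Z (A \<^bold>\<times> A) (A \<^bold>\<times> X) ((!) bs ` {..<length as}) x"
    by (rule coh_mono[OF c'(2)]) (metis l(1) image_subsetI lessThan_iff nth_mem)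
  have c2: "coh Z (A \<^bold>\<times> A) (A \<^bold>\<times> X) ((!) as ` p ` {..<length as}) x"
    unfolding pim by (rule coh_mono[OF c'(1)]) auto
  have "app C (fseq df (length as)) bs x = dd Z {..<length as} (nth bs) x"
    using app_D[OF c'(2)] c l by (cases "bs = []") auto
  also have "\<dots> = dd Z {..<length as} (\<lambda>i. as ! p i) x"
    using p by (intro ds_cong coh_D c1) (auto simp: permute_list_nth)
  also have "\<dots> = dd Z (p ` {..<length as}) (nth as) x"
    using coh_D[OF c2] p(1) by (intro ds_reindex[symmetric]) (auto simp: permutes_inj_on image_image)
  also have "\<dots> = app C (fseq df (length as)) as x" using app_D[OF c'(1) c(2)] pim by simp
  finally show "app C (fseq df (length as)) bs x = app C (fseq df (length as)) as x" .
next
  fix Z a b as x assume c: "coh Z (mobj MM) (A \<^bold>\<times> X) (insert a (insert b (set as))) x"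
  let ?c = "plus_map C MM a b"
  let ?v = "\<lambda>i. (a # as) ! i \<cdot> pA0" and ?w = "\<lambda>i. (a # as) ! i \<cdot> pA1"
  have ab: "a \<in> Hom C Z (A \<^bold>\<times> A)" "b \<in> Hom C Z (A \<^bold>\<times> A)" "\<rho> a = \<rho> x" "\<rho> b = \<rho> x"
    "coh Z (A \<^bold>\<times> A) (A \<^bold>\<times> X) (set as) x"
    using c by (auto simp: coh_insert)
  have n: "(\<lambda>i. (d # as) ! i \<cdot> k) = (\<lambda>i. (a # as) ! i \<cdot> k)(0 := d \<cdot> k)" for d k
    by (auto simp: fun_eq_iff nth_Cons split: nat.split)
  have im: "(nth (a # as)) ` ({..<Suc (length as)} - {0}) \<subseteq> set as" by (auto simp: nth_Cons' intro!: nth_mem)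
  have x: "x \<in> Hom C Z (A \<^bold>\<times> X)" using cohD(1)[OF c] .
  have cc: "coh Z (A \<^bold>\<times> A) (A \<^bold>\<times> X) (set (?c # as)) x"
    using ab x cm_prod[OF cM cM] crc_monoid.plus_map_type[of C MM a b] by (auto simp: coh_insert Hom_iff)
  have ca: "coh Z (A \<^bold>\<times> A) (A \<^bold>\<times> X) (set (a # as)) x" "coh Z (A \<^bold>\<times> A) (A \<^bold>\<times> X) (set (b # as)) x"
    using c by (auto simp: coh_insert)
  have cD: "coh Z A X ({x \<cdot> pX0, a \<cdot> pA0, b \<cdot> pA0, a \<cdot> pA1, b \<cdot> pA1} \<union> ?v ` ({..<Suc (length as)} - {0}) \<union>
     ?w ` ({..<Suc (length as)} - {0})) (x \<cdot> pX1)"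
    using coh_D[of Z id "insert a (insert b (set as))" x] c im
    by (auto elim!: coh_mono)
  show "app C (fseq df (Suc (length as))) (?c # as) x = plus_map C N
    (app C (fseq df (Suc (length as))) (a # as) x) (app C (fseq df (Suc (length as))) (b # as) x)"
    using app_D[OF cc] app_D[OF ca(1)] app_D[OF ca(2)] ds_update_plus[OF cD]
    by (simp add: n[of ?c] n[of b] n[of a, symmetric] plus_map_prod_Pr[OF cM cM ab(1,2)])
next
  fix Z as x assume c: "coh Z (mobj MM) (A \<^bold>\<times> X) (set as) x"
  let ?c = "\<rho> x \<cdot> zero_map C MM Z"
  let ?v = "\<lambda>i. (?c # as) ! i \<cdot> pA0" and ?w = "\<lambda>i. (?c # as) ! i \<cdot> pA1"
  note x = cohD(1,4)[OF c]
  have x': "x \<in> Ar C" "Dom C x = Z" "Cod C x = A \<^bold>\<times> X" using x by (auto simp: Hom_iff)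
  have n: "(\<lambda>i. (?c # as) ! i \<cdot> k) = (\<lambda>i. (?c # as) ! i \<cdot> k)(0 := ?c \<cdot> k)" for k
    by (auto simp: fun_eq_iff nth_Cons split: nat.split)
  have im: "(nth (?c # as)) ` ({..<Suc (length as)} - {0}) \<subseteq> set as" by (auto simp: nth_Cons' intro!: nth_mem)
  have cc: "coh Z (A \<^bold>\<times> A) (A \<^bold>\<times> X) (set (?c # as)) x"
    using c x' x(2) by (auto simp: coh_insert Hom_iff)
  have cD: "coh Z A X (insert (x \<cdot> pX0) (?v ` ({..<Suc (length as)} - {0}) \<union>
     ?w ` ({..<Suc (length as)} - {0}))) (x \<cdot> pX1)"
    using coh_D[of Z id "set as" x] c im by (auto elim!: coh_mono)
  have z: "?c \<cdot> pA0 = \<rho> (x \<cdot> pX1) \<cdot> zero_map C M Z" "?c \<cdot> pA1 = \<rho> (x \<cdot> pX1) \<cdot> zero_map C M Z"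
    using x' x(2) by simp_all
  have "app C (fseq df (Suc (length as))) (?c # as) x = ds Z {..<Suc (length as)} (?v(0 := ?c \<cdot> pA0)) (?w(0 := ?c \<cdot> pA1)) (x \<cdot> pX0) (x \<cdot> pX1)"
    using app_D[OF cc] n[of pA0] n[of pA1] by simp
  also have "\<dots> = \<rho> ((x \<cdot> pX1) \<cdot> fseq f 0) \<cdot> zero_map C N Z" unfolding z by (rule ds_update_rzero[OF cD]) auto
  also have "\<rho> ((x \<cdot> pX1) \<cdot> fseq f 0) = \<rho> (x \<cdot> fseq df 0)"
  proof -
    have "\<rho> (x \<cdot> (pX1 \<cdot> fseq f 0)) = \<rho> (x \<cdot> fseq f 1)"
      using x' f1 HomD[OF f1(1)] by (intro Rst_mono_eq) simp_all
    then show ?thesis unfolding D_simps using x' by simp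
  qed
  finally show "app C (fseq df (Suc (length as))) (?c # as) x = \<rho> (x \<cdot> fseq df 0) \<cdot> zero_map C N Z" .
qed

lemma E_D:
  assumes c: "coh Z (A \<^bold>\<times> A) (A \<^bold>\<times> X) (p ` S) q" "finite S"
  shows "E df S p q = dd Z S p q"
proof (cases "S = {}")
  case True
  have q: "q \<in> Ar C" "Dom C q = Z" "Cod C q = A \<^bold>\<times> X" "Z \<in> Ob C"
    using cohD(1,4)[OF c(1)] by (auto simp: Hom_iff)
  have "coh Z A X (set [q \<cdot> pX0]) (q \<cdot> pX1)" using q by (simp add: coh_def Hom_iff)
  from ev_mset[OF f this] have "ev f {#q \<cdot> pX0#} (q \<cdot> pX1) = \<langle>q \<cdot> pX0, q \<cdot> pX1\<rangle> \<cdot> fseq f 1" by (simp add: app_tup)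
  also have "\<langle>q \<cdot> pX0, q \<cdot> pX1\<rangle> = q" using q by simp
  finally show ?thesis using True q f1 by (simp add: E_def ds_def ev_empty D_simps Hom_iff)
next
  case False
  obtain s where s: "distinct s" "set s = S" using c(2) finite_distinct_list by metis
  let ?n = "length s"
  have sn: "nth s ` {..<?n} = S" using s(2) by (auto simp: set_conv_nth)
  have cl: "coh Z (A \<^bold>\<times> A) (A \<^bold>\<times> X) (set (map p s)) q" using c s by simp
  have cl': "coh Z (mobj MM) (A \<^bold>\<times> X) (set (map p s)) q" using cl by simp
  have c1: "coh Z (A \<^bold>\<times> A) (A \<^bold>\<times> X) ((!) (map p s) ` {..<?n}) q" by (rule coh_mono[OF cl]) auto
  have "E df S p q = ev df (mset (map p s)) q" using mset_set_set[OF s(1)] s(2) by (simp add: E_def)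
  also have "\<dots> = app C (fseq df (length (map p s))) (map p s) q" by (rule ev_mset[OF D_FH cl'])
  also have "\<dots> = dd Z {..<?n} (nth (map p s)) q" using app_D[OF cl] False s(2) by auto
  also have "\<dots> = dd Z {..<?n} (\<lambda>i. p (s ! i)) q"
    by (intro ds_cong coh_D c1) auto
  also have "\<dots> = dd Z (nth s ` {..<?n}) p q"
    using s(1) coh_D[OF c(1)] sn by (intro ds_reindex[symmetric]) (auto simp: inj_on_nth)
  finally show ?thesis using sn by simp
qed

end

section \<open>The chain rule\<close>

definition part_add :: "'i \<Rightarrow> 'i set set \<Rightarrow> 'i set \<Rightarrow> 'i set set" where
  "part_add n P B = insert (insert n B) (P - {B})"

text \<open>Deletes the point from its block and discards the empty set that is left if the point
  was alone. It is a left inverse of both ways of adding the point and hence separates the cases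
  belonging to different partitions.\<close>

definition part_del :: "'i \<Rightarrow> 'i set set \<Rightarrow> 'i set set" where
  "part_del n Q = (\<lambda>B. B - {n}) ` Q - {{}}"

lemma part_insert:
  assumes P: "partition_on S P" and n: "n \<notin> S"
  shows "partition_on (insert n S) (insert {n} P)" "part_del n (insert {n} P) = P" "{n} \<notin> P"
proof -
  have nb: "n \<notin> B" "B \<noteq> {}" if "B \<in> P" for B using partition_on_block[OF P that] n by auto
  have im: "(\<lambda>B. B - {n}) ` P = P" using nb by (force simp: image_iff)
  show "{n} \<notin> P" using nb by blast
  show "part_del n (insert {n} P) = P" unfolding part_del_def using im nb by auto
  show "partition_on (insert n S) (insert {n} P)"
    using P n nb by (auto simp: partition_on_def disjoint_def)
qed

lemma part_add:
  assumes P: "partition_on S P" and n: "n \<notin> S" and B: "B \<in> P"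
  shows "partition_on (insert n S) (part_add n P B)" "part_del n (part_add n P B) = P" "insert n B \<notin> P"
proof -
  have nb: "n \<notin> B" "B \<noteq> {}" if "B \<in> P" for B using partition_on_block[OF P that] n by auto
  have im: "(\<lambda>B. B - {n}) ` (P - {B}) = P - {B}" using nb by (force simp: image_iff)
  have "insert n B - {n} = B" using nb[OF B] by auto
  then show "part_del n (part_add n P B) = P"
    unfolding part_del_def part_add_def image_insert im using nb B by auto
  show "insert n B \<notin> P" using nb by blast
  have "\<Union>(part_add n P B) = insert n S" using P B by (auto simp: part_add_def partition_on_def)
  moreover have "disjoint (part_add n P B)"
  proof (rule disjointI)
    have dj: "B' \<inter> B'' = {}" if "B' \<in> P" "B'' \<in> P" "B' \<noteq> B''" for B' B''
      using P that by (auto simp: partition_on_def disjoint_def)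
    have 1: "insert n B \<inter> B' = {}" if "B' \<in> P - {B}" for B'
      using that dj[OF B, of B'] nb[of B'] by auto
    fix p q assume a: "p \<in> part_add n P B" "q \<in> part_add n P B" "p \<noteq> q"
    then consider "p = insert n B" "q \<in> P - {B}" | "q = insert n B" "p \<in> P - {B}" | "p \<in> P" "q \<in> P"
      unfolding part_add_def by blast
    then show "p \<inter> q = {}"
    proof cases
      case 1 then show ?thesis using \<open>\<And>B'. B' \<in> P - {B} \<Longrightarrow> insert n B \<inter> B' = {}\<close>[of q] by simp
    next
      case 2 then show ?thesis using \<open>\<And>B'. B' \<in> P - {B} \<Longrightarrow> insert n B \<inter> B' = {}\<close>[of p] by (simp add: Int_commute)
    next
      case 3 then show ?thesis using dj a(3) by simp
    qed
  qed
  ultimately show "partition_on (insert n S) (part_add n P B)"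
    using P by (auto simp: partition_on_def part_add_def)
qed

lemma part_del:
  assumes Q: "partition_on (insert n S) Q" and n: "n \<notin> S"
  shows "partition_on S (part_del n Q)"
    "Q = insert {n} (part_del n Q) \<or> (\<exists>B \<in> part_del n Q. Q = part_add n (part_del n Q) B)"
proof -
  obtain B0 where B0: "B0 \<in> Q" "n \<in> B0" and un: "\<And>B'. B' \<in> Q \<Longrightarrow> n \<in> B' \<Longrightarrow> B' = B0"
    using partition_on_ex1[OF Q, of n] by blast
  have dj: "B \<inter> B' = {}" if "B \<in> Q" "B' \<in> Q" "B \<noteq> B'" for B B'
    using Q that by (auto simp: partition_on_def disjoint_def)
  have ne: "B \<noteq> {}" if "B \<in> Q" for B using partition_on_block[OF Q that] by auto
  have im: "(\<lambda>B. B - {n}) ` (Q - {B0}) = Q - {B0}" using un by (force simp: image_iff)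
  have Q': "Q = insert B0 (Q - {B0})" using B0 by auto
  have del: "part_del n Q = insert (B0 - {n}) (Q - {B0}) - {{}}"
    unfolding part_del_def by (subst Q') (simp only: image_insert im)
  have U: "\<Union>Q = insert n S" using Q by (auto simp: partition_on_def)
  show "partition_on S (part_del n Q)"
  proof (rule partition_onI)
    have "\<Union>(part_del n Q) = \<Union>Q - {n}" unfolding part_del_def by auto
    then show "\<Union>(part_del n Q) = S" using U n by auto
    show "{} \<notin> part_del n Q" by (simp add: part_del_def)
    fix p q assume "p \<in> part_del n Q" "q \<in> part_del n Q" "p \<noteq> q"
    then obtain B B' where "p = B - {n}" "q = B' - {n}" "B \<in> Q" "B' \<in> Q" "B \<noteq> B'"
      unfolding part_del_def by blast
    then show "disjnt p q" using dj[of B B'] by (auto simp: disjnt_def)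
  qed
  show "Q = insert {n} (part_del n Q) \<or> (\<exists>B \<in> part_del n Q. Q = part_add n (part_del n Q) B)"
  proof (cases "B0 = {n}")
    case True
    then have "part_del n Q = Q - {{n}}" using del ne by auto
    then show ?thesis using B0 True by auto
  next
    case False
    have b: "B0 - {n} \<noteq> {}" using False B0 by auto
    \<comment> \<open>What remains of \<open>B0\<close> is nonempty and disjoint from all other
      blocks, so the deletion identifies no two blocks.\<close>
    have ni: "B0 - {n} \<notin> Q - {B0}" using dj[of "B0 - {n}" B0] B0 b by blast
    have d: "part_del n Q = insert (B0 - {n}) (Q - {B0})" using del ne b by auto
    have i: "insert n (B0 - {n}) = B0" using B0(2) by blast
    have j: "part_del n Q - {B0 - {n}} = Q - {B0}" unfolding d using ni by blast
    have "part_add n (part_del n Q) (B0 - {n}) = Q"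
      unfolding part_add_def i j by (rule insert_Diff[OF B0(1)])
    then show ?thesis using d by (intro disjI2 bexI[of _ "B0 - {n}"]) auto
  qed
qed

lemma partitions_insert:
  assumes n: "n \<notin> S"
  shows "partitions (insert n S) = (\<Union>P\<in>partitions S. insert (insert {n} P) (part_add n P ` P))"
proof (rule Set.set_eqI, rule iffI)
  fix Q assume "Q \<in> partitions (insert n S)"
  then have "partition_on (insert n S) Q" by simp
  from part_del[OF this n] show "Q \<in> (\<Union>P\<in>partitions S. insert (insert {n} P) (part_add n P ` P))" by blast
next
  fix Q assume "Q \<in> (\<Union>P\<in>partitions S. insert (insert {n} P) (part_add n P ` P))"
  then obtain P where P: "partition_on S P" and "Q = insert {n} P \<or> (\<exists>B\<in>P. Q = part_add n P B)" by auto
  then show "Q \<in> partitions (insert n S)" using part_insert(1)[OF P n] part_add(1)[OF P n] by auto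
qed

text \<open>The partitions of the larger set are grouped by what is left after deletion of the new
  point; \<open>part_del\<close> shows that the groups are disjoint. Inside a group, the block
  containing the new point tells the partitions apart.\<close>

lemma (in crc_monoid) sum_map_partitions_insert:
  assumes Z: "Z \<in> Ob C" and S: "finite S" "n \<notin> S"
    and T: "\<And>Q. partition_on (insert n S) Q \<Longrightarrow> T Q \<in> Hom C Z (mobj M)"
  shows "sm Z T (partitions (insert n S)) =
    sm Z (\<lambda>P. pl (T (insert {n} P)) (sm Z (\<lambda>B. T (part_add n P B)) P)) (partitions S)"
proof -
  let ?J = "\<lambda>P. insert (insert {n} P) (part_add n P ` P)"
  have fin: "finite P" if "partition_on S P" for P using that S finite_elements by blast
  have res: "part_del n Q = P" "T Q \<in> Hom C Z (mobj M)" if "partition_on S P" "Q \<in> ?J P" for P Q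
    using that part_insert[OF that(1) S(2)] part_add[OF that(1) S(2)] T by auto
  have "sm Z T (partitions (insert n S)) = sm Z (\<lambda>P. sm Z T (?J P)) (partitions S)"
    unfolding partitions_insert[OF S(2)]
  proof (rule sum_map_UN[OF Z])
    show "finite (partitions S)" using finitely_many_partition_on[OF S(1)] .
    show "finite (?J P)" if "P \<in> partitions S" for P using fin that by simp
    show "?J P \<inter> ?J P' = {}" if "P \<in> partitions S" "P' \<in> partitions S" "P \<noteq> P'" for P P'
    proof (rule equals0I)
      fix Q assume Q: "Q \<in> ?J P \<inter> ?J P'"
      have "partition_on S P" "partition_on S P'" using that by simp_all
      from res(1)[OF this(1) IntD1[OF Q]] res(1)[OF this(2) IntD2[OF Q]] show False using that(3) by simp
    qed
    show "T Q \<in> Hom C Z (mobj M)" if "P \<in> partitions S" "Q \<in> ?J P" for P Q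
      by (rule res(2)[OF _ that(2)]) (use that(1) in simp)
  qed
  also have "\<dots> = sm Z (\<lambda>P. pl (T (insert {n} P)) (sm Z (\<lambda>B. T (part_add n P B)) P)) (partitions S)"
  proof (rule sum_map_cong[OF Z])
    fix P assume "P \<in> partitions S"
    then have P: "partition_on S P" by simp
    have nb: "n \<notin> B" "B \<noteq> {}" if "B \<in> P" for B using partition_on_block[OF P that] S by auto
    have blk: "B' = insert n B" if "B' \<in> part_add n P B" "n \<in> B'" "B \<in> P" for B B'
      using that nb by (auto simp: part_add_def)
    have inj: "inj_on (part_add n P) P"
    proof (rule inj_onI)
      fix B B' assume B: "B \<in> P" "B' \<in> P" "part_add n P B = part_add n P B'"
      have "insert n B \<in> part_add n P B'" unfolding B(3)[symmetric] by (simp add: part_add_def)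
      then have "insert n B = insert n B'" using blk B by blast
      then show "B = B'" using nb B by (metis insert_ident)
    qed
    have notin: "insert {n} P \<notin> part_add n P ` P"
    proof
      assume "insert {n} P \<in> part_add n P ` P"
      then obtain B where "B \<in> P" "insert {n} P = part_add n P B" by blast
      then have "{n} = insert n B" using blk[of "{n}" B] by auto
      then show False using nb \<open>B \<in> P\<close> by blast
    qed
    have H: "T Q \<in> Hom C Z (mobj M)" if "Q \<in> ?J P" for Q using res(2)[OF P that] .
    have "sm Z T (?J P) = pl (T (insert {n} P)) (sm Z T (part_add n P ` P))"
      using fin[OF P] notin H by (intro sum_map_insert[OF Z]) auto
    also have "sm Z T (part_add n P ` P) = sm Z (\<lambda>B. T (part_add n P B)) P"
      using inj H by (intro sum_map_reindex[OF Z]) auto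
    finally show "sm Z T (?J P) = pl (T (insert {n} P)) (sm Z (\<lambda>B. T (part_add n P B)) P)" .
    have "sm Z (\<lambda>B. T (part_add n P B)) P \<in> Hom C Z (mobj M)" using H by (intro sum_map_Hom[OF Z]) auto
    then show "pl (T (insert {n} P)) (sm Z (\<lambda>B. T (part_add n P B)) P) \<in> Hom C Z (mobj M)"
      using H[of "insert {n} P"] by (simp add: Hom_iff)
  qed
  finally show ?thesis .
qed

context cartesian_restriction_category
begin

text \<open>Index sets of natural numbers suffice to test equality. Since they are finite subsets of
  an infinite type, a fresh index is always available.\<close>

lemma faa_eqI_E:
  assumes f: "f \<in> FH M X N Y" and g: "g \<in> FH M X N Y" and 0: "fseq f 0 = fseq g 0"
    and E: "\<And>Z (S::nat set) a x. coh Z (mobj M) X (a ` S) x \<Longrightarrow> \<rho> x = Idn C Z \<Longrightarrow> finite S \<Longrightarrow> S \<noteq> {}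
      \<Longrightarrow> E f S a x = E g S a x"
  shows "f = g"
proof (rule faa_eqI[OF f g 0])
  fix Z m x assume c: "coh Z (mobj M) X (set_mset m) x" "\<rho> x = Idn C Z" "m \<noteq> {#}"
  obtain n and as :: "'m list" where m: "m = image_mset (nth as) (mset_set {..<n})" using ev_indexed by metis
  have ne: "{..<n} \<noteq> {}" using c(3) m by (auto simp: mset_set_empty_iff)
  show "ev f m x = ev g m x" unfolding m
    using E[of Z "nth as" "{..<n}" x] c ne by (simp add: E_def m)
qed

lemma E_Pair:
  assumes f: "f \<in> FH M X N Y" and g: "g \<in> FH M X K V"
    and c: "coh Z (mobj M) X (a ` S) x" "finite S" "S \<noteq> {}"
  shows "E (faa_Pair C f g) S a x = \<langle>E f S a x, E g S a x\<rangle>"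
  unfolding E_def using c by (intro ev_Pair[OF f g]) (auto simp: mset_set_empty_iff)

lemma faa_mapI: "f \<in> FH M X N Y \<Longrightarrow> faa_map C f M X N Y"
  by (simp add: faa_map_def faa_map_axioms_def cartesian_restriction_category_axioms)

text \<open>The tangent functor. Its functoriality is the chain rule.\<close>

definition Tf :: "('o, 'm) faa_ar \<Rightarrow> ('o, 'm) faa_ar" where
  "Tf f = (let (M, X) = fsrc f in
    faa_Pair C (faa_D C f) (faa_Comp C (faa_Pr1 C (M, mobj M) (M, X)) f))"

lemma Comp_Pair_faa:
  assumes h: "h \<in> FH M X N Y" and f: "f \<in> FH N Y K V" and g: "g \<in> FH N Y L W"
  shows "faa_Comp C h (faa_Pair C f g) = faa_Pair C (faa_Comp C h f) (faa_Comp C h g)"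
proof (rule faa_eqI_E)
  let ?p = "faa_Pair C f g"
  note p = Pair_FH[OF f g]
  show "faa_Comp C h ?p \<in> FH M X (prod_monoid C K L) (V \<^bold>\<times> W)" by (rule Comp_FH[OF h p])
  show "faa_Pair C (faa_Comp C h f) (faa_Comp C h g) \<in> FH M X (prod_monoid C K L) (V \<^bold>\<times> W)"
    by (intro Pair_FH Comp_FH[OF h f] Comp_FH[OF h g])
  show "fseq (faa_Comp C h ?p) 0 = fseq (faa_Pair C (faa_Comp C h f) (faa_Comp C h g)) 0"
    using HomD[OF FH_D(7)[OF h]] HomD[OF FH_D(7)[OF f]] HomD[OF FH_D(7)[OF g]] by simp
  interpret f: faa_pair C h f M X N Y K V by (rule faa_pairI[OF h f])
  interpret g: faa_pair C h g M X N Y L W by (rule faa_pairI[OF h g])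
  interpret p: faa_pair C h ?p M X N Y "prod_monoid C K L" "V \<^bold>\<times> W" by (rule faa_pairI[OF h p])
  fix Z and S :: "nat set" and a x
  assume c: "coh Z (mobj M) X (a ` S) x" "finite S" "S \<noteq> {}"
  have Z: "Z \<in> Ob C" using cohD(4)[OF c(1)] .
  have t: "p.tm a x P = \<langle>f.tm a x P, g.tm a x P\<rangle>" if P: "partition_on S P" for P
    using f.coh_block[OF c(1,2) P] c(3) by (intro E_Pair[OF f g]) auto
  have "E (faa_Comp C h ?p) S a x = sum_map C (prod_monoid C K L) Z (\<lambda>P. \<langle>f.tm a x P, g.tm a x P\<rangle>) (partitions S)"
    unfolding p.E_Comp[OF c] p.cs_K using t p.tm_type(1)[OF c] Z
    by (intro crc_monoid.sum_map_cong) (auto simp flip: t)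
  also have "\<dots> = \<langle>E (faa_Comp C h f) S a x, E (faa_Comp C h g) S a x\<rangle>"
    unfolding f.E_Comp[OF c] g.E_Comp[OF c] f.cs_K g.cs_K
    using f.tm_type(1)[OF c] g.tm_type(1)[OF c] Z finitely_many_partition_on[OF c(2)]
    by (intro sum_map_prod_Pair) auto
  also have "\<dots> = E (faa_Pair C (faa_Comp C h f) (faa_Comp C h g)) S a x"
    by (rule E_Pair[OF Comp_FH[OF h f] Comp_FH[OF h g] c, symmetric])
  finally show "E (faa_Comp C h ?p) S a x = E (faa_Pair C (faa_Comp C h f) (faa_Comp C h g)) S a x" .
qed

end

context faa_map
begin

abbreviation "P1 \<equiv> faa_Pr1 C (M, A) (M, X)"
abbreviation "p1f \<equiv> faa_Comp C P1 f"

lemma P1: "P1 \<in> FH MM (A \<^bold>\<times> X) M X" "lin P1"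
  using fPr1_FH[OF cM _ cM ob(1)] lin_fPr1[OF cM _ cM ob(1)] by auto

lemma p1f_FH: "p1f \<in> FH MM (A \<^bold>\<times> X) N Y"
  by (rule Comp_FH[OF P1(1) f])

lemma E_p1f:
  assumes c: "coh Z (A \<^bold>\<times> A) (A \<^bold>\<times> X) (p ` S) q" "finite S" "S \<noteq> {}"
  shows "E p1f S p q = E f S (\<lambda>i. p i \<cdot> pA1) (q \<cdot> pX1)"
proof -
  interpret faa_pair C P1 f MM "A \<^bold>\<times> X" M X N Y by (rule faa_pairI[OF P1(1) f])
  have c': "coh Z (mobj MM) (A \<^bold>\<times> X) (p ` S) q" using c by simp
  have "E p1f S p q = E f S (\<lambda>i. ev P1 {#p i#} q) (q \<cdot> pX1)"
    using E_Comp_lin_left[OF P1(2) c' c(2,3)] by simp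
  also have "\<dots> = E f S (\<lambda>i. p i \<cdot> pA1) (q \<cdot> pX1)"
    using c(1) by (intro E_cong ev_fPr1) (auto elim: coh_mono)
  finally show ?thesis .
qed

lemma T_eq: "Tf f = faa_Pair C df p1f"
  using FH_D(5)[OF f] by (simp add: Tf_def)

lemma T_FH: "Tf f \<in> FH MM (A \<^bold>\<times> X) (prod_monoid C N N) (mobj N \<^bold>\<times> Y)"
  unfolding T_eq by (rule Pair_FH[OF D_FH p1f_FH])

lemma fseq_T: "fseq (Tf f) 0 = \<langle>fseq f 1, pX1 \<cdot> fseq f 0\<rangle>"
  unfolding T_eq by (simp add: D_simps)

lemma E_T:
  assumes c: "coh Z (A \<^bold>\<times> A) (A \<^bold>\<times> X) (p ` S) q" "finite S" "S \<noteq> {}"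
  shows "E (Tf f) S p q = \<langle>dd Z S p q, E f S (\<lambda>i. p i \<cdot> pA1) (q \<cdot> pX1)\<rangle>"
  unfolding T_eq using E_Pair[OF D_FH p1f_FH, of Z p S q] c E_D[OF c(1,2)] E_p1f[OF c] by simp

text \<open>Both components of \<open>Tf f\<close> have the same domain, so projecting introduces no
  restriction. The four values are the arguments \<open>v\<close>, \<open>w\<close>,
  \<open>a\<close> and \<open>x\<close> that a derivative composed with \<open>Tf f\<close>
  receives.\<close>

lemma T_coh:
  assumes c: "coh Z (A \<^bold>\<times> A) (A \<^bold>\<times> X) (p ` S) q" "finite S" "S \<noteq> {}"
  shows "E (Tf f) S p q \<cdot> Pr0 C (mobj N) (mobj N) = dd Z S p q"
    "E (Tf f) S p q \<cdot> Pr1 C (mobj N) (mobj N) = E f S (\<lambda>i. p i \<cdot> pA1) (q \<cdot> pX1)"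
    "(q \<cdot> fseq (Tf f) 0) \<cdot> Pr0 C (mobj N) Y = ev f {#q \<cdot> pX0#} (q \<cdot> pX1)"
    "(q \<cdot> fseq (Tf f) 0) \<cdot> Pr1 C (mobj N) Y = (q \<cdot> pX1) \<cdot> fseq f 0"
proof -
  note cD = coh_D[OF c(1)]
  have c2: "coh Z A X ((\<lambda>i. p i \<cdot> pA1) ` S) (q \<cdot> pX1)" by (rule coh_mono[OF cD]) auto
  note ty = ds_type[OF cD c(2)] E_Hom[OF f c2 c(2,3)] E_Rst[OF f c2 c(2)]
  show "E (Tf f) S p q \<cdot> Pr0 C (mobj N) (mobj N) = dd Z S p q"
    "E (Tf f) S p q \<cdot> Pr1 C (mobj N) (mobj N) = E f S (\<lambda>i. p i \<cdot> pA1) (q \<cdot> pX1)"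
    unfolding E_T[OF c] using ty by (auto intro!: Pair_Comp_Pr_same[of _ Z])
  have q: "q \<in> Ar C" "Dom C q = Z" "Cod C q = A \<^bold>\<times> X" "Z \<in> Ob C"
    using cohD(1,4)[OF c(1)] by (auto simp: Hom_iff)
  note f1' = HomD[OF f1(1)]
  have "coh Z A X (set [q \<cdot> pX0]) (q \<cdot> pX1)" using q by (simp add: coh_def Hom_iff)
  from ev_mset[OF f this] have "ev f {#q \<cdot> pX0#} (q \<cdot> pX1) = \<langle>q \<cdot> pX0, q \<cdot> pX1\<rangle> \<cdot> fseq f 1" by (simp add: app_tup)
  also have "\<langle>q \<cdot> pX0, q \<cdot> pX1\<rangle> = q" using q by simp
  finally have 1: "ev f {#q \<cdot> pX0#} (q \<cdot> pX1) = q \<cdot> fseq f 1" .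
  have 2: "q \<cdot> fseq (Tf f) 0 = \<langle>q \<cdot> fseq f 1, q \<cdot> (pX1 \<cdot> fseq f 0)\<rangle>"
    unfolding fseq_T using q f1' by (intro Comp_Pair) simp_all
  have R: "\<rho> (q \<cdot> fseq f 1) = \<rho> (q \<cdot> (pX1 \<cdot> fseq f 0))"
    using q f1' f1(2) by (intro Rst_mono_eq) simp_all
  show "(q \<cdot> fseq (Tf f) 0) \<cdot> Pr0 C (mobj N) Y = ev f {#q \<cdot> pX0#} (q \<cdot> pX1)"
    unfolding 1 2 by (rule Pair_Comp_Pr_same(1)[of _ Z, OF _ _ R]) (use q f1' in \<open>simp_all add: Hom_iff\<close>)
  have "(q \<cdot> fseq (Tf f) 0) \<cdot> Pr1 C (mobj N) Y = q \<cdot> (pX1 \<cdot> fseq f 0)"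
    unfolding 2 by (rule Pair_Comp_Pr_same(2)[of _ Z, OF _ _ R]) (use q f1' in \<open>simp_all add: Hom_iff\<close>)
  then show "(q \<cdot> fseq (Tf f) 0) \<cdot> Pr1 C (mobj N) Y = (q \<cdot> pX1) \<cdot> fseq f 0" using q by simp
qed

end

context faa_pair
begin

sublocale f: faa_map C f M X N Y by (rule faa_mapI[OF f])
sublocale g: faa_map C g N Y K V by (rule faa_mapI[OF g])
sublocale fg: faa_map C fg M X K V by (rule faa_mapI[OF Comp_FH])

text \<open>A new singleton block gives \<open>g\<close> the additional argument
  \<open>f\<^sub>1(a, x)\<close>. This is the first summand in the derivative of
  \<open>g\<close>.\<close>

lemma tm_insert_singleton:
  assumes P: "partition_on S P" and n: "n \<notin> S" and S: "finite S"
  shows "tm (w(n := a)) x (insert {n} P)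
    = ev g (add_mset (ev f {#a#} x) (image_mset (\<lambda>B. E f B w x) (mset_set P))) (x \<cdot> fseq f 0)"
proof -
  have fin: "finite P" using P S finite_elements by blast
  have "E f B (w(n := a)) x = E f B w x" if "B \<in> P" for B
    using partition_on_block[OF P that] n by (intro E_cong) auto
  then have "image_mset (\<lambda>B. E f B (w(n := a)) x) (mset_set P) = image_mset (\<lambda>B. E f B w x) (mset_set P)"
    using fin by (intro image_mset_cong) auto
  then show ?thesis
    using E_insert[OF fin part_insert(3)[OF P n], of g "\<lambda>B. E f B (w(n := a)) x"]
    by (simp add: E_singleton)
qed

text \<open>The block \<open>insert n B\<close> takes the place of \<open>B\<close>, so
  \<open>g\<close> keeps the number of its arguments while \<open>f\<close> receives one more at
  this block. This is the first summand of the derivative of \<open>f\<close> at \<open>B\<close>,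
  inside the summand of the derivative of \<open>g\<close> that distinguishes
  \<open>B\<close>.\<close>

lemma tm_part_add:
  assumes P: "partition_on S P" and n: "n \<notin> S" and S: "finite S" and B: "B \<in> P"
  shows "tm (w(n := a)) x (part_add n P B)
    = E g P ((\<lambda>B. E f B w x)(B := ev f (add_mset a (image_mset w (mset_set B))) x)) (x \<cdot> fseq f 0)"
proof -
  have fin: "finite P" "finite B" using P S B finite_elements partition_on_finite_block by blast+
  have nB: "n \<notin> B'" if "B' \<in> P" for B' using partition_on_block[OF P that] n by auto
  have "E f B' (w(n := a)) x = E f B' w x" if "B' \<in> P" for B'
    using nB[OF that] by (intro E_cong) auto
  then have 1: "image_mset (\<lambda>B. E f B (w(n := a)) x) (mset_set (P - {B})) = image_mset (\<lambda>B. E f B w x) (mset_set (P - {B}))"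
    using fin by (intro image_mset_cong) auto
  have "image_mset (w(n := a)) (mset_set B) = image_mset w (mset_set B)"
    using fin nB[OF B] by (intro image_mset_cong) auto
  then have 2: "E f (insert n B) (w(n := a)) x = ev f (add_mset a (image_mset w (mset_set B))) x"
    using E_insert[OF fin(2) nB[OF B], of f "w(n := a)"] by simp
  have "insert n B \<notin> P - {B}" using part_add(3)[OF P n B] by simp
  then have "tm (w(n := a)) x (part_add n P B) = ev g (add_mset (E f (insert n B) (w(n := a)) x)
     (image_mset (\<lambda>B. E f B (w(n := a)) x) (mset_set (P - {B})))) (x \<cdot> fseq f 0)"
    unfolding part_add_def using fin by (subst E_insert) auto
  then show ?thesis unfolding 1 2 E_update[OF fin(1) B] .
qed

lemma tm_update_block:
  assumes P: "partition_on S P" and S: "finite S" and B: "B \<in> P" "j \<in> B"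
  shows "tm (w(j := d)) x P = E g P ((\<lambda>B. E f B w x)(B := E f B (w(j := d)) x)) (x \<cdot> fseq f 0)"
proof (rule E_cong)
  fix B' assume B': "B' \<in> P"
  show "E f B' (w(j := d)) x = ((\<lambda>B. E f B w x)(B := E f B (w(j := d)) x)) B'"
  proof (cases "B' = B")
    case False
    then have "j \<notin> B'" using P B B' by (auto simp: partition_on_def disjoint_def)
    then have "E f B' (w(j := d)) x = E f B' w x" by (intro E_cong) auto
    then show ?thesis using False by simp
  qed simp
qed

text \<open>The core of the chain rule: a partition of \<open>S\<close> with an additional point either has that point
  as a singleton block, or has it added to a block of a partition of \<open>S\<close>.\<close>

lemma ds_Comp:
  fixes S :: "nat set"
  assumes c: "coh Z (mobj M) X (insert a (v ` S \<union> w ` S)) x" "finite S" "S \<noteq> {}"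
  shows "fg.ds Z S v w a x = sum_map C K Z (\<lambda>P. g.ds Z P (\<lambda>B. f.ds Z B v w a x) (\<lambda>B. E f B w x)
    (ev f {#a#} x) (x \<cdot> fseq f 0)) (partitions S)"
proof -
  have Z: "Z \<in> Ob C" using cohD(4)[OF c(1)] .
  \<comment> \<open>The fresh index carries the additional argument \<open>a\<close> in the first
    summand of \<open>fg.ds\<close>, which thus becomes a Faa di Bruno sum over
    \<open>insert n S\<close>.\<close>
  obtain n where n: "n \<notin> S" using c(2) by (metis ex_new_if_finite infinite_UNIV_nat)
  let ?F = "\<lambda>B. E f B w x" and ?y = "x \<cdot> fseq f 0"
  let ?u = "\<lambda>B. ev f (add_mset a (image_mset w (mset_set B))) x"
  let ?s = "\<lambda>B j. E f B (w(j := v j)) x"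
  \<comment> \<open>In \<open>t1\<close> the fresh index forms a block of its own, in
    \<open>t2\<close> it is added to the block \<open>B\<close>. The terms \<open>t3\<close> come
    from the summands of \<open>fg.ds\<close> in which the variable of an index \<open>j\<close> of
    \<open>S\<close> is replaced by \<open>v j\<close>.\<close>
  define t1 where "t1 P = ev g (add_mset (ev f {#a#} x) (image_mset ?F (mset_set P))) ?y" for P
  define t2 where "t2 P B = E g P (?F(B := ?u B)) ?y" for P B
  define t3 where "t3 P j = tm (w(j := v j)) x P" for P j
  let ?s3 = "\<lambda>P. sum_map C K Z (t3 P) S"
  have fp: "finite (partitions S)" using finitely_many_partition_on[OF c(2)] .
  have fin: "finite P" if "partition_on S P" for P using that c(2) finite_elements by blast
  have cn: "coh Z (mobj M) X ((w(n := a)) ` insert n S) x" using n by (intro coh_mono[OF c(1)]) auto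
  have cw: "coh Z (mobj M) X (w ` S) x" by (rule coh_mono[OF c(1)]) auto
  have cj: "coh Z (mobj M) X ((w(j := v j)) ` S) x" if "j \<in> S" for j
    using that by (intro coh_mono[OF c(1)]) auto
  note tmn = tm_type(1)[OF cn]
  have T: "tm (w(n := a)) x Q \<in> Hom C Z (mobj K)" if "partition_on (insert n S) Q" for Q
    using tmn[OF _ _ that] c(2) by simp
  have t1: "t1 P = tm (w(n := a)) x (insert {n} P)" "t1 P \<in> Hom C Z (mobj K)" if P: "partition_on S P" for P
  proof -
    show "t1 P = tm (w(n := a)) x (insert {n} P)"
      unfolding t1_def tm_insert_singleton[OF P n c(2)] ..
    then show "t1 P \<in> Hom C Z (mobj K)" using T part_insert(1)[OF P n] by simp
  qed
  have t2: "t2 P B = tm (w(n := a)) x (part_add n P B)" "t2 P B \<in> Hom C Z (mobj K)"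
    if P: "partition_on S P" and B: "B \<in> P" for P B
  proof -
    show "t2 P B = tm (w(n := a)) x (part_add n P B)"
      unfolding t2_def tm_part_add[OF P n c(2) B] ..
    then show "t2 P B \<in> Hom C Z (mobj K)" using T part_add(1)[OF P n B] by simp
  qed
  have t3: "t3 P j \<in> Hom C Z (mobj K)" if "partition_on S P" "j \<in> S" for P j
    unfolding t3_def by (rule tm_type(1)[OF cj[OF that(2)] c(2,3) that(1)])
  have s2: "sum_map C K Z (t2 P) P \<in> Hom C Z (mobj K)" if P: "partition_on S P" for P
    using t2(2)[OF P] Z by (intro crc_monoid.sum_map_Hom) auto
  have s3: "?s3 P \<in> Hom C Z (mobj K)" if P: "partition_on S P" for P
    using t3[OF P] Z by (intro crc_monoid.sum_map_Hom) auto
  have "E fg (insert n S) (w(n := a)) x = ev fg (add_mset a (image_mset (w(n := a)) (mset_set S))) x"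
    using E_insert[OF c(2) n, of fg "w(n := a)"] by simp
  also have "image_mset (w(n := a)) (mset_set S) = image_mset w (mset_set S)"
    using n c(2) by (intro image_mset_cong) auto
  finally have "ev fg (add_mset a (image_mset w (mset_set S))) x = E fg (insert n S) (w(n := a)) x" ..
  also have "\<dots> = sum_map C K Z (tm (w(n := a)) x) (partitions (insert n S))"
    using E_Comp[OF cn] c(2) unfolding cs_K by simp
  also have "\<dots> = sum_map C K Z (\<lambda>P. plus_map C K (tm (w(n := a)) x (insert {n} P))
      (sum_map C K Z (\<lambda>B. tm (w(n := a)) x (part_add n P B)) P)) (partitions S)"
    by (rule crc_monoid.sum_map_partitions_insert[OF cK Z c(2) n T])
  also have "\<dots> = sum_map C K Z (\<lambda>P. plus_map C K (t1 P) (sum_map C K Z (t2 P) P)) (partitions S)"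
  proof (rule crc_monoid.sum_map_cong[OF cK Z])
    fix P assume "P \<in> partitions S"
    then have P: "partition_on S P" by simp
    have "sum_map C K Z (\<lambda>B. tm (w(n := a)) x (part_add n P B)) P = sum_map C K Z (t2 P) P"
      by (rule crc_monoid.sum_map_cong[OF cK Z]) (use t2[OF P] in auto)
    then show "plus_map C K (tm (w(n := a)) x (insert {n} P))
      (sum_map C K Z (\<lambda>B. tm (w(n := a)) x (part_add n P B)) P) = plus_map C K (t1 P) (sum_map C K Z (t2 P) P)"
      using t1(1)[OF P] by simp
    show "plus_map C K (t1 P) (sum_map C K Z (t2 P) P) \<in> Hom C Z (mobj K)"
      using t1(2)[OF P] s2[OF P] by (simp add: Hom_iff)
  qed
  finally have L1: "ev fg (add_mset a (image_mset w (mset_set S))) x =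
    sum_map C K Z (\<lambda>P. plus_map C K (t1 P) (sum_map C K Z (t2 P) P)) (partitions S)" .
  have "sum_map C K Z (\<lambda>j. E fg S (w(j := v j)) x) S = sum_map C K Z (\<lambda>j. sum_map C K Z (\<lambda>P. t3 P j) (partitions S)) S"
  proof (rule crc_monoid.sum_map_cong[OF cK Z])
    fix j assume j: "j \<in> S"
    show "E fg S (w(j := v j)) x = sum_map C K Z (\<lambda>P. t3 P j) (partitions S)"
      unfolding E_Comp[OF cj[OF j] c(2,3)] cs_K t3_def ..
    show "sum_map C K Z (\<lambda>P. t3 P j) (partitions S) \<in> Hom C Z (mobj K)"
      using t3 j Z by (intro crc_monoid.sum_map_Hom) auto
  qed
  also have "\<dots> = sum_map C K Z ?s3 (partitions S)"
    using t3 by (intro crc_monoid.sum_map_swap[OF cK Z c(2) fp]) auto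
  finally have L2: "sum_map C K Z (\<lambda>j. E fg S (w(j := v j)) x) S = sum_map C K Z ?s3 (partitions S)" .
  have "fg.ds Z S v w a x = plus_map C K
     (sum_map C K Z (\<lambda>P. plus_map C K (t1 P) (sum_map C K Z (t2 P) P)) (partitions S))
     (sum_map C K Z ?s3 (partitions S))"
    unfolding fg.ds_def L1 L2 ..
  also have "\<dots> = sum_map C K Z (\<lambda>P. plus_map C K (plus_map C K (t1 P) (sum_map C K Z (t2 P) P)) (?s3 P)) (partitions S)"
  proof (rule crc_monoid.sum_map_plus[OF cK Z, symmetric])
    fix P assume "P \<in> partitions S"
    then show "plus_map C K (t1 P) (sum_map C K Z (t2 P) P) \<in> Hom C Z (mobj K)" "?s3 P \<in> Hom C Z (mobj K)"
      using t1(2) s2 s3 by (simp_all add: Hom_iff)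
  qed
  also have "\<dots> = sum_map C K Z (\<lambda>P. g.ds Z P (\<lambda>B. f.ds Z B v w a x) ?F (ev f {#a#} x) ?y) (partitions S)"
  proof (rule crc_monoid.sum_map_cong[OF cK Z])
    fix P assume "P \<in> partitions S"
    then have P: "partition_on S P" by simp
    have sub: "B \<subseteq> S" "B \<noteq> {}" "finite B" if "B \<in> P" for B
      using partition_on_block[OF P that] partition_on_finite_block[OF c(2) P that] by auto
    let ?s3' = "\<lambda>B. sum_map C K Z (t3 P) B"
    have s3': "?s3' B \<in> Hom C Z (mobj K)" if "B \<in> P" for B
      using t3[OF P] sub[OF that] Z by (intro crc_monoid.sum_map_Hom) auto
    \<comment> \<open>Every \<open>j\<close> lies in exactly one block of \<open>P\<close>, so the
      sum over \<open>S\<close> splits into sums over the blocks.\<close>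
    have "?s3 P = sum_map C K Z (t3 P) (\<Union>B\<in>P. B)" using P by (simp add: partition_on_def)
    also have "\<dots> = sum_map C K Z ?s3' P"
    proof (rule crc_monoid.sum_map_UN[OF cK Z fin[OF P]])
      show "B \<inter> B' = {}" if "B \<in> P" "B' \<in> P" "B \<noteq> B'" for B B'
        using P that by (auto simp: partition_on_def disjoint_def)
      show "t3 P j \<in> Hom C Z (mobj K)" if "B \<in> P" "j \<in> B" for B j
        by (rule t3[OF P subsetD[OF sub(1)[OF that(1)] that(2)]])
    qed (use sub in auto)
    finally have e3: "?s3 P = sum_map C K Z ?s3' P" .
    have "plus_map C K (plus_map C K (t1 P) (sum_map C K Z (t2 P) P)) (?s3 P)
      = plus_map C K (t1 P) (plus_map C K (sum_map C K Z (t2 P) P) (?s3 P))"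
      using t1(2)[OF P] s2[OF P] s3[OF P] by (intro crc_monoid.plus_map_assoc[OF cK]) (simp_all add: Hom_iff)
    also have "plus_map C K (sum_map C K Z (t2 P) P) (?s3 P) = sum_map C K Z (\<lambda>B. plus_map C K (t2 P B) (?s3' B)) P"
      unfolding e3 using t2(2)[OF P] s3' by (intro crc_monoid.sum_map_plus[OF cK Z, symmetric]) auto
    also have "\<dots> = sum_map C K Z (\<lambda>B. E g P (?F(B := f.ds Z B v w a x)) ?y) P"
    proof (rule crc_monoid.sum_map_cong[OF cK Z])
      fix B assume B: "B \<in> P"
      have cB: "coh Z (mobj M) X (insert a (v ` B \<union> w ` B)) x"
        using sub(1)[OF B] by (intro coh_mono[OF c(1)]) auto
      note fB = f.ds_summands[OF cB sub(3)[OF B]] f.ds_sum[OF cB sub(3)[OF B]]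
      have cF: "coh Z (mobj N) Y (?F ` (P - {B})) ?y"
        by (rule coh_mono[OF coh_block(1)[OF cw c(2) P]]) auto
      have c1: "coh Z (mobj N) Y (?s B ` B \<union> ?F ` (P - {B})) ?y"
        using cF fB(3,4) unfolding coh_def by blast
      have c2: "coh Z (mobj N) Y (insert (?u B) (insert (sum_map C N Z (?s B) B) (?F ` (P - {B})))) ?y"
        using cF fB(1,2,5) fB(6)[OF sub(2)[OF B]] unfolding coh_def by blast
      have "?s3' B = sum_map C K Z (\<lambda>j. E g P (?F(B := ?s B j)) ?y) B"
      proof (rule crc_monoid.sum_map_cong[OF cK Z])
        fix j assume j: "j \<in> B"
        show "t3 P j = E g P (?F(B := ?s B j)) ?y" unfolding t3_def by (rule tm_update_block[OF P c(2) B j])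
        then show "E g P (?F(B := ?s B j)) ?y \<in> Hom C Z (mobj K)" using t3[OF P, of j] sub(1)[OF B] j by auto
      qed
      also have "\<dots> = E g P (?F(B := sum_map C N Z (?s B) B)) ?y"
        by (rule E_update_sum[OF g fin[OF P] B c1 sub(3,2)[OF B], symmetric])
      finally have e: "?s3' B = E g P (?F(B := sum_map C N Z (?s B) B)) ?y" .
      \<comment> \<open>Additivity of \<open>g\<close> in the argument at \<open>B\<close> unites
        the term with the fresh index in \<open>B\<close> and the terms for the indices
        \<open>j\<close> of \<open>B\<close>. These are precisely the two parts of the derivative of
        \<open>f\<close> at \<open>B\<close>.\<close>
      show eB: "plus_map C K (t2 P B) (?s3' B) = E g P (?F(B := f.ds Z B v w a x)) ?y"
        unfolding e t2_def f.ds_def by (rule E_update_plus[OF g fin[OF P] B c2, symmetric])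
      have "plus_map C K (t2 P B) (?s3' B) \<in> Hom C Z (mobj K)"
        using t2(2)[OF P B] s3'[OF B] by (simp add: Hom_iff)
      then show "E g P (?F(B := f.ds Z B v w a x)) ?y \<in> Hom C Z (mobj K)" unfolding eB .
    qed
    also have "plus_map C K (t1 P) \<dots> = g.ds Z P (\<lambda>B. f.ds Z B v w a x) ?F (ev f {#a#} x) ?y"
      unfolding g.ds_def t1_def ..
    finally show eP: "plus_map C K (plus_map C K (t1 P) (sum_map C K Z (t2 P) P)) (?s3 P)
      = g.ds Z P (\<lambda>B. f.ds Z B v w a x) ?F (ev f {#a#} x) ?y" .
    have "plus_map C K (plus_map C K (t1 P) (sum_map C K Z (t2 P) P)) (?s3 P) \<in> Hom C Z (mobj K)"
      using t1(2)[OF P] s2[OF P] s3[OF P] by (simp add: Hom_iff)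
    then show "g.ds Z P (\<lambda>B. f.ds Z B v w a x) ?F (ev f {#a#} x) ?y \<in> Hom C Z (mobj K)" unfolding eP .
  qed
  finally show ?thesis .
qed

text \<open>With \<open>Tf\<close> unfolded this is [DR.5]. By \<open>ds_Comp\<close> it remains to
  verify that \<open>Tf f\<close> supplies the derivative of \<open>g\<close> with the right
  arguments at every block, which is \<open>T_coh\<close>.\<close>

lemma D_Comp: "faa_D C fg = faa_Comp C (Tf f) (faa_D C g)"
proof (rule faa_eqI_E)
  interpret T: faa_pair C "Tf f" "faa_D C g" f.MM "f.A \<^bold>\<times> X" "prod_monoid C N N" "mobj N \<^bold>\<times> Y" K "mobj K"
    by (rule faa_pairI[OF f.T_FH g.D_FH])
  show "faa_D C fg \<in> FH f.MM (f.A \<^bold>\<times> X) K (mobj K)" by (rule fg.D_FH)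
  show "faa_Comp C (Tf f) (faa_D C g) \<in> FH f.MM (f.A \<^bold>\<times> X) K (mobj K)" by (rule T.Comp_FH)
  have cA: "coh (f.A \<^bold>\<times> X) f.A X {f.pX0} f.pX1" by (simp add: coh_def Hom_iff)
  have "coh (f.A \<^bold>\<times> X) (mobj N) Y (set [ev f {#f.pX0#} f.pX1]) (f.pX1 \<cdot> fseq f 0)"
    using ev_Hom[OF f, of _ "{#f.pX0#}"] ev_Rst[OF f, of _ "{#f.pX0#}"] cA by (simp add: coh_def Hom_iff)
  note e = ev_mset[OF g this]
  show "fseq (faa_D C fg) 0 = fseq (faa_Comp C (Tf f) (faa_D C g)) 0"
    using fseq_1[OF Comp_FH] ev_Comp_singleton[OF cA] e fseq_1[OF f]
    by (simp add: fg.D_simps g.D_simps f.fseq_T app_tup)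
  fix Z and S :: "nat set" and p q
  assume "coh Z (mobj f.MM) (f.A \<^bold>\<times> X) (p ` S) q" and S: "finite S" "S \<noteq> {}"
  then have c: "coh Z (f.A \<^bold>\<times> f.A) (f.A \<^bold>\<times> X) (p ` S) q" and c': "coh Z (mobj f.MM) (f.A \<^bold>\<times> X) (p ` S) q" by simp_all
  note cD = f.coh_D[OF c]
  have Z: "Z \<in> Ob C" using cohD(4)[OF c] .
  let ?v = "\<lambda>i. p i \<cdot> f.pA0" and ?w = "\<lambda>i. p i \<cdot> f.pA1" and ?a = "q \<cdot> f.pX0" and ?x = "q \<cdot> f.pX1"
  let ?G = "\<lambda>B. E (Tf f) B p q" and ?q = "q \<cdot> fseq (Tf f) 0"
  have t: "T.tm p q P = g.ds Z P (\<lambda>B. f.ds Z B ?v ?w ?a ?x) (\<lambda>B. E f B ?w ?x) (ev f {#?a#} ?x) (?x \<cdot> fseq f 0)"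
    if P: "partition_on S P" for P
  proof -
    note b = T.coh_block[OF c' S(1) P]
    have b': "coh Z (mobj N \<^bold>\<times> mobj N) (mobj N \<^bold>\<times> Y) (?G ` P) ?q" using b(1) by simp
    have G: "?G B \<cdot> g.pA0 = f.ds Z B ?v ?w ?a ?x" "?G B \<cdot> g.pA1 = E f B ?w ?x" if B: "B \<in> P" for B
    proof -
      have "coh Z (f.A \<^bold>\<times> f.A) (f.A \<^bold>\<times> X) (p ` B) q"
        using partition_on_block[OF P B] by (intro coh_mono[OF c]) auto
      from f.T_coh(1,2)[OF this] show "?G B \<cdot> g.pA0 = f.ds Z B ?v ?w ?a ?x" "?G B \<cdot> g.pA1 = E f B ?w ?x"
        using partition_on_block[OF P B] partition_on_finite_block[OF S(1) P B] by auto
    qed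
    have "T.tm p q P = g.dd Z P ?G ?q" by (rule g.E_D[OF b' b(2)])
    also have "\<dots> = g.ds Z P (\<lambda>B. f.ds Z B ?v ?w ?a ?x) (\<lambda>B. E f B ?w ?x) (?q \<cdot> g.pX0) (?q \<cdot> g.pX1)"
      by (rule g.ds_cong[OF g.coh_D[OF b'] b(2)]) (use G in auto)
    finally show ?thesis unfolding f.T_coh(3,4)[OF c S] .
  qed
  have "E (faa_D C fg) S p q = fg.ds Z S ?v ?w ?a ?x" by (rule fg.E_D[OF c S(1)])
  also have "\<dots> = sum_map C K Z (T.tm p q) (partitions S)"
    unfolding ds_Comp[OF cD S]
    by (rule crc_monoid.sum_map_cong[OF cK Z]) (use t T.tm_type(1)[OF c' S] in auto)
  also have "\<dots> = E (faa_Comp C (Tf f) (faa_D C g)) S p q"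
    unfolding T.E_Comp[OF c' S] T.cs_K ..
  finally show "E (faa_D C fg) S p q = E (faa_Comp C (Tf f) (faa_D C g)) S p q" .
qed

text \<open>The first component is the chain rule. The second expresses naturality of the projection
  from the tangent object; it is compared term by term, because associativity in
  \<open>faa C\<close> is still open.\<close>

lemma T_Comp: "Tf fg = faa_Comp C (Tf f) (Tf g)"
proof -
  have "faa_Comp C (Tf f) g.p1f = faa_Comp C f.P1 fg"
  proof (rule faa_eqI_E)
    interpret T: faa_pair C "Tf f" g.p1f f.MM "f.A \<^bold>\<times> X" "prod_monoid C N N" "mobj N \<^bold>\<times> Y" K V
      by (rule faa_pairI[OF f.T_FH g.p1f_FH])
    show "faa_Comp C (Tf f) g.p1f \<in> FH f.MM (f.A \<^bold>\<times> X) K V" by (rule T.Comp_FH)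
    show "faa_Comp C f.P1 fg \<in> FH f.MM (f.A \<^bold>\<times> X) K V" by (rule fg.p1f_FH)
    have R: "\<rho> (fseq f 1) = \<rho> (f.pX1 \<cdot> fseq f 0)" using f.f1 by simp
    have "\<langle>fseq f 1, f.pX1 \<cdot> fseq f 0\<rangle> \<cdot> Pr1 C (mobj N) Y = f.pX1 \<cdot> fseq f 0"
      by (rule Pair_Comp_Pr_same(2)[OF _ _ R]) (use f.f1 in \<open>simp_all add: Hom_iff\<close>)
    then show "fseq (faa_Comp C (Tf f) g.p1f) 0 = fseq (faa_Comp C f.P1 fg) 0"
      using HomD[OF f.f1(1)] assoc[of "\<langle>fseq f 1, f.pX1 \<cdot> fseq f 0\<rangle>" "Pr1 C (mobj N) Y" "fseq g 0"]
      by (simp add: f.fseq_T del: Pair_Comp_Pr1 Pair_Comp_Pr1_Comp)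
    fix Z and S :: "nat set" and p q
    assume "coh Z (mobj f.MM) (f.A \<^bold>\<times> X) (p ` S) q" and S: "finite S" "S \<noteq> {}"
    then have c: "coh Z (f.A \<^bold>\<times> f.A) (f.A \<^bold>\<times> X) (p ` S) q" and c': "coh Z (mobj f.MM) (f.A \<^bold>\<times> X) (p ` S) q" by simp_all
    have Z: "Z \<in> Ob C" using cohD(4)[OF c] .
    let ?w = "\<lambda>i. p i \<cdot> f.pA1" and ?x = "q \<cdot> f.pX1"
    have cw: "coh Z f.A X (?w ` S) ?x" by (rule coh_mono[OF f.coh_D[OF c]]) auto
    have t: "T.tm p q P = tm ?w ?x P" if P: "partition_on S P" for P
    proof -
      note b = T.coh_block[OF c' S(1) P]
      have b': "coh Z (mobj N \<^bold>\<times> mobj N) (mobj N \<^bold>\<times> Y) ((\<lambda>B. E (Tf f) B p q) ` P) (q \<cdot> fseq (Tf f) 0)" using b(1) by simp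
      have G: "E (Tf f) B p q \<cdot> g.pA1 = E f B ?w ?x" if B: "B \<in> P" for B
      proof -
        have "coh Z (f.A \<^bold>\<times> f.A) (f.A \<^bold>\<times> X) (p ` B) q"
          using partition_on_block[OF P B] by (intro coh_mono[OF c]) auto
        from f.T_coh(2)[OF this] show "E (Tf f) B p q \<cdot> g.pA1 = E f B ?w ?x"
          using partition_on_block[OF P B] partition_on_finite_block[OF S(1) P B] by auto
      qed
      have "T.tm p q P = E g P (\<lambda>B. E (Tf f) B p q \<cdot> g.pA1) ((q \<cdot> fseq (Tf f) 0) \<cdot> g.pX1)"
        by (rule g.E_p1f[OF b' b(2) b(3)[OF S(2)]])
      also have "\<dots> = E g P (\<lambda>B. E f B ?w ?x) ((q \<cdot> fseq (Tf f) 0) \<cdot> g.pX1)"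
        by (rule E_cong) (rule G)
      finally show ?thesis unfolding f.T_coh(4)[OF c S] .
    qed
    have "E (faa_Comp C (Tf f) g.p1f) S p q = sum_map C K Z (T.tm p q) (partitions S)"
      unfolding T.E_Comp[OF c' S] T.cs_K ..
    also have "\<dots> = E fg S ?w ?x"
      unfolding E_Comp[OF cw S] cs_K
      by (rule crc_monoid.sum_map_cong[OF cK Z]) (use t tm_type(1)[OF cw S] in auto)
    also have "\<dots> = E (faa_Comp C f.P1 fg) S p q" by (rule fg.E_p1f[OF c S, symmetric])
    finally show "E (faa_Comp C (Tf f) g.p1f) S p q = E (faa_Comp C f.P1 fg) S p q" .
  qed
  then show ?thesis unfolding fg.T_eq D_Comp g.T_eq
    using Comp_Pair_faa[OF f.T_FH g.D_FH g.p1f_FH] by simp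
qed

end

section \<open>Associativity from the chain rule\<close>

context faa_map
begin

text \<open>Every summand containing some \<open>v j\<close> has a zero argument. What remains is
  the component of \<open>f\<close> with one argument more than there are indices.\<close>

lemma zero_sum:
  assumes c: "coh Z A X (insert a (w ` S)) x" "finite S"
  shows "ds Z S (\<lambda>i. \<rho> x \<cdot> zero_map C M Z) w a x = ev f (add_mset a (image_mset w (mset_set S))) x"
proof -
  let ?e = "ev f (add_mset a (image_mset w (mset_set S))) x"
  note x = cohD(1,4)[OF c(1)]
  have c': "coh Z A X (set_mset (add_mset a (image_mset w (mset_set S)))) x" using c by simp
  have e: "?e \<in> Hom C Z (mobj N)" "\<rho> ?e = \<rho> (x \<cdot> fseq f 0)"
    by (rule ev_Hom[OF f c'], simp) (rule ev_Rst[OF f c'])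
  have t: "E f S (w(j := \<rho> x \<cdot> zero_map C M Z)) x = \<rho> ?e \<cdot> zero_map C N Z" if j: "j \<in> S" for j
    unfolding e(2) by (rule E_update_rzero[OF f c(2) j]) (rule coh_mono[OF c(1)], auto)
  show ?thesis unfolding ds_def
    by (rule crc_monoid.sum_map_rzero[OF cN c(2) e(1)]) (rule t)
qed

text \<open>Setting all variables \<open>v\<close> to zero recovers a component of \<open>f\<close>
  from the component of the derivative with one argument less. Totality of \<open>x\<close> makes
  the total zero map coherent with it.\<close>

lemma ev_from_D:
  assumes c: "coh Z A X (insert a (w ` S)) x" "finite S" and x: "\<rho> x = Idn C Z"
  shows "ev f (add_mset a (image_mset w (mset_set S))) x = E df S (\<lambda>i. \<langle>zero_map C M Z, w i\<rangle>) \<langle>a, x\<rangle>"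
proof -
  let ?z = "zero_map C M Z" and ?p = "\<lambda>i. \<langle>zero_map C M Z, w i\<rangle>" and ?q = "\<langle>a, x\<rangle>"
  note Z = cohD(4)[OF c(1)]
  have h: "a \<in> Ar C" "Dom C a = Z" "Cod C a = A" "\<rho> a = Idn C Z" "x \<in> Ar C" "Dom C x = Z" "Cod C x = X"
    using c(1) cohD(1)[OF c(1)] x by (auto simp: coh_insert Hom_iff)
  have w: "w i \<in> Ar C" "Dom C (w i) = Z" "Cod C (w i) = A" "\<rho> (w i) = Idn C Z" if "i \<in> S" for i
    using c(1) that x by (auto simp: coh_def Hom_iff)
  have "coh Z (A \<^bold>\<times> A) (A \<^bold>\<times> X) (?p ` S) ?q"
    using h w x Z by (auto simp: coh_def Hom_iff)
  note cp = this
  have "E df S ?p ?q = dd Z S ?p ?q" by (rule E_D[OF cp c(2)])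
  also have "\<dots> = ds Z S (\<lambda>i. \<rho> x \<cdot> ?z) w (?q \<cdot> pX0) (?q \<cdot> pX1)"
    using w x Z by (intro ds_cong coh_D[OF cp] c(2)) simp_all
  also have "\<dots> = ds Z S (\<lambda>i. \<rho> x \<cdot> ?z) w a x" using h x by simp
  finally show ?thesis using zero_sum[OF c] by simp
qed

end

context cartesian_restriction_category
begin

lemma fseq_ev:
  assumes h: "h \<in> FH M X N Y" and n: "n \<ge> 1"
  shows "fseq h n = ev h (mset (map (pow_proj C (mobj M) X n) [0..<n])) (pow_proj C (mobj M) X n n)"
proof -
  have o: "mobj M \<in> Ob C" "X \<in> Ob C" using FH_D(1,3)[OF h] by auto
  show ?thesis using ev_mset[OF h coh_pow_proj[OF o, of n]] tup_pow_proj[OF o, of n] FH_D(8)[OF h n] o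
    by (simp add: app_tup Hom_iff)
qed

text \<open>The component \<open>Suc n\<close> of a map is determined by the component
  \<open>n\<close> of its derivative, so after finitely many derivations only components at index 0
  have to be compared. The induction varies the objects, since a derivative has a different source
  and target.\<close>

lemma fseq_eq_of_D_iterates:
  assumes "f \<in> FH M X N Y" "g \<in> FH M X N Y"
    "\<And>k. fseq ((faa_D C ^^ k) f) 0 = fseq ((faa_D C ^^ k) g) 0"
  shows "fseq f n = fseq g n"
  using assms
proof (induction n arbitrary: f g M X N Y)
  case 0
  show ?case using 0(3)[of 0] by simp
next
  case (Suc n)
  interpret f: faa_map C f M X N Y by (rule faa_mapI[OF Suc.prems(1)])
  interpret g: faa_map C g M X N Y by (rule faa_mapI[OF Suc.prems(2)])
  have Dn: "fseq f.df n = fseq g.df n"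
  proof (rule Suc.IH[OF f.D_FH g.D_FH])
    show "fseq ((faa_D C ^^ k) f.df) 0 = fseq ((faa_D C ^^ k) g.df) 0" for k
      using Suc.prems(3)[of "Suc k"] by (simp add: funpow_swap1)
  qed
  \<comment> \<open>The value at \<open>n\<close> arguments inspects only the component at index
    \<open>n\<close>.\<close>
  have ED: "E f.df {..<n} p q = E g.df {..<n} p q" for p q
    using Dn by (simp add: E_def ev_def)
  let ?p = "pow_proj C (mobj M) X (Suc n)" and ?Z = "pow_times C (mobj M) (Suc n) X"
  have ms: "mset (map ?p [0..<Suc n]) = add_mset (?p n) (image_mset ?p (mset_set {..<n}))"
    by (simp add: atLeast0LessThan)
  have "insert (?p n) (?p ` {..<n}) = set (map ?p [0..<Suc n])" by auto
  then have c: "coh ?Z (mobj M) X (insert (?p n) (?p ` {..<n})) (?p (Suc n))"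
    using coh_pow_proj[of "mobj M" X "Suc n"] by simp
  have x: "\<rho> (?p (Suc n)) = Idn C ?Z" by (rule pow_proj_type) simp_all
  have "ev f (mset (map ?p [0..<Suc n])) (?p (Suc n)) = ev g (mset (map ?p [0..<Suc n])) (?p (Suc n))"
    unfolding ms f.ev_from_D[OF c finite_lessThan x] g.ev_from_D[OF c finite_lessThan x] by (rule ED)
  then show ?case using fseq_ev[OF Suc.prems(1), of "Suc n"] fseq_ev[OF Suc.prems(2), of "Suc n"] by simp
qed

lemma faa_eq_fseq:
  assumes "f \<in> FH M X N Y" "g \<in> FH M X N Y" "\<And>n. fseq f n = fseq g n"
  shows "f = g"
  using FH_D(5,6)[OF assms(1)] FH_D(5,6)[OF assms(2)] assms(3) by (simp add: faa_ar.equality fun_eq_iff)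

text \<open>By the chain rule and functoriality of \<open>Tf\<close>, the derivatives of the two
  bracketings of \<open>f\<close>, \<open>g\<close>, \<open>h\<close> are the two bracketings of
  \<open>Tf f\<close>, \<open>Tf g\<close>, \<open>faa_D C h\<close>. The induction on the number of
  derivations therefore ranges over all triples and ends at associativity in the base
  category.\<close>

lemma Comp_assoc_faa:
  assumes f: "f \<in> FH M X N Y" and g: "g \<in> FH N Y K V" and h: "h \<in> FH K V L W"
  shows "faa_Comp C (faa_Comp C f g) h = faa_Comp C f (faa_Comp C g h)"
proof (rule faa_eq_fseq)
  show l: "faa_Comp C (faa_Comp C f g) h \<in> FH M X L W" by (rule Comp_FH[OF Comp_FH[OF f g] h])
  show r: "faa_Comp C f (faa_Comp C g h) \<in> FH M X L W" by (rule Comp_FH[OF f Comp_FH[OF g h]])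
  have "fseq ((faa_D C ^^ k) (faa_Comp C (faa_Comp C f g) h)) 0 = fseq ((faa_D C ^^ k) (faa_Comp C f (faa_Comp C g h))) 0" for k
    using f g h
  proof (induction k arbitrary: f g h M X N Y K V L W)
    case 0
    then show ?case using HomD[OF FH_D(7)[OF 0(1)]] HomD[OF FH_D(7)[OF 0(2)]] HomD[OF FH_D(7)[OF 0(3)]] by simp
  next
    case (Suc k)
    interpret fg: faa_pair C f g M X N Y K V by (rule faa_pairI[OF Suc.prems(1,2)])
    interpret gh: faa_pair C g h N Y K V L W by (rule faa_pairI[OF Suc.prems(2,3)])
    interpret fgh: faa_pair C "faa_Comp C f g" h M X K V L W
      by (rule faa_pairI[OF Comp_FH[OF Suc.prems(1,2)] Suc.prems(3)])
    interpret fgh': faa_pair C f "faa_Comp C g h" M X N Y L W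
      by (rule faa_pairI[OF Suc.prems(1) Comp_FH[OF Suc.prems(2,3)]])
    show ?case
      using Suc.IH[OF fg.f.T_FH fg.g.T_FH gh.g.D_FH]
      by (simp add: funpow_swap1 fgh.D_Comp fgh'.D_Comp fg.T_Comp gh.D_Comp)
  qed
  then show "fseq (faa_Comp C (faa_Comp C f g) h) n = fseq (faa_Comp C f (faa_Comp C g h)) n" for n
    by (rule fseq_eq_of_D_iterates[OF l r])
qed


section \<open>The Cartesian restriction structure\<close>

lemma ev_Comp_lin_right:
  assumes f: "f \<in> FH M X N Y" and g: "g \<in> FH N Y K V" "lin g" and c: "coh Z (mobj M) X (set_mset m) x" "m \<noteq> {#}"
  shows "ev (faa_Comp C f g) m x = ev g {#ev f m x#} (x \<cdot> fseq f 0)"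
  using faa_pair.ev_Comp_lin_right[OF faa_pairI[OF f g(1)] g(2) c] .

lemma ev_Comp_lin_left:
  assumes f: "f \<in> FH M X N Y" "lin f" and g: "g \<in> FH N Y K V" and c: "coh Z (mobj M) X (set_mset m) x" "m \<noteq> {#}"
  shows "ev (faa_Comp C f g) m x = ev g (image_mset (\<lambda>a. ev f {#a#} x) m) (x \<cdot> fseq f 0)"
  using faa_pair.ev_Comp_lin_left[OF faa_pairI[OF f(1) g] f(2) c] .

lemma coh_single: "coh Z A X (set_mset m) x \<Longrightarrow> a \<in># m \<Longrightarrow> coh Z A X {a} x"
  by (rule coh_mono) auto

lemma Comp_Id_faa:
  assumes f: "f \<in> FH M X N Y"
  shows "faa_Comp C f (faa_Id C (N, Y)) = f" "faa_Comp C (faa_Id C (M, X)) f = f"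
proof -
  note o = FH_D(1-4)[OF f] and f0 = HomD[OF FH_D(7)[OF f]]
  have IN: "faa_Id C (N, Y) \<in> FH N Y N Y" "lin (faa_Id C (N, Y))" using Id_FH lin_Id o by auto
  have IM: "faa_Id C (M, X) \<in> FH M X M X" "lin (faa_Id C (M, X))" using Id_FH lin_Id o by auto
  show "faa_Comp C f (faa_Id C (N, Y)) = f"
  proof (rule faa_eqI[OF Comp_FH[OF f IN(1)] f])
    fix Z m x assume c: "coh Z (mobj M) X (set_mset m) x" "m \<noteq> {#}"
    have "coh Z (mobj N) Y {ev f m x} (x \<cdot> fseq f 0)"
      using ev_Hom[OF f c] ev_Rst[OF f c(1)] f0 cohD(1)[OF c(1)] by (simp add: coh_def Hom_iff)
    then show "ev (faa_Comp C f (faa_Id C (N, Y))) m x = ev f m x"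
      unfolding ev_Comp_lin_right[OF f IN c] by (rule ev_Id[OF o(2,4)])
  qed (use f0 in simp)
  show "faa_Comp C (faa_Id C (M, X)) f = f"
  proof (rule faa_eqI[OF Comp_FH[OF IM(1) f] f])
    fix Z m x assume c: "coh Z (mobj M) X (set_mset m) x" "m \<noteq> {#}"
    have "image_mset (\<lambda>a. ev (faa_Id C (M, X)) {#a#} x) m = image_mset (\<lambda>a. a) m"
      using ev_Id[OF o(1,3) coh_single[OF c(1)]] by (intro image_mset_cong) simp
    then show "ev (faa_Comp C (faa_Id C (M, X)) f) m x = ev f m x"
      unfolding ev_Comp_lin_left[OF IM f c] using HomD[OF cohD(1)[OF c(1)]] by simp
  qed (use f0 in simp)
qed

lemma fseq_Rst_0 [simp]: "fseq (faa_Rst C f) 0 = \<rho> (fseq f 0)"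
  by (simp add: faa_Rst_def Let_def case_prod_beta)

text \<open>A restriction is linear but in general not total, so it is not an instance of
  \<open>flin\<close>. Its value at one argument is this argument restricted to where
  \<open>fseq f 0\<close> is defined; the verification otherwise follows the same pattern.\<close>

lemma faa_Rst:
  assumes f: "f \<in> FH M X N Y"
  shows Rst_FH: "faa_Rst C f \<in> FH M X M X"
    and ev_Rst1: "coh Z (mobj M) X {a} x \<Longrightarrow> ev (faa_Rst C f) {#a#} x = \<rho> (x \<cdot> fseq f 0) \<cdot> a"
    and lin_Rst: "lin (faa_Rst C f)"
proof -
  note ob = FH_D(1-4)[OF f] and st = FH_D(5,6)[OF f] and f0 = HomD[OF FH_D(7)[OF f]]
  let ?r = "faa_Rst C f" and ?A = "mobj M"
  have f1: "fseq ?r (Suc 0) = \<rho> (Pr1 C ?A X \<cdot> fseq f 0) \<cdot> Pr0 C ?A X"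
    using st ob by (simp add: faa_Rst_def Let_def)
  have f2: "fseq ?r n = \<rho> (pow_proj C ?A X n n \<cdot> fseq f 0) \<cdot> zero_map C M (pow_times C ?A n X)" if "n \<ge> 2" for n
    using that st by (simp add: faa_Rst_def Let_def)
  have a1: "app C (fseq ?r (Suc 0)) [a] x = \<rho> (x \<cdot> fseq f 0) \<cdot> a" if c: "coh Z ?A X (set [a]) x" for Z a x
  proof -
    have a: "a \<in> Ar C" "Dom C a = Z" "Cod C a = ?A" "x \<in> Ar C" "Dom C x = Z" "Cod C x = X"
      "\<rho> a = \<rho> x"
      using c by (auto simp: coh_insert Hom_iff dest: cohD(1))
    have t: "\<langle>a, x\<rangle> \<cdot> Pr0 C ?A X = a" "\<langle>a, x\<rangle> \<cdot> Pr1 C ?A X = x"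
      by (rule Pair_Comp_Pr_same[of _ Z]; use a in \<open>simp add: Hom_iff\<close>)+
    have "app C (fseq ?r (Suc 0)) [a] x = (\<langle>a, x\<rangle> \<cdot> \<rho> (Pr1 C ?A X \<cdot> fseq f 0)) \<cdot> Pr0 C ?A X"
      unfolding f1 app_tup using a ob f0 by (subst assoc) simp_all
    also have "\<langle>a, x\<rangle> \<cdot> \<rho> (Pr1 C ?A X \<cdot> fseq f 0) = \<rho> ((\<langle>a, x\<rangle> \<cdot> Pr1 C ?A X) \<cdot> fseq f 0) \<cdot> \<langle>a, x\<rangle>"
      using a ob f0 by (subst Comp_Rst) simp_all
    also have "\<dots> \<cdot> Pr0 C ?A X = \<rho> ((\<langle>a, x\<rangle> \<cdot> Pr1 C ?A X) \<cdot> fseq f 0) \<cdot> (\<langle>a, x\<rangle> \<cdot> Pr0 C ?A X)"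
      unfolding t(2) using a ob f0 by (intro assoc) simp_all
    finally show ?thesis unfolding t .
  qed
  have a2: "app C (fseq ?r (length as)) as x = \<rho> (x \<cdot> fseq f 0) \<cdot> zero_map C M Z"
    if c: "coh Z ?A X (set as) x" and n: "length as \<ge> 2" for Z as x
  proof -
    let ?n = "length as" and ?t = "tup as x"
    let ?p = "pow_proj C ?A X ?n ?n"
    have t: "?t \<in> Ar C" "Dom C ?t = Z" "Cod C ?t = pow_times C ?A ?n X" using coh_tup[OF c] by (auto simp: Hom_iff)
    have x: "x \<in> Ar C" "Dom C x = Z" "Cod C x = X" "Z \<in> Ob C" using cohD(1,4)[OF c] by (auto simp: Hom_iff)
    have tp: "?t \<cdot> ?p = x" using tup_proj[OF c, of ?n] ob by simp
    have "app C (fseq ?r ?n) as x = (?t \<cdot> \<rho> (?p \<cdot> fseq f 0)) \<cdot> zero_map C M (pow_times C ?A ?n X)"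
      unfolding f2[OF n] app_tup using t ob f0 by (subst assoc) simp_all
    also have "?t \<cdot> \<rho> (?p \<cdot> fseq f 0) = \<rho> (?t \<cdot> (?p \<cdot> fseq f 0)) \<cdot> ?t" using t ob f0 by (intro Comp_Rst) simp_all
    also have "?t \<cdot> (?p \<cdot> fseq f 0) = x \<cdot> fseq f 0" using t ob f0 tp assoc[of ?t ?p "fseq f 0"] by simp
    also have "(\<rho> (x \<cdot> fseq f 0) \<cdot> ?t) \<cdot> zero_map C M (pow_times C ?A ?n X) = \<rho> (x \<cdot> fseq f 0) \<cdot> (?t \<cdot> zero_map C M (pow_times C ?A ?n X))"
      using t x f0 ob by (intro assoc) simp_all
    also have "?t \<cdot> zero_map C M (pow_times C ?A ?n X) = \<rho> x \<cdot> zero_map C M Z"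
      using crc_monoid.Comp_zero_map[OF ob(1) t(1,3)] t coh_tup(2)[OF c] by simp
    also have "\<rho> (x \<cdot> fseq f 0) \<cdot> (\<rho> x \<cdot> zero_map C M Z) = (\<rho> (x \<cdot> fseq f 0) \<cdot> \<rho> x) \<cdot> zero_map C M Z"
      using x f0 ob by (intro assoc[symmetric]) simp_all
    also have "\<rho> (x \<cdot> fseq f 0) \<cdot> \<rho> x = \<rho> (x \<cdot> fseq f 0)" using x f0 by simp
    finally show ?thesis .
  qed
  show FH: "?r \<in> FH M X M X"
  proof (rule FH_I)
    show "fsrc ?r = (M, X)" "ftgt ?r = (M, X)" using st by (simp_all add: faa_Rst_def Let_def)
    show "fseq ?r 0 \<in> Hom C X X" using f0 by (simp add: Hom_iff)
    fix n :: nat assume n: "1 \<le> n"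
    have r: "\<rho> (pow_proj C ?A X n n \<cdot> fseq ?r 0) = \<rho> (pow_proj C ?A X n n \<cdot> fseq f 0)" using f0 ob by simp
    consider "n = 1" | "n \<ge> 2" using n by linarith
    then show "fseq ?r n \<in> Hom C (pow_times C ?A n X) ?A"
      "\<rho> (fseq ?r n) = \<rho> (pow_proj C ?A X n n \<cdot> fseq ?r 0)"
      unfolding r
      by (cases; use f1 f2 ob f0 in \<open>simp add: Hom_iff\<close>)+
  next
    fix Z as bs x assume c: "coh Z ?A X (set as) x" "as \<noteq> []" "mset bs = mset as"
    then have l: "length bs = length as" "set bs = set as" using mset_eq_length mset_eq_setD by metis+
    show "app C (fseq ?r (length as)) bs x = app C (fseq ?r (length as)) as x"
    proof (cases "length as \<ge> 2")
      case True
      then show ?thesis using a2[OF c(1)] a2[of Z bs x] c l by simp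
    next
      case False
      then obtain a where "as = [a]" using c(2) by (cases as; cases "tl as") auto
      then have "bs = as" using c(3) by simp
      then show ?thesis by simp
    qed
  next
    fix Z a b as x assume c: "coh Z ?A X (insert a (insert b (set as))) x"
    then have ab: "a \<in> Hom C Z ?A" "b \<in> Hom C Z ?A" "\<rho> a = \<rho> x" "\<rho> b = \<rho> x"
      "coh Z ?A X (set as) x" by (auto simp: coh_insert)
    note x = cohD(1,4)[OF c]
    have cc: "coh Z ?A X (set (plus_map C M a b # as)) x" "coh Z ?A X (set (a # as)) x" "coh Z ?A X (set (b # as)) x"
      using ab x ob by (auto simp: coh_insert Hom_iff)
    show "app C (fseq ?r (Suc (length as))) (plus_map C M a b # as) x = plus_map C M
      (app C (fseq ?r (Suc (length as))) (a # as) x) (app C (fseq ?r (Suc (length as))) (b # as) x)"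
    proof (cases "as = []")
      case True
      then show ?thesis using a1 cc ab x ob f0 by (simp add: Hom_iff)
    next
      case False
      then have n: "length (d # as) \<ge> 2" for d by (cases as) auto
      then show ?thesis using a2[OF cc(1) n] a2[OF cc(2) n] a2[OF cc(3) n] x ob f0 by (simp add: Hom_iff)
    qed
  next
    fix Z as x assume c: "coh Z ?A X (set as) x"
    let ?z = "\<rho> x \<cdot> zero_map C M Z"
    note x = cohD(1,4)[OF c]
    have cz: "coh Z ?A X (set (?z # as)) x" using c x ob by (auto simp: coh_insert Hom_iff)
    have R: "\<rho> (x \<cdot> fseq ?r 0) = \<rho> (x \<cdot> fseq f 0)" using x f0 by (simp add: Hom_iff)
    show "app C (fseq ?r (Suc (length as))) (?z # as) x = \<rho> (x \<cdot> fseq ?r 0) \<cdot> zero_map C M Z"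
      unfolding R
    proof (cases "as = []")
      case True
      have "\<rho> (x \<cdot> fseq f 0) \<cdot> ?z = (\<rho> (x \<cdot> fseq f 0) \<cdot> \<rho> x) \<cdot> zero_map C M Z"
        using x f0 ob by (intro assoc[symmetric]) (simp_all add: Hom_iff)
      also have "\<rho> (x \<cdot> fseq f 0) \<cdot> \<rho> x = \<rho> (x \<cdot> fseq f 0)" using x f0 by (simp add: Hom_iff)
      finally show "app C (fseq ?r (Suc (length as))) (?z # as) x = \<rho> (x \<cdot> fseq f 0) \<cdot> zero_map C M Z"
        using True a1[of Z ?z x] cz by simp
    next
      case False
      then have n: "length (d # as) \<ge> 2" for d by (cases as) auto
      then show "app C (fseq ?r (Suc (length as))) (?z # as) x = \<rho> (x \<cdot> fseq f 0) \<cdot> zero_map C M Z"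
        using a2[OF cz n] by simp
    qed
  qed (use ob in simp_all)
  show "ev ?r {#a#} x = \<rho> (x \<cdot> fseq f 0) \<cdot> a" if c: "coh Z ?A X {a} x"
    using ev_mset[OF FH, of Z "[a]" x] a1[of Z a x] c by simp
  show "lin ?r" unfolding lin_def
  proof (intro allI impI)
    fix M' X' N' Y' Z m x
    assume h: "?r \<in> FH M' X' N' Y'" and c: "coh Z (mobj M') X' (set_mset m) x" and m: "size m \<ge> 2"
    have e: "M' = M" "X' = X" "N' = M"
      using FH_D(5,6)[OF h] FH_D(5,6)[OF FH] by auto
    note c = c[unfolded e]
    obtain as where as: "m = mset as" using ex_mset by metis
    show "ev ?r m x = \<rho> (x \<cdot> fseq ?r 0) \<cdot> zero_map C N' Z"
      using ev_mset[OF FH, of Z as x] a2[of Z as x] c m f0 cohD(1)[OF c] by (simp add: as e Hom_iff)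
  qed
qed

text \<open>The restriction of \<open>f\<close> is linear and acts on every argument as
  precomposition with one idempotent, which can be pulled out of the value of \<open>g\<close>. With
  this lemma and \<open>ev_Comp_Rst\<close> the restriction axioms reduce to those of the base
  category.\<close>

lemma ev_Rst_Comp:
  assumes f: "f \<in> FH M X N Y" and g: "g \<in> FH M X K V" and c: "coh Z (mobj M) X (set_mset m) x" "m \<noteq> {#}"
  shows "ev (faa_Comp C (faa_Rst C f) g) m x = \<rho> (x \<cdot> fseq f 0) \<cdot> ev g m x"
proof -
  note f0 = HomD[OF FH_D(7)[OF f]]
  have x: "x \<in> Ar C" "Dom C x = Z" "Cod C x = X" using cohD(1)[OF c(1)] by (auto simp: Hom_iff)
  let ?e = "\<rho> (x \<cdot> fseq f 0)"
  have e: "?e \<in> Hom C Z Z" using x f0 by (simp add: Hom_iff)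
  have "image_mset (\<lambda>a. ev (faa_Rst C f) {#a#} x) m = image_mset (\<lambda>a. ?e \<cdot> a) m"
    using ev_Rst1[OF f coh_single[OF c(1)]] by (intro image_mset_cong) simp
  then show ?thesis unfolding ev_Comp_lin_left[OF Rst_FH[OF f] lin_Rst[OF f] g c] Comp_ev[OF g c(1) e]
    using x f0 by (simp add: Comp_Rst)
qed

lemma ev_Comp_Rst:
  assumes f: "f \<in> FH M X N Y" and g: "g \<in> FH N Y K V" and c: "coh Z (mobj M) X (set_mset m) x" "m \<noteq> {#}"
  shows "ev (faa_Comp C f (faa_Rst C g)) m x = \<rho> (x \<cdot> (fseq f 0 \<cdot> fseq g 0)) \<cdot> ev f m x"
proof -
  note f0 = HomD[OF FH_D(7)[OF f]] and g0 = HomD[OF FH_D(7)[OF g]]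
  have x: "x \<in> Ar C" "Dom C x = Z" "Cod C x = X" using cohD(1)[OF c(1)] by (auto simp: Hom_iff)
  have "coh Z (mobj N) Y {ev f m x} (x \<cdot> fseq f 0)"
    using ev_Hom[OF f c] ev_Rst[OF f c(1)] f0 x by (simp add: coh_def Hom_iff)
  from ev_Rst1[OF g this] show ?thesis
    unfolding ev_Comp_lin_right[OF f Rst_FH[OF g] lin_Rst[OF g] c] using x f0 g0 by simp
qed

lemma ev_Rst_faa:
  assumes f: "f \<in> FH M X N Y" and c: "coh Z (mobj M) X (set_mset m) x" "m \<noteq> {#}"
  shows "ev (faa_Rst C f) m x = \<rho> (x \<cdot> fseq f 0) \<cdot> ev (faa_Id C (M, X)) m x"
proof -
  note ob = FH_D(1-4)[OF f]
  show ?thesis using ev_Rst_Comp[OF f Id_FH[OF ob(1,3)] c] Comp_Id_faa(1)[OF Rst_FH[OF f]] by simp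
qed

text \<open>The domain of every component is prescribed by that of \<open>fseq f 0\<close>, so
  totality is decided there.\<close>

lemma total_faa_iff:
  assumes f: "f \<in> FH M X N Y"
  shows "is_total (faa C) f \<longleftrightarrow> \<rho> (fseq f 0) = Idn C X"
proof
  note f0 = HomD[OF FH_D(7)[OF f]] and ob = FH_D(1-4)[OF f] and st = FH_D(5,6)[OF f]
  show "\<rho> (fseq f 0) = Idn C X" if "is_total (faa C) f"
  proof -
    have "faa_Rst C f = faa_Id C (M, X)" using that st by (simp add: is_total_def)
    then have "fseq (faa_Rst C f) 0 = fseq (faa_Id C (M, X)) 0" by simp
    then show ?thesis by simp
  qed
  assume t: "\<rho> (fseq f 0) = Idn C X"
  have "faa_Rst C f = faa_Id C (M, X)"
  proof (rule faa_eqI[OF Rst_FH[OF f] Id_FH[OF ob(1,3)]])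
    fix Z m x assume c: "coh Z (mobj M) X (set_mset m) x" "m \<noteq> {#}"
    have x: "x \<in> Ar C" "Dom C x = Z" "Cod C x = X" using cohD(1)[OF c(1)] by (auto simp: Hom_iff)
    have "\<rho> (x \<cdot> fseq f 0) = \<rho> x" using x f0 t by simp
    moreover have "\<rho> (ev (faa_Id C (M, X)) m x) = \<rho> x" using ev_Rst[OF Id_FH[OF ob(1,3)] c(1)] x by simp
    ultimately show "ev (faa_Rst C f) m x = ev (faa_Id C (M, X)) m x"
      using ev_Rst_faa[OF f c] ev_Hom[OF Id_FH[OF ob(1,3)] c] Rst_Comp_self[of "ev (faa_Id C (M, X)) m x"]
      by (simp add: Hom_iff)
  qed (use t in simp)
  then show "is_total (faa C) f" using st by (simp add: is_total_def)
qed

lemma restriction_category_faa: "restriction_category (faa C)"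
proof
  fix S T U V :: "('o, 'm) faa_ob" and f g h :: "('o, 'm) faa_ar"
  show "f \<in> Ar (faa C) \<Longrightarrow> Dom (faa C) f \<in> Ob (faa C)" "f \<in> Ar (faa C) \<Longrightarrow> Cod (faa C) f \<in> Ob (faa C)"
    by (simp_all add: faa_Ar_def)
  obtain M X N Y K V' L W where st: "S = (M, X)" "T = (N, Y)" "U = (K, V')" "V = (L, W)" by (metis surj_pair)
  show "S \<in> Ob (faa C) \<Longrightarrow> Idn (faa C) S \<in> Hom (faa C) S S" unfolding st by (simp add: Id_FH)
  show "f \<in> Hom (faa C) S T \<Longrightarrow> g \<in> Hom (faa C) T U \<Longrightarrow> f \<cdot>\<^bsub>faa C\<^esub> g \<in> Hom (faa C) S U"
    unfolding st by (simp add: Comp_FH)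
  show "f \<in> Hom (faa C) S T \<Longrightarrow> Idn (faa C) S \<cdot>\<^bsub>faa C\<^esub> f = f"
    "f \<in> Hom (faa C) S T \<Longrightarrow> f \<cdot>\<^bsub>faa C\<^esub> Idn (faa C) T = f"
    unfolding st by (simp_all add: Comp_Id_faa)
  show "f \<in> Hom (faa C) S T \<Longrightarrow> g \<in> Hom (faa C) T U \<Longrightarrow> h \<in> Hom (faa C) U V \<Longrightarrow>
      (f \<cdot>\<^bsub>faa C\<^esub> g) \<cdot>\<^bsub>faa C\<^esub> h = f \<cdot>\<^bsub>faa C\<^esub> (g \<cdot>\<^bsub>faa C\<^esub> h)"
    unfolding st by (simp add: Comp_assoc_faa)
  show "f \<in> Hom (faa C) S T \<Longrightarrow> \<rho>\<^bsub>faa C\<^esub> f \<in> Hom (faa C) S S"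
    unfolding st by (simp add: Rst_FH)
  show "\<rho>\<^bsub>faa C\<^esub> f \<cdot>\<^bsub>faa C\<^esub> f = f" if "f \<in> Hom (faa C) S T"
  proof -
    have f: "f \<in> FH M X N Y" using that st by simp
    note f0 = HomD[OF FH_D(7)[OF f]]
    have "faa_Comp C (faa_Rst C f) f = f"
    proof (rule faa_eqI[OF Comp_FH[OF Rst_FH[OF f] f] f])
      fix Z m x assume c: "coh Z (mobj M) X (set_mset m) x" "m \<noteq> {#}"
      show "ev (faa_Comp C (faa_Rst C f) f) m x = ev f m x"
        unfolding ev_Rst_Comp[OF f f c]
        using ev_Rst[OF f c(1)] ev_Hom[OF f c] Rst_Comp_self[of "ev f m x"] by (simp add: Hom_iff)
    qed (use f0 in simp)
    then show ?thesis by simp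
  qed
  show "\<rho>\<^bsub>faa C\<^esub> f \<cdot>\<^bsub>faa C\<^esub> \<rho>\<^bsub>faa C\<^esub> g = \<rho>\<^bsub>faa C\<^esub> g \<cdot>\<^bsub>faa C\<^esub> \<rho>\<^bsub>faa C\<^esub> f"
    if "f \<in> Hom (faa C) S T" "g \<in> Hom (faa C) S U"
  proof -
    have f: "f \<in> FH M X N Y" and g: "g \<in> FH M X K V'" using that st by simp_all
    note f0 = HomD[OF FH_D(7)[OF f]] and g0 = HomD[OF FH_D(7)[OF g]] and I = Id_FH[OF FH_D(1,3)[OF f]]
    have "faa_Comp C (faa_Rst C f) (faa_Rst C g) = faa_Comp C (faa_Rst C g) (faa_Rst C f)"
    proof (rule faa_eqI[OF Comp_FH[OF Rst_FH[OF f] Rst_FH[OF g]] Comp_FH[OF Rst_FH[OF g] Rst_FH[OF f]]])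
      fix Z m x assume c: "coh Z (mobj M) X (set_mset m) x" "m \<noteq> {#}"
      have x: "x \<in> Ar C" "Dom C x = Z" "Cod C x = X" using cohD(1)[OF c(1)] by (auto simp: Hom_iff)
      show "ev (faa_Comp C (faa_Rst C f) (faa_Rst C g)) m x = ev (faa_Comp C (faa_Rst C g) (faa_Rst C f)) m x"
        unfolding ev_Rst_Comp[OF f Rst_FH[OF g] c] ev_Rst_Comp[OF g Rst_FH[OF f] c]
          ev_Rst_faa[OF f c] ev_Rst_faa[OF g c]
        using HomD[OF ev_Hom[OF I c]] x f0 g0 by (intro Rst_left_commute) simp_all
    qed (use f0 g0 in \<open>simp add: Rst_commute\<close>)
    then show ?thesis by simp
  qed
  show "\<rho>\<^bsub>faa C\<^esub> (\<rho>\<^bsub>faa C\<^esub> f \<cdot>\<^bsub>faa C\<^esub> g) = \<rho>\<^bsub>faa C\<^esub> f \<cdot>\<^bsub>faa C\<^esub> \<rho>\<^bsub>faa C\<^esub> g"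
    if "f \<in> Hom (faa C) S T" "g \<in> Hom (faa C) S U"
  proof -
    have f: "f \<in> FH M X N Y" and g: "g \<in> FH M X K V'" using that st by simp_all
    note f0 = HomD[OF FH_D(7)[OF f]] and g0 = HomD[OF FH_D(7)[OF g]] and I = Id_FH[OF FH_D(1,3)[OF f]]
    note h = Comp_FH[OF Rst_FH[OF f] g]
    have "faa_Rst C (faa_Comp C (faa_Rst C f) g) = faa_Comp C (faa_Rst C f) (faa_Rst C g)"
    proof (rule faa_eqI[OF Rst_FH[OF h] Comp_FH[OF Rst_FH[OF f] Rst_FH[OF g]]])
      fix Z m x assume c: "coh Z (mobj M) X (set_mset m) x" "m \<noteq> {#}"
      have x: "x \<in> Ar C" "Dom C x = Z" "Cod C x = X" using cohD(1)[OF c(1)] by (auto simp: Hom_iff)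
      have "x \<cdot> (\<rho> (fseq f 0) \<cdot> fseq g 0) = \<rho> (x \<cdot> fseq f 0) \<cdot> (x \<cdot> fseq g 0)"
        using x f0 g0 assoc[of x "\<rho> (fseq f 0)" "fseq g 0"] Comp_Rst[of x "fseq f 0"] by simp
      then have "\<rho> (x \<cdot> (\<rho> (fseq f 0) \<cdot> fseq g 0)) = \<rho> (x \<cdot> fseq f 0) \<cdot> \<rho> (x \<cdot> fseq g 0)" using x f0 g0 by simp
      then show "ev (faa_Rst C (faa_Comp C (faa_Rst C f) g)) m x = ev (faa_Comp C (faa_Rst C f) (faa_Rst C g)) m x"
        unfolding ev_Rst_Comp[OF f Rst_FH[OF g] c] ev_Rst_faa[OF h c] ev_Rst_faa[OF g c]
        using HomD[OF ev_Hom[OF I c]] x f0 g0 by simp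
    qed (use f0 g0 in simp)
    then show ?thesis by simp
  qed
  show "f \<cdot>\<^bsub>faa C\<^esub> \<rho>\<^bsub>faa C\<^esub> g = \<rho>\<^bsub>faa C\<^esub> (f \<cdot>\<^bsub>faa C\<^esub> g) \<cdot>\<^bsub>faa C\<^esub> f"
    if "f \<in> Hom (faa C) S T" "g \<in> Hom (faa C) T U"
  proof -
    have f: "f \<in> FH M X N Y" and g: "g \<in> FH N Y K V'" using that st by simp_all
    note f0 = HomD[OF FH_D(7)[OF f]] and g0 = HomD[OF FH_D(7)[OF g]]
    note h = Comp_FH[OF f g]
    have "faa_Comp C f (faa_Rst C g) = faa_Comp C (faa_Rst C (faa_Comp C f g)) f"
    proof (rule faa_eqI[OF Comp_FH[OF f Rst_FH[OF g]] Comp_FH[OF Rst_FH[OF h] f]])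
      fix Z m x assume c: "coh Z (mobj M) X (set_mset m) x" "m \<noteq> {#}"
      show "ev (faa_Comp C f (faa_Rst C g)) m x = ev (faa_Comp C (faa_Rst C (faa_Comp C f g)) f) m x"
        unfolding ev_Comp_Rst[OF f g c] ev_Rst_Comp[OF h f c] by simp
    qed (use f0 g0 Comp_Rst[of "fseq f 0" "fseq g 0"] in simp)
    then show ?thesis by simp
  qed
qed

section \<open>The terminal object and binary products\<close>

lemma faa_to_Trm_eqI:
  assumes f: "f \<in> FH M X (trivial_monoid C) \<^bold>1" and g: "g \<in> FH M X (trivial_monoid C) \<^bold>1"
    and r: "\<rho> (fseq f 0) = \<rho> (fseq g 0)"
  shows "f = g"
proof (rule faa_eqI[OF f g])
  show "fseq f 0 = fseq g 0" using FH_D(7)[OF f] FH_D(7)[OF g] r by (rule to_Trm_eqI)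
  fix Z m x assume c: "coh Z (mobj M) X (set_mset m) x" "m \<noteq> {#}"
  show "ev f m x = ev g m x"
  proof (rule to_Trm_eqI)
    show "ev f m x \<in> Hom C Z \<^bold>1" "ev g m x \<in> Hom C Z \<^bold>1" using ev_Hom[OF f c] ev_Hom[OF g c] by simp_all
    show "\<rho> (ev f m x) = \<rho> (ev g m x)" unfolding ev_Rst[OF f c(1)] ev_Rst[OF g c(1)]
      by (rule arg_cong[OF \<open>fseq f 0 = fseq g 0\<close>])
  qed
qed

lemma faa_Bang_FH:
  assumes ob: "cm M" "X \<in> Ob C"
  shows "faa_Bang C (M, X) \<in> FH M X (trivial_monoid C) \<^bold>1"
proof (rule FH_I)
  let ?b = "faa_Bang C (M, X)"
  have b: "fseq ?b n = \<^bold>! (pow_times C (mobj M) n X)" for n by (simp add: faa_Bang_def)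
  have a: "app C (fseq ?b (length as)) as x = \<rho> x \<cdot> \<^bold>! Z" if c: "coh Z (mobj M) X (set as) x" for Z as x
    using Comp_Bang[of "tup as x"] coh_tup[OF c] by (simp add: b app_tup Hom_iff)
  show "fsrc ?b = (M, X)" "ftgt ?b = (trivial_monoid C, \<^bold>1)" "fseq ?b 0 \<in> Hom C X \<^bold>1"
    using ob by (simp_all add: faa_Bang_def faa_Trm_def Hom_iff)
  fix n :: nat
  show "fseq ?b n \<in> Hom C (pow_times C (mobj M) n X) (mobj (trivial_monoid C))"
    "\<rho> (fseq ?b n) = \<rho> (pow_proj C (mobj M) X n n \<cdot> fseq ?b 0)"
    using ob by (simp_all add: b Hom_iff)
next
  let ?b = "faa_Bang C (M, X)"
  have b: "fseq ?b n = \<^bold>! (pow_times C (mobj M) n X)" for n by (simp add: faa_Bang_def)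
  have a: "app C (fseq ?b (length as)) as x = \<rho> x \<cdot> \<^bold>! Z" if c: "coh Z (mobj M) X (set as) x" for Z as x
    using Comp_Bang[of "tup as x"] coh_tup[OF c] by (simp add: b app_tup Hom_iff)
  {
    fix Z as bs x assume c: "coh Z (mobj M) X (set as) x" "mset bs = mset as"
    then have l: "length bs = length as" "set bs = set as" using mset_eq_length mset_eq_setD by metis+
    show "app C (fseq ?b (length as)) bs x = app C (fseq ?b (length as)) as x"
      using a[OF c(1)] a[of Z bs x] c l by simp
  }
  {
    fix Z a' b' as x assume c: "coh Z (mobj M) X (insert a' (insert b' (set as))) x"
    note x = cohD(1,4)[OF c]
    have cc: "coh Z (mobj M) X (set (plus_map C M a' b' # as)) x" "coh Z (mobj M) X (set (a' # as)) x"
      "coh Z (mobj M) X (set (b' # as)) x"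
      using c ob x by (auto simp: coh_insert Hom_iff)
    \<comment> \<open>Maps into the terminal object are determined by their domain, and
      \<open>k + k\<close> has the domain of \<open>k\<close>. Additivity is thus an equation
      between copies of the same value.\<close>
    have "plus_map C (trivial_monoid C) k k = k" if k: "k \<in> Hom C Z \<^bold>1" for k
    proof (rule to_Trm_eqI[OF _ k])
      note k = HomD[OF k]
      show "plus_map C (trivial_monoid C) k k \<in> Hom C Z \<^bold>1"
        using k crc_monoid.plus_map_type(1-3)[OF cm_trivial k(1,1)] by (simp add: Hom_iff)
      show "\<rho> (plus_map C (trivial_monoid C) k k) = \<rho> k"
        using k crc_monoid.plus_map_type(4)[OF cm_trivial k(1,1)] by simp
    qed
    moreover have "\<rho> x \<cdot> \<^bold>! Z \<in> Hom C Z \<^bold>1" using x by (simp add: Hom_iff)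
    ultimately have "plus_map C (trivial_monoid C) (\<rho> x \<cdot> \<^bold>! Z) (\<rho> x \<cdot> \<^bold>! Z) = \<rho> x \<cdot> \<^bold>! Z" by blast
    then show "app C (fseq ?b (Suc (length as))) (plus_map C M a' b' # as) x = plus_map C (trivial_monoid C)
      (app C (fseq ?b (Suc (length as))) (a' # as) x) (app C (fseq ?b (Suc (length as))) (b' # as) x)"
      using a[OF cc(1)] a[OF cc(2)] a[OF cc(3)] by simp
  }
  {
    fix Z as x assume c: "coh Z (mobj M) X (set as) x"
    note x = cohD(1,4)[OF c]
    have cz: "coh Z (mobj M) X (set (\<rho> x \<cdot> zero_map C M Z # as)) x" using c x ob by (auto simp: coh_insert Hom_iff)
    have "\<rho> (x \<cdot> fseq ?b 0) = \<rho> x" using x ob by (simp add: b Hom_iff)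
    then show "app C (fseq ?b (Suc (length as))) (\<rho> x \<cdot> zero_map C M Z # as) x
      = \<rho> (x \<cdot> fseq ?b 0) \<cdot> zero_map C (trivial_monoid C) Z"
      using a[OF cz] x by (simp add: zero_map_def)
  }
qed (use ob in simp_all)

lemma fseq_Bang_0 [simp]: "fseq (faa_Bang C (M, X)) 0 = \<^bold>! X"
  by (simp add: faa_Bang_def)

lemma ev_Comp_fPr:
  assumes h: "h \<in> FH M X (prod_monoid C N K) (Y \<^bold>\<times> V)" and ob: "cm N" "cm K" "Y \<in> Ob C" "V \<in> Ob C"
    and c: "coh Z (mobj M) X (set_mset m) x" "m \<noteq> {#}"
  shows "ev (faa_Comp C h (faa_Pr0 C (N, Y) (K, V))) m x = ev h m x \<cdot> Pr0 C (mobj N) (mobj K)"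
    "ev (faa_Comp C h (faa_Pr1 C (N, Y) (K, V))) m x = ev h m x \<cdot> Pr1 C (mobj N) (mobj K)"
proof -
  have y: "coh Z (mobj N \<^bold>\<times> mobj K) (Y \<^bold>\<times> V) {ev h m x} (x \<cdot> fseq h 0)"
    using ev_Hom[OF h c] ev_Rst[OF h c(1)] HomD[OF FH_D(7)[OF h]] cohD(1)[OF c(1)] by (simp add: coh_def Hom_iff)
  note P0 = fPr0_FH[OF ob(1,3,2,4)] lin_fPr0[OF ob(1,3,2,4)] and P1 = fPr1_FH[OF ob(1,3,2,4)] lin_fPr1[OF ob(1,3,2,4)]
  show "ev (faa_Comp C h (faa_Pr0 C (N, Y) (K, V))) m x = ev h m x \<cdot> Pr0 C (mobj N) (mobj K)"
    unfolding ev_Comp_lin_right[OF h P0 c] by (rule ev_fPr0[OF ob(1,3,2,4) y])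
  show "ev (faa_Comp C h (faa_Pr1 C (N, Y) (K, V))) m x = ev h m x \<cdot> Pr1 C (mobj N) (mobj K)"
    unfolding ev_Comp_lin_right[OF h P1 c] by (rule ev_fPr1[OF ob(1,3,2,4) y])
qed

lemma faa_Pair_Pr:
  assumes f: "f \<in> FH M X N Y" and g: "g \<in> FH M X K V"
  shows "faa_Comp C (faa_Pair C f g) (faa_Pr0 C (N, Y) (K, V)) = faa_Comp C (faa_Rst C g) f"
    "faa_Comp C (faa_Pair C f g) (faa_Pr1 C (N, Y) (K, V)) = faa_Comp C (faa_Rst C f) g"
proof -
  note f0 = HomD[OF FH_D(7)[OF f]] and g0 = HomD[OF FH_D(7)[OF g]]
  note ob = FH_D(2)[OF f] FH_D(2)[OF g] FH_D(4)[OF f] FH_D(4)[OF g]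
  note p = Pair_FH[OF f g]
  show "faa_Comp C (faa_Pair C f g) (faa_Pr0 C (N, Y) (K, V)) = faa_Comp C (faa_Rst C g) f"
  proof (rule faa_eqI[OF Comp_FH[OF p fPr0_FH[OF ob(1,3,2,4)]] Comp_FH[OF Rst_FH[OF g] f]])
    fix Z m x assume c: "coh Z (mobj M) X (set_mset m) x" "m \<noteq> {#}"
    show "ev (faa_Comp C (faa_Pair C f g) (faa_Pr0 C (N, Y) (K, V))) m x = ev (faa_Comp C (faa_Rst C g) f) m x"
      unfolding ev_Comp_fPr[OF p ob c] ev_Rst_Comp[OF g f c] ev_Pair[OF f g c]
      using HomD[OF ev_Hom[OF f c]] HomD[OF ev_Hom[OF g c]] ev_Rst[OF g c(1)] by simp
  qed (use f0 g0 in simp)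
  show "faa_Comp C (faa_Pair C f g) (faa_Pr1 C (N, Y) (K, V)) = faa_Comp C (faa_Rst C f) g"
  proof (rule faa_eqI[OF Comp_FH[OF p fPr1_FH[OF ob(1,3,2,4)]] Comp_FH[OF Rst_FH[OF f] g]])
    fix Z m x assume c: "coh Z (mobj M) X (set_mset m) x" "m \<noteq> {#}"
    show "ev (faa_Comp C (faa_Pair C f g) (faa_Pr1 C (N, Y) (K, V))) m x = ev (faa_Comp C (faa_Rst C f) g) m x"
      unfolding ev_Comp_fPr[OF p ob c] ev_Rst_Comp[OF f g c] ev_Pair[OF f g c]
      using HomD[OF ev_Hom[OF f c]] HomD[OF ev_Hom[OF g c]] ev_Rst[OF f c(1)] by simp
  qed (use f0 g0 in simp)
qed

text \<open>The projections are linear, so composing \<open>h\<close> with them acts directly on its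
  values. Uniqueness then reduces to uniqueness of pairings in the base category, applied at index 0
  and to each value.\<close>

lemma faa_Pair_unique:
  assumes f: "f \<in> FH M X N Y" and g: "g \<in> FH M X K V" and h: "h \<in> FH M X (prod_monoid C N K) (Y \<^bold>\<times> V)"
    and e: "faa_Comp C h (faa_Pr0 C (N, Y) (K, V)) = faa_Comp C (faa_Rst C g) f"
    "faa_Comp C h (faa_Pr1 C (N, Y) (K, V)) = faa_Comp C (faa_Rst C f) g"
  shows "h = faa_Pair C f g"
proof (rule faa_eqI[OF h Pair_FH[OF f g]])
  note ob = FH_D(2)[OF f] FH_D(2)[OF g] FH_D(4)[OF f] FH_D(4)[OF g]
  show "fseq h 0 = fseq (faa_Pair C f g) 0"
    unfolding fseq_Pair_0 using arg_cong[OF e(1), of "\<lambda>h. fseq h 0"] arg_cong[OF e(2), of "\<lambda>h. fseq h 0"]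
    by (intro Pair_unique[OF FH_D(7)[OF f] FH_D(7)[OF g] FH_D(7)[OF h]]) simp_all
  fix Z m x assume c: "coh Z (mobj M) X (set_mset m) x" "m \<noteq> {#}"
  have H: "ev h m x \<in> Hom C Z (mobj N \<^bold>\<times> mobj K)" using ev_Hom[OF h c] by simp
  show "ev h m x = ev (faa_Pair C f g) m x"
    unfolding ev_Pair[OF f g c]
    using ev_Comp_fPr[OF h ob c] ev_Rst_Comp[OF g f c] ev_Rst_Comp[OF f g c] e ev_Rst[OF f c(1)] ev_Rst[OF g c(1)]
    by (intro Pair_unique[OF ev_Hom[OF f c] ev_Hom[OF g c] H]) simp_all
qed

lemma cartesian_restriction_category_faa: "cartesian_restriction_category (faa C)"
proof -
  interpret F: restriction_category "faa C" by (rule restriction_category_faa)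
  show ?thesis
  proof
    fix S T U :: "('o, 'm) faa_ob" and f g h :: "('o, 'm) faa_ar"
    obtain M X N Y K V where st: "S = (M, X)" "T = (N, Y)" "U = (K, V)" by (metis surj_pair)
    show "\<^bold>1\<^bsub>faa C\<^esub> \<in> Ob (faa C)" by (simp add: faa_Trm_def)
    show "S \<in> Ob (faa C) \<Longrightarrow> \<^bold>!\<^bsub>faa C\<^esub> S \<in> Hom (faa C) S \<^bold>1\<^bsub>faa C\<^esub>"
      unfolding st using faa_Bang_FH[of M X] by (simp add: faa_Trm_def)
    show "S \<in> Ob (faa C) \<Longrightarrow> is_total (faa C) (\<^bold>!\<^bsub>faa C\<^esub> S)"
      unfolding st using total_faa_iff[OF faa_Bang_FH[of M X]] by simp
    show "f \<in> Hom (faa C) S \<^bold>1\<^bsub>faa C\<^esub> \<Longrightarrow> is_total (faa C) f \<Longrightarrow> f = \<^bold>!\<^bsub>faa C\<^esub> S"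
      unfolding st using faa_to_Trm_eqI[of f M X "faa_Bang C (M, X)"] faa_Bang_FH[of M X]
        total_faa_iff[of f M X "trivial_monoid C" "\<^bold>1"] FH_D(1,3)[of f M X "trivial_monoid C" "\<^bold>1"]
      by (simp add: faa_Trm_def)
    show "f = \<rho>\<^bsub>faa C\<^esub> f \<cdot>\<^bsub>faa C\<^esub> \<^bold>!\<^bsub>faa C\<^esub> S" if "f \<in> Hom (faa C) S \<^bold>1\<^bsub>faa C\<^esub>"
    proof -
      have f: "f \<in> FH M X (trivial_monoid C) \<^bold>1" using that st by (simp add: faa_Trm_def)
      note ob = FH_D(1,3)[OF f] and f0 = HomD[OF FH_D(7)[OF f]]
      have "f = faa_Comp C (faa_Rst C f) (faa_Bang C (M, X))"
        by (rule faa_to_Trm_eqI[OF f Comp_FH[OF Rst_FH[OF f] faa_Bang_FH[OF ob]]]) (use f0 ob in simp)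
      then show ?thesis using st by simp
    qed
    show "S \<in> Ob (faa C) \<Longrightarrow> T \<in> Ob (faa C) \<Longrightarrow> S \<^bold>\<times>\<^bsub>faa C\<^esub> T \<in> Ob (faa C)"
      unfolding st by (simp add: faa_Prd_def)
    show "S \<in> Ob (faa C) \<Longrightarrow> T \<in> Ob (faa C) \<Longrightarrow> Pr0 (faa C) S T \<in> Hom (faa C) (S \<^bold>\<times>\<^bsub>faa C\<^esub> T) S"
      "S \<in> Ob (faa C) \<Longrightarrow> T \<in> Ob (faa C) \<Longrightarrow> Pr1 (faa C) S T \<in> Hom (faa C) (S \<^bold>\<times>\<^bsub>faa C\<^esub> T) T"
      unfolding st using fPr0_FH[of M X N Y] fPr1_FH[of M X N Y] by (simp_all add: faa_Prd_def)
    show "S \<in> Ob (faa C) \<Longrightarrow> T \<in> Ob (faa C) \<Longrightarrow> is_total (faa C) (Pr0 (faa C) S T)"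
      "S \<in> Ob (faa C) \<Longrightarrow> T \<in> Ob (faa C) \<Longrightarrow> is_total (faa C) (Pr1 (faa C) S T)"
      unfolding st using total_faa_iff[OF fPr0_FH[of M X N Y]] total_faa_iff[OF fPr1_FH[of M X N Y]] by simp_all
    assume "f \<in> Hom (faa C) S T" "g \<in> Hom (faa C) S U"
    then have f: "f \<in> FH M X N Y" and g: "g \<in> FH M X K V" using st by simp_all
    show "\<langle>f, g\<rangle>\<^bsub>faa C\<^esub> \<in> Hom (faa C) S (T \<^bold>\<times>\<^bsub>faa C\<^esub> U)"
      using Pair_FH[OF f g] st by (simp add: faa_Prd_def)
    show "\<langle>f, g\<rangle>\<^bsub>faa C\<^esub> \<cdot>\<^bsub>faa C\<^esub> Pr0 (faa C) T U = \<rho>\<^bsub>faa C\<^esub> g \<cdot>\<^bsub>faa C\<^esub> f"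
      "\<langle>f, g\<rangle>\<^bsub>faa C\<^esub> \<cdot>\<^bsub>faa C\<^esub> Pr1 (faa C) T U = \<rho>\<^bsub>faa C\<^esub> f \<cdot>\<^bsub>faa C\<^esub> g"
      using faa_Pair_Pr[OF f g] st by simp_all
    assume "h \<in> Hom (faa C) S (T \<^bold>\<times>\<^bsub>faa C\<^esub> U)" "h \<cdot>\<^bsub>faa C\<^esub> Pr0 (faa C) T U = \<rho>\<^bsub>faa C\<^esub> g \<cdot>\<^bsub>faa C\<^esub> f"
      "h \<cdot>\<^bsub>faa C\<^esub> Pr1 (faa C) T U = \<rho>\<^bsub>faa C\<^esub> f \<cdot>\<^bsub>faa C\<^esub> g"
    then show "h = \<langle>f, g\<rangle>\<^bsub>faa C\<^esub>" using faa_Pair_unique[OF f g, of h] st by (simp add: faa_Prd_def)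
  qed
qed

end

section \<open>Reduction of the differential axioms to generic arguments\<close>

text \<open>An axiom about arbitrary, possibly partial arguments \<open>a, b, d\<close> follows from its instance at the
  total projections \<open>Pa, Pb, Pd\<close> by composing with \<open>\<langle>\<langle>a, b\<rangle>, d\<rangle>\<close>. In \<open>faa C\<close> these projections have
  vanishing higher components, which keeps the composites computable.\<close>

context cartesian_restriction_category
begin

lemma triple:
  fixes B X
  defines "Pa \<equiv> Pr0 C (B \<^bold>\<times> B) X \<cdot> Pr0 C B B" and "Pb \<equiv> Pr0 C (B \<^bold>\<times> B) X \<cdot> Pr1 C B B" and "Pd \<equiv> Pr1 C (B \<^bold>\<times> B) X"
  assumes ty: "a \<in> Hom C Z B" "b \<in> Hom C Z B" "d \<in> Hom C Z X"
  defines "t \<equiv> \<langle>\<langle>a, b\<rangle>, d\<rangle>"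
  shows "t \<in> Hom C Z ((B \<^bold>\<times> B) \<^bold>\<times> X)" "\<rho> t = \<rho> a \<cdot> (\<rho> b \<cdot> \<rho> d)"
    "t \<cdot> Pa = \<rho> t \<cdot> a" "t \<cdot> Pb = \<rho> t \<cdot> b" "t \<cdot> Pd = \<rho> t \<cdot> d"
proof -
  have o: "B \<in> Ob C" "X \<in> Ob C" using ty Cod_Ob by (auto simp: Hom_iff)
  note ty = ty[unfolded Hom_iff]
  show t: "t \<in> Hom C Z ((B \<^bold>\<times> B) \<^bold>\<times> X)" "\<rho> t = \<rho> a \<cdot> (\<rho> b \<cdot> \<rho> d)" using ty by (simp_all add: t_def Hom_iff)
  show "t \<cdot> Pa = \<rho> t \<cdot> a" "t \<cdot> Pb = \<rho> t \<cdot> b" "t \<cdot> Pd = \<rho> t \<cdot> d"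
    unfolding t(2) unfolding t_def Pa_def Pb_def Pd_def using ty o by (simp_all add: Rst_ac)
qed

lemma Comp_Comp: "f \<in> Hom C X Y \<Longrightarrow> g \<in> Hom C Y V \<Longrightarrow> h \<in> Hom C V W \<Longrightarrow> f \<cdot> (g \<cdot> h) = (f \<cdot> g) \<cdot> h"
  by (simp add: Hom_iff)

lemma Comp_Pair_Hom: "z \<in> Hom C W Z \<Longrightarrow> f \<in> Hom C Z X \<Longrightarrow> g \<in> Hom C Z Y \<Longrightarrow> z \<cdot> \<langle>f, g\<rangle> = \<langle>z \<cdot> f, z \<cdot> g\<rangle>"
  by (simp add: Hom_iff)

lemma generic_plus:
  assumes L: "cm L" and K: "cm K" and h: "h \<in> Hom C (mobj L \<^bold>\<times> X) (mobj K)"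
    and ty: "a \<in> Hom C Z (mobj L)" "b \<in> Hom C Z (mobj L)" "d \<in> Hom C Z X"
    and gen: "\<And>Pa Pb Pd. Pa = Pr0 C (mobj L \<^bold>\<times> mobj L) X \<cdot> Pr0 C (mobj L) (mobj L) \<Longrightarrow>
      Pb = Pr0 C (mobj L \<^bold>\<times> mobj L) X \<cdot> Pr1 C (mobj L) (mobj L) \<Longrightarrow> Pd = Pr1 C (mobj L \<^bold>\<times> mobj L) X \<Longrightarrow>
      \<langle>plus_map C L Pa Pb, Pd\<rangle> \<cdot> h = plus_map C K (\<langle>Pa, Pd\<rangle> \<cdot> h) (\<langle>Pb, Pd\<rangle> \<cdot> h)"
  shows "\<langle>plus_map C L a b, d\<rangle> \<cdot> h = plus_map C K (\<langle>a, d\<rangle> \<cdot> h) (\<langle>b, d\<rangle> \<cdot> h)"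
proof -
  let ?B = "mobj L" and ?G = "(mobj L \<^bold>\<times> mobj L) \<^bold>\<times> X"
  define Pa Pb Pd t where "Pa = Pr0 C (?B \<^bold>\<times> ?B) X \<cdot> Pr0 C ?B ?B" and "Pb = Pr0 C (?B \<^bold>\<times> ?B) X \<cdot> Pr1 C ?B ?B"
    and "Pd = Pr1 C (?B \<^bold>\<times> ?B) X" and "t = \<langle>\<langle>a, b\<rangle>, d\<rangle>"
  note t = triple[OF ty, folded Pa_def Pb_def Pd_def t_def]
  have o: "?B \<in> Ob C" "X \<in> Ob C" using ty Cod_Ob L by (auto simp: Hom_iff)
  have P: "Pa \<in> Hom C ?G ?B" "Pb \<in> Hom C ?G ?B" "Pd \<in> Hom C ?G X"
    using o by (simp_all add: Pa_def Pb_def Pd_def Hom_iff)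
  let ?e = "\<rho> t"
  have e: "?e \<in> Hom C Z Z" using t(1) by (simp add: Hom_iff)
  let ?u = "\<langle>a, d\<rangle> \<cdot> h" and ?v = "\<langle>b, d\<rangle> \<cdot> h"
  have uv: "?u \<in> Hom C Z (mobj K)" "?v \<in> Hom C Z (mobj K)" using ty h by (simp_all add: Hom_iff)
  have pP: "plus_map C L Pa Pb \<in> Hom C ?G ?B" and pab: "plus_map C L a b \<in> Hom C Z ?B"
    using P ty L by (simp_all add: Hom_iff)
  have pr: "\<langle>plus_map C L Pa Pb, Pd\<rangle> \<in> Hom C ?G (?B \<^bold>\<times> X)" "\<langle>Pa, Pd\<rangle> \<in> Hom C ?G (?B \<^bold>\<times> X)" "\<langle>Pb, Pd\<rangle> \<in> Hom C ?G (?B \<^bold>\<times> X)"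
    "\<langle>a, d\<rangle> \<in> Hom C Z (?B \<^bold>\<times> X)" "\<langle>b, d\<rangle> \<in> Hom C Z (?B \<^bold>\<times> X)" "\<langle>plus_map C L a b, d\<rangle> \<in> Hom C Z (?B \<^bold>\<times> X)"
    using pP pab P ty by (auto intro: Pair_Hom)
  have l: "t \<cdot> (\<langle>k, Pd\<rangle> \<cdot> h) = ?e \<cdot> (\<langle>k', d\<rangle> \<cdot> h)"
    if "k \<in> Hom C ?G ?B" "k' \<in> Hom C Z ?B" "t \<cdot> k = ?e \<cdot> k'" for k k'
  proof -
    have "t \<cdot> (\<langle>k, Pd\<rangle> \<cdot> h) = (t \<cdot> \<langle>k, Pd\<rangle>) \<cdot> h" using that P by (intro Comp_Comp[OF t(1) Pair_Hom h])
    also have "t \<cdot> \<langle>k, Pd\<rangle> = \<langle>?e \<cdot> k', ?e \<cdot> d\<rangle>" using Comp_Pair_Hom[OF t(1) that(1) P(3)] that(3) t(5) by simp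
    also have "\<dots> = ?e \<cdot> \<langle>k', d\<rangle>" using Comp_Pair_Hom[OF e that(2) ty(3)] by simp
    also have "\<dots> \<cdot> h = ?e \<cdot> (\<langle>k', d\<rangle> \<cdot> h)" using that ty by (intro Comp_Comp[OF e Pair_Hom h, symmetric])
    finally show ?thesis .
  qed
  have tp: "t \<cdot> plus_map C L Pa Pb = ?e \<cdot> plus_map C L a b"
    using crc_monoid.Comp_plus_map[OF L, of t Pa Pb] crc_monoid.Comp_plus_map[OF L, of ?e a b] P ty t e by (simp add: Hom_iff)
  have "?e \<cdot> (\<langle>plus_map C L a b, d\<rangle> \<cdot> h) = t \<cdot> (\<langle>plus_map C L Pa Pb, Pd\<rangle> \<cdot> h)"
    by (rule l[OF pP pab tp, symmetric])
  also have "\<dots> = t \<cdot> plus_map C K (\<langle>Pa, Pd\<rangle> \<cdot> h) (\<langle>Pb, Pd\<rangle> \<cdot> h)"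
    using gen[OF Pa_def Pb_def Pd_def] by simp
  also have "\<dots> = plus_map C K (t \<cdot> (\<langle>Pa, Pd\<rangle> \<cdot> h)) (t \<cdot> (\<langle>Pb, Pd\<rangle> \<cdot> h))"
    using HomD[OF t(1)] HomD[OF pr(2)] HomD[OF pr(3)] HomD[OF h] by (intro crc_monoid.Comp_plus_map[OF K]) simp_all
  also have "\<dots> = plus_map C K (?e \<cdot> ?u) (?e \<cdot> ?v)"
    using l[OF P(1) ty(1) t(3)] l[OF P(2) ty(2) t(4)] by simp
  also have "\<dots> = ?e \<cdot> plus_map C K ?u ?v"
    using HomD[OF uv(1)] HomD[OF uv(2)] HomD[OF e] by (intro crc_monoid.Comp_plus_map[OF K, symmetric]) simp_all
  finally have 1: "?e \<cdot> (\<langle>plus_map C L a b, d\<rangle> \<cdot> h) = ?e \<cdot> plus_map C K ?u ?v" .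
  let ?w = "plus_map C K ?u ?v"
  have w: "?w \<in> Ar C" "Dom C ?w = Z" using HomD[OF uv(1)] HomD[OF uv(2)] K by simp_all
  have ru: "\<rho> a \<cdot> (\<rho> d \<cdot> \<rho> ?u) = \<rho> ?u" and rv: "\<rho> b \<cdot> (\<rho> d \<cdot> \<rho> ?v) = \<rho> ?v"
  proof -
    have "\<rho> \<langle>a, d\<rangle> \<cdot> \<rho> ?u = \<rho> ?u" "\<rho> \<langle>b, d\<rangle> \<cdot> \<rho> ?v = \<rho> ?v"
      using HomD[OF pr(4)] HomD[OF pr(5)] HomD[OF h] by (intro Rst_Comp_le; simp)+
    then show "\<rho> a \<cdot> (\<rho> d \<cdot> \<rho> ?u) = \<rho> ?u" "\<rho> b \<cdot> (\<rho> d \<cdot> \<rho> ?v) = \<rho> ?v"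
      using ty HomD[OF uv(1)] HomD[OF uv(2)] by (simp_all add: Hom_iff)
  qed
  \<comment> \<open>Substitution of the triple gives the equation only on \<open>?e\<close>, the
    meet of the domains of \<open>a\<close>, \<open>b\<close> and \<open>d\<close>. Since both sides
    are defined only inside \<open>?e\<close>, the factor can be removed from each of them.\<close>
  have "?e \<cdot> \<rho> ?w = \<rho> ?w"
  proof -
    define u v where "u = ?u" and "v = ?v"
    have uv': "u \<in> Ar C" "Dom C u = Z" "v \<in> Ar C" "Dom C v = Z" using uv by (simp_all add: u_def v_def Hom_iff)
    have rw: "\<rho> ?w = \<rho> u \<cdot> \<rho> v" using HomD[OF uv(1)] HomD[OF uv(2)] K by (simp add: u_def v_def)
    have "?e \<cdot> \<rho> ?w = (\<rho> a \<cdot> (\<rho> d \<cdot> \<rho> u)) \<cdot> (\<rho> b \<cdot> (\<rho> d \<cdot> \<rho> v))"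
      unfolding rw t(2) using ty uv' by (simp add: Hom_iff Rst_ac)
    also have "\<dots> = \<rho> u \<cdot> \<rho> v" using ru rv by (simp only: u_def v_def)
    finally show ?thesis using rw by simp
  qed
  then have 2: "?e \<cdot> ?w = ?w" using Comp_eq_self[OF e w] by simp
  let ?k = "\<langle>plus_map C L a b, d\<rangle>"
  have "?e \<cdot> \<rho> ?k = \<rho> ?k" unfolding t(2) using ty L by (simp add: Hom_iff Rst_ac)
  then have "?e \<cdot> ?k = ?k" using Comp_eq_self[OF e] HomD[OF pr(6)] by blast
  then have "?e \<cdot> (?k \<cdot> h) = ?k \<cdot> h" using Comp_Comp[OF e pr(6) h] by simp
  then show ?thesis using 1 2 by simp
qed

text \<open>There is only one variable, so the identity of \<open>X\<close> is the generic
  argument.\<close>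

lemma generic_zero:
  assumes L: "cm L" and K: "cm K" and h: "h \<in> Hom C (mobj L \<^bold>\<times> X) (mobj K)" and f: "f \<in> Hom C X Y"
    and a: "a \<in> Hom C Z X"
    and gen: "\<langle>zero_map C L X, Idn C X\<rangle> \<cdot> h = \<rho> f \<cdot> zero_map C K X"
  shows "\<langle>zero_map C L Z, a\<rangle> \<cdot> h = \<rho> (a \<cdot> f) \<cdot> zero_map C K Z"
proof -
  note a' = HomD[OF a] and f' = HomD[OF f]
  have o: "X \<in> Ob C" "Z \<in> Ob C" using a' Dom_Ob Cod_Ob by auto
  have "\<langle>zero_map C L Z, a\<rangle> \<cdot> h = \<langle>\<rho> a \<cdot> zero_map C L Z, a\<rangle> \<cdot> h"
    using a' o L by (subst Pair_Rst(1)) simp_all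
  also have "\<langle>\<rho> a \<cdot> zero_map C L Z, a\<rangle> = a \<cdot> \<langle>zero_map C L X, Idn C X\<rangle>"
    using a' o L crc_monoid.Comp_zero_map[OF L a'(1,3)] by simp
  also have "\<dots> \<cdot> h = a \<cdot> (\<rho> f \<cdot> zero_map C K X)"
    unfolding gen[symmetric] by (rule Comp_Comp[OF a _ h, symmetric]) (use o L in \<open>simp add: Hom_iff\<close>)
  also have "\<dots> = (a \<cdot> \<rho> f) \<cdot> zero_map C K X" using a' f' o K by (intro assoc[symmetric]) simp_all
  also have "a \<cdot> \<rho> f = \<rho> (a \<cdot> f) \<cdot> a" using a' f' by (intro Comp_Rst) simp_all
  also have "(\<rho> (a \<cdot> f) \<cdot> a) \<cdot> zero_map C K X = \<rho> (a \<cdot> f) \<cdot> (a \<cdot> zero_map C K X)"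
    using a' f' o K by (intro assoc) simp_all
  also have "a \<cdot> zero_map C K X = \<rho> a \<cdot> zero_map C K Z" using crc_monoid.Comp_zero_map[OF K a'(1,3)] a'(2) by simp
  also have "\<rho> (a \<cdot> f) \<cdot> (\<rho> a \<cdot> zero_map C K Z) = (\<rho> (a \<cdot> f) \<cdot> \<rho> a) \<cdot> zero_map C K Z" using a' f' o K by (intro assoc[symmetric]) simp_all
  also have "\<rho> (a \<cdot> f) \<cdot> \<rho> a = \<rho> (a \<cdot> f)" using a' f' by simp
  finally show ?thesis .
qed

text \<open>The first three tuples contain each of \<open>a\<close>, \<open>b\<close> and
  \<open>d\<close>, so they have the domain of the triple \<open>t\<close> and absorb its
  restriction. The last one omits \<open>b\<close>, and the restriction to \<open>t\<close> stays
  visible.\<close>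

lemma generic_pairs:
  assumes ty: "a \<in> Hom C Z B" "b \<in> Hom C Z B" "d \<in> Hom C Z X"
    and P: "Pa = Pr0 C (B \<^bold>\<times> B) X \<cdot> Pr0 C B B" "Pb = Pr0 C (B \<^bold>\<times> B) X \<cdot> Pr1 C B B" "Pd = Pr1 C (B \<^bold>\<times> B) X"
    and t: "t = \<langle>\<langle>a, b\<rangle>, d\<rangle>" and L: "cm L" "mobj L = B"
  shows "t \<cdot> \<langle>\<langle>Pa, zero_map C L ((B \<^bold>\<times> B) \<^bold>\<times> X)\<rangle>, \<langle>Pb, Pd\<rangle>\<rangle> = \<langle>\<langle>a, zero_map C L Z\<rangle>, \<langle>b, d\<rangle>\<rangle>"
    "t \<cdot> \<langle>\<langle>zero_map C L ((B \<^bold>\<times> B) \<^bold>\<times> X), Pa\<rangle>, \<langle>Pb, Pd\<rangle>\<rangle> = \<langle>\<langle>zero_map C L Z, a\<rangle>, \<langle>b, d\<rangle>\<rangle>"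
    "t \<cdot> \<langle>\<langle>zero_map C L ((B \<^bold>\<times> B) \<^bold>\<times> X), Pb\<rangle>, \<langle>Pa, Pd\<rangle>\<rangle> = \<langle>\<langle>zero_map C L Z, b\<rangle>, \<langle>a, d\<rangle>\<rangle>"
    "t \<cdot> \<langle>Pa, Pd\<rangle> = \<rho> t \<cdot> \<langle>a, d\<rangle>"
proof -
  let ?G = "(B \<^bold>\<times> B) \<^bold>\<times> X"
  note tt = triple[OF ty, folded P t]
  have o: "B \<in> Ob C" "X \<in> Ob C" "Z \<in> Ob C" using ty Cod_Ob Dom_Ob by (auto simp: Hom_iff)
  have PH: "Pa \<in> Hom C ?G B" "Pb \<in> Hom C ?G B" "Pd \<in> Hom C ?G X" using o by (simp_all add: P Hom_iff)
  have e: "\<rho> t \<in> Hom C Z Z" using tt(1) by (simp add: Hom_iff)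
  have z: "zero_map C L ?G \<in> Hom C ?G B" "zero_map C L Z \<in> Hom C Z B" using L o by (simp_all add: Hom_iff)
  have tz: "t \<cdot> zero_map C L ?G = \<rho> t \<cdot> zero_map C L Z"
    using crc_monoid.Comp_zero_map[OF L(1), of t ?G] tt(1) by (simp add: Hom_iff)
  note q = PH z(1) and q' = ty z(2) and tq = tt(3-5) tz
  have main: "t \<cdot> \<langle>\<langle>k1, k2\<rangle>, \<langle>k3, Pd\<rangle>\<rangle> = \<langle>\<langle>l1, l2\<rangle>, \<langle>l3, d\<rangle>\<rangle>"
    if k: "k1 \<in> Hom C ?G B" "k2 \<in> Hom C ?G B" "k3 \<in> Hom C ?G B" and l: "l1 \<in> Hom C Z B" "l2 \<in> Hom C Z B" "l3 \<in> Hom C Z B"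
      and kl: "t \<cdot> k1 = \<rho> t \<cdot> l1" "t \<cdot> k2 = \<rho> t \<cdot> l2" "t \<cdot> k3 = \<rho> t \<cdot> l3"
      and r: "\<rho> t = \<rho> l1 \<cdot> (\<rho> l2 \<cdot> (\<rho> l3 \<cdot> \<rho> d))" for k1 k2 k3 l1 l2 l3
  proof -
    let ?l = "\<langle>\<langle>l1, l2\<rangle>, \<langle>l3, d\<rangle>\<rangle>"
    have "t \<cdot> \<langle>\<langle>k1, k2\<rangle>, \<langle>k3, Pd\<rangle>\<rangle> = \<langle>\<langle>\<rho> t \<cdot> l1, \<rho> t \<cdot> l2\<rangle>, \<langle>\<rho> t \<cdot> l3, \<rho> t \<cdot> d\<rangle>\<rangle>"
      using kl tt(5) Comp_Pair_Hom[OF tt(1) Pair_Hom[OF k(1,2)] Pair_Hom[OF k(3) PH(3)]]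
        Comp_Pair_Hom[OF tt(1) k(1,2)] Comp_Pair_Hom[OF tt(1) k(3) PH(3)] by simp
    also have "\<dots> = \<rho> t \<cdot> ?l"
      using Comp_Pair_Hom[OF e Pair_Hom[OF l(1,2)] Pair_Hom[OF l(3) ty(3)]]
        Comp_Pair_Hom[OF e l(1,2)] Comp_Pair_Hom[OF e l(3) ty(3)] by simp
    also have "\<dots> = ?l"
    proof (rule Comp_eq_self[OF e])
      show "?l \<in> Ar C" "Dom C ?l = Z" using l ty by (simp_all add: Hom_iff)
      have "\<rho> ?l = \<rho> t" unfolding r using l ty by (simp add: Hom_iff)
      then show "\<rho> t \<cdot> \<rho> ?l = \<rho> ?l" using tt(1) by (simp add: Hom_iff)
    qed
    finally show ?thesis .
  qed
  show "t \<cdot> \<langle>\<langle>Pa, zero_map C L ?G\<rangle>, \<langle>Pb, Pd\<rangle>\<rangle> = \<langle>\<langle>a, zero_map C L Z\<rangle>, \<langle>b, d\<rangle>\<rangle>"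
    by (rule main[OF q(1,4,2) q'(1,4,2) tq(1,4,2)]) (use L o ty in \<open>simp add: tt(2) Hom_iff\<close>)
  show "t \<cdot> \<langle>\<langle>zero_map C L ?G, Pa\<rangle>, \<langle>Pb, Pd\<rangle>\<rangle> = \<langle>\<langle>zero_map C L Z, a\<rangle>, \<langle>b, d\<rangle>\<rangle>"
    by (rule main[OF q(4,1,2) q'(4,1,2) tq(4,1,2)]) (use L o ty in \<open>simp add: tt(2) Hom_iff\<close>)
  show "t \<cdot> \<langle>\<langle>zero_map C L ?G, Pb\<rangle>, \<langle>Pa, Pd\<rangle>\<rangle> = \<langle>\<langle>zero_map C L Z, b\<rangle>, \<langle>a, d\<rangle>\<rangle>"
    by (rule main[OF q(4,2,1) q'(4,2,1) tq(4,2,1)]) (use L o ty in \<open>simp add: tt(2) Hom_iff Rst_ac\<close>)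
  show "t \<cdot> \<langle>Pa, Pd\<rangle> = \<rho> t \<cdot> \<langle>a, d\<rangle>"
    using Comp_Pair_Hom[OF tt(1) PH(1,3)] Comp_Pair_Hom[OF e ty(1,3)] tt(3,5) by simp
qed

text \<open>The variable \<open>b\<close> plays the part of \<open>c\<close> in [DR.6]. It occurs
  only on the left of the generic equation, so its domain reappears on the right as the factor
  \<open>\<rho> b\<close>.\<close>

lemma generic_DR6:
  assumes L: "cm L" and h: "h \<in> Hom C (mobj L \<^bold>\<times> X) K" and hh: "hh \<in> Hom C ((mobj L \<^bold>\<times> mobj L) \<^bold>\<times> (mobj L \<^bold>\<times> X)) K"
    and ty: "a \<in> Hom C Z (mobj L)" "b \<in> Hom C Z (mobj L)" "d \<in> Hom C Z X"
    and P: "Pa = Pr0 C (mobj L \<^bold>\<times> mobj L) X \<cdot> Pr0 C (mobj L) (mobj L)"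
      "Pb = Pr0 C (mobj L \<^bold>\<times> mobj L) X \<cdot> Pr1 C (mobj L) (mobj L)" "Pd = Pr1 C (mobj L \<^bold>\<times> mobj L) X"
    and gen: "\<langle>\<langle>Pa, zero_map C L ((mobj L \<^bold>\<times> mobj L) \<^bold>\<times> X)\<rangle>, \<langle>Pb, Pd\<rangle>\<rangle> \<cdot> hh = \<langle>Pa, Pd\<rangle> \<cdot> h"
  shows "\<langle>\<langle>a, zero_map C L Z\<rangle>, \<langle>b, d\<rangle>\<rangle> \<cdot> hh = \<rho> b \<cdot> (\<langle>a, d\<rangle> \<cdot> h)"
proof -
  let ?B = "mobj L" and ?G = "(mobj L \<^bold>\<times> mobj L) \<^bold>\<times> X"
  define t where "t = \<langle>\<langle>a, b\<rangle>, d\<rangle>"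
  note p = generic_pairs[OF ty P t_def L refl] and tt = triple[OF ty, folded P t_def]
  have o: "?B \<in> Ob C" "X \<in> Ob C" "Z \<in> Ob C" using ty Cod_Ob Dom_Ob L by (auto simp: Hom_iff)
  have PH: "Pa \<in> Hom C ?G ?B" "Pb \<in> Hom C ?G ?B" "Pd \<in> Hom C ?G X" using o by (simp_all add: P Hom_iff)
  have z: "zero_map C L ?G \<in> Hom C ?G ?B" using L o by (simp add: Hom_iff)
  have "\<langle>\<langle>a, zero_map C L Z\<rangle>, \<langle>b, d\<rangle>\<rangle> \<cdot> hh = t \<cdot> (\<langle>\<langle>Pa, zero_map C L ?G\<rangle>, \<langle>Pb, Pd\<rangle>\<rangle> \<cdot> hh)"
    unfolding p(1)[symmetric] by (rule Comp_Comp[OF tt(1) Pair_Hom[OF Pair_Hom[OF PH(1) z] Pair_Hom[OF PH(2,3)]] hh, symmetric])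
  also have "\<dots> = (t \<cdot> \<langle>Pa, Pd\<rangle>) \<cdot> h" unfolding gen by (rule Comp_Comp[OF tt(1) Pair_Hom[OF PH(1,3)] h])
  also have "\<dots> = (\<rho> t \<cdot> \<langle>a, d\<rangle>) \<cdot> h" unfolding p(4) ..
  also have "\<rho> t \<cdot> \<langle>a, d\<rangle> = \<rho> b \<cdot> \<langle>a, d\<rangle>"
  proof -
    note ty' = ty[unfolded Hom_iff]
    define k where "k = \<langle>a, d\<rangle>"
    have k: "k \<in> Ar C" "Dom C k = Z" "\<rho> k = \<rho> a \<cdot> \<rho> d" using ty' by (simp_all add: k_def)
    have "\<rho> t \<cdot> k = \<rho> b \<cdot> ((\<rho> a \<cdot> \<rho> d) \<cdot> k)" unfolding tt(2) using ty' k by (simp add: Rst_ac)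
    also have "(\<rho> a \<cdot> \<rho> d) \<cdot> k = k" unfolding k(3)[symmetric] using k(1) by (rule Rst_Comp_self)
    finally show ?thesis unfolding k_def .
  qed
  also have "(\<rho> b \<cdot> \<langle>a, d\<rangle>) \<cdot> h = \<rho> b \<cdot> (\<langle>a, d\<rangle> \<cdot> h)"
    by (rule Comp_Comp[OF _ Pair_Hom[OF ty(1,3)] h, symmetric, of _ Z]) (use ty in \<open>simp add: Hom_iff\<close>)
  finally show ?thesis .
qed

lemma generic_DR7:
  assumes L: "cm L" and hh: "hh \<in> Hom C ((mobj L \<^bold>\<times> mobj L) \<^bold>\<times> (mobj L \<^bold>\<times> X)) K"
    and ty: "a \<in> Hom C Z (mobj L)" "b \<in> Hom C Z (mobj L)" "d \<in> Hom C Z X"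
    and P: "Pa = Pr0 C (mobj L \<^bold>\<times> mobj L) X \<cdot> Pr0 C (mobj L) (mobj L)"
      "Pb = Pr0 C (mobj L \<^bold>\<times> mobj L) X \<cdot> Pr1 C (mobj L) (mobj L)" "Pd = Pr1 C (mobj L \<^bold>\<times> mobj L) X"
    and gen: "\<langle>\<langle>zero_map C L ((mobj L \<^bold>\<times> mobj L) \<^bold>\<times> X), Pa\<rangle>, \<langle>Pb, Pd\<rangle>\<rangle> \<cdot> hh
      = \<langle>\<langle>zero_map C L ((mobj L \<^bold>\<times> mobj L) \<^bold>\<times> X), Pb\<rangle>, \<langle>Pa, Pd\<rangle>\<rangle> \<cdot> hh"
  shows "\<langle>\<langle>zero_map C L Z, a\<rangle>, \<langle>b, d\<rangle>\<rangle> \<cdot> hh = \<langle>\<langle>zero_map C L Z, b\<rangle>, \<langle>a, d\<rangle>\<rangle> \<cdot> hh"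
proof -
  let ?B = "mobj L" and ?G = "(mobj L \<^bold>\<times> mobj L) \<^bold>\<times> X"
  define t where "t = \<langle>\<langle>a, b\<rangle>, d\<rangle>"
  note p = generic_pairs[OF ty P t_def L refl] and tt = triple[OF ty, folded P t_def]
  have o: "?B \<in> Ob C" "X \<in> Ob C" "Z \<in> Ob C" using ty Cod_Ob Dom_Ob L by (auto simp: Hom_iff)
  have PH: "Pa \<in> Hom C ?G ?B" "Pb \<in> Hom C ?G ?B" "Pd \<in> Hom C ?G X" using o by (simp_all add: P Hom_iff)
  have z: "zero_map C L ?G \<in> Hom C ?G ?B" using L o by (simp add: Hom_iff)
  have "\<langle>\<langle>zero_map C L Z, a\<rangle>, \<langle>b, d\<rangle>\<rangle> \<cdot> hh = t \<cdot> (\<langle>\<langle>zero_map C L ?G, Pa\<rangle>, \<langle>Pb, Pd\<rangle>\<rangle> \<cdot> hh)"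
    unfolding p(2)[symmetric] by (rule Comp_Comp[OF tt(1) Pair_Hom[OF Pair_Hom[OF z PH(1)] Pair_Hom[OF PH(2,3)]] hh, symmetric])
  also have "\<dots> = \<langle>\<langle>zero_map C L Z, b\<rangle>, \<langle>a, d\<rangle>\<rangle> \<cdot> hh"
    unfolding gen p(3)[symmetric] by (rule Comp_Comp[OF tt(1) Pair_Hom[OF Pair_Hom[OF z PH(2)] Pair_Hom[OF PH(1,3)]] hh])
  finally show ?thesis .
qed


section \<open>The monoids \<open>L\<close> and the linear axioms\<close>

text \<open>At two or more arguments both maps are zero, with the domain given by the component at
  index 0.\<close>

lemma lin_eqI:
  assumes f: "f \<in> FH M X N Y" "lin f" and g: "g \<in> FH M X N Y" "lin g" and 0: "fseq f 0 = fseq g 0"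
    and 1: "\<And>Z a x. coh Z (mobj M) X {a} x \<Longrightarrow> \<rho> x = Idn C Z \<Longrightarrow> ev f {#a#} x = ev g {#a#} x"
  shows "f = g"
proof (rule faa_eqI[OF f(1) g(1) 0])
  fix Z m x assume c: "coh Z (mobj M) X (set_mset m) x" "\<rho> x = Idn C Z" "m \<noteq> {#}"
  show "ev f m x = ev g m x"
  proof (cases "size m \<ge> 2")
    case True
    then show ?thesis using linD[OF f(2,1) c(1)] linD[OF g(2,1) c(1)] 0 by simp
  next
    case False
    then have "size m = 1" using c(3) by (simp add: not_le less_2_cases_iff)
    then obtain a where "m = {#a#}" using size_1_singleton_mset by blast
    then show ?thesis using 1 c by simp
  qed
qed

lemma lin_Comp: "f \<in> FH M X N Y \<Longrightarrow> g \<in> FH N Y K V \<Longrightarrow> lin f \<Longrightarrow> lin g \<Longrightarrow> lin (faa_Comp C f g)"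
  using faa_pair.lin_Comp[OF faa_pairI] .

lemma ev_Comp_singleton: "f \<in> FH M X N Y \<Longrightarrow> g \<in> FH N Y K V \<Longrightarrow> coh Z (mobj M) X {a} x \<Longrightarrow>
    ev (faa_Comp C f g) {#a#} x = ev g {#ev f {#a#} x#} (x \<cdot> fseq f 0)"
  using faa_pair.ev_Comp_singleton[OF faa_pairI] .

lemma coh_ev:
  assumes f: "f \<in> FH M X N Y" and c: "coh Z (mobj M) X (set_mset m) x" "m \<noteq> {#}"
  shows "coh Z (mobj N) Y {ev f m x} (x \<cdot> fseq f 0)"
  using ev_Hom[OF f c] ev_Rst[OF f c(1)] HomD[OF FH_D(7)[OF f]] HomD[OF cohD(1)[OF c(1)]] by (simp add: coh_def Hom_iff)

text \<open>Addition is a homomorphism because the monoid is commutative: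
  \<open>(a + b) + (a' + b') = (a + a') + (b + b')\<close>.\<close>

lemma addhom_madd:
  assumes M: "cm M"
  shows "addhom (prod_monoid C M M) M (madd M)"
proof -
  let ?A = "mobj M"
  have e: "k \<cdot> madd M = plus_map C M (k \<cdot> Pr0 C ?A ?A) (k \<cdot> Pr1 C ?A ?A)" if "k \<in> Hom C Z (?A \<^bold>\<times> ?A)" for k Z
    using that M by (simp add: plus_map_def Hom_iff)
  show ?thesis unfolding addhom_def
  proof (intro conjI allI impI ballI)
    show "madd M \<in> Hom C (mobj (prod_monoid C M M)) (mobj M)" "\<rho> (madd M) = Idn C (mobj (prod_monoid C M M))"
      using M by (simp_all add: Hom_iff)
    show "zero_map C (prod_monoid C M M) Z \<cdot> madd M = zero_map C M Z" if "Z \<in> Ob C" for Z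
      using M that e[of "zero_map C (prod_monoid C M M) Z" Z] by (simp add: Hom_iff)
    fix Z a b assume "a \<in> Hom C Z (mobj (prod_monoid C M M))" "b \<in> Hom C Z (mobj (prod_monoid C M M))"
    then have ab: "a \<in> Hom C Z (?A \<^bold>\<times> ?A)" "b \<in> Hom C Z (?A \<^bold>\<times> ?A)" by simp_all
    let ?p = "\<lambda>k. k \<cdot> Pr0 C ?A ?A" and ?q = "\<lambda>k. k \<cdot> Pr1 C ?A ?A"
    have "plus_map C (prod_monoid C M M) a b \<in> Hom C Z (?A \<^bold>\<times> ?A)"
      using ab crc_monoid.plus_map_type[OF cm_prod[OF M M], of a b] by (simp add: Hom_iff)
    from e[OF this] have "plus_map C (prod_monoid C M M) a b \<cdot> madd M
      = plus_map C M (plus_map C M (?p a) (?p b)) (plus_map C M (?q a) (?q b))"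
      by (simp add: plus_map_prod_Pr[OF M M ab])
    also have "\<dots> = plus_map C M (plus_map C M (?p a) (?q a)) (plus_map C M (?p b) (?q b))"
      using ab M by (simp add: crc_monoid.plus_map_ac[OF M] Hom_iff)
    finally show "plus_map C (prod_monoid C M M) a b \<cdot> madd M = plus_map C M (a \<cdot> madd M) (b \<cdot> madd M)"
      using e ab by simp
  qed
qed

lemma addhom_mzero:
  assumes M: "cm M"
  shows "addhom (trivial_monoid C) M (mzero M)"
  unfolding addhom_def
proof (intro conjI allI impI ballI)
  show "mzero M \<in> Hom C (mobj (trivial_monoid C)) (mobj M)" "\<rho> (mzero M) = Idn C (mobj (trivial_monoid C))"
    using M by (simp_all add: Hom_iff)
  show "zero_map C (trivial_monoid C) Z \<cdot> mzero M = zero_map C M Z" if "Z \<in> Ob C" for Z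
    using M that by (simp add: zero_map_def)
  fix Z a b assume "a \<in> Hom C Z (mobj (trivial_monoid C))" "b \<in> Hom C Z (mobj (trivial_monoid C))"
  then have ab: "a \<in> Hom C Z \<^bold>1" "b \<in> Hom C Z \<^bold>1" by simp_all
  have Z: "Z \<in> Ob C" using ab Dom_Ob by (auto simp: Hom_iff)
  have m: "k \<cdot> mzero M = \<rho> k \<cdot> zero_map C M Z" if k: "k \<in> Hom C Z \<^bold>1" for k
  proof -
    have "k \<cdot> mzero M = (\<rho> k \<cdot> \<^bold>! Z) \<cdot> mzero M" using Bang_Rst[OF k] by simp
    also have "\<dots> = \<rho> k \<cdot> zero_map C M Z" using k Z M unfolding zero_map_def by (intro assoc) (simp_all add: Hom_iff)
    finally show ?thesis .
  qed
  have p: "plus_map C (trivial_monoid C) a b \<in> Hom C Z \<^bold>1" "\<rho> (plus_map C (trivial_monoid C) a b) = \<rho> a \<cdot> \<rho> b"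
    using ab crc_monoid.plus_map_type[OF cm_trivial, of a b] by (simp_all add: Hom_iff)
  have "plus_map C M (\<rho> a \<cdot> zero_map C M Z) (\<rho> b \<cdot> zero_map C M Z)
    = \<rho> a \<cdot> plus_map C M (zero_map C M Z) (\<rho> b \<cdot> zero_map C M Z)"
    using ab Z M by (intro crc_monoid.plus_map_Rst(1)[OF M]) (simp_all add: Hom_iff)
  also have "\<dots> = \<rho> a \<cdot> (\<rho> b \<cdot> zero_map C M Z)" using ab Z M by (simp add: Hom_iff)
  finally show "plus_map C (trivial_monoid C) a b \<cdot> mzero M = plus_map C M (a \<cdot> mzero M) (b \<cdot> mzero M)"
    unfolding m[OF p(1)] m[OF ab(1)] m[OF ab(2)] p(2) using ab Z M by (simp add: Hom_iff)
qed

abbreviation "LA M \<equiv> flin (prod_monoid C M M) (mobj M \<^bold>\<times> mobj M) M (mobj M) (madd M) (madd M)"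
abbreviation "LZ M \<equiv> flin (trivial_monoid C) \<^bold>1 M (mobj M) (mzero M) (mzero M)"

lemma faa_L_simps:
  "mobj (faa_L C (M, X)) = (M, mobj M)" "madd (faa_L C (M, X)) = LA M" "mzero (faa_L C (M, X)) = LZ M"
  by (simp_all add: faa_L_def Let_def faa_Prd_def faa_Trm_def)

lemma LA_flin:
  assumes M: "cm M"
  shows "LA M \<in> FH (prod_monoid C M M) (mobj M \<^bold>\<times> mobj M) M (mobj M)" "lin (LA M)" "fseq (LA M) 0 = madd M"
    "coh Z (mobj M \<^bold>\<times> mobj M) (mobj M \<^bold>\<times> mobj M) {a} x \<Longrightarrow> ev (LA M) {#a#} x = a \<cdot> madd M"
  using flin[OF cm_prod[OF M M] M _ _ _ _ addhom_madd[OF M], of "mobj M \<^bold>\<times> mobj M" "mobj M" "madd M"] M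
  by (auto simp: Hom_iff[of _ C])

lemma LZ_flin:
  assumes M: "cm M"
  shows "LZ M \<in> FH (trivial_monoid C) \<^bold>1 M (mobj M)" "lin (LZ M)" "fseq (LZ M) 0 = mzero M"
    "coh Z \<^bold>1 \<^bold>1 {a} x \<Longrightarrow> ev (LZ M) {#a#} x = a \<cdot> mzero M"
  using flin[OF cm_trivial M _ _ _ _ addhom_mzero[OF M], of "\<^bold>1" "mobj M" "mzero M"] M
  by (auto simp: Hom_iff[of _ C])

text \<open>The monoid \<open>faa_L C (M, X)\<close> is formed from \<open>M\<close> alone, so
  \<open>mobj M\<close> represents every choice of the second component.\<close>

abbreviation "fplus M f g \<equiv> plus_map (faa C) (faa_L C (M, mobj M)) f g"
abbreviation "fzero M S \<equiv> zero_map (faa C) (faa_L C (M, mobj M)) S"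

lemma fplus_eq: "plus_map (faa C) (faa_L C (M, X)) f g = faa_Comp C (faa_Pair C f g) (LA M)"
  by (simp add: plus_map_def faa_L_simps)

lemma fzero_eq: "zero_map (faa C) (faa_L C (M, X)) S = faa_Comp C (faa_Bang C S) (LZ M)"
  by (simp add: zero_map_def faa_L_simps)

text \<open>The addition of \<open>faa_L\<close> is linear and is given by \<open>madd M\<close>
  both at index 0 and on single arguments. Sums in \<open>faa C\<close> are therefore sums of
  values.\<close>

lemma fplus:
  assumes f: "f \<in> FH K V M (mobj M)" and g: "g \<in> FH K V M (mobj M)"
  shows fplus_FH: "fplus M f g \<in> FH K V M (mobj M)"
    and ev_fplus: "coh Z (mobj K) V (set_mset m) x \<Longrightarrow> m \<noteq> {#} \<Longrightarrow> ev (fplus M f g) m x = plus_map C M (ev f m x) (ev g m x)"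
    and fseq_fplus: "fseq (fplus M f g) 0 = plus_map C M (fseq f 0) (fseq g 0)"
    and lin_fplus: "lin f \<Longrightarrow> lin g \<Longrightarrow> lin (fplus M f g)"
proof -
  note M = FH_D(2)[OF f] and p = Pair_FH[OF f g]
  show "fplus M f g \<in> FH K V M (mobj M)" unfolding fplus_eq by (rule Comp_FH[OF p LA_flin(1)[OF M]])
  show "fseq (fplus M f g) 0 = plus_map C M (fseq f 0) (fseq g 0)"
    unfolding fplus_eq using LA_flin(3)[OF M] by (simp add: plus_map_def)
  show "lin (fplus M f g)" if "lin f" "lin g"
    unfolding fplus_eq by (rule lin_Comp[OF p LA_flin(1)[OF M] lin_Pair[OF f g that] LA_flin(2)[OF M]])
  assume c: "coh Z (mobj K) V (set_mset m) x" "m \<noteq> {#}"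
  have "ev (fplus M f g) m x = ev (LA M) {#ev (faa_Pair C f g) m x#} (x \<cdot> fseq (faa_Pair C f g) 0)"
    unfolding fplus_eq by (rule ev_Comp_lin_right[OF p LA_flin(1,2)[OF M] c])
  also have "\<dots> = ev (faa_Pair C f g) m x \<cdot> madd M"
    using coh_ev[OF p c] by (intro LA_flin(4)[OF M]) simp
  finally show "ev (fplus M f g) m x = plus_map C M (ev f m x) (ev g m x)"
    unfolding ev_Pair[OF f g c] plus_map_def .
qed

lemma fzero:
  assumes M: "cm M" and K: "cm K" "V \<in> Ob C"
  shows fzero_FH: "fzero M (K, V) \<in> FH K V M (mobj M)"
    and ev_fzero: "coh Z (mobj K) V (set_mset m) x \<Longrightarrow> m \<noteq> {#} \<Longrightarrow> ev (fzero M (K, V)) m x = \<rho> x \<cdot> zero_map C M Z"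
    and fseq_fzero: "fseq (fzero M (K, V)) 0 = zero_map C M V"
    and lin_fzero: "lin (fzero M (K, V))"
proof -
  note B = faa_Bang_FH[OF K]
  show F: "fzero M (K, V) \<in> FH K V M (mobj M)" unfolding fzero_eq by (rule Comp_FH[OF B LZ_flin(1)[OF M]])
  show F0: "fseq (fzero M (K, V)) 0 = zero_map C M V"
    unfolding fzero_eq using LZ_flin(3)[OF M] by (simp add: zero_map_def)
  show e: "ev (fzero M (K, V)) m x = \<rho> x \<cdot> zero_map C M Z" if c: "coh Z (mobj K) V (set_mset m) x" "m \<noteq> {#}" for Z m x
  proof -
    note x = HomD[OF cohD(1)[OF c(1)]] cohD(4)[OF c(1)]
    have E: "ev (faa_Bang C (K, V)) m x = \<rho> x \<cdot> \<^bold>! Z"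
    proof (rule to_Trm_eqI)
      show "ev (faa_Bang C (K, V)) m x \<in> Hom C Z \<^bold>1" using ev_Hom[OF B c] by simp
    qed (use x K ev_Rst[OF B c(1)] in \<open>simp_all add: Hom_iff\<close>)
    have "ev (fzero M (K, V)) m x = ev (LZ M) {#ev (faa_Bang C (K, V)) m x#} (x \<cdot> fseq (faa_Bang C (K, V)) 0)"
      unfolding fzero_eq by (rule ev_Comp_lin_right[OF B LZ_flin(1,2)[OF M] c])
    also have "\<dots> = ev (faa_Bang C (K, V)) m x \<cdot> mzero M"
      using coh_ev[OF B c] by (intro LZ_flin(4)[OF M]) simp
    finally show ?thesis unfolding E using x M by (simp add: zero_map_def)
  qed
  show "lin (fzero M (K, V))" unfolding lin_def
  proof (intro allI impI)
    fix K' V' M' B' Z m x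
    assume h: "fzero M (K, V) \<in> FH K' V' M' B'" and c: "coh Z (mobj K') V' (set_mset m) x" and m: "size m \<ge> 2"
    have ee: "K' = K" "V' = V" "M' = M" using FH_D(5,6)[OF h] FH_D(5,6)[OF F] by auto
    note c = c[unfolded ee]
    note x = HomD[OF cohD(1)[OF c(1)]] cohD(4)[OF c(1)]
    have "m \<noteq> {#}" using m by auto
    then show "ev (fzero M (K, V)) m x = \<rho> (x \<cdot> fseq (fzero M (K, V)) 0) \<cdot> zero_map C M' Z"
      using e[OF c] x M K by (simp add: F0 ee)
  qed
qed

text \<open>Since sums are formed on values, the monoid laws are inherited from \<open>M\<close> for
  arbitrary maps with this target. The diagrams in the definition are instances at the
  projections.\<close>

lemma cm_faa_L:
  assumes M: "cm M"
  shows "crc_monoid (faa C) (faa_L C (M, X))"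
proof -
  let ?A = "mobj M" and ?L = "faa_L C (M, mobj M)"
  have L: "faa_L C (M, X) = ?L" by (simp add: faa_L_def)
  have A: "?A \<in> Ob C" using M by simp
  have com: "fplus M f g = fplus M g f" if f: "f \<in> FH K V M ?A" and g: "g \<in> FH K V M ?A" for f g K V
  proof (rule faa_eqI[OF fplus_FH[OF f g] fplus_FH[OF g f]])
    show "fseq (fplus M f g) 0 = fseq (fplus M g f) 0"
      unfolding fseq_fplus[OF f g] fseq_fplus[OF g f] using HomD[OF FH_D(7)[OF f]] HomD[OF FH_D(7)[OF g]]
      by (intro crc_monoid.plus_map_commute[OF M]) simp_all
    fix Z m x assume c: "coh Z (mobj K) V (set_mset m) x" "m \<noteq> {#}"
    show "ev (fplus M f g) m x = ev (fplus M g f) m x"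
      unfolding ev_fplus[OF f g c] ev_fplus[OF g f c] using HomD[OF ev_Hom[OF f c]] HomD[OF ev_Hom[OF g c]]
      by (intro crc_monoid.plus_map_commute[OF M]) simp_all
  qed
  have ass: "fplus M (fplus M f g) h = fplus M f (fplus M g h)"
    if f: "f \<in> FH K V M ?A" and g: "g \<in> FH K V M ?A" and h: "h \<in> FH K V M ?A" for f g h K V
  proof (rule faa_eqI[OF fplus_FH[OF fplus_FH[OF f g] h] fplus_FH[OF f fplus_FH[OF g h]]])
    show "fseq (fplus M (fplus M f g) h) 0 = fseq (fplus M f (fplus M g h)) 0"
      unfolding fseq_fplus[OF f g] fseq_fplus[OF g h] fseq_fplus[OF fplus_FH[OF f g] h] fseq_fplus[OF f fplus_FH[OF g h]]
      using HomD[OF FH_D(7)[OF f]] HomD[OF FH_D(7)[OF g]] HomD[OF FH_D(7)[OF h]]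
      by (intro crc_monoid.plus_map_assoc[OF M]) simp_all
    fix Z m x assume c: "coh Z (mobj K) V (set_mset m) x" "m \<noteq> {#}"
    show "ev (fplus M (fplus M f g) h) m x = ev (fplus M f (fplus M g h)) m x"
      unfolding ev_fplus[OF f g c] ev_fplus[OF g h c] ev_fplus[OF fplus_FH[OF f g] h c] ev_fplus[OF f fplus_FH[OF g h] c]
      using HomD[OF ev_Hom[OF f c]] HomD[OF ev_Hom[OF g c]] HomD[OF ev_Hom[OF h c]]
      by (intro crc_monoid.plus_map_assoc[OF M]) simp_all
  qed
  have uni: "fplus M (fzero M (K, V)) f = f" if f: "f \<in> FH K V M ?A" for f K V
  proof -
   have K: "cm M" "cm K" "V \<in> Ob C" using M FH_D(1-3)[OF f] by auto
   note z = fzero_FH[OF K]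
   show ?thesis
   proof (rule faa_eqI[OF fplus_FH[OF z f] f])
    show "fseq (fplus M (fzero M (K, V)) f) 0 = fseq f 0"
      unfolding fseq_fplus[OF z f] fseq_fzero[OF K(1-3)] using HomD[OF FH_D(7)[OF f]] M by simp
    fix Z m x assume c: "coh Z (mobj K) V (set_mset m) x" "\<rho> x = Idn C Z" "m \<noteq> {#}"
    show "ev (fplus M (fzero M (K, V)) f) m x = ev f m x"
      unfolding ev_fplus[OF z f c(1,3)] ev_fzero[OF K(1-3) c(1,3)]
      using HomD[OF ev_Hom[OF f c(1,3)]] M cohD(4)[OF c(1)] by (simp add: c(2))
   qed
  qed
  have CF: "cartesian_restriction_category (faa C)" by (rule cartesian_restriction_category_faa)
  note P0 = fPr0_FH[OF M A M A] and P1 = fPr1_FH[OF M A M A]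
  have AA: "?A \<^bold>\<times> ?A \<in> Ob C" and MM: "cm (prod_monoid C M M)" using A M by simp_all
  note Q0 = fPr0_FH[OF M A MM AA] and Q1 = fPr1_FH[OF M A MM AA]
  have "total_comm_monoid (faa C) ?L"
    unfolding total_comm_monoid_def Let_def
  proof (intro conjI)
    show "mobj ?L \<in> Ob (faa C)" using M A by (simp add: faa_L_simps)
    show "madd ?L \<in> Hom (faa C) (mobj ?L \<^bold>\<times>\<^bsub>faa C\<^esub> mobj ?L) (mobj ?L)"
      using LA_flin(1)[OF M] by (simp add: faa_L_simps faa_Prd_def)
    show "is_total (faa C) (madd ?L)"
      using total_faa_iff[OF LA_flin(1)[OF M]] LA_flin(3)[OF M] M by (simp add: faa_L_simps)
    show "mzero ?L \<in> Hom (faa C) \<^bold>1\<^bsub>faa C\<^esub> (mobj ?L)"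
      using LZ_flin(1)[OF M] by (simp add: faa_L_simps faa_Trm_def)
    show "is_total (faa C) (mzero ?L)"
      using total_faa_iff[OF LZ_flin(1)[OF M]] LZ_flin(3)[OF M] M by (simp add: faa_L_simps)
    show "fplus M (fzero M (mobj ?L)) (Idn (faa C) (mobj ?L)) = Idn (faa C) (mobj ?L)"
      using uni[OF Id_FH[OF M A]] by (simp add: faa_L_simps)
    show "fplus M (Pr1 (faa C) (mobj ?L) (mobj ?L)) (Pr0 (faa C) (mobj ?L) (mobj ?L))
      = fplus M (Pr0 (faa C) (mobj ?L) (mobj ?L)) (Pr1 (faa C) (mobj ?L) (mobj ?L))"
      using com[OF P1 P0] by (simp add: faa_L_simps)
    show "fplus M (fplus M (Pr0 (faa C) (mobj ?L) (mobj ?L \<^bold>\<times>\<^bsub>faa C\<^esub> mobj ?L))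
        (Pr1 (faa C) (mobj ?L) (mobj ?L \<^bold>\<times>\<^bsub>faa C\<^esub> mobj ?L) \<cdot>\<^bsub>faa C\<^esub> Pr0 (faa C) (mobj ?L) (mobj ?L)))
        (Pr1 (faa C) (mobj ?L) (mobj ?L \<^bold>\<times>\<^bsub>faa C\<^esub> mobj ?L) \<cdot>\<^bsub>faa C\<^esub> Pr1 (faa C) (mobj ?L) (mobj ?L))
      = fplus M (Pr0 (faa C) (mobj ?L) (mobj ?L \<^bold>\<times>\<^bsub>faa C\<^esub> mobj ?L))
        (fplus M (Pr1 (faa C) (mobj ?L) (mobj ?L \<^bold>\<times>\<^bsub>faa C\<^esub> mobj ?L) \<cdot>\<^bsub>faa C\<^esub> Pr0 (faa C) (mobj ?L) (mobj ?L))
        (Pr1 (faa C) (mobj ?L) (mobj ?L \<^bold>\<times>\<^bsub>faa C\<^esub> mobj ?L) \<cdot>\<^bsub>faa C\<^esub> Pr1 (faa C) (mobj ?L) (mobj ?L)))"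
      using ass[OF Q0 Comp_FH[OF Q1 P0] Comp_FH[OF Q1 P1]] by (simp add: faa_L_simps faa_Prd_def)
  qed
  then show ?thesis using CF L by (simp add: crc_monoid_def crc_monoid_axioms_def)
qed

text \<open>All structure maps here are total maps into the terminal object, hence equal.\<close>

lemma faa_L_Trm: "faa_L C (faa_Trm C) = trivial_monoid (faa C)"
proof -
  let ?t = "trivial_monoid C"
  have 1: "LA ?t = faa_Bang C (faa_Prd C (faa_Trm C) (faa_Trm C))"
  proof -
    have b: "faa_Bang C (prod_monoid C ?t ?t, \<^bold>1 \<^bold>\<times> \<^bold>1) \<in> FH (prod_monoid C ?t ?t) (\<^bold>1 \<^bold>\<times> \<^bold>1) ?t \<^bold>1" by (rule faa_Bang_FH) simp_all
    have l: "LA ?t \<in> FH (prod_monoid C ?t ?t) (\<^bold>1 \<^bold>\<times> \<^bold>1) ?t \<^bold>1" using LA_flin(1)[OF cm_trivial] by simp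
    show ?thesis using faa_to_Trm_eqI[OF l b] LA_flin(3)[OF cm_trivial] by (simp add: faa_Prd_def faa_Trm_def)
  qed
  have 2: "LZ ?t = faa_Bang C (faa_Trm C)"
  proof -
    have b: "faa_Bang C (?t, \<^bold>1) \<in> FH ?t \<^bold>1 ?t \<^bold>1" by (rule faa_Bang_FH) simp_all
    have l: "LZ ?t \<in> FH ?t \<^bold>1 ?t \<^bold>1" using LZ_flin(1)[OF cm_trivial] by simp
    show ?thesis using faa_to_Trm_eqI[OF l b] LZ_flin(3)[OF cm_trivial] by (simp add: faa_Trm_def)
  qed
  show ?thesis using 1 2 unfolding trivial_monoid_def[of "faa C"]
    by (simp add: faa_L_def Let_def faa_Trm_def faa_Prd_def)
qed

text \<open>Linear maps are compared at index 0 and at one argument. At index 0 the claim is the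
  definition of the product monoid in the base category; at one argument every factor acts by
  composition with its underlying homomorphism, and the same formula appears.\<close>

lemma faa_L_prod:
  assumes M: "cm M" and N: "cm N"
  shows "faa_L C (faa_Prd C (M, X) (N, Y)) = prod_monoid (faa C) (faa_L C (M, X)) (faa_L C (N, Y))"
proof -
  let ?A = "mobj M" and ?B = "mobj N" and ?P = "prod_monoid C M N"
  have o: "?A \<in> Ob C" "?B \<in> Ob C" using M N by simp_all
  have P: "cm ?P" and oP: "?A \<^bold>\<times> ?B \<in> Ob C" using M N by simp_all
  let ?S = "(?P, ?A \<^bold>\<times> ?B)" and ?PP = "prod_monoid C ?P ?P" and ?AB2 = "(?A \<^bold>\<times> ?B) \<^bold>\<times> (?A \<^bold>\<times> ?B)"
  note Q0 = fPr0_FH[OF P oP P oP] and Q1 = fPr1_FH[OF P oP P oP] and lQ = lin_fPr0[OF P oP P oP] lin_fPr1[OF P oP P oP]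
  note R0 = fPr0_FH[OF M o(1) N o(2)] and R1 = fPr1_FH[OF M o(1) N o(2)] and lR = lin_fPr0[OF M o(1) N o(2)] lin_fPr1[OF M o(1) N o(2)]
  let ?q0 = "faa_Pr0 C ?S ?S" and ?q1 = "faa_Pr1 C ?S ?S" and ?r0 = "faa_Pr0 C (M, ?A) (N, ?B)" and ?r1 = "faa_Pr1 C (M, ?A) (N, ?B)"
  let ?c0 = "faa_Pair C (faa_Comp C ?q0 ?r0) (faa_Comp C ?q1 ?r0)"
  let ?c1 = "faa_Pair C (faa_Comp C ?q0 ?r1) (faa_Comp C ?q1 ?r1)"
  note qr = Comp_FH[OF Q0 R0] Comp_FH[OF Q1 R0] Comp_FH[OF Q0 R1] Comp_FH[OF Q1 R1]
  note lqr = lin_Comp[OF Q0 R0 lQ(1) lR(1)] lin_Comp[OF Q1 R0 lQ(2) lR(1)] lin_Comp[OF Q0 R1 lQ(1) lR(2)] lin_Comp[OF Q1 R1 lQ(2) lR(2)]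
  note c0 = Pair_FH[OF qr(1,2)] lin_Pair[OF qr(1,2) lqr(1,2)] and c1 = Pair_FH[OF qr(3,4)] lin_Pair[OF qr(3,4) lqr(3,4)]
  note d0 = Comp_FH[OF c0(1) LA_flin(1)[OF M]] lin_Comp[OF c0(1) LA_flin(1)[OF M] c0(2) LA_flin(2)[OF M]]
    and d1 = Comp_FH[OF c1(1) LA_flin(1)[OF N]] lin_Comp[OF c1(1) LA_flin(1)[OF N] c1(2) LA_flin(2)[OF N]]
  let ?d = "faa_Pair C (faa_Comp C ?c0 (LA M)) (faa_Comp C ?c1 (LA N))"
  note d = Pair_FH[OF d0(1) d1(1)] lin_Pair[OF d0(1) d1(1) d0(2) d1(2)]
  have lP: "LA ?P \<in> FH ?PP ?AB2 ?P (?A \<^bold>\<times> ?B)" using LA_flin(1)[OF P] by simp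
  have mP: "madd ?P = \<langle>cross C (Pr0 C ?A ?B) (Pr0 C ?A ?B) \<cdot> madd M, cross C (Pr1 C ?A ?B) (Pr1 C ?A ?B) \<cdot> madd N\<rangle>"
    by (simp add: prod_monoid_def Let_def)
  have madd: "LA ?P = ?d"
  proof (rule lin_eqI[OF lP LA_flin(2)[OF P] d])
    show "fseq (LA ?P) 0 = fseq ?d 0"
      unfolding LA_flin(3)[OF P] using LA_flin(3)[OF M] LA_flin(3)[OF N] o by (simp add: mP cross_def)
    fix Z a x assume "coh Z (mobj ?PP) ?AB2 {a} x" and tot: "\<rho> x = Idn C Z"
    then have c: "coh Z ?AB2 ?AB2 {a} x" and c': "coh Z (mobj ?PP) ?AB2 {a} x"
      and cm: "coh Z (mobj ?PP) ?AB2 (set_mset {#a#}) x" by simp_all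
    note x = HomD[OF cohD(1)[OF c]] cohD(4)[OF c]
    have a: "a \<in> Ar C" "Dom C a = Z" "Cod C a = ?AB2" "\<rho> a = Idn C Z"
      using c tot by (auto simp: coh_insert Hom_iff)
    have cq: "coh Z (mobj ?P) (?A \<^bold>\<times> ?B) {a \<cdot> Pr0 C (?A \<^bold>\<times> ?B) (?A \<^bold>\<times> ?B)} (x \<cdot> Pr0 C (?A \<^bold>\<times> ?B) (?A \<^bold>\<times> ?B))"
      "coh Z (mobj ?P) (?A \<^bold>\<times> ?B) {a \<cdot> Pr1 C (?A \<^bold>\<times> ?B) (?A \<^bold>\<times> ?B)} (x \<cdot> Pr1 C (?A \<^bold>\<times> ?B) (?A \<^bold>\<times> ?B))"
      using a x tot oP by (simp_all add: coh_def Hom_iff)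
    have eq: "ev ?q0 {#a#} x = a \<cdot> Pr0 C (?A \<^bold>\<times> ?B) (?A \<^bold>\<times> ?B)" "ev ?q1 {#a#} x = a \<cdot> Pr1 C (?A \<^bold>\<times> ?B) (?A \<^bold>\<times> ?B)"
      using ev_fPr0[OF P oP P oP] ev_fPr1[OF P oP P oP] c by simp_all
    have e: "ev (faa_Comp C ?q0 ?r0) {#a#} x = (a \<cdot> Pr0 C (?A \<^bold>\<times> ?B) (?A \<^bold>\<times> ?B)) \<cdot> Pr0 C ?A ?B"
      "ev (faa_Comp C ?q1 ?r0) {#a#} x = (a \<cdot> Pr1 C (?A \<^bold>\<times> ?B) (?A \<^bold>\<times> ?B)) \<cdot> Pr0 C ?A ?B"
      "ev (faa_Comp C ?q0 ?r1) {#a#} x = (a \<cdot> Pr0 C (?A \<^bold>\<times> ?B) (?A \<^bold>\<times> ?B)) \<cdot> Pr1 C ?A ?B"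
      "ev (faa_Comp C ?q1 ?r1) {#a#} x = (a \<cdot> Pr1 C (?A \<^bold>\<times> ?B) (?A \<^bold>\<times> ?B)) \<cdot> Pr1 C ?A ?B"
      using ev_Comp_singleton[OF Q0 R0 c'] ev_Comp_singleton[OF Q1 R0 c'] ev_Comp_singleton[OF Q0 R1 c'] ev_Comp_singleton[OF Q1 R1 c']
        ev_fPr0[OF M o(1) N o(2)] ev_fPr1[OF M o(1) N o(2)] cq by (simp_all add: eq del: assoc)
    have ne: "{#a#} \<noteq> {#}" by simp
    note ec = ev_Pair[OF qr(1,2) cm ne] ev_Pair[OF qr(3,4) cm ne]
    have ed: "ev (faa_Comp C ?c0 (LA M)) {#a#} x = ev ?c0 {#a#} x \<cdot> madd M"
      "ev (faa_Comp C ?c1 (LA N)) {#a#} x = ev ?c1 {#a#} x \<cdot> madd N"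
      using ev_Comp_singleton[OF c0(1) LA_flin(1)[OF M] c'] ev_Comp_singleton[OF c1(1) LA_flin(1)[OF N] c']
        coh_ev[OF c0(1) cm] coh_ev[OF c1(1) cm] LA_flin(4)[OF M] LA_flin(4)[OF N] by simp_all
    have "ev ?d {#a#} x = \<langle>ev ?c0 {#a#} x \<cdot> madd M, ev ?c1 {#a#} x \<cdot> madd N\<rangle>"
      using ev_Pair[OF d0(1) d1(1) cm] ed by simp
    also have "\<dots> = a \<cdot> madd ?P"
    proof -
      have s: "a \<cdot> (cross C p p \<cdot> k) = \<langle>(a \<cdot> Pr0 C (?A \<^bold>\<times> ?B) (?A \<^bold>\<times> ?B)) \<cdot> p, (a \<cdot> Pr1 C (?A \<^bold>\<times> ?B) (?A \<^bold>\<times> ?B)) \<cdot> p\<rangle> \<cdot> k"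
        if "p \<in> Hom C (?A \<^bold>\<times> ?B) D" "k \<in> Hom C (D \<^bold>\<times> D) W" for p k D W
      proof -
        note that = HomD[OF that(1)] HomD[OF that(2)]
        have "a \<cdot> (cross C p p \<cdot> k) = (a \<cdot> cross C p p) \<cdot> k" using a that by (intro assoc[symmetric]) simp_all
        then show ?thesis using a that oP by (simp add: Comp_cross)
      qed
      have mA: "madd M \<in> Hom C (?A \<^bold>\<times> ?A) ?A" "madd N \<in> Hom C (?B \<^bold>\<times> ?B) ?B" using M N by (simp_all add: Hom_iff)
      have eqn: "a \<cdot> madd ?P = \<langle>a \<cdot> (cross C (Pr0 C ?A ?B) (Pr0 C ?A ?B) \<cdot> madd M), a \<cdot> (cross C (Pr1 C ?A ?B) (Pr1 C ?A ?B) \<cdot> madd N)\<rangle>"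
        unfolding mP using a o M N by (intro Comp_Pair) simp_all
      show ?thesis unfolding ec e eqn s[OF Pr0_Hom[OF o] mA(1)] s[OF Pr1_Hom[OF o] mA(2)] ..
    qed
    finally show "ev (LA ?P) {#a#} x = ev ?d {#a#} x" using LA_flin(4)[OF P] c by simp
  qed
  have lZ: "LZ ?P \<in> FH (trivial_monoid C) \<^bold>1 ?P (?A \<^bold>\<times> ?B)" using LZ_flin(1)[OF P] by simp
  note dz = Pair_FH[OF LZ_flin(1)[OF M] LZ_flin(1)[OF N]] lin_Pair[OF LZ_flin(1)[OF M] LZ_flin(1)[OF N] LZ_flin(2)[OF M] LZ_flin(2)[OF N]]
  have mzero: "LZ ?P = faa_Pair C (LZ M) (LZ N)"
  proof (rule lin_eqI[OF lZ LZ_flin(2)[OF P] dz])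
    show "fseq (LZ ?P) 0 = fseq (faa_Pair C (LZ M) (LZ N)) 0"
      using LZ_flin(3)[OF P] LZ_flin(3)[OF M] LZ_flin(3)[OF N] by simp
    fix Z a x assume c: "coh Z (mobj (trivial_monoid C)) \<^bold>1 {a} x"
    then have c1: "coh Z \<^bold>1 \<^bold>1 {a} x" and cm: "coh Z (mobj (trivial_monoid C)) \<^bold>1 (set_mset {#a#}) x" by simp_all
    have a: "a \<in> Ar C" "Dom C a = Z" "Cod C a = \<^bold>1" using c1 by (auto simp: coh_insert Hom_iff)
    show "ev (LZ ?P) {#a#} x = ev (faa_Pair C (LZ M) (LZ N)) {#a#} x"
      using ev_Pair[OF LZ_flin(1)[OF M] LZ_flin(1)[OF N] cm] LZ_flin(4)[OF P c1] LZ_flin(4)[OF M c1] LZ_flin(4)[OF N c1] a M N by simp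
  qed
  show ?thesis
    unfolding prod_monoid_def[of "faa C"] Let_def faa_L_simps
    using madd mzero FH_D(5)[OF R0] FH_D(5)[OF R1] by (simp add: faa_L_def Let_def faa_Prd_def cross_def faa_Trm_def)
qed

text \<open>Admitting the empty index set includes the comparison at index 0, which is obtained by
  evaluation at the identity.\<close>

lemma faa_eqI_E0:
  assumes f: "f \<in> FH M X N Y" and g: "g \<in> FH M X N Y"
    and E: "\<And>Z (S::nat set) a x. coh Z (mobj M) X (a ` S) x \<Longrightarrow> finite S \<Longrightarrow> E f S a x = E g S a x"
  shows "f = g"
proof (rule faa_eqI_E[OF f g])
  note f0 = HomD[OF FH_D(7)[OF f]] and g0 = HomD[OF FH_D(7)[OF g]] and X = FH_D(3)[OF f]
  have "coh X (mobj M) X ((\<lambda>i. undefined) ` ({}::nat set)) (Idn C X)" using X by (simp add: coh_def Hom_iff)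
  from E[OF this] show "fseq f 0 = fseq g 0" using f0 g0 by (simp add: E_def ev_empty)
qed (rule E)

lemma E_empty: "E f {} a x = x \<cdot> fseq f 0"
  by (simp add: E_def ev_empty)

lemma E_fplus:
  assumes f: "f \<in> FH K V M (mobj M)" and g: "g \<in> FH K V M (mobj M)" and c: "coh Z (mobj K) V (a ` S) x" "finite S"
  shows "E (fplus M f g) S a x = plus_map C M (E f S a x) (E g S a x)"
proof (cases "S = {}")
  case True
  show ?thesis unfolding True E_empty fseq_fplus[OF f g]
    using HomD[OF FH_D(7)[OF f]] HomD[OF FH_D(7)[OF g]] HomD[OF cohD(1)[OF c(1)]]
    by (intro crc_monoid.Comp_plus_map[OF FH_D(2)[OF f]]) simp_all
next
  case False
  then show ?thesis unfolding E_def using c by (intro ev_fplus[OF f g]) (auto simp: mset_set_empty_iff)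
qed

lemma E_fzero:
  assumes M: "cm M" "cm K" "V \<in> Ob C" and c: "coh Z (mobj K) V (a ` S) x" "finite S"
  shows "E (fzero M (K, V)) S a x = \<rho> x \<cdot> zero_map C M Z"
proof (cases "S = {}")
  case True
  show ?thesis unfolding True E_empty fseq_fzero[OF M]
    using HomD[OF cohD(1)[OF c(1)]] crc_monoid.Comp_zero_map[OF M(1), of x V] by simp
next
  case False
  then show ?thesis unfolding E_def using c by (intro ev_fzero[OF M]) (auto simp: mset_set_empty_iff)
qed

lemma E_Rst_Comp:
  assumes f: "f \<in> FH M X N Y" and g: "g \<in> FH M X K V" and c: "coh Z (mobj M) X (a ` S) x" "finite S"
  shows "E (faa_Comp C (faa_Rst C f) g) S a x = \<rho> (x \<cdot> fseq f 0) \<cdot> E g S a x"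
proof (cases "S = {}")
  case True
  note x = HomD[OF cohD(1)[OF c(1)]] and f0 = HomD[OF FH_D(7)[OF f]] and g0 = HomD[OF FH_D(7)[OF g]]
  have "x \<cdot> (\<rho> (fseq f 0) \<cdot> fseq g 0) = (x \<cdot> \<rho> (fseq f 0)) \<cdot> fseq g 0" using x f0 g0 by (intro assoc[symmetric]) simp_all
  also have "x \<cdot> \<rho> (fseq f 0) = \<rho> (x \<cdot> fseq f 0) \<cdot> x" using x f0 by (intro Comp_Rst) simp_all
  finally show ?thesis unfolding True E_empty using x f0 g0 by simp
next
  case False
  then show ?thesis unfolding E_def using c by (intro ev_Rst_Comp[OF f g]) (auto simp: mset_set_empty_iff)
qed

lemma Rst_faa_eqI:
  assumes f: "f \<in> FH M X N Y" and g: "g \<in> FH M X K V" and r: "\<rho> (fseq f 0) = \<rho> (fseq g 0)"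
  shows "faa_Rst C f = faa_Rst C g"
proof (rule faa_eqI[OF Rst_FH[OF f] Rst_FH[OF g]])
  show "fseq (faa_Rst C f) 0 = fseq (faa_Rst C g) 0" using r by simp
  fix Z m x assume c: "coh Z (mobj M) X (set_mset m) x" "m \<noteq> {#}"
  have "\<rho> (x \<cdot> fseq f 0) = \<rho> (x \<cdot> fseq g 0)"
    using HomD[OF FH_D(7)[OF f]] HomD[OF FH_D(7)[OF g]] HomD[OF cohD(1)[OF c(1)]] r by (intro Rst_mono_eq) simp_all
  then show "ev (faa_Rst C f) m x = ev (faa_Rst C g) m x"
    unfolding ev_Rst_faa[OF f c] ev_Rst_faa[OF g c] by simp
qed

end

section \<open>The derivative of linear maps\<close>

context faa_map
begin

text \<open>With one variable the derivative is \<open>f\<^sub>2(a, w, x) + f\<^sub>1(v, x)\<close>,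
  whose first summand vanishes. With two or more variables each summand evaluates \<open>f\<close>
  at two or more arguments.\<close>

lemma D_lin:
  assumes l: "lin f"
  shows lin_D: "lin df"
    and ev_D_lin: "coh Z (A \<^bold>\<times> A) (A \<^bold>\<times> X) {p} q \<Longrightarrow> ev df {#p#} q = ev f {#p \<cdot> pA0#} (q \<cdot> pX1)"
proof -
  show "ev df {#p#} q = ev f {#p \<cdot> pA0#} (q \<cdot> pX1)" if c: "coh Z (A \<^bold>\<times> A) (A \<^bold>\<times> X) {p} q"
  proof -
    let ?x = "q \<cdot> pX1"
    have c0: "coh Z (A \<^bold>\<times> A) (A \<^bold>\<times> X) ((\<lambda>i::nat. p) ` {0}) q" using c by simp
    note cD = coh_D[OF c0]
    have Z: "Z \<in> Ob C" using cohD(4)[OF c] .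
    have cA: "coh Z A X {p \<cdot> pA0} ?x" by (rule coh_mono[OF cD]) auto
    have e: "ev f {#p \<cdot> pA0#} ?x \<in> Hom C Z (mobj N)" "\<rho> (ev f {#p \<cdot> pA0#} ?x) = \<rho> (?x \<cdot> fseq f 0)"
      using ev_Hom[OF f, of Z "{#p \<cdot> pA0#}"] ev_Rst[OF f, of Z "{#p \<cdot> pA0#}"] cA by simp_all
    have "coh Z A X (set_mset {#q \<cdot> pX0, p \<cdot> pA1#}) ?x" by (rule coh_mono[OF cD]) auto
    from linD[OF l f this] have z: "ev f {#q \<cdot> pX0, p \<cdot> pA1#} ?x = \<rho> (ev f {#p \<cdot> pA0#} ?x) \<cdot> zero_map C N Z" using e by simp
    have "ev df {#p#} q = dd Z {0::nat} (\<lambda>i. p) q" using E_D[OF c0] by (simp add: E_singleton)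
    also have "\<dots> = plus_map C N (ev f {#q \<cdot> pX0, p \<cdot> pA1#} ?x) (ev f {#p \<cdot> pA0#} ?x)"
      using e(1) Z by (simp add: ds_def E_singleton)
    also have "\<dots> = ev f {#p \<cdot> pA0#} ?x" unfolding z using HomD[OF e(1)] by simp
    finally show ?thesis .
  qed
  show "lin df" unfolding lin_def
  proof (intro allI impI)
    fix M' X' N' Y' Z m q
    assume h: "df \<in> FH M' X' N' Y'" and c: "coh Z (mobj M') X' (set_mset m) q" and m: "size m \<ge> 2"
    have ee: "M' = MM" "X' = A \<^bold>\<times> X" "N' = N" using FH_D(5,6)[OF h] FH_D(5,6)[OF D_FH] by auto
    obtain n and ps :: "'m list" where ps: "m = image_mset (nth ps) (mset_set {..<n})" using ev_indexed by metis
    let ?p = "nth ps" and ?S = "{..<n}"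
    have n: "n \<ge> 2" using m ps by simp
    have c: "coh Z (A \<^bold>\<times> A) (A \<^bold>\<times> X) (?p ` ?S) q" using c ps ee by simp
    let ?v = "\<lambda>i. ?p i \<cdot> pA0" and ?w = "\<lambda>i. ?p i \<cdot> pA1" and ?a = "q \<cdot> pX0" and ?x = "q \<cdot> pX1"
    let ?o = "\<rho> (?x \<cdot> fseq f 0) \<cdot> zero_map C N Z"
    note cD = coh_D[OF c]
    have Z: "Z \<in> Ob C" using cohD(4)[OF c] .
    have x: "?x \<in> Ar C" "Dom C ?x = Z" "Cod C ?x = X" using HomD[OF cohD(1)[OF cD]] by simp_all
    have h: "ev f (add_mset ?a (image_mset ?w (mset_set ?S))) ?x = ?o"
      by (rule linD[OF l f]) (rule coh_mono[OF cD], use n in auto)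
    have t: "E f ?S (?w(j := ?v j)) ?x = ?o" if "j \<in> ?S" for j
      unfolding E_def by (rule linD[OF l f]) (rule coh_mono[OF cD], use n that in auto)
    have S: "?S \<noteq> {}" using n by (auto simp: lessThan_empty_iff)
    have "E df ?S ?p q = dd Z ?S ?p q" by (rule E_D[OF c finite_lessThan])
    also have "\<dots> = plus_map C N ?o ?o" unfolding ds_def h
      using crc_monoid.sum_map_all_rzero[OF cN finite_lessThan S, of "?x \<cdot> fseq f 0" Z "\<lambda>j. E f ?S (?w(j := ?v j)) ?x"] t x by simp
    also have "\<dots> = ?o" using Z x by simp
    also have "\<rho> (?x \<cdot> fseq f 0) = \<rho> (q \<cdot> fseq df 0)"
      using ev_Rst[OF D_FH, of Z "{#}" q] ds_type(2)[OF cD finite_lessThan]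
        E_Rst[OF D_FH, of Z ?p ?S q] c E_D[OF c finite_lessThan] by simp
    finally show "ev df m q = \<rho> (q \<cdot> fseq df 0) \<cdot> zero_map C N' Z" by (simp add: E_def ps ee)
  qed
qed

text \<open>Additivity in the direction \<open>(v, a)\<close> for fixed \<open>w\<close>, the
  content of [DR.2]. Each summand contains exactly one of \<open>a\<close> and the
  \<open>v j\<close> as an argument, and only once.\<close>

lemma ds_plus:
  assumes c: "coh Z A X ({a, a'} \<union> v ` S \<union> v' ` S \<union> w ` S) x" and S: "finite S"
  shows "ds Z S (\<lambda>i. plus_map C M (v i) (v' i)) w (plus_map C M a a') x
    = plus_map C N (ds Z S v w a x) (ds Z S v' w a' x)"
proof -
  have Z: "Z \<in> Ob C" using cohD(4)[OF c] .
  have c1: "coh Z A X (insert a (v ` S \<union> w ` S)) x" and c2: "coh Z A X (insert a' (v' ` S \<union> w ` S)) x"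
    by (rule coh_mono[OF c], auto)+
  note s1 = ds_summands(1,3)[OF c1 S] ds_sum(1)[OF c1 S] and s2 = ds_summands(1,3)[OF c2 S] ds_sum(1)[OF c2 S]
  have h: "ev f (add_mset (plus_map C M a a') (image_mset w (mset_set S))) x
    = plus_map C N (ev f (add_mset a (image_mset w (mset_set S))) x) (ev f (add_mset a' (image_mset w (mset_set S))) x)"
    by (rule ev_plus[OF f]) (rule coh_mono[OF c], use S in auto)
  have t: "E f S (w(j := plus_map C M (v j) (v' j))) x = plus_map C N (E f S (w(j := v j)) x) (E f S (w(j := v' j)) x)"
    if j: "j \<in> S" for j
    by (rule E_update_plus[OF f S j]) (rule coh_mono[OF c], use j in auto)
  have "sum_map C N Z (\<lambda>j. E f S (w(j := plus_map C M (v j) (v' j))) x) S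
    = sum_map C N Z (\<lambda>j. plus_map C N (E f S (w(j := v j)) x) (E f S (w(j := v' j)) x)) S"
    using t s1(2) s2(2) Z by (intro crc_monoid.sum_map_cong) (auto simp: Hom_iff)
  also have "\<dots> = plus_map C N (sum_map C N Z (\<lambda>j. E f S (w(j := v j)) x) S) (sum_map C N Z (\<lambda>j. E f S (w(j := v' j)) x) S)"
    using s1(2) s2(2) Z by (intro crc_monoid.sum_map_plus) auto
  finally show ?thesis unfolding ds_def h using s1(1,3) s2(1,3)
    by (simp add: Hom_iff crc_monoid.plus_map_ac[OF cN])
qed

text \<open>All summands containing \<open>w j\<close> vanish; the only one without it has
  \<open>v j\<close> in its place.\<close>

lemma ds_zero_at:
  assumes c: "coh Z A X (insert a (v ` S \<union> w ` S)) x" and S: "finite S" "j \<in> S" and w: "w j = \<rho> x \<cdot> zero_map C M Z"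
  shows "ds Z S v w a x = E f S (w(j := v j)) x"
proof -
  let ?z = "\<rho> x \<cdot> zero_map C M Z" and ?e = "E f S (w(j := v j)) x"
  note s = ds_summands[OF c S(1)]
  have Z: "Z \<in> Ob C" using cohD(4)[OF c] .
  have ms: "mset_set S = add_mset j (mset_set (S - {j}))"
    using S mset_set.remove by fastforce
  have "ev f (add_mset ?z (add_mset a (image_mset w (mset_set (S - {j}))))) x = \<rho> (x \<cdot> fseq f 0) \<cdot> zero_map C N Z"
    by (rule ev_rzero[OF f]) (rule coh_mono[OF c], use S(1) in auto)
  then have h: "ev f (add_mset a (image_mset w (mset_set S))) x = \<rho> (x \<cdot> fseq f 0) \<cdot> zero_map C N Z"
    unfolding ms by (simp add: w add_mset_commute)
  have t: "E f S (w(k := v k)) x = \<rho> (x \<cdot> fseq f 0) \<cdot> zero_map C N Z" if k: "k \<in> S" "k \<noteq> j" for k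
  proof -
    have e: "w(k := v k) = (w(k := v k))(j := ?z)" using k(2) w by auto
    show ?thesis by (subst e, rule E_update_rzero[OF f S]) (rule coh_mono[OF c], use k in auto)
  qed
  have "sum_map C N Z (\<lambda>j. E f S (w(j := v j)) x) S = ?e"
    by (rule crc_monoid.sum_map_single[OF cN S]) (use s(3,4)[OF S(2)] t in simp_all)
  then show ?thesis unfolding ds_def h using s(3,4)[OF S(2)] Z HomD[OF s(3)[OF S(2)]] cohD(1)[OF c]
    by (simp add: Hom_iff)
qed

text \<open>A pair of linear maps acts on the arguments one by one, so composing it with the
  derivative substitutes values into \<open>ds\<close>. The generic instances of the differential
  axioms are computed in this way.\<close>

lemma pair_D:
  assumes u: "u \<in> FH K V M A" "lin u" "\<rho> (fseq u 0) = Idn C V"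
    and w: "w \<in> FH K V M X" "lin w" "\<rho> (fseq w 0) = Idn C V"
    and c: "coh Z (mobj K) V (r ` S) s" "finite S"
  shows E_pair_coh: "coh Z A X (insert (s \<cdot> fseq u 0) ((\<lambda>i. ev u {#r i#} s) ` S \<union> (\<lambda>i. ev w {#r i#} s) ` S)) (s \<cdot> fseq w 0)"
    and E_pair_D: "E (faa_Comp C (faa_Pair C u w) df) S r s
    = ds Z S (\<lambda>i. ev u {#r i#} s) (\<lambda>i. ev w {#r i#} s) (s \<cdot> fseq u 0) (s \<cdot> fseq w 0)"
proof -
  let ?l = "faa_Pair C u w"
  note u0 = HomD[OF FH_D(7)[OF u(1)]] u(3) and w0 = HomD[OF FH_D(7)[OF w(1)]] w(3)
  note s = HomD[OF cohD(1)[OF c(1)]] cohD(4)[OF c(1)]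
  have ci: "coh Z (mobj K) V (set_mset {#r i#}) s" if "i \<in> S" for i using that by (intro coh_mono[OF c(1)]) auto
  have e: "ev u {#r i#} s \<in> Hom C Z A" "\<rho> (ev u {#r i#} s) = \<rho> s"
    "ev w {#r i#} s \<in> Hom C Z A" "\<rho> (ev w {#r i#} s) = \<rho> s" if "i \<in> S" for i
    using ev_Hom[OF u(1) ci[OF that]] ev_Rst[OF u(1) ci[OF that]] ev_Hom[OF w(1) ci[OF that]] ev_Rst[OF w(1) ci[OF that]]
      s u0 w0 by simp_all
  show coh: "coh Z A X (insert (s \<cdot> fseq u 0) ((\<lambda>i. ev u {#r i#} s) ` S \<union> (\<lambda>i. ev w {#r i#} s) ` S)) (s \<cdot> fseq w 0)"
    using e s u0 w0 by (auto simp: coh_def Hom_iff)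
  have l: "?l \<in> FH K V MM (A \<^bold>\<times> X)" "lin ?l" using Pair_FH[OF u(1) w(1)] lin_Pair[OF u(1) w(1) u(2) w(2)] by simp_all
  let ?p = "\<lambda>i. \<langle>ev u {#r i#} s, ev w {#r i#} s\<rangle>" and ?q = "\<langle>s \<cdot> fseq u 0, s \<cdot> fseq w 0\<rangle>"
  have q: "s \<cdot> fseq ?l 0 = ?q" using s u0 w0 by simp
  have cp: "coh Z (A \<^bold>\<times> A) (A \<^bold>\<times> X) (?p ` S) ?q" using e s u0 w0 by (auto simp: coh_def Hom_iff)
  have "E (faa_Comp C ?l df) S r s = E df S ?p ?q"
  proof (cases "S = {}")
    case True
    have "s \<cdot> (fseq ?l 0 \<cdot> fseq df 0) = (s \<cdot> fseq ?l 0) \<cdot> fseq df 0"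
      by (rule Comp_Comp[OF cohD(1)[OF c(1)] FH_D(7)[OF l(1)] FH_D(7)[OF D_FH]])
    then show ?thesis unfolding True E_empty fseq_Comp_0 q .
  next
    case False
    have lc: "E (faa_Comp C ?l df) S r s = E df S (\<lambda>i. ev ?l {#r i#} s) (s \<cdot> fseq ?l 0)"
      by (rule faa_pair.E_Comp_lin_left[OF faa_pairI[OF l(1) D_FH] l(2) c False])
    show ?thesis unfolding lc q
    proof (rule E_cong)
      show "ev ?l {#r i#} s = ?p i" if "i \<in> S" for i by (rule ev_Pair[OF u(1) w(1) ci[OF that]]) simp
    qed
  qed
  also have "\<dots> = dd Z S ?p ?q" by (rule E_D[OF cp c(2)])
  also have "\<dots> = ds Z S (\<lambda>i. ev u {#r i#} s) (\<lambda>i. ev w {#r i#} s) (s \<cdot> fseq u 0) (s \<cdot> fseq w 0)"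
  proof -
    have qq: "?q \<cdot> pX0 = s \<cdot> fseq u 0" "?q \<cdot> pX1 = s \<cdot> fseq w 0"
      by (rule Pair_Comp_Pr_same[of _ Z]; use s u0 w0 in \<open>simp add: Hom_iff\<close>)+
    have pp: "?p i \<cdot> pA0 = ev u {#r i#} s" "?p i \<cdot> pA1 = ev w {#r i#} s" if "i \<in> S" for i
      by (rule Pair_Comp_Pr_same[of _ Z]; use e[OF that] in simp)+
    show ?thesis unfolding qq by (rule ds_cong[OF coh_D[OF cp, unfolded qq] c(2) pp])
  qed
  finally show "E (faa_Comp C ?l df) S r s
    = ds Z S (\<lambda>i. ev u {#r i#} s) (\<lambda>i. ev w {#r i#} s) (s \<cdot> fseq u 0) (s \<cdot> fseq w 0)" .
qed

end

context cartesian_restriction_category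
begin

text \<open>This covers [DR.1] and [DR.3], as addition, zero and the projections all have this form.
  Both sides are linear and apply \<open>k\<close> to the first component of their argument.\<close>

lemma D_flin:
  assumes M: "cm M" "cm N" "X \<in> Ob C" "Y \<in> Ob C" and u: "u \<in> Hom C X Y" "\<rho> u = Idn C X" and k: "addhom M N k"
  shows "faa_D C (flin M X N Y u k) = faa_Comp C (faa_Pr0 C (M, mobj M) (M, X)) (flin M (mobj M) N (mobj N) k k)"
proof -
  have k': "k \<in> Hom C (mobj M) (mobj N)" "\<rho> k = Idn C (mobj M)" using k by (auto simp: addhom_def)
  have o: "mobj M \<in> Ob C" "mobj N \<in> Ob C" using M by simp_all
  let ?f = "flin M X N Y u k" and ?g = "flin M (mobj M) N (mobj N) k k" and ?p = "faa_Pr0 C (M, mobj M) (M, X)"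
  note fl = flin[OF M u k] and g = flin[OF M(1,2) o k' k]
  note p = fPr0_FH[OF M(1) o(1) M(1,3)] lin_fPr0[OF M(1) o(1) M(1,3)]
  interpret faa_map C ?f M X N Y by (rule faa_mapI[OF fl(1)])
  have f1: "fseq ?f 1 = Pr0 C (mobj M) X \<cdot> k" by (simp add: faa_linear_def)
  show ?thesis
  proof (rule lin_eqI[OF D_FH lin_D[OF fl(2)] Comp_FH[OF p(1) g(1)] lin_Comp[OF p(1) g(1) p(2) g(2)]])
    show "fseq df 0 = fseq (faa_Comp C ?p ?g) 0" using g(4) f1 by (simp add: D_simps)
    fix Z a x assume c: "coh Z (mobj MM) (A \<^bold>\<times> X) {a} x"
    then have c': "coh Z (A \<^bold>\<times> A) (A \<^bold>\<times> X) {a} x" by simp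
    have c0: "coh Z (A \<^bold>\<times> A) (A \<^bold>\<times> X) ((\<lambda>i::nat. a) ` {0}) x" using c' by simp
    have cA: "coh Z A X {a \<cdot> pA0} (x \<cdot> pX1)" by (rule coh_mono[OF coh_D[OF c0]]) auto
    have e: "ev ?p {#a#} x = a \<cdot> pA0" by (rule ev_fPr0[OF M(1) o(1) M(1,3) c'])
    have cB: "coh Z A A {a \<cdot> pA0} (x \<cdot> pX0)" using coh_ev[OF p(1), of Z "{#a#}" x] c e by simp
    have "ev df {#a#} x = (a \<cdot> pA0) \<cdot> k" unfolding ev_D_lin[OF fl(2) c'] by (rule fl(3)[OF cA])
    also have "\<dots> = ev (faa_Comp C ?p ?g) {#a#} x"
      unfolding ev_Comp_singleton[OF p(1) g(1) c] e fseq_fPr_0 by (rule g(3)[OF cB, symmetric])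
    finally show "ev df {#a#} x = ev (faa_Comp C ?p ?g) {#a#} x" .
  qed
qed

lemma D_LA: "cm M \<Longrightarrow> faa_D C (LA M) = faa_Comp C (faa_Pr0 C (prod_monoid C M M, mobj M \<^bold>\<times> mobj M) (prod_monoid C M M, mobj M \<^bold>\<times> mobj M)) (LA M)"
  using D_flin[OF cm_prod[of M M] _ _ _ _ _ addhom_madd[of M], of "mobj M \<^bold>\<times> mobj M" "mobj M" "madd M"]
  by (simp add: Hom_iff[of _ C])

lemma D_LZ: "cm M \<Longrightarrow> faa_D C (LZ M) = faa_Comp C (faa_Pr0 C (faa_Trm C) (faa_Trm C)) (LZ M)"
  using D_flin[OF cm_trivial _ _ _ _ _ addhom_mzero[of M], of "\<^bold>1" "mobj M" "mzero M"]
  by (simp add: Hom_iff[of _ C] faa_Trm_def)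

lemma D_faa_Pr:
  assumes M: "cm M" and X: "X \<in> Ob C" and N: "cm N" and Y: "Y \<in> Ob C"
  shows "faa_D C (faa_Pr0 C (M, X) (N, Y)) = faa_Comp C (faa_Pr0 C (prod_monoid C M N, mobj M \<^bold>\<times> mobj N) (prod_monoid C M N, X \<^bold>\<times> Y)) (faa_Pr0 C (M, mobj M) (N, mobj N))"
    "faa_D C (faa_Pr1 C (M, X) (N, Y)) = faa_Comp C (faa_Pr0 C (prod_monoid C M N, mobj M \<^bold>\<times> mobj N) (prod_monoid C M N, X \<^bold>\<times> Y)) (faa_Pr1 C (M, mobj M) (N, mobj N))"
proof -
  have o: "mobj M \<in> Ob C" "mobj N \<in> Ob C" using M N by simp_all
  show "faa_D C (faa_Pr0 C (M, X) (N, Y)) = faa_Comp C (faa_Pr0 C (prod_monoid C M N, mobj M \<^bold>\<times> mobj N) (prod_monoid C M N, X \<^bold>\<times> Y)) (faa_Pr0 C (M, mobj M) (N, mobj N))"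
    unfolding faa_Pr_flin(1)[OF M X N Y] D_flin[OF Pr0_flin[OF M X N Y]] faa_Pr_flin(1)[OF M o(1) N o(2)] by simp
  show "faa_D C (faa_Pr1 C (M, X) (N, Y)) = faa_Comp C (faa_Pr0 C (prod_monoid C M N, mobj M \<^bold>\<times> mobj N) (prod_monoid C M N, X \<^bold>\<times> Y)) (faa_Pr1 C (M, mobj M) (N, mobj N))"
    unfolding faa_Pr_flin(2)[OF M X N Y] D_flin[OF Pr1_flin[OF M X N Y]] faa_Pr_flin(2)[OF M o(1) N o(2)] by simp
qed

text \<open>The values and the sum from which the derivative is built are formed componentwise in a
  product monoid.\<close>

lemma D_faa_Pair:
  assumes f: "f \<in> FH M X N Y" and g: "g \<in> FH M X K V"
  shows "faa_D C (faa_Pair C f g) = faa_Pair C (faa_D C f) (faa_D C g)"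
proof (rule faa_eqI_E)
  interpret f: faa_map C f M X N Y by (rule faa_mapI[OF f])
  interpret g: faa_map C g M X K V by (rule faa_mapI[OF g])
  let ?h = "faa_Pair C f g"
  interpret h: faa_map C ?h M X "prod_monoid C N K" "Y \<^bold>\<times> V" by (rule faa_mapI[OF Pair_FH[OF f g]])
  show "faa_D C ?h \<in> FH f.MM (f.A \<^bold>\<times> X) (prod_monoid C N K) (mobj N \<^bold>\<times> mobj K)" using h.D_FH by simp
  show "faa_Pair C f.df g.df \<in> FH f.MM (f.A \<^bold>\<times> X) (prod_monoid C N K) (mobj N \<^bold>\<times> mobj K)" by (rule Pair_FH[OF f.D_FH g.D_FH])
  show "fseq (faa_D C ?h) 0 = fseq (faa_Pair C f.df g.df) 0" by (simp add: h.D_simps f.D_simps g.D_simps)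
  fix Z and S :: "nat set" and p q
  assume c: "coh Z (mobj f.MM) (f.A \<^bold>\<times> X) (p ` S) q" "finite S" "S \<noteq> {}"
  then have c1: "coh Z (f.A \<^bold>\<times> f.A) (f.A \<^bold>\<times> X) (p ` S) q" by simp
  note cD = f.coh_D[OF c1]
  let ?v = "\<lambda>i. p i \<cdot> f.pA0" and ?w = "\<lambda>i. p i \<cdot> f.pA1" and ?a = "q \<cdot> f.pX0" and ?x = "q \<cdot> f.pX1"
  note sf = f.ds_summands[OF cD c(2)] f.ds_sum(1)[OF cD c(2)] and sg = g.ds_summands[OF cD c(2)] g.ds_sum(1)[OF cD c(2)]
    and sh = h.ds_summands[OF cD c(2)]
  have Z: "Z \<in> Ob C" using cohD(4)[OF cD] .
  have h: "ev ?h (add_mset ?a (image_mset ?w (mset_set S))) ?x =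
    \<langle>ev f (add_mset ?a (image_mset ?w (mset_set S))) ?x, ev g (add_mset ?a (image_mset ?w (mset_set S))) ?x\<rangle>"
    by (rule ev_Pair[OF f g]) (rule coh_mono[OF cD], use c in auto)
  have t: "E ?h S (?w(j := ?v j)) ?x = \<langle>E f S (?w(j := ?v j)) ?x, E g S (?w(j := ?v j)) ?x\<rangle>" if j: "j \<in> S" for j
    by (rule E_Pair[OF f g _ c(2,3)]) (rule coh_mono[OF cD], use j in auto)
  have "sum_map C (prod_monoid C N K) Z (\<lambda>j. E ?h S (?w(j := ?v j)) ?x) S =
     sum_map C (prod_monoid C N K) Z (\<lambda>j. \<langle>E f S (?w(j := ?v j)) ?x, E g S (?w(j := ?v j)) ?x\<rangle>) S"
  proof (rule crc_monoid.sum_map_cong[OF h.cN Z])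
    fix j assume j: "j \<in> S"
    show "E ?h S (?w(j := ?v j)) ?x = \<langle>E f S (?w(j := ?v j)) ?x, E g S (?w(j := ?v j)) ?x\<rangle>" by (rule t[OF j])
    then show "\<langle>E f S (?w(j := ?v j)) ?x, E g S (?w(j := ?v j)) ?x\<rangle> \<in> Hom C Z (mobj (prod_monoid C N K))"
      using sh(3)[OF j] by simp
  qed
  also have "\<dots> = \<langle>sum_map C N Z (\<lambda>j. E f S (?w(j := ?v j)) ?x) S, sum_map C K Z (\<lambda>j. E g S (?w(j := ?v j)) ?x) S\<rangle>"
    by (rule sum_map_prod_Pair[OF f.cN g.cN Z c(2)]) (rule sf(3), assumption, rule sg(3), assumption)
  finally have s: "sum_map C (prod_monoid C N K) Z (\<lambda>j. E ?h S (?w(j := ?v j)) ?x) S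
    = \<langle>sum_map C N Z (\<lambda>j. E f S (?w(j := ?v j)) ?x) S, sum_map C K Z (\<lambda>j. E g S (?w(j := ?v j)) ?x) S\<rangle>" .
  have "E (faa_D C ?h) S p q = h.dd Z S p q" by (rule h.E_D[OF c1 c(2)])
  also have "\<dots> = \<langle>f.dd Z S p q, g.dd Z S p q\<rangle>"
    unfolding h.ds_def h s f.ds_def g.ds_def
    using HomD[OF sf(1)] HomD[OF sg(1)] HomD[OF sf(5)] HomD[OF sg(5)] by (intro plus_map_prod_Pair) simp_all
  also have "\<dots> = E (faa_Pair C f.df g.df) S p q"
    unfolding E_Pair[OF f.D_FH g.D_FH c] f.E_D[OF c1 c(2)] g.E_D[OF c1 c(2)] ..
  finally show "E (faa_D C ?h) S p q = E (faa_Pair C f.df g.df) S p q" .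
qed

end

context faa_map
begin

text \<open>Both sides are linear, and at one argument each of them is \<open>a \<cdot> pA0\<close>
  restricted to where \<open>x \<cdot> (pX1 \<cdot> fseq f 0)\<close> is defined. This is the first
  equation of [DR.8].\<close>

lemma D_faa_Rst: "faa_D C (faa_Rst C f) = faa_Comp C (faa_Rst C p1f) (faa_Pr0 C (M, A) (M, X))"
proof -
  interpret r: faa_map C "faa_Rst C f" M X M X by (rule faa_mapI[OF Rst_FH[OF f]])
  note p = fPr0_FH[OF cM _ cM ob(1)] lin_fPr0[OF cM _ cM ob(1)]
  have oA: "A \<in> Ob C" by simp
  note p = p(1)[OF oA] p(2)[OF oA] and R = Rst_FH[OF p1f_FH] lin_Rst[OF p1f_FH]
  show ?thesis
  proof (rule lin_eqI[OF r.D_FH r.lin_D[OF lin_Rst[OF f]] Comp_FH[OF R(1) p(1)] lin_Comp[OF R(1) p(1) R(2) p(2)]])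
    have "fseq (faa_Rst C f) 1 = \<rho> (pX1 \<cdot> fseq f 0) \<cdot> pX0"
      using FH_D(5)[OF f] by (simp add: faa_Rst_def Let_def)
    then show "fseq (faa_D C (faa_Rst C f)) 0 = fseq (faa_Comp C (faa_Rst C p1f) (faa_Pr0 C (M, A) (M, X))) 0"
      by (simp add: r.D_simps)
    fix Z a x assume c: "coh Z (mobj MM) (A \<^bold>\<times> X) {a} x"
    then have c': "coh Z (A \<^bold>\<times> A) (A \<^bold>\<times> X) {a} x" and cm: "coh Z (mobj MM) (A \<^bold>\<times> X) (set_mset {#a#}) x" by simp_all
    have c0: "coh Z (A \<^bold>\<times> A) (A \<^bold>\<times> X) ((\<lambda>i::nat. a) ` {0}) x" using c' by simp
    have cA: "coh Z A X {a \<cdot> pA0} (x \<cdot> pX1)" by (rule coh_mono[OF coh_D[OF c0]]) auto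
    have x: "x \<in> Ar C" "Cod C x = A \<^bold>\<times> X" using HomD[OF cohD(1)[OF c']] by auto
    have "ev (faa_D C (faa_Rst C f)) {#a#} x = \<rho> ((x \<cdot> pX1) \<cdot> fseq f 0) \<cdot> (a \<cdot> pA0)"
      unfolding r.ev_D_lin[OF lin_Rst[OF f] c'] by (rule ev_Rst1[OF f cA])
    also have "\<dots> = \<rho> (x \<cdot> fseq p1f 0) \<cdot> ev (faa_Pr0 C (M, A) (M, X)) {#a#} x"
      unfolding ev_fPr0[OF cM oA cM ob(1) c'] using x by simp
    also have "\<dots> = ev (faa_Comp C (faa_Rst C p1f) (faa_Pr0 C (M, A) (M, X))) {#a#} x"
      by (rule ev_Rst_Comp[OF p1f_FH p(1) cm, symmetric]) simp
    finally show "ev (faa_D C (faa_Rst C f)) {#a#} x = ev (faa_Comp C (faa_Rst C p1f) (faa_Pr0 C (M, A) (M, X))) {#a#} x" .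
  qed
qed

lemma Rst_D: "faa_Rst C df = faa_Rst C p1f"
  by (rule Rst_faa_eqI[OF D_FH p1f_FH]) (use f1 in \<open>simp add: D_simps\<close>)

section \<open>The second derivative\<close>

lemma dd_eq:
  assumes c: "coh Z (A \<^bold>\<times> A) (A \<^bold>\<times> X) (p ` S) q" "finite S"
    and e: "\<And>i. i \<in> S \<Longrightarrow> p i \<cdot> pA0 = v i" "\<And>i. i \<in> S \<Longrightarrow> p i \<cdot> pA1 = w i" "q \<cdot> pX0 = a" "q \<cdot> pX1 = x"
  shows "dd Z S p q = ds Z S v w a x"
  unfolding e(3,4) by (rule ds_cong[OF coh_D[OF c(1), unfolded e(3,4)] c(2) e(1,2)])

lemma E_D_eq:
  assumes c: "coh Z A X (insert a (v ` S \<union> w ` S)) x" "finite S"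
    and p: "\<And>i. i \<in> S \<Longrightarrow> p i = \<langle>v i, w i\<rangle>"
  shows "E df S p \<langle>a, x\<rangle> = ds Z S v w a x"
proof -
  have t: "v i \<in> Hom C Z A" "\<rho> (v i) = \<rho> x" "w i \<in> Hom C Z A" "\<rho> (w i) = \<rho> x" if "i \<in> S" for i
    using c(1) that by (auto simp: coh_def)
  have a: "a \<in> Hom C Z A" "\<rho> a = \<rho> x" "x \<in> Hom C Z X" using c(1) by (auto simp: coh_def)
  have R: "\<rho> x \<cdot> \<rho> x = \<rho> x" using HomD[OF a(3)] by simp
  have cp: "coh Z (A \<^bold>\<times> A) (A \<^bold>\<times> X) (p ` S) \<langle>a, x\<rangle>"
    using t a p R by (auto simp: coh_def Hom_iff)
  show ?thesis unfolding E_D[OF cp c(2)]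
  proof (rule dd_eq[OF cp c(2)])
    show "p i \<cdot> pA0 = v i" "p i \<cdot> pA1 = w i" if "i \<in> S" for i
      unfolding p[OF that] using t[OF that] by (auto intro!: Pair_Comp_Pr_same[of _ Z])
    show "\<langle>a, x\<rangle> \<cdot> pX0 = a" "\<langle>a, x\<rangle> \<cdot> pX1 = x" using a by (auto intro!: Pair_Comp_Pr_same[of _ Z])
  qed
qed

lemma pair_D_eq:
  assumes u: "u \<in> FH K V M A" "lin u" "\<rho> (fseq u 0) = Idn C V"
    and w: "w \<in> FH K V M X" "lin w" "\<rho> (fseq w 0) = Idn C V"
    and c: "coh Z (mobj K) V (r ` S) s" "finite S"
    and e: "\<And>i. i \<in> S \<Longrightarrow> ev u {#r i#} s = v i" "\<And>i. i \<in> S \<Longrightarrow> ev w {#r i#} s = w' i"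
      "s \<cdot> fseq u 0 = a" "s \<cdot> fseq w 0 = x"
  shows "E (faa_Comp C (faa_Pair C u w) df) S r s = ds Z S v w' a x"
  unfolding E_pair_D[OF u w c] e(3,4) by (rule ds_cong[OF E_pair_coh[OF u w c, unfolded e(3,4)] c(2) e(1,2)])

text \<open>The content of [DR.6]. In every summand of the outer derivative some variable of the
  inner one has a zero as its second entry. By \<open>ds_zero_at\<close> the inner derivative
  reduces to the summand in which that zero is replaced by \<open>a0\<close> or by
  \<open>a j\<close>, and the results add up to a first derivative.\<close>

lemma ds_D_zero_right:
  fixes S :: "nat set"
  assumes c: "coh Z A X ({a0, b0} \<union> a ` S \<union> b ` S \<union> e ` S) x" and S: "finite S"
  defines "z \<equiv> \<rho> x \<cdot> zero_map C M Z"
  shows "faa_map.ds C df N Z S (\<lambda>i. \<langle>a i, z\<rangle>) (\<lambda>i. \<langle>b i, e i\<rangle>) \<langle>a0, z\<rangle> \<langle>b0, x\<rangle> = ds Z S a e a0 x"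
proof -
  interpret d: faa_map C df MM "A \<^bold>\<times> X" N "mobj N" by (rule faa_mapI[OF D_FH])
  let ?v = "\<lambda>i. \<langle>a i, z\<rangle>" and ?w = "\<lambda>i. \<langle>b i, e i\<rangle>" and ?a = "\<langle>a0, z\<rangle>" and ?q = "\<langle>b0, x\<rangle>"
  have xZ: "x \<in> Ar C" "Dom C x = Z" "Cod C x = X" "Z \<in> Ob C" using HomD[OF cohD(1)[OF c]] cohD(4)[OF c] by auto
  have z: "z \<in> Hom C Z A" "\<rho> z = \<rho> x" using xZ by (simp_all add: z_def Hom_iff)
  \<comment> \<open>A fresh index makes the additional argument a member of the indexed family, so
    that the formula for the inner derivative applies to it.\<close>
  obtain n where n: "n \<notin> S" using S by (metis ex_new_if_finite infinite_UNIV_nat)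
  have cz: "coh Z A X (insert z ({a0, b0} \<union> a ` S \<union> b ` S \<union> e ` S)) x" using c z by (simp add: coh_insert)
  have c1: "coh Z A X (insert b0 ((b(n := a0)) ` insert n S \<union> (e(n := z)) ` insert n S)) x"
    by (rule coh_mono[OF cz]) auto
  have "ev df (add_mset ?a (image_mset ?w (mset_set S))) ?q = E df (insert n S) (?w(n := ?a)) ?q"
  proof -
    have "image_mset (?w(n := ?a)) (mset_set S) = image_mset ?w (mset_set S)"
      using n S by (intro image_mset_cong) auto
    then show ?thesis using E_insert[OF S n, of df "?w(n := ?a)" ?q] by simp
  qed
  also have "\<dots> = ds Z (insert n S) (b(n := a0)) (e(n := z)) b0 x"
    by (rule E_D_eq[OF c1]) (use S in auto)
  also have "\<dots> = E f (insert n S) ((e(n := z))(n := (b(n := a0)) n)) x"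
    by (rule ds_zero_at[OF c1]) (use S in \<open>auto simp: z_def\<close>)
  also have "\<dots> = ev f (add_mset a0 (image_mset e (mset_set S))) x"
  proof -
    have "image_mset (e(n := a0)) (mset_set S) = image_mset e (mset_set S)"
      using n S by (intro image_mset_cong) auto
    then show ?thesis using E_insert[OF S n, of f "e(n := a0)" x] by simp
  qed
  finally have h1: "ev df (add_mset ?a (image_mset ?w (mset_set S))) ?q = ev f (add_mset a0 (image_mset e (mset_set S))) x" .
  have h2: "E df S (?w(j := ?v j)) ?q = E f S (e(j := a j)) x" if j: "j \<in> S" for j
  proof -
    have c2: "coh Z A X (insert b0 ((b(j := a j)) ` S \<union> (e(j := z)) ` S)) x"
      by (rule coh_mono[OF cz]) (use j in auto)
    have "E df S (?w(j := ?v j)) ?q = ds Z S (b(j := a j)) (e(j := z)) b0 x"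
      by (rule E_D_eq[OF c2 S]) auto
    also have "\<dots> = E f S ((e(j := z))(j := (b(j := a j)) j)) x"
      by (rule ds_zero_at[OF c2 S j]) (simp add: z_def)
    finally show ?thesis by simp
  qed
  have c3: "coh Z A X (insert a0 (a ` S \<union> e ` S)) x" by (rule coh_mono[OF c]) auto
  have sm: "sum_map C N Z (\<lambda>j. E df S (?w(j := ?v j)) ?q) S = sum_map C N Z (\<lambda>j. E f S (e(j := a j)) x) S"
    by (rule crc_monoid.sum_map_cong[OF cN xZ(4) h2 ds_summands(3)[OF c3 S]])
  show ?thesis unfolding d.ds_def ds_def h1 sm ..
qed

text \<open>The second derivative, expanded. The term \<open>e0\<close> contains both extra
  arguments, \<open>s1\<close> and \<open>s2\<close> contain one of them and replace one variable,
  and \<open>u\<close> replaces two distinct variables. On the diagonal of \<open>u\<close> the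
  variable is replaced by the zero entry instead, which yields a restricted zero. The expansion is
  made explicit because it is visibly symmetric in the two directions.\<close>

lemma ds_D_zero_left:
  fixes S :: "nat set"
  assumes c: "coh Z A X ({b0, c0} \<union> b ` S \<union> c' ` S \<union> e ` S) x" and S: "finite S"
  defines "z \<equiv> \<rho> x \<cdot> zero_map C M Z"
  defines "u \<equiv> \<lambda>b c' j k. if j = k then \<rho> (x \<cdot> fseq f 0) \<cdot> zero_map C N Z else E f S ((e(j := b j))(k := c' k)) x"
  defines "e0 \<equiv> ev f (add_mset c0 (add_mset b0 (image_mset e (mset_set S)))) x"
  defines "s1 \<equiv> \<lambda>k. ev f (add_mset b0 (image_mset (e(k := c' k)) (mset_set S))) x"
  defines "s2 \<equiv> \<lambda>j. ev f (add_mset c0 (image_mset (e(j := b j)) (mset_set S))) x"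
  shows "faa_map.ds C df N Z S (\<lambda>i. \<langle>z, b i\<rangle>) (\<lambda>i. \<langle>c' i, e i\<rangle>) \<langle>z, b0\<rangle> \<langle>c0, x\<rangle> =
    plus_map C N (plus_map C N e0 (sum_map C N Z s1 S))
      (plus_map C N (sum_map C N Z s2 S) (sum_map C N Z (\<lambda>j. sum_map C N Z (u b c' j) S) S))"
    and "e0 \<in> Hom C Z (mobj N)" "sum_map C N Z s1 S \<in> Hom C Z (mobj N)" "sum_map C N Z s2 S \<in> Hom C Z (mobj N)"
      "sum_map C N Z (\<lambda>j. sum_map C N Z (u b c' j) S) S \<in> Hom C Z (mobj N)"
      "\<And>j k. j \<in> S \<Longrightarrow> k \<in> S \<Longrightarrow> u b c' j k \<in> Hom C Z (mobj N)"
proof -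
  interpret d: faa_map C df MM "A \<^bold>\<times> X" N "mobj N" by (rule faa_mapI[OF D_FH])
  let ?v = "\<lambda>i. \<langle>z, b i\<rangle>" and ?w = "\<lambda>i. \<langle>c' i, e i\<rangle>" and ?a = "\<langle>z, b0\<rangle>" and ?q = "\<langle>c0, x\<rangle>"
  let ?o = "\<rho> (x \<cdot> fseq f 0) \<cdot> zero_map C N Z"
  have xZ: "x \<in> Ar C" "Dom C x = Z" "Cod C x = X" "Z \<in> Ob C" using HomD[OF cohD(1)[OF c]] cohD(4)[OF c] by auto
  have z: "z \<in> Hom C Z A" "\<rho> z = \<rho> x" using xZ by (simp_all add: z_def Hom_iff)
  have o: "?o \<in> Hom C Z (mobj N)" using xZ by (simp add: Hom_iff)
  obtain n where n: "n \<notin> S" using S by (metis ex_new_if_finite infinite_UNIV_nat)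
  have cz: "coh Z A X (insert z ({b0, c0} \<union> b ` S \<union> c' ` S \<union> e ` S)) x" using c z by (simp add: coh_insert)
  have ce0: "coh Z A X (set_mset (add_mset c0 (add_mset b0 (image_mset e (mset_set S))))) x"
    by (rule coh_mono[OF c]) (use S in auto)
  show e0: "e0 \<in> Hom C Z (mobj N)" unfolding e0_def by (rule ev_Hom[OF f ce0]) simp
  have s1: "s1 k \<in> Hom C Z (mobj N)" if "k \<in> S" for k
    unfolding s1_def by (rule ev_Hom[OF f]) (rule coh_mono[OF c], use S that in auto)
  have s2: "s2 k \<in> Hom C Z (mobj N)" if "k \<in> S" for k
    unfolding s2_def by (rule ev_Hom[OF f]) (rule coh_mono[OF c], use S that in auto)
  show u: "u b c' j k \<in> Hom C Z (mobj N)" if "j \<in> S" "k \<in> S" for j k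
  proof (cases "j = k")
    case True
    then show ?thesis using o by (simp add: u_def)
  next
    case False
    have "E f S ((e(j := b j))(k := c' k)) x \<in> Hom C Z (mobj N)"
      by (rule E_Hom[OF f _ S]) (rule coh_mono[OF c], use that in auto)
    then show ?thesis using False by (simp add: u_def)
  qed
  show S1: "sum_map C N Z s1 S \<in> Hom C Z (mobj N)" by (rule crc_monoid.sum_map_Hom[OF cN xZ(4) s1])
  show "sum_map C N Z s2 S \<in> Hom C Z (mobj N)" by (rule crc_monoid.sum_map_Hom[OF cN xZ(4) s2])
  have uj: "sum_map C N Z (u b c' j) S \<in> Hom C Z (mobj N)" if "j \<in> S" for j
    by (rule crc_monoid.sum_map_Hom[OF cN xZ(4) u[OF that]])
  show "sum_map C N Z (\<lambda>j. sum_map C N Z (u b c' j) S) S \<in> Hom C Z (mobj N)" by (rule crc_monoid.sum_map_Hom[OF cN xZ(4) uj])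
  let ?T = "insert n S" and ?V = "c'(n := z)" and ?W = "e(n := b0)"
  have c1: "coh Z A X (insert c0 (?V ` ?T \<union> ?W ` ?T)) x"
    by (rule coh_mono[OF cz]) auto
  have imn: "image_mset (w(n := y)) (mset_set S) = image_mset w (mset_set S)" for w :: "nat \<Rightarrow> 'm" and y
    using n S by (intro image_mset_cong) auto
  have "ev df (add_mset ?a (image_mset ?w (mset_set S))) ?q = E df ?T (?w(n := ?a)) ?q"
    using E_insert[OF S n, of df "?w(n := ?a)" ?q] by (simp add: imn)
  also have "\<dots> = ds Z ?T ?V ?W c0 x"
    by (rule E_D_eq[OF c1]) (use S in auto)
  also have "\<dots> = plus_map C N e0 (sum_map C N Z s1 S)"
  proof -
    have m: "image_mset ?W (mset_set ?T) = add_mset b0 (image_mset e (mset_set S))"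
      using S n by (simp add: imn)
    \<comment> \<open>At the fresh index the first entry is zero, so this summand is a restricted
      zero and is absorbed by \<open>e0\<close>.\<close>
    have tn: "E f ?T (?W(n := ?V n)) x = ?o"
    proof -
      have "E f ?T (?W(n := z)) x = ?o" unfolding z_def
        by (rule E_update_rzero[OF f]) (use S in auto, rule coh_mono[OF c], auto)
      then show ?thesis by simp
    qed
    have tk: "E f ?T (?W(k := ?V k)) x = s1 k" if k: "k \<in> S" for k
    proof -
      have nk: "n \<noteq> k" using n k by auto
      have ew: "?W(k := ?V k) = (e(k := c' k))(n := b0)" using nk by (auto simp: fun_upd_twist)
      show ?thesis unfolding ew s1_def using E_insert[OF S n, of f "(e(k := c' k))(n := b0)" x] by (simp only: imn fun_upd_same)
    qed
    have sT: "sum_map C N Z (\<lambda>k. E f ?T (?W(k := ?V k)) x) ?T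
      = plus_map C N (E f ?T (?W(n := ?V n)) x) (sum_map C N Z (\<lambda>k. E f ?T (?W(k := ?V k)) x) S)"
    proof (rule crc_monoid.sum_map_insert[OF cN xZ(4) S n])
      fix i assume "i \<in> ?T"
      then show "E f ?T (?W(i := ?V i)) x \<in> Hom C Z (mobj N)" using ds_summands(3)[OF c1] S by blast
    qed
    have sS: "sum_map C N Z (\<lambda>k. E f ?T (?W(k := ?V k)) x) S = sum_map C N Z s1 S"
      by (rule crc_monoid.sum_map_cong[OF cN xZ(4) tk s1])
    have "ds Z ?T ?V ?W c0 x = plus_map C N e0 (plus_map C N ?o (sum_map C N Z s1 S))"
      unfolding ds_def sT sS tn m e0_def ..
    also have "\<dots> = plus_map C N (plus_map C N e0 ?o) (sum_map C N Z s1 S)"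
      using HomD[OF e0] HomD[OF o] HomD[OF S1] by (intro crc_monoid.plus_map_assoc[OF cN, symmetric]) simp_all
    also have "plus_map C N e0 ?o = e0"
      by (rule crc_monoid.plus_map_rzero(2)[OF cN]) (use HomD[OF e0] xZ ev_Rst[OF f ce0] in \<open>simp_all add: e0_def\<close>)
    finally show ?thesis .
  qed
  finally have h1: "ev df (add_mset ?a (image_mset ?w (mset_set S))) ?q = plus_map C N e0 (sum_map C N Z s1 S)" .
  have h2: "E df S (?w(j := ?v j)) ?q = plus_map C N (s2 j) (sum_map C N Z (u b c' j) S)" if j: "j \<in> S" for j
  proof -
    let ?V = "c'(j := z)" and ?W = "e(j := b j)"
    have c2: "coh Z A X (insert c0 (?V ` S \<union> ?W ` S)) x"
      by (rule coh_mono[OF cz]) (use j in auto)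
    have t: "E f S (?W(k := ?V k)) x = u b c' j k" if k: "k \<in> S" for k
    proof (cases "k = j")
      case True
      have "E f S (e(j := z)) x = ?o" unfolding z_def
        by (rule E_update_rzero[OF f S j]) (rule coh_mono[OF c], auto)
      then show ?thesis using True by (simp add: u_def)
    next
      case False
      then show ?thesis by (simp add: u_def)
    qed
    have "E df S (?w(j := ?v j)) ?q = ds Z S ?V ?W c0 x"
      by (rule E_D_eq[OF c2 S]) auto
    also have "\<dots> = plus_map C N (s2 j) (sum_map C N Z (\<lambda>k. E f S (?W(k := ?V k)) x) S)"
      unfolding ds_def s2_def ..
    also have "sum_map C N Z (\<lambda>k. E f S (?W(k := ?V k)) x) S = sum_map C N Z (u b c' j) S"
      by (rule crc_monoid.sum_map_cong[OF cN xZ(4) t u[OF j]])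
    finally show ?thesis .
  qed
  have sm: "sum_map C N Z (\<lambda>j. E df S (?w(j := ?v j)) ?q) S = sum_map C N Z (\<lambda>j. plus_map C N (s2 j) (sum_map C N Z (u b c' j) S)) S"
  proof -
    have sH: "plus_map C N (s2 j) (sum_map C N Z (u b c' j) S) \<in> Hom C Z (mobj N)" if "j \<in> S" for j
      using HomD[OF s2[OF that]] HomD[OF uj[OF that]] by (simp add: Hom_iff crc_monoid.plus_map_type[OF cN])
    show ?thesis by (rule crc_monoid.sum_map_cong[OF cN xZ(4) h2 sH])
  qed
  have sm2: "sum_map C N Z (\<lambda>j. plus_map C N (s2 j) (sum_map C N Z (u b c' j) S)) S = plus_map C N (sum_map C N Z s2 S) (sum_map C N Z (\<lambda>j. sum_map C N Z (u b c' j) S) S)"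
    by (rule crc_monoid.sum_map_plus[OF cN xZ(4) s2 uj])
  show "d.ds Z S ?v ?w ?a ?q = plus_map C N (plus_map C N e0 (sum_map C N Z s1 S)) (plus_map C N (sum_map C N Z s2 S) (sum_map C N Z (\<lambda>j. sum_map C N Z (u b c' j) S) S))"
    unfolding d.ds_def h1 sm sm2 ..
qed

text \<open>The content of [DR.7]. Exchanging the two directions interchanges \<open>s1\<close> and
  \<open>s2\<close>, transposes the double sum over \<open>u\<close> and leaves \<open>e0\<close>
  unchanged.\<close>

lemma ds_D_commute:
  fixes S :: "nat set"
  assumes c: "coh Z A X ({b0, c0} \<union> b ` S \<union> c' ` S \<union> e ` S) x" and S: "finite S"
  defines "z \<equiv> \<rho> x \<cdot> zero_map C M Z"
  shows "faa_map.ds C df N Z S (\<lambda>i. \<langle>z, b i\<rangle>) (\<lambda>i. \<langle>c' i, e i\<rangle>) \<langle>z, b0\<rangle> \<langle>c0, x\<rangle>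
    = faa_map.ds C df N Z S (\<lambda>i. \<langle>z, c' i\<rangle>) (\<lambda>i. \<langle>b i, e i\<rangle>) \<langle>z, c0\<rangle> \<langle>b0, x\<rangle>"
proof -
  have c2: "coh Z A X ({c0, b0} \<union> c' ` S \<union> b ` S \<union> e ` S) x" by (rule coh_mono[OF c]) auto
  note l = ds_D_zero_left[OF c S] and r = ds_D_zero_left[OF c2 S]
  have Z: "Z \<in> Ob C" using cohD(4)[OF c] .
  let ?u = "\<lambda>b c' j k. if j = k then \<rho> (x \<cdot> fseq f 0) \<cdot> zero_map C N Z else E f S ((e(j := b j))(k := c' k)) x"
  have uc: "?u c' b j k = ?u b c' k j" for j k by (simp add: fun_upd_twist)
  have ss: "sum_map C N Z (\<lambda>j. sum_map C N Z (?u c' b j) S) S = sum_map C N Z (\<lambda>j. sum_map C N Z (?u b c' j) S) S"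
    unfolding uc by (rule crc_monoid.sum_map_swap[OF cN Z S S]) (rule l(6))
  have e0: "ev f (add_mset c0 (add_mset b0 (image_mset e (mset_set S)))) x = ev f (add_mset b0 (add_mset c0 (image_mset e (mset_set S)))) x"
    by (simp only: add_mset_commute)
  show ?thesis unfolding z_def l(1) r(1) ss e0
    using HomD[OF r(2)] HomD[OF l(3)] HomD[OF l(4)] HomD[OF l(5)]
    by (simp add: crc_monoid.plus_map_ac[OF cN])
qed

section \<open>The generic instances of the axioms\<close>

abbreviation "MMM \<equiv> prod_monoid C MM M"
abbreviation "GX \<equiv> (A \<^bold>\<times> A) \<^bold>\<times> X"
abbreviation "fPa \<equiv> faa_Comp C (faa_Pr0 C (MM, A \<^bold>\<times> A) (M, X)) (faa_Pr0 C (M, A) (M, A))"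
abbreviation "fPb \<equiv> faa_Comp C (faa_Pr0 C (MM, A \<^bold>\<times> A) (M, X)) (faa_Pr1 C (M, A) (M, A))"
abbreviation "fPd \<equiv> faa_Pr1 C (MM, A \<^bold>\<times> A) (M, X)"
abbreviation "ra r \<equiv> r \<cdot> (Pr0 C (A \<^bold>\<times> A) A \<cdot> pA0)"
abbreviation "rb r \<equiv> r \<cdot> (Pr0 C (A \<^bold>\<times> A) A \<cdot> pA1)"
abbreviation "rd r \<equiv> r \<cdot> Pr1 C (A \<^bold>\<times> A) A"
abbreviation "sa s \<equiv> s \<cdot> (Pr0 C (A \<^bold>\<times> A) X \<cdot> pA0)"
abbreviation "sb s \<equiv> s \<cdot> (Pr0 C (A \<^bold>\<times> A) X \<cdot> pA1)"
abbreviation "sd s \<equiv> s \<cdot> Pr1 C (A \<^bold>\<times> A) X"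

lemma oA: "A \<in> Ob C" "A \<^bold>\<times> A \<in> Ob C" "cm MM" "GX \<in> Ob C" "cm MMM"
  by simp_all

text \<open>The generic arguments of the axioms: projections in \<open>faa C\<close> from the
  product of two copies of \<open>(M, A)\<close> and one of \<open>(M, X)\<close>. They are total
  and linear, as \<open>pair_D_eq\<close> requires.\<close>

lemma fP:
  shows fPa: "fPa \<in> FH MMM GX M A" "lin fPa" "\<rho> (fseq fPa 0) = Idn C GX"
    and fPb: "fPb \<in> FH MMM GX M A" "lin fPb" "\<rho> (fseq fPb 0) = Idn C GX"
    and fPd: "fPd \<in> FH MMM GX M X" "lin fPd" "\<rho> (fseq fPd 0) = Idn C GX"
    and ev_fP: "coh Z ((A \<^bold>\<times> A) \<^bold>\<times> A) GX {r} s \<Longrightarrow> ev fPa {#r#} s = ra r"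
      "coh Z ((A \<^bold>\<times> A) \<^bold>\<times> A) GX {r} s \<Longrightarrow> ev fPb {#r#} s = rb r"
      "coh Z ((A \<^bold>\<times> A) \<^bold>\<times> A) GX {r} s \<Longrightarrow> ev fPd {#r#} s = rd r"
proof -
  note G0 = fPr0_FH[OF oA(3,2) cM ob(1)] lin_fPr0[OF oA(3,2) cM ob(1)] ev_fPr0[OF oA(3,2) cM ob(1)]
  note G1 = fPr1_FH[OF oA(3,2) cM ob(1)] lin_fPr1[OF oA(3,2) cM ob(1)] ev_fPr1[OF oA(3,2) cM ob(1)]
  note H0 = fPr0_FH[OF cM oA(1) cM oA(1)] lin_fPr0[OF cM oA(1) cM oA(1)] ev_fPr0[OF cM oA(1) cM oA(1)]
  note H1 = fPr1_FH[OF cM oA(1) cM oA(1)] lin_fPr1[OF cM oA(1) cM oA(1)] ev_fPr1[OF cM oA(1) cM oA(1)]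
  show "fPa \<in> FH MMM GX M A" "fPb \<in> FH MMM GX M A" "fPd \<in> FH MMM GX M X"
    by (rule Comp_FH[OF G0(1) H0(1)] Comp_FH[OF G0(1) H1(1)] G1(1))+
  show "lin fPa" "lin fPb" "lin fPd"
    by (rule lin_Comp[OF G0(1) H0(1) G0(2) H0(2)] lin_Comp[OF G0(1) H1(1) G0(2) H1(2)] G1(2))+
  show "\<rho> (fseq fPa 0) = Idn C GX" "\<rho> (fseq fPb 0) = Idn C GX" "\<rho> (fseq fPd 0) = Idn C GX" by simp_all
  assume c: "coh Z ((A \<^bold>\<times> A) \<^bold>\<times> A) GX {r} s"
  then have c1: "coh Z (mobj MM \<^bold>\<times> A) GX {r} s" and c2: "coh Z (mobj MMM) GX {r} s"
    and c3: "coh Z (mobj MMM) GX (set_mset {#r#}) s" by simp_all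
  have r: "r \<in> Ar C" "Dom C r = Z" "Cod C r = (A \<^bold>\<times> A) \<^bold>\<times> A" using c by (auto simp: coh_def Hom_iff)
  have e: "ev (faa_Pr0 C (MM, A \<^bold>\<times> A) (M, X)) {#r#} s = r \<cdot> Pr0 C (A \<^bold>\<times> A) A" using G0(3)[OF c1] by simp
  have c4: "coh Z (A \<^bold>\<times> A) (A \<^bold>\<times> A) {r \<cdot> Pr0 C (A \<^bold>\<times> A) A} (s \<cdot> Pr0 C (A \<^bold>\<times> A) X)"
    using coh_ev[OF G0(1) c3] e by simp
  show "ev fPa {#r#} s = ra r" "ev fPb {#r#} s = rb r"
    unfolding ev_Comp_singleton[OF G0(1) H0(1) c2] ev_Comp_singleton[OF G0(1) H1(1) c2] e fseq_fPr_0
      H0(3)[OF c4] H1(3)[OF c4] using r by simp_all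
  show "ev fPd {#r#} s = rd r" using G1(3)[OF c1] by simp
qed

lemma coh_G:
  assumes c: "coh Z ((A \<^bold>\<times> A) \<^bold>\<times> A) GX (r ` S) s"
  shows "coh Z A X ({sa s, sb s} \<union> (\<lambda>i. ra (r i)) ` S \<union> (\<lambda>i. rb (r i)) ` S \<union> (\<lambda>i. rd (r i)) ` S) (sd s)"
    "\<And>i. i \<in> S \<Longrightarrow> coh Z ((A \<^bold>\<times> A) \<^bold>\<times> A) GX {r i} s"
    "s \<cdot> fseq fPa 0 = sa s" "s \<cdot> fseq fPb 0 = sb s" "s \<cdot> fseq fPd 0 = sd s" "\<rho> (sd s) = \<rho> s" "s \<in> Hom C Z GX"
proof -
  show "coh Z A X ({sa s, sb s} \<union> (\<lambda>i. ra (r i)) ` S \<union> (\<lambda>i. rb (r i)) ` S \<union> (\<lambda>i. rd (r i)) ` S) (sd s)"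
    using c by (auto simp: coh_def Hom_iff)
  show "coh Z ((A \<^bold>\<times> A) \<^bold>\<times> A) GX {r i} s" if "i \<in> S" for i by (rule coh_mono[OF c]) (use that in auto)
  show "s \<cdot> fseq fPa 0 = sa s" "s \<cdot> fseq fPb 0 = sb s" "s \<cdot> fseq fPd 0 = sd s" by simp_all
  show s: "s \<in> Hom C Z GX" by (rule cohD(1)[OF c])
  show "\<rho> (sd s) = \<rho> s" using HomD[OF s] by simp
qed

lemma D_plus_generic:
  "faa_Comp C (faa_Pair C (fplus M fPa fPb) fPd) df
    = fplus N (faa_Comp C (faa_Pair C fPa fPd) df) (faa_Comp C (faa_Pair C fPb fPd) df)"
proof (rule faa_eqI_E0)
  note p = fplus_FH[OF fPa(1) fPb(1)] lin_fplus[OF fPa(1) fPb(1) fPa(2) fPb(2)]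
  have p0: "\<rho> (fseq (fplus M fPa fPb) 0) = Idn C GX"
    unfolding fseq_fplus[OF fPa(1) fPb(1)]
    using HomD[OF FH_D(7)[OF fPa(1)]] HomD[OF FH_D(7)[OF fPb(1)]] fPa(3) fPb(3)
    by (simp del: fseq_Comp_0)
  note q = Comp_FH[OF Pair_FH[OF p(1) fPd(1)] D_FH]
    and qa = Comp_FH[OF Pair_FH[OF fPa(1) fPd(1)] D_FH] and qb = Comp_FH[OF Pair_FH[OF fPb(1) fPd(1)] D_FH]
  show "faa_Comp C (faa_Pair C (fplus M fPa fPb) fPd) df \<in> FH MMM GX N (mobj N)" by (rule q)
  show "fplus N (faa_Comp C (faa_Pair C fPa fPd) df) (faa_Comp C (faa_Pair C fPb fPd) df) \<in> FH MMM GX N (mobj N)"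
    by (rule fplus_FH[OF qa qb])
  fix Z and S :: "nat set" and r s
  assume c': "coh Z (mobj MMM) GX (r ` S) s" and S: "finite S"
  then have c: "coh Z ((A \<^bold>\<times> A) \<^bold>\<times> A) GX (r ` S) s" by simp
  note G = coh_G[OF c]
  have c1: "coh Z A X ({sa s, sb s} \<union> (\<lambda>i. ra (r i)) ` S \<union> (\<lambda>i. rb (r i)) ` S \<union> (\<lambda>i. rd (r i)) ` S) (sd s)" by (rule G(1))
  have ea: "E (faa_Comp C (faa_Pair C fPa fPd) df) S r s = ds Z S (\<lambda>i. ra (r i)) (\<lambda>i. rd (r i)) (sa s) (sd s)"
    by (rule pair_D_eq[OF fPa fPd c' S ev_fP(1)[OF G(2)] ev_fP(3)[OF G(2)] G(3,5)])
  have eb: "E (faa_Comp C (faa_Pair C fPb fPd) df) S r s = ds Z S (\<lambda>i. rb (r i)) (\<lambda>i. rd (r i)) (sb s) (sd s)"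
    by (rule pair_D_eq[OF fPb fPd c' S ev_fP(2)[OF G(2)] ev_fP(3)[OF G(2)] G(4,5)])
  have ep: "ev (fplus M fPa fPb) {#r i#} s = plus_map C M (ra (r i)) (rb (r i))" if "i \<in> S" for i
    using ev_fplus[OF fPa(1) fPb(1), of Z "{#r i#}" s] G(2)[OF that] ev_fP(1,2)[OF G(2)[OF that]] by simp
  have sp: "s \<cdot> fseq (fplus M fPa fPb) 0 = plus_map C M (sa s) (sb s)"
    unfolding fseq_fplus[OF fPa(1) fPb(1)] G(3,4)[symmetric]
    using HomD[OF FH_D(7)[OF fPa(1)]] HomD[OF FH_D(7)[OF fPb(1)]] HomD[OF G(7)]
    by (intro crc_monoid.Comp_plus_map[OF cM]) (simp_all del: fseq_Comp_0)
  have "E (faa_Comp C (faa_Pair C (fplus M fPa fPb) fPd) df) S r s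
    = ds Z S (\<lambda>i. plus_map C M (ra (r i)) (rb (r i))) (\<lambda>i. rd (r i)) (plus_map C M (sa s) (sb s)) (sd s)"
    by (rule pair_D_eq[OF p p0 fPd c' S ep ev_fP(3)[OF G(2)] sp G(5)])
  also have "\<dots> = plus_map C N (ds Z S (\<lambda>i. ra (r i)) (\<lambda>i. rd (r i)) (sa s) (sd s)) (ds Z S (\<lambda>i. rb (r i)) (\<lambda>i. rd (r i)) (sb s) (sd s))"
    by (rule ds_plus[OF c1 S])
  also have "\<dots> = E (fplus N (faa_Comp C (faa_Pair C fPa fPd) df) (faa_Comp C (faa_Pair C fPb fPd) df)) S r s"
    unfolding E_fplus[OF qa qb c' S] ea eb ..
  finally show "E (faa_Comp C (faa_Pair C (fplus M fPa fPb) fPd) df) S r s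
    = E (fplus N (faa_Comp C (faa_Pair C fPa fPd) df) (faa_Comp C (faa_Pair C fPb fPd) df)) S r s" .
qed

text \<open>All summands containing a variable \<open>v\<close> vanish by \<open>zero_sum\<close>,
  and the remaining summand has the zero direction among its arguments as well.\<close>

lemma D_zero_generic:
  "faa_Comp C (faa_Pair C (fzero M (M, X)) (faa_Id C (M, X))) df = faa_Comp C (faa_Rst C f) (fzero N (M, X))"
proof (rule faa_eqI_E0)
  note z = fzero_FH[OF cM cM ob(1)] lin_fzero[OF cM cM ob(1)] and zN = fzero_FH[OF cN cM ob(1)]
  note I = Id_FH[OF cM ob(1)] lin_Id[OF cM ob(1)]
  have z0: "\<rho> (fseq (fzero M (M, X)) 0) = Idn C X" unfolding fseq_fzero[OF cM cM ob(1)] by simp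
  have I0: "\<rho> (fseq (faa_Id C (M, X)) 0) = Idn C X" by simp
  show "faa_Comp C (faa_Pair C (fzero M (M, X)) (faa_Id C (M, X))) df \<in> FH M X N (mobj N)"
    by (rule Comp_FH[OF Pair_FH[OF z(1) I(1)] D_FH])
  show "faa_Comp C (faa_Rst C f) (fzero N (M, X)) \<in> FH M X N (mobj N)"
    by (rule Comp_FH[OF Rst_FH[OF f] zN])
  fix Z and S :: "nat set" and r s
  assume c: "coh Z A X (r ` S) s" and S: "finite S"
  let ?z = "\<rho> s \<cdot> zero_map C M Z"
  have s: "s \<in> Ar C" "Dom C s = Z" "Cod C s = X" "Z \<in> Ob C" using HomD[OF cohD(1)[OF c]] cohD(4)[OF c] by auto
  have ci: "coh Z A X {r i} s" if "i \<in> S" for i by (rule coh_mono[OF c]) (use that in auto)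
  have c1: "coh Z A X (insert ?z (r ` S)) s" using c s by (simp add: coh_insert Hom_iff)
  have "E (faa_Comp C (faa_Pair C (fzero M (M, X)) (faa_Id C (M, X))) df) S r s = ds Z S (\<lambda>i. ?z) r ?z s"
  proof (rule pair_D_eq[OF z z0 I I0 c S])
    show "ev (fzero M (M, X)) {#r i#} s = ?z" if "i \<in> S" for i
      using ev_fzero[OF cM cM ob(1), of Z "{#r i#}" s] ci[OF that] by simp
    show "ev (faa_Id C (M, X)) {#r i#} s = r i" if "i \<in> S" for i by (rule ev_Id[OF cM ob(1) ci[OF that]])
    show "s \<cdot> fseq (fzero M (M, X)) 0 = ?z" unfolding fseq_fzero[OF cM cM ob(1)]
      using crc_monoid.Comp_zero_map[OF cM s(1,3)] s by simp
    show "s \<cdot> fseq (faa_Id C (M, X)) 0 = s" using s by simp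
  qed
  also have "\<dots> = ev f (add_mset ?z (image_mset r (mset_set S))) s" by (rule zero_sum[OF c1 S])
  also have "\<dots> = \<rho> (s \<cdot> fseq f 0) \<cdot> zero_map C N Z" by (rule ev_rzero[OF f]) (use c S in simp)
  also have "\<dots> = (\<rho> (s \<cdot> fseq f 0) \<cdot> \<rho> s) \<cdot> zero_map C N Z" using s by simp
  also have "\<dots> = E (faa_Comp C (faa_Rst C f) (fzero N (M, X))) S r s"
    unfolding E_Rst_Comp[OF f zN c S] E_fzero[OF cN cM ob(1) c S] using s by (intro assoc) simp_all
  finally show "E (faa_Comp C (faa_Pair C (fzero M (M, X)) (faa_Id C (M, X))) df) S r s = E (faa_Comp C (faa_Rst C f) (fzero N (M, X))) S r s" .
qed

lemma ev_Pair_singleton: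
  "u \<in> FH K V L W \<Longrightarrow> w \<in> FH K V L' W' \<Longrightarrow> coh Z (mobj K) V {r} s \<Longrightarrow>
    ev (faa_Pair C u w) {#r#} s = \<langle>ev u {#r#} s, ev w {#r#} s\<rangle>"
  by (rule ev_Pair) simp_all

abbreviation "fZ \<equiv> fzero M (MMM, GX)"

lemma fZ: "fZ \<in> FH MMM GX M A" "lin fZ" "\<rho> (fseq fZ 0) = Idn C GX"
  "coh Z ((A \<^bold>\<times> A) \<^bold>\<times> A) GX {r} s \<Longrightarrow> ev fZ {#r#} s = \<rho> s \<cdot> zero_map C M Z"
  "s \<in> Hom C Z GX \<Longrightarrow> s \<cdot> fseq fZ 0 = \<rho> s \<cdot> zero_map C M Z"
proof -
  show "fZ \<in> FH MMM GX M A" "lin fZ" by (rule fzero_FH[OF cM oA(5,4)] lin_fzero[OF cM oA(5,4)])+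
  show "\<rho> (fseq fZ 0) = Idn C GX" unfolding fseq_fzero[OF cM oA(5,4)] by simp
  show "ev fZ {#r#} s = \<rho> s \<cdot> zero_map C M Z" if "coh Z ((A \<^bold>\<times> A) \<^bold>\<times> A) GX {r} s"
    using ev_fzero[OF cM oA(5,4), of Z "{#r#}" s] that by simp
  show "s \<cdot> fseq fZ 0 = \<rho> s \<cdot> zero_map C M Z" if "s \<in> Hom C Z GX"
    unfolding fseq_fzero[OF cM oA(5,4)] using crc_monoid.Comp_zero_map[OF cM, of s GX] HomD[OF that] by simp
qed

lemma Pair_total:
  assumes u: "u \<in> FH K V L W" "lin u" "\<rho> (fseq u 0) = Idn C V" and w: "w \<in> FH K V L' W'" "lin w" "\<rho> (fseq w 0) = Idn C V"
  shows "faa_Pair C u w \<in> FH K V (prod_monoid C L L') (W \<^bold>\<times> W')" "lin (faa_Pair C u w)" "\<rho> (fseq (faa_Pair C u w) 0) = Idn C V"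
    "s \<in> Hom C Z V \<Longrightarrow> s \<cdot> fseq (faa_Pair C u w) 0 = \<langle>s \<cdot> fseq u 0, s \<cdot> fseq w 0\<rangle>"
proof -
  show "faa_Pair C u w \<in> FH K V (prod_monoid C L L') (W \<^bold>\<times> W')" by (rule Pair_FH[OF u(1) w(1)])
  show "lin (faa_Pair C u w)" by (rule lin_Pair[OF u(1) w(1) u(2) w(2)])
  show "\<rho> (fseq (faa_Pair C u w) 0) = Idn C V"
    using HomD[OF FH_D(7)[OF u(1)]] HomD[OF FH_D(7)[OF w(1)]] u(3) w(3) FH_D(3)[OF u(1)] by simp
  show "s \<cdot> fseq (faa_Pair C u w) 0 = \<langle>s \<cdot> fseq u 0, s \<cdot> fseq w 0\<rangle>" if "s \<in> Hom C Z V"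
    unfolding fseq_Pair_0 by (rule Comp_Pair_Hom[OF that FH_D(7)[OF u(1)] FH_D(7)[OF w(1)]])
qed

text \<open>The computation common to [DR.6] and [DR.7]: the derivative of \<open>f\<close> is
  itself a map of \<open>faa C\<close>, so \<open>pair_D_eq\<close> applies to it.\<close>

lemma DD_generic:
  assumes u: "u1 \<in> FH MMM GX M A" "lin u1" "\<rho> (fseq u1 0) = Idn C GX" "u2 \<in> FH MMM GX M A" "lin u2" "\<rho> (fseq u2 0) = Idn C GX"
      "u3 \<in> FH MMM GX M A" "lin u3" "\<rho> (fseq u3 0) = Idn C GX"
    and c: "coh Z ((A \<^bold>\<times> A) \<^bold>\<times> A) GX (r ` S) s" and S: "finite S"
    and e: "\<And>i. i \<in> S \<Longrightarrow> ev u1 {#r i#} s = v1 i" "\<And>i. i \<in> S \<Longrightarrow> ev u2 {#r i#} s = v2 i" "\<And>i. i \<in> S \<Longrightarrow> ev u3 {#r i#} s = v3 i"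
    and s: "s \<cdot> fseq u1 0 = s1" "s \<cdot> fseq u2 0 = s2" "s \<cdot> fseq u3 0 = s3"
  shows "E (faa_Comp C (faa_Pair C (faa_Pair C u1 u2) (faa_Pair C u3 fPd)) (faa_D C df)) S r s
    = faa_map.ds C df N Z S (\<lambda>i. \<langle>v1 i, v2 i\<rangle>) (\<lambda>i. \<langle>v3 i, rd (r i)\<rangle>) \<langle>s1, s2\<rangle> \<langle>s3, sd s\<rangle>"
    "faa_Comp C (faa_Pair C (faa_Pair C u1 u2) (faa_Pair C u3 fPd)) (faa_D C df) \<in> FH MMM GX N (mobj N)"
proof -
  interpret d: faa_map C df MM "A \<^bold>\<times> X" N "mobj N" by (rule faa_mapI[OF D_FH])
  note p = Pair_total[OF u(1-6)] and q = Pair_total[OF u(7-9) fPd]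
  have p1: "faa_Pair C u1 u2 \<in> FH MMM GX MM (mobj MM)" using p(1) by simp
  have c': "coh Z (mobj MMM) GX (r ` S) s" using c by simp
  note G = coh_G[OF c]
  have G2: "coh Z (mobj MMM) GX {r i} s" if "i \<in> S" for i using G(2)[OF that] by simp
  show "E (faa_Comp C (faa_Pair C (faa_Pair C u1 u2) (faa_Pair C u3 fPd)) (faa_D C df)) S r s
    = d.ds Z S (\<lambda>i. \<langle>v1 i, v2 i\<rangle>) (\<lambda>i. \<langle>v3 i, rd (r i)\<rangle>) \<langle>s1, s2\<rangle> \<langle>s3, sd s\<rangle>"
  proof (rule d.pair_D_eq[OF p1 p(2,3) q(1-3) c' S])
    show "ev (faa_Pair C u1 u2) {#r i#} s = \<langle>v1 i, v2 i\<rangle>" if "i \<in> S" for i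
      unfolding ev_Pair_singleton[OF u(1,4) G2[OF that]] e(1,2)[OF that] ..
    show "ev (faa_Pair C u3 fPd) {#r i#} s = \<langle>v3 i, rd (r i)\<rangle>" if "i \<in> S" for i
      unfolding ev_Pair_singleton[OF u(7) fPd(1) G2[OF that]] e(3)[OF that] ev_fP(3)[OF G(2)[OF that]] ..
    show "s \<cdot> fseq (faa_Pair C u1 u2) 0 = \<langle>s1, s2\<rangle>" unfolding p(4)[OF G(7)] s ..
    show "s \<cdot> fseq (faa_Pair C u3 fPd) 0 = \<langle>s3, sd s\<rangle>" unfolding q(4)[OF G(7)] s G(5) ..
  qed
  show "faa_Comp C (faa_Pair C (faa_Pair C u1 u2) (faa_Pair C u3 fPd)) (faa_D C df) \<in> FH MMM GX N (mobj N)"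
    by (rule Comp_FH[OF Pair_FH[OF p1 q(1)] d.D_FH])
qed

lemma DR6_generic:
  "faa_Comp C (faa_Pair C (faa_Pair C fPa fZ) (faa_Pair C fPb fPd)) (faa_D C df) = faa_Comp C (faa_Pair C fPa fPd) df"
proof (rule faa_eqI_E0)
  \<comment> \<open>The empty family at the identity instantiates the premises of
    \<open>DD_generic\<close>, from which only the typing statement is taken here.\<close>
  have triv: "coh GX ((A \<^bold>\<times> A) \<^bold>\<times> A) GX ((\<lambda>i. undefined) ` ({}::nat set)) (Idn C GX)" by (simp add: coh_def Hom_iff)
  show "faa_Comp C (faa_Pair C (faa_Pair C fPa fZ) (faa_Pair C fPb fPd)) (faa_D C df) \<in> FH MMM GX N (mobj N)"
    by (rule DD_generic(2)[OF fPa fZ(1-3) fPb triv _ refl refl refl refl refl refl]) simp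
  show "faa_Comp C (faa_Pair C fPa fPd) df \<in> FH MMM GX N (mobj N)" by (rule Comp_FH[OF Pair_FH[OF fPa(1) fPd(1)] D_FH])
  fix Z and S :: "nat set" and r s
  assume c': "coh Z (mobj MMM) GX (r ` S) s" and S: "finite S"
  then have c: "coh Z ((A \<^bold>\<times> A) \<^bold>\<times> A) GX (r ` S) s" by simp
  note G = coh_G[OF c]
  have "E (faa_Comp C (faa_Pair C (faa_Pair C fPa fZ) (faa_Pair C fPb fPd)) (faa_D C df)) S r s
    = faa_map.ds C df N Z S (\<lambda>i. \<langle>ra (r i), \<rho> (sd s) \<cdot> zero_map C M Z\<rangle>) (\<lambda>i. \<langle>rb (r i), rd (r i)\<rangle>) \<langle>sa s, \<rho> (sd s) \<cdot> zero_map C M Z\<rangle> \<langle>sb s, sd s\<rangle>"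
    unfolding G(6)
    by (rule DD_generic(1)[OF fPa fZ(1-3) fPb c S ev_fP(1)[OF G(2)] fZ(4)[OF G(2)] ev_fP(2)[OF G(2)] G(3) fZ(5)[OF G(7)] G(4)])
  also have "\<dots> = ds Z S (\<lambda>i. ra (r i)) (\<lambda>i. rd (r i)) (sa s) (sd s)"
    by (rule ds_D_zero_right[OF G(1) S])
  also have "\<dots> = E (faa_Comp C (faa_Pair C fPa fPd) df) S r s"
    by (rule pair_D_eq[OF fPa fPd c' S ev_fP(1)[OF G(2)] ev_fP(3)[OF G(2)] G(3,5), symmetric])
  finally show "E (faa_Comp C (faa_Pair C (faa_Pair C fPa fZ) (faa_Pair C fPb fPd)) (faa_D C df)) S r s
    = E (faa_Comp C (faa_Pair C fPa fPd) df) S r s" .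
qed

lemma DR7_generic:
  "faa_Comp C (faa_Pair C (faa_Pair C fZ fPa) (faa_Pair C fPb fPd)) (faa_D C df)
    = faa_Comp C (faa_Pair C (faa_Pair C fZ fPb) (faa_Pair C fPa fPd)) (faa_D C df)"
proof (rule faa_eqI_E0)
  have triv: "coh GX ((A \<^bold>\<times> A) \<^bold>\<times> A) GX ((\<lambda>i. undefined) ` ({}::nat set)) (Idn C GX)" by (simp add: coh_def Hom_iff)
  show "faa_Comp C (faa_Pair C (faa_Pair C fZ fPa) (faa_Pair C fPb fPd)) (faa_D C df) \<in> FH MMM GX N (mobj N)"
    by (rule DD_generic(2)[OF fZ(1-3) fPa fPb triv _ refl refl refl refl refl refl]) simp
  show "faa_Comp C (faa_Pair C (faa_Pair C fZ fPb) (faa_Pair C fPa fPd)) (faa_D C df) \<in> FH MMM GX N (mobj N)"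
    by (rule DD_generic(2)[OF fZ(1-3) fPb fPa triv _ refl refl refl refl refl refl]) simp
  fix Z and S :: "nat set" and r s
  assume "coh Z (mobj MMM) GX (r ` S) s" and S: "finite S"
  then have c: "coh Z ((A \<^bold>\<times> A) \<^bold>\<times> A) GX (r ` S) s" by simp
  note G = coh_G[OF c]
  have "E (faa_Comp C (faa_Pair C (faa_Pair C fZ fPa) (faa_Pair C fPb fPd)) (faa_D C df)) S r s
    = faa_map.ds C df N Z S (\<lambda>i. \<langle>\<rho> (sd s) \<cdot> zero_map C M Z, ra (r i)\<rangle>) (\<lambda>i. \<langle>rb (r i), rd (r i)\<rangle>) \<langle>\<rho> (sd s) \<cdot> zero_map C M Z, sa s\<rangle> \<langle>sb s, sd s\<rangle>"
    unfolding G(6)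
    by (rule DD_generic(1)[OF fZ(1-3) fPa fPb c S fZ(4)[OF G(2)] ev_fP(1)[OF G(2)] ev_fP(2)[OF G(2)] fZ(5)[OF G(7)] G(3) G(4)])
  also have "\<dots> = faa_map.ds C df N Z S (\<lambda>i. \<langle>\<rho> (sd s) \<cdot> zero_map C M Z, rb (r i)\<rangle>) (\<lambda>i. \<langle>ra (r i), rd (r i)\<rangle>) \<langle>\<rho> (sd s) \<cdot> zero_map C M Z, sb s\<rangle> \<langle>sa s, sd s\<rangle>"
    by (rule ds_D_commute[OF G(1) S])
  also have "\<dots> = E (faa_Comp C (faa_Pair C (faa_Pair C fZ fPb) (faa_Pair C fPa fPd)) (faa_D C df)) S r s"
    unfolding G(6)
    by (rule DD_generic(1)[OF fZ(1-3) fPb fPa c S fZ(4)[OF G(2)] ev_fP(2)[OF G(2)] ev_fP(1)[OF G(2)] fZ(5)[OF G(7)] G(4) G(3), symmetric])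
  finally show "E (faa_Comp C (faa_Pair C (faa_Pair C fZ fPa) (faa_Pair C fPb fPd)) (faa_D C df)) S r s
    = E (faa_Comp C (faa_Pair C (faa_Pair C fZ fPb) (faa_Pair C fPa fPd)) (faa_D C df)) S r s" .
qed

end

section \<open>The differential structure\<close>

context cartesian_restriction_category
begin

lemma faa_L_fst: "faa_L C (M, X) = faa_L C (M, mobj M)"
  by (simp add: faa_L_def)

lemmas CF = cartesian_restriction_category_faa

text \<open>The reduction \<open>generic_plus\<close> holds in every Cartesian restriction category
  and is applied to \<open>faa C\<close> itself; \<open>D_plus_generic\<close> provides its generic
  premise.\<close>

lemma gdrc_DR2_add:
  assumes f: "f \<in> FH M X N Y" and a: "a \<in> FH K V M (mobj M)" and b: "b \<in> FH K V M (mobj M)" and d: "d \<in> FH K V M X"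
  shows "faa_Comp C (faa_Pair C (fplus M a b) d) (faa_D C f)
    = fplus N (faa_Comp C (faa_Pair C a d) (faa_D C f)) (faa_Comp C (faa_Pair C b d) (faa_D C f))"
proof -
  interpret f: faa_map C f M X N Y by (rule faa_mapI[OF f])
  show ?thesis
    using cartesian_restriction_category.generic_plus[OF CF cm_faa_L[OF f.cM, of f.A] cm_faa_L[OF f.cN, of "mobj N"],
      where X = "(M, X)" and h = "faa_D C f" and a = a and b = b and d = d and Z = "(K, V)"]
      f.D_FH a b d f.D_plus_generic
    by (simp add: faa_L_simps faa_Prd_def)
qed

lemma gdrc_DR2_zero:
  assumes f: "f \<in> FH M X N Y" and a: "a \<in> FH K V M X"
  shows "faa_Comp C (faa_Pair C (fzero M (K, V)) a) (faa_D C f) = faa_Comp C (faa_Rst C (faa_Comp C a f)) (fzero N (K, V))"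
proof -
  interpret f: faa_map C f M X N Y by (rule faa_mapI[OF f])
  show ?thesis
    using cartesian_restriction_category.generic_zero[OF CF cm_faa_L[OF f.cM, of f.A] cm_faa_L[OF f.cN, of "mobj N"],
      where X = "(M, X)" and h = "faa_D C f" and a = a and f = f and Z = "(K, V)" and Y = "(N, Y)"]
      f.D_FH f a f.D_zero_generic
    by (simp add: faa_L_simps faa_Prd_def)
qed

lemma gdrc_DR6:
  assumes f: "f \<in> FH M X N Y" and a: "a \<in> FH K V M (mobj M)" and b: "b \<in> FH K V M (mobj M)" and d: "d \<in> FH K V M X"
  shows "faa_Comp C (faa_Pair C (faa_Pair C a (fzero M (K, V))) (faa_Pair C b d)) (faa_D C (faa_D C f))
    = faa_Comp C (faa_Rst C b) (faa_Comp C (faa_Pair C a d) (faa_D C f))"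
proof -
  interpret f: faa_map C f M X N Y by (rule faa_mapI[OF f])
  interpret d: faa_map C f.df f.MM "f.A \<^bold>\<times> X" N "mobj N" by (rule faa_mapI[OF f.D_FH])
  show ?thesis
    using cartesian_restriction_category.generic_DR6[OF CF cm_faa_L[OF f.cM, of f.A],
      where X = "(M, X)" and h = "faa_D C f" and hh = "faa_D C (faa_D C f)" and a = a and b = b and d = d and Z = "(K, V)"
        and K = "(N, mobj N)", OF _ _ _ _ _ refl refl refl]
      f.D_FH d.D_FH a b d f.DR6_generic
    by (simp add: faa_L_simps faa_Prd_def)
qed

lemma gdrc_DR7:
  assumes f: "f \<in> FH M X N Y" and a: "a \<in> FH K V M (mobj M)" and b: "b \<in> FH K V M (mobj M)" and d: "d \<in> FH K V M X"
  shows "faa_Comp C (faa_Pair C (faa_Pair C (fzero M (K, V)) a) (faa_Pair C b d)) (faa_D C (faa_D C f))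
    = faa_Comp C (faa_Pair C (faa_Pair C (fzero M (K, V)) b) (faa_Pair C a d)) (faa_D C (faa_D C f))"
proof -
  interpret f: faa_map C f M X N Y by (rule faa_mapI[OF f])
  interpret d: faa_map C f.df f.MM "f.A \<^bold>\<times> X" N "mobj N" by (rule faa_mapI[OF f.D_FH])
  show ?thesis
    using cartesian_restriction_category.generic_DR7[OF CF cm_faa_L[OF f.cM, of f.A],
      where X = "(M, X)" and hh = "faa_D C (faa_D C f)" and a = a and b = b and d = d and Z = "(K, V)"
        and K = "(N, mobj N)", OF _ _ _ _ refl refl refl]
      d.D_FH a b d f.DR7_generic
    by (simp add: faa_L_simps faa_Prd_def)
qed

lemma cross_Idn_Rst_faa:
  assumes f: "f \<in> FH M X N Y"
  shows "cross (faa C) (faa_Id C (M, mobj M)) (faa_Rst C f) = faa_Rst C (faa_Comp C (faa_Pr1 C (M, mobj M) (M, X)) f)"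
  using cartesian_restriction_category.cross_Idn_Rst[OF CF, of f "(M, mobj M)" "(M, X)"] f FH_D(1,3,5)[OF f]
  by (simp add: Hom_iff[of f "faa C"])

lemma generalized_differential_restriction_category_faa:
  "generalized_differential_restriction_category (faa C) (faa_L C) (faa_D C)"
proof (intro generalized_differential_restriction_category.intro CF generalized_differential_restriction_category_axioms.intro)
  fix S T U A B :: "('o, 'm) faa_ob" and f g a b c d :: "('o, 'm) faa_ar"
  obtain M X N Y K V where st: "S = (M, X)" "T = (N, Y)" "U = (K, V)" by (metis surj_pair)
  have L: "mobj (faa_L C (P, Q)) = (P, mobj P)" "fst (P, Q) = P" for P :: "('o, 'm) imonoid" and Q by (simp_all add: faa_L_simps)
  show "total_comm_monoid (faa C) (faa_L C S)" if "S \<in> Ob (faa C)"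
    using that cartesian_restriction_category.cm_iff[OF CF] cm_faa_L[of M X] unfolding st by simp
  show "faa_L C (mobj (faa_L C S)) = faa_L C S" if "S \<in> Ob (faa C)" by (simp add: faa_L_def Let_def)
  show "faa_L C (S \<^bold>\<times>\<^bsub>faa C\<^esub> T) = prod_monoid (faa C) (faa_L C S) (faa_L C T)"
    if "S \<in> Ob (faa C)" "T \<in> Ob (faa C)"
    using that faa_L_prod unfolding st by simp
  show "faa_L C \<^bold>1\<^bsub>faa C\<^esub> = trivial_monoid (faa C)" by (simp add: faa_L_Trm)
  show "faa_D C f \<in> Hom (faa C) (mobj (faa_L C S) \<^bold>\<times>\<^bsub>faa C\<^esub> S) (mobj (faa_L C T))" if "f \<in> Hom (faa C) S T"
    using faa_map.D_FH[OF faa_mapI[OF that[unfolded st]]] unfolding st by (simp add: faa_L_simps faa_Prd_def)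
  show "faa_D C (madd (faa_L C S)) = Pr0 (faa C) (A \<^bold>\<times>\<^bsub>faa C\<^esub> A) (A \<^bold>\<times>\<^bsub>faa C\<^esub> A) \<cdot>\<^bsub>faa C\<^esub> madd (faa_L C S)"
    if "S \<in> Ob (faa C)" "A = mobj (faa_L C S)"
    using that D_LA[of M] unfolding st by (simp add: faa_L_simps faa_Prd_def)
  show "faa_D C (mzero (faa_L C S)) = Pr0 (faa C) \<^bold>1\<^bsub>faa C\<^esub> \<^bold>1\<^bsub>faa C\<^esub> \<cdot>\<^bsub>faa C\<^esub> mzero (faa_L C S)" if "S \<in> Ob (faa C)"
    using that D_LZ[of M] unfolding st by (simp add: faa_L_simps)
  show "\<langle>plus_map (faa C) (faa_L C S) a b, c\<rangle>\<^bsub>faa C\<^esub> \<cdot>\<^bsub>faa C\<^esub> faa_D C f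
      = plus_map (faa C) (faa_L C T) (\<langle>a, c\<rangle>\<^bsub>faa C\<^esub> \<cdot>\<^bsub>faa C\<^esub> faa_D C f) (\<langle>b, c\<rangle>\<^bsub>faa C\<^esub> \<cdot>\<^bsub>faa C\<^esub> faa_D C f)"
    if "f \<in> Hom (faa C) S T" "a \<in> Hom (faa C) U (mobj (faa_L C S))" "b \<in> Hom (faa C) U (mobj (faa_L C S))" "c \<in> Hom (faa C) U S"
    using gdrc_DR2_add[OF that(1)[unfolded st] that(2-4)[unfolded st L]] unfolding st faa_L_fst[of M X] faa_L_fst[of N Y] by simp
  show "\<langle>zero_map (faa C) (faa_L C S) U, a\<rangle>\<^bsub>faa C\<^esub> \<cdot>\<^bsub>faa C\<^esub> faa_D C f = \<rho>\<^bsub>faa C\<^esub> (a \<cdot>\<^bsub>faa C\<^esub> f) \<cdot>\<^bsub>faa C\<^esub> zero_map (faa C) (faa_L C T) U"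
    if "f \<in> Hom (faa C) S T" "a \<in> Hom (faa C) U S"
    using gdrc_DR2_zero[OF that[unfolded st]] unfolding st faa_L_fst[of M X] faa_L_fst[of N Y] by simp
  show "faa_D C (Pr0 (faa C) S T) = Pr0 (faa C) (A \<^bold>\<times>\<^bsub>faa C\<^esub> B) (S \<^bold>\<times>\<^bsub>faa C\<^esub> T) \<cdot>\<^bsub>faa C\<^esub> Pr0 (faa C) A B"
    "faa_D C (Pr1 (faa C) S T) = Pr0 (faa C) (A \<^bold>\<times>\<^bsub>faa C\<^esub> B) (S \<^bold>\<times>\<^bsub>faa C\<^esub> T) \<cdot>\<^bsub>faa C\<^esub> Pr1 (faa C) A B"
    if "S \<in> Ob (faa C)" "T \<in> Ob (faa C)" "A = mobj (faa_L C S)" "B = mobj (faa_L C T)"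
    using that D_faa_Pr[of M X N Y] unfolding st by (simp_all add: faa_L_simps faa_Prd_def)
  show "faa_D C \<langle>f, g\<rangle>\<^bsub>faa C\<^esub> = \<langle>faa_D C f, faa_D C g\<rangle>\<^bsub>faa C\<^esub>" if "f \<in> Hom (faa C) U S" "g \<in> Hom (faa C) U T"
    using that D_faa_Pair unfolding st by simp
  show "faa_D C (f \<cdot>\<^bsub>faa C\<^esub> g) = \<langle>faa_D C f, Pr1 (faa C) (mobj (faa_L C S)) S \<cdot>\<^bsub>faa C\<^esub> f\<rangle>\<^bsub>faa C\<^esub> \<cdot>\<^bsub>faa C\<^esub> faa_D C g"
    if "f \<in> Hom (faa C) S T" "g \<in> Hom (faa C) T U"
    \<comment> \<open>The pair on the right of [DR.5] is \<open>Tf f\<close>, so the axiom is the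
      chain rule.\<close>
    using faa_pair.D_Comp[of C f g M X N Y K V] faa_map.T_eq[OF faa_mapI[OF that(1)[unfolded st]]] that
    unfolding st by (simp add: faa_L_simps faa_pair_def faa_pair_axioms_def cartesian_restriction_category_axioms)
  show "\<langle>\<langle>a, zero_map (faa C) (faa_L C S) U\<rangle>\<^bsub>faa C\<^esub>, \<langle>c, d\<rangle>\<^bsub>faa C\<^esub>\<rangle>\<^bsub>faa C\<^esub> \<cdot>\<^bsub>faa C\<^esub> faa_D C (faa_D C f)
      = \<rho>\<^bsub>faa C\<^esub> c \<cdot>\<^bsub>faa C\<^esub> (\<langle>a, d\<rangle>\<^bsub>faa C\<^esub> \<cdot>\<^bsub>faa C\<^esub> faa_D C f)"
    if "f \<in> Hom (faa C) S T" "a \<in> Hom (faa C) U (mobj (faa_L C S))" "c \<in> Hom (faa C) U (mobj (faa_L C S))" "d \<in> Hom (faa C) U S"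
    using gdrc_DR6[OF that(1)[unfolded st] that(2-4)[unfolded st L]] unfolding st faa_L_fst[of M X] by simp
  show "\<langle>\<langle>zero_map (faa C) (faa_L C S) U, b\<rangle>\<^bsub>faa C\<^esub>, \<langle>c, d\<rangle>\<^bsub>faa C\<^esub>\<rangle>\<^bsub>faa C\<^esub> \<cdot>\<^bsub>faa C\<^esub> faa_D C (faa_D C f)
      = \<langle>\<langle>zero_map (faa C) (faa_L C S) U, c\<rangle>\<^bsub>faa C\<^esub>, \<langle>b, d\<rangle>\<^bsub>faa C\<^esub>\<rangle>\<^bsub>faa C\<^esub> \<cdot>\<^bsub>faa C\<^esub> faa_D C (faa_D C f)"
    if "f \<in> Hom (faa C) S T" "b \<in> Hom (faa C) U (mobj (faa_L C S))" "c \<in> Hom (faa C) U (mobj (faa_L C S))" "d \<in> Hom (faa C) U S"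
    using gdrc_DR7[OF that(1)[unfolded st] that(2-4)[unfolded st L]] unfolding st faa_L_fst[of M X] by simp
  show "faa_D C (\<rho>\<^bsub>faa C\<^esub> f) = cross (faa C) (Idn (faa C) A) (\<rho>\<^bsub>faa C\<^esub> f) \<cdot>\<^bsub>faa C\<^esub> Pr0 (faa C) A S
      \<and> cross (faa C) (Idn (faa C) A) (\<rho>\<^bsub>faa C\<^esub> f) \<cdot>\<^bsub>faa C\<^esub> Pr0 (faa C) A S = \<rho>\<^bsub>faa C\<^esub> (Pr1 (faa C) A S \<cdot>\<^bsub>faa C\<^esub> f) \<cdot>\<^bsub>faa C\<^esub> Pr0 (faa C) A S"
    "\<rho>\<^bsub>faa C\<^esub> (faa_D C f) = cross (faa C) (Idn (faa C) A) (\<rho>\<^bsub>faa C\<^esub> f)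
      \<and> cross (faa C) (Idn (faa C) A) (\<rho>\<^bsub>faa C\<^esub> f) = \<rho>\<^bsub>faa C\<^esub> (Pr1 (faa C) A S \<cdot>\<^bsub>faa C\<^esub> f)"
    if "f \<in> Hom (faa C) S T" "A = mobj (faa_L C S)"
    using that cross_Idn_Rst_faa[OF that(1)[unfolded st]] faa_map.D_faa_Rst[OF faa_mapI[OF that(1)[unfolded st]]]
      faa_map.Rst_D[OF faa_mapI[OF that(1)[unfolded st]]]
    unfolding st by (simp_all add: L(1))
qed

end

theorem corollary3p14:
  fixes X :: "('o, 'm) crc"
  assumes "cartesian_restriction_category X"
  shows "generalized_differential_restriction_category (faa X) (faa_L X) (faa_D X)"
  by (rule cartesian_restriction_category.generalized_differential_restriction_category_faa[OF assms])

end
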